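(* The 2-category $\mathsf{Cat}$ of categories admits the construction of the torsion tensor (for tangent categories with negatives). Moreover, given a tangent category $(\mathbb X,\mathbb T)$ with negatives, the corresponding torsion tensor operator $$\mathsf W:\mathsf{VF}_2(\mathbb X,\mathbb T)\times_{(\mathbb X,\mathbb T)}\mathsf{VAC}(\mathbb X,\mathbb T)\to\mathsf{VF}(\mathbb X,\mathbb T)$$ is a functor which sends a tuple $(M,k;u,v)$, formed by an object $M$ of $\mathbb X$, a vertical affine connection $k$ on $M$ and vector fields $u$ and $v$ on $M$, to the vector field $\mathsf W^k_uv$ on $M$ obtained by applying the torsion tensor of $k$ to $u$ and $v$.
   Context: Composition $\circ$ is in the usual order. A tangent category $(\mathbb X,\mathbb T)$ is a category with a functor $T$ and natural transformations $p:T\Rightarrow\mathrm{id}$, $z:\mathrm{id}\Rightarrow T$, $s:T_2\Rightarrow T$, $l:T\Rightarrow T^2$, $c:T^2\Rightarrow T^2$, where $T_nA$ is the $n$-fold pullback of $p_A$ along itself (required to exist and be preserved by all $T^m$), such that: $(p_A,z_A,s_A)$ is a commutative monoid in $\mathbb X/A$; $Tp\circ l=z\circ p$, $l\circ z=Tz\circ z$, $l\circ s=Ts\circ\langle l\pi_1,l\pi_2\rangle$; $p_T\circ c=Tp$, $c\circ Tz=z_T$, $c\circ Ts=s_T\circ\langle c\,T\pi_1,c\,T\pi_2\rangle$; $Tl\circ l=l_T\circ l$, $c\circ l=l$, $c_T\circ Tc\circ l_T=Tl\circ c$; $c\circ c=\mathrm{id}$, $Tc\circ c_T\circ Tc=c_T\circ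 Tc\circ c_T$; and the square with top $Ts\circ\langle z_T\pi_1,l\pi_2\rangle:T_2A\to T^2A$, left $p\pi_1$, right $Tp$, bottom $z$ is a pullback. It has negatives if there is $n:T\Rightarrow T$ with $s\circ\langle n,\mathrm{id}\rangle=z\circ p$. A lax tangent morphism $(F,\alpha):(\mathbb X',\mathbb T')\to(\mathbb X,\mathbb T)$ is a functor with $\alpha:FT'\Rightarrow TF$ such that $p_F\circ\alpha=Fp'$, $\alpha\circ Fz'=z_F$, $\alpha\circ Fs'=s_F\circ\langle\alpha F\pi_1,\alpha F\pi_2\rangle$, $l_F\circ\alpha=T\alpha\circ\alpha_{T'}\circ Fl'$, $c_F\circ T\alpha\circ\alpha_{T'}=T\alpha\circ\alpha_{T'}\circ Fc'$ (strict if $\alpha=\mathrm{id}$). Tangent natural transformations satisfy $T\varphi\circ\alpha=\beta\circ\varphi_{T'}$. $[\mathbb X',\mathbb T'\mid\mathbb X,\mathbb T]$ is the tangent category of these (with negatives if $(\mathbb X,\mathbb T)$ has them), with $\bar T(F,\alpha)=(TF,c_F\circ T\alpha)$, $\bar T\varphi=T\varphi$, $\bar p_{(F,\alpha)}=p_F$, etc. A vector field on $M$ is a section $v:M\to TM$ of $p_M$. The vector fields of a tangent category form a tangent category with objects $(M,v)$, morphisms $f:M\to M'$ with $v'\circ f=Tf\circ v$, and tangent functor $(M,v)\mapsto(TM,c_M\circ Tv)$. A vertical affine connection on $M$ is $k:T^2M\to TM$ with $k\circ l_M=\mathrm{id}_{TM}$, $p_M\circ k=p_M\circ p_{TM}$,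 $Tk\circ l_{TM}=l_M\circ k$, $Tk\circ c_{TM}\circ Tl_M=l_M\circ k$. These form a tangent category with objects $(M,k)$, morphisms $f$ with $k'\circ T^2f=Tf\circ k$, and tangent functor $(M,k)\mapsto(TM,c_M\circ Tk\circ c_{TM}\circ Tc_M)$. The torsion of $k$ is $\tau^k=k\circ c_M-k:T^2M\to TM$ (difference in the fibres of $p_M$), and the torsion tensor sends vector fields $u,v$ on $M$ to the vector field $\mathsf W^k_uv=\tau^k\circ Tu\circ v$. $(\mathbb X,\mathbb T)$ admits the construction of vector fields if there are a tangent category $\mathsf{VF}(\mathbb X,\mathbb T)$, a strict tangent morphism $U^{\mathsf{VF}}:\mathsf{VF}(\mathbb X,\mathbb T)\to(\mathbb X,\mathbb T)$ and a vector field $\mathcal v$ on $U^{\mathsf{VF}}$ in $[\mathsf{VF}(\mathbb X,\mathbb T)\mid\mathbb X,\mathbb T]$ such that for every tangent category $(\mathbb X',\mathbb T')$, $H\mapsto(U^{\mathsf{VF}}\circ H,\mathcal v_H)$ is an isomorphism of tangent categories from $[\mathbb X',\mathbb T'\mid\mathsf{VF}(\mathbb X,\mathbb T)]$ to the tangent category of vector fields of $[\mathbb X',\mathbb T'\mid\mathbb X,\mathbb T]$. It admits the construction of vertical affine connections if there are a tangent category $\mathsf{VAC}(\mathbb X,\mathbb T)$, a tangent morphism $U^{\mathsf{VAC}}:\mathsf{VAC}(\mathbb X,\mathbb T)\to(\mathbb X,\mathbb T)$ and a vertical affine connection $\mathcal k$ on $U^{\mathsf{VAC}}$ in $[\mathsf{VAC}(\mathbb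 X,\mathbb T)\mid\mathbb X,\mathbb T]$ such that $H\mapsto(U^{\mathsf{VAC}}\circ H,\mathcal k_H)$ is an isomorphism of tangent categories from $[\mathbb X',\mathbb T'\mid\mathsf{VAC}(\mathbb X,\mathbb T)]$ to the tangent category of vertical affine connections of $[\mathbb X',\mathbb T'\mid\mathbb X,\mathbb T]$, for every $(\mathbb X',\mathbb T')$. $(\mathbb X,\mathbb T)$ admits the construction of the torsion tensor if it admits these two constructions and the threefold 2-pullback $\mathsf{VF}_2(\mathbb X,\mathbb T)\times_{(\mathbb X,\mathbb T)}\mathsf{VAC}(\mathbb X,\mathbb T)$ of $U^{\mathsf{VF}},U^{\mathsf{VF}},U^{\mathsf{VAC}}$ over $(\mathbb X,\mathbb T)$ exists. Pulling back the universal data along its projections gives vector fields $\tilde{\mathcal v}_1,\tilde{\mathcal v}_2$ and a vertical affine connection $\tilde{\mathcal k}$ on the same object, and the torsion tensor operator $\mathsf W$ is the tangent morphism to $\mathsf{VF}(\mathbb X,\mathbb T)$ corresponding, by the universal property of $\mathsf{VF}(\mathbb X,\mathbb T)$, to the vector field $\mathsf W^{\tilde{\mathcal k}}_{\tilde{\mathcal v}_1}\tilde{\mathcal v}_2$. $\mathsf{Cat}$ admits the construction of the torsion tensor if every tangent category (with negatives) does. *)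

theory Defs
  imports "HOL-Library.FuncSet"
begin

section \<open>Categories and pullbacks\<close>

text \<open>A category is given by a set of objects and a set of arrows; composition is in the usual
  order, so \<open>g \<cdot>\<^bsub>C\<^esub> f\<close> means "first \<open>f\<close>, then \<open>g\<close>". The operations matter only on the
  carriers.\<close>

record ('o, 'a) cat =
  Ob :: "'o set"
  Ar :: "'a set"
  Dom :: "'a \<Rightarrow> 'o"
  Cod :: "'a \<Rightarrow> 'o"
  Idn :: "'o \<Rightarrow> 'a"
  Cmp :: "'a \<Rightarrow> 'a \<Rightarrow> 'a"

abbreviation cmp_syntax :: "'a \<Rightarrow> ('o, 'a, 'z) cat_scheme \<Rightarrow> 'a \<Rightarrow> 'a"
    ("(_ \<cdot>\<^bsub>_\<^esub>/ _)" [76, 0, 75] 75) where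
  "g \<cdot>\<^bsub>C\<^esub> f \<equiv> Cmp C g f"

definition hom :: "('o, 'a, 'z) cat_scheme \<Rightarrow> 'o \<Rightarrow> 'o \<Rightarrow> 'a set" where
  "hom C A B = {f \<in> Ar C. Dom C f = A \<and> Cod C f = B}"

definition is_category :: "('o, 'a, 'z) cat_scheme \<Rightarrow> bool" where
  "is_category C \<longleftrightarrow>
     (\<forall>f\<in>Ar C. Dom C f \<in> Ob C \<and> Cod C f \<in> Ob C) \<and>
     (\<forall>A\<in>Ob C. Idn C A \<in> hom C A A) \<and>
     (\<forall>f\<in>Ar C. \<forall>g\<in>Ar C. Cod C f = Dom C g \<longrightarrow> g \<cdot>\<^bsub>C\<^esub> f \<in> hom C (Dom C f) (Cod C g)) \<and>
     (\<forall>f\<in>Ar C. f \<cdot>\<^bsub>C\<^esub> Idn C (Dom C f) = f \<and> Idn C (Cod C f) \<cdot>\<^bsub>C\<^esub> f = f) \<and>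
     (\<forall>f\<in>Ar C. \<forall>g\<in>Ar C. \<forall>h\<in>Ar C. Cod C f = Dom C g \<longrightarrow> Cod C g = Dom C h \<longrightarrow>
        h \<cdot>\<^bsub>C\<^esub> (g \<cdot>\<^bsub>C\<^esub> f) = (h \<cdot>\<^bsub>C\<^esub> g) \<cdot>\<^bsub>C\<^esub> f)"

definition is_functor ::
  "('o, 'a, 'z) cat_scheme \<Rightarrow> ('p, 'b, 'w) cat_scheme \<Rightarrow> ('o \<Rightarrow> 'p) \<Rightarrow> ('a \<Rightarrow> 'b) \<Rightarrow> bool" where
  "is_functor C D Fo Fa \<longleftrightarrow>
     (\<forall>A\<in>Ob C. Fo A \<in> Ob D \<and> Fa (Idn C A) = Idn D (Fo A)) \<and>
     (\<forall>f\<in>Ar C. Fa f \<in> hom D (Fo (Dom C f)) (Fo (Cod C f))) \<and>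
     (\<forall>f\<in>Ar C. \<forall>g\<in>Ar C. Cod C f = Dom C g \<longrightarrow> Fa (g \<cdot>\<^bsub>C\<^esub> f) = Fa g \<cdot>\<^bsub>D\<^esub> Fa f)"

definition is_natural ::
  "('o, 'a, 'z) cat_scheme \<Rightarrow> ('p, 'b, 'w) cat_scheme \<Rightarrow> ('o \<Rightarrow> 'p) \<Rightarrow> ('a \<Rightarrow> 'b) \<Rightarrow>
   ('o \<Rightarrow> 'p) \<Rightarrow> ('a \<Rightarrow> 'b) \<Rightarrow> ('o \<Rightarrow> 'b) \<Rightarrow> bool" where
  "is_natural C D Fo Fa Go Ga \<phi> \<longleftrightarrow>
     (\<forall>A\<in>Ob C. \<phi> A \<in> hom D (Fo A) (Go A)) \<and>
     (\<forall>f\<in>Ar C. Ga f \<cdot>\<^bsub>D\<^esub> \<phi> (Dom C f) = \<phi> (Cod C f) \<cdot>\<^bsub>D\<^esub> Fa f)"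

definition is_pullback ::
  "('o, 'a, 'z) cat_scheme \<Rightarrow> 'a \<Rightarrow> 'a \<Rightarrow> 'o \<Rightarrow> 'a \<Rightarrow> 'a \<Rightarrow> bool" where
  "is_pullback C f g P a b \<longleftrightarrow>
     f \<in> Ar C \<and> g \<in> Ar C \<and> Cod C f = Cod C g \<and>
     a \<in> hom C P (Dom C f) \<and> b \<in> hom C P (Dom C g) \<and> f \<cdot>\<^bsub>C\<^esub> a = g \<cdot>\<^bsub>C\<^esub> b \<and>
     (\<forall>Q\<in>Ob C. \<forall>x\<in>hom C Q (Dom C f). \<forall>y\<in>hom C Q (Dom C g). f \<cdot>\<^bsub>C\<^esub> x = g \<cdot>\<^bsub>C\<^esub> y \<longrightarrow>
        (\<exists>!h. h \<in> hom C Q P \<and> a \<cdot>\<^bsub>C\<^esub> h = x \<and> b \<cdot>\<^bsub>C\<^esub> h = y))"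

text \<open>The \<open>n\<close>-fold pullback of \<open>e\<close> along itself, with projections \<open>\<pi> 0, \<dots>, \<pi> (n - 1)\<close>. The arrow
  \<open>q\<close> to the codomain of \<open>e\<close> is the common composite \<open>e \<cdot> \<pi> i\<close>; it is listed separately so that
  the case \<open>n = 0\<close> is covered too (then \<open>q\<close> is an isomorphism).\<close>

definition is_fold_pullback ::
  "('o, 'a, 'z) cat_scheme \<Rightarrow> nat \<Rightarrow> 'a \<Rightarrow> 'o \<Rightarrow> 'a \<Rightarrow> (nat \<Rightarrow> 'a) \<Rightarrow> bool" where
  "is_fold_pullback C n e P q \<pi> \<longleftrightarrow>
     e \<in> Ar C \<and> q \<in> hom C P (Cod C e) \<and>
     (\<forall>i<n. \<pi> i \<in> hom C P (Dom C e) \<and> e \<cdot>\<^bsub>C\<^esub> \<pi> i = q) \<and>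
     (\<forall>Q\<in>Ob C. \<forall>r\<in>hom C Q (Cod C e). \<forall>g.
        (\<forall>i<n. g i \<in> hom C Q (Dom C e) \<and> e \<cdot>\<^bsub>C\<^esub> g i = r) \<longrightarrow>
        (\<exists>!h. h \<in> hom C Q P \<and> q \<cdot>\<^bsub>C\<^esub> h = r \<and> (\<forall>i<n. \<pi> i \<cdot>\<^bsub>C\<^esub> h = g i)))"


section \<open>Tangent categories\<close>

text \<open>\<open>Tob\<close>, \<open>Tar\<close> are the tangent functor; \<open>tp\<close>, \<open>tz\<close>, \<open>ts\<close>, \<open>tl\<close>, \<open>tc\<close>, \<open>tn\<close> are the projection,
  zero, sum, vertical lift, canonical flip and negation; \<open>T2\<close>, \<open>pr1\<close>, \<open>pr2\<close> are a choice of the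
  pullbacks \<open>T\<^sub>2 A\<close>, which the domain of \<open>ts\<close> needs. The field \<open>tn\<close> is meaningful
  only under \<open>has_negatives\<close>.\<close>

record ('o, 'a) tang = "('o, 'a) cat" +
  Tob :: "'o \<Rightarrow> 'o"
  Tar :: "'a \<Rightarrow> 'a"
  T2 :: "'o \<Rightarrow> 'o"
  pr1 :: "'o \<Rightarrow> 'a"
  pr2 :: "'o \<Rightarrow> 'a"
  tp :: "'o \<Rightarrow> 'a"
  tz :: "'o \<Rightarrow> 'a"
  ts :: "'o \<Rightarrow> 'a"
  tl :: "'o \<Rightarrow> 'a"
  tc :: "'o \<Rightarrow> 'a"
  tn :: "'o \<Rightarrow> 'a"

text \<open>\<open>pair X A f g\<close> is the arrow induced into \<open>T\<^sub>2 A\<close>, and \<open>tpair X A f g\<close> the one induced into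
  the pullback \<open>T T\<^sub>2 A\<close> of \<open>T p\<^sub>A\<close> along itself.\<close>

definition pair :: "('o, 'a) tang \<Rightarrow> 'o \<Rightarrow> 'a \<Rightarrow> 'a \<Rightarrow> 'a" where
  "pair X A f g =
     (THE h. h \<in> hom X (Dom X f) (T2 X A) \<and> pr1 X A \<cdot>\<^bsub>X\<^esub> h = f \<and> pr2 X A \<cdot>\<^bsub>X\<^esub> h = g)"

definition tpair :: "('o, 'a) tang \<Rightarrow> 'o \<Rightarrow> 'a \<Rightarrow> 'a \<Rightarrow> 'a" where
  "tpair X A f g =
     (THE h. h \<in> hom X (Dom X f) (Tob X (T2 X A)) \<and>
        Tar X (pr1 X A) \<cdot>\<^bsub>X\<^esub> h = f \<and> Tar X (pr2 X A) \<cdot>\<^bsub>X\<^esub> h = g)"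

definition T2ar :: "('o, 'a) tang \<Rightarrow> 'a \<Rightarrow> 'a" where
  "T2ar X f =
     pair X (Cod X f) (Tar X f \<cdot>\<^bsub>X\<^esub> pr1 X (Dom X f)) (Tar X f \<cdot>\<^bsub>X\<^esub> pr2 X (Dom X f))"

text \<open>Associativity in the third clause of the monoid axioms is an equation of arrows
  \<open>T\<^sub>3 A \<rightarrow> T A\<close>.\<close>

definition tangent_category :: "('o, 'a) tang \<Rightarrow> bool" where
  "tangent_category X \<longleftrightarrow>
     \<comment> \<open>functor and pullbacks\<close>
     is_category X \<and> is_functor X X (Tob X) (Tar X) \<and>
     is_natural X X (Tob X) (Tar X) (\<lambda>A. A) (\<lambda>f. f) (tp X) \<and>
     (\<forall>A\<in>Ob X. is_pullback X (tp X A) (tp X A) (T2 X A) (pr1 X A) (pr2 X A)) \<and>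
     (\<forall>A\<in>Ob X. \<forall>n. \<exists>P q \<pi>. is_fold_pullback X n (tp X A) P q \<pi>) \<and>
     (\<forall>A\<in>Ob X. \<forall>n m P q \<pi>. is_fold_pullback X n (tp X A) P q \<pi> \<longrightarrow>
        is_fold_pullback X n ((Tar X ^^ m) (tp X A)) ((Tob X ^^ m) P) ((Tar X ^^ m) q)
          (\<lambda>i. (Tar X ^^ m) (\<pi> i))) \<and>
     \<comment> \<open>naturality\<close>
     is_natural X X (\<lambda>A. A) (\<lambda>f. f) (Tob X) (Tar X) (tz X) \<and>
     is_natural X X (T2 X) (T2ar X) (Tob X) (Tar X) (ts X) \<and>
     is_natural X X (Tob X) (Tar X) (\<lambda>A. Tob X (Tob X A)) (\<lambda>f. Tar X (Tar X f)) (tl X) \<and>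
     is_natural X X (\<lambda>A. Tob X (Tob X A)) (\<lambda>f. Tar X (Tar X f))
       (\<lambda>A. Tob X (Tob X A)) (\<lambda>f. Tar X (Tar X f)) (tc X) \<and>
     (\<forall>A\<in>Ob X.
       \<comment> \<open>commutative monoid in the slice over \<open>A\<close>\<close>
       tp X A \<cdot>\<^bsub>X\<^esub> tz X A = Idn X A \<and>
       tp X A \<cdot>\<^bsub>X\<^esub> ts X A = tp X A \<cdot>\<^bsub>X\<^esub> pr1 X A \<and>
       (\<forall>P q \<pi>. is_fold_pullback X 3 (tp X A) P q \<pi> \<longrightarrow>
          ts X A \<cdot>\<^bsub>X\<^esub> pair X A (ts X A \<cdot>\<^bsub>X\<^esub> pair X A (\<pi> 0) (\<pi> 1)) (\<pi> 2) =
          ts X A \<cdot>\<^bsub>X\<^esub> pair X A (\<pi> 0) (ts X A \<cdot>\<^bsub>X\<^esub> pair X A (\<pi> 1) (\<pi> 2))) \<and>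
       ts X A \<cdot>\<^bsub>X\<^esub> pair X A (tz X A \<cdot>\<^bsub>X\<^esub> tp X A) (Idn X (Tob X A)) = Idn X (Tob X A) \<and>
       ts X A \<cdot>\<^bsub>X\<^esub> pair X A (pr2 X A) (pr1 X A) = ts X A \<and>
       \<comment> \<open>the lift is additive\<close>
       Tar X (tp X A) \<cdot>\<^bsub>X\<^esub> tl X A = tz X A \<cdot>\<^bsub>X\<^esub> tp X A \<and>
       tl X A \<cdot>\<^bsub>X\<^esub> tz X A = Tar X (tz X A) \<cdot>\<^bsub>X\<^esub> tz X A \<and>
       tl X A \<cdot>\<^bsub>X\<^esub> ts X A =
         Tar X (ts X A) \<cdot>\<^bsub>X\<^esub> tpair X A (tl X A \<cdot>\<^bsub>X\<^esub> pr1 X A) (tl X A \<cdot>\<^bsub>X\<^esub> pr2 X A) \<and>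
       \<comment> \<open>the flip is additive\<close>
       tp X (Tob X A) \<cdot>\<^bsub>X\<^esub> tc X A = Tar X (tp X A) \<and>
       tc X A \<cdot>\<^bsub>X\<^esub> Tar X (tz X A) = tz X (Tob X A) \<and>
       tc X A \<cdot>\<^bsub>X\<^esub> Tar X (ts X A) =
         ts X (Tob X A) \<cdot>\<^bsub>X\<^esub>
           pair X (Tob X A) (tc X A \<cdot>\<^bsub>X\<^esub> Tar X (pr1 X A)) (tc X A \<cdot>\<^bsub>X\<^esub> Tar X (pr2 X A)) \<and>
       \<comment> \<open>coherences\<close>
       Tar X (tl X A) \<cdot>\<^bsub>X\<^esub> tl X A = tl X (Tob X A) \<cdot>\<^bsub>X\<^esub> tl X A \<and>
       tc X A \<cdot>\<^bsub>X\<^esub> tl X A = tl X A \<and>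
       tc X (Tob X A) \<cdot>\<^bsub>X\<^esub> Tar X (tc X A) \<cdot>\<^bsub>X\<^esub> tl X (Tob X A) = Tar X (tl X A) \<cdot>\<^bsub>X\<^esub> tc X A \<and>
       tc X A \<cdot>\<^bsub>X\<^esub> tc X A = Idn X (Tob X (Tob X A)) \<and>
       Tar X (tc X A) \<cdot>\<^bsub>X\<^esub> tc X (Tob X A) \<cdot>\<^bsub>X\<^esub> Tar X (tc X A) =
         tc X (Tob X A) \<cdot>\<^bsub>X\<^esub> Tar X (tc X A) \<cdot>\<^bsub>X\<^esub> tc X (Tob X A) \<and>
       \<comment> \<open>universality of the lift\<close>
       is_pullback X (Tar X (tp X A)) (tz X A) (T2 X A)
         (Tar X (ts X A) \<cdot>\<^bsub>X\<^esub> tpair X A (tz X (Tob X A) \<cdot>\<^bsub>X\<^esub> pr1 X A) (tl X A \<cdot>\<^bsub>X\<^esub> pr2 X A))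
         (tp X A \<cdot>\<^bsub>X\<^esub> pr1 X A))"

text \<open>The equation \<open>p \<cdot> n = p\<close> is what makes the pairing of \<open>n\<close> with the identity exist.\<close>

definition has_negatives :: "('o, 'a) tang \<Rightarrow> bool" where
  "has_negatives X \<longleftrightarrow>
     is_natural X X (Tob X) (Tar X) (Tob X) (Tar X) (tn X) \<and>
     (\<forall>A\<in>Ob X. tp X A \<cdot>\<^bsub>X\<^esub> tn X A = tp X A \<and>
        ts X A \<cdot>\<^bsub>X\<^esub> pair X A (tn X A) (Idn X (Tob X A)) = tz X A \<cdot>\<^bsub>X\<^esub> tp X A)"


section \<open>Tangent morphisms\<close>

text \<open>A lax tangent morphism is a functor together with a distributive law
  \<open>lax A : F T' A \<rightarrow> T F A\<close>. All three maps are required to be \<open>extensional\<close> on the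
  carriers, so that equality of tangent morphisms is equality in HOL.\<close>

record ('x, 'y, 'o, 'a) mor =
  obm :: "'x \<Rightarrow> 'o"
  arm :: "'y \<Rightarrow> 'a"
  lax :: "'x \<Rightarrow> 'a"

definition tangent_morphism ::
  "('x, 'y) tang \<Rightarrow> ('o, 'a) tang \<Rightarrow> ('x, 'y, 'o, 'a) mor \<Rightarrow> bool" where
  "tangent_morphism X' X F \<longleftrightarrow>
     obm F \<in> extensional (Ob X') \<and> arm F \<in> extensional (Ar X') \<and> lax F \<in> extensional (Ob X') \<and>
     is_functor X' X (obm F) (arm F) \<and>
     is_natural X' X (\<lambda>A. obm F (Tob X' A)) (\<lambda>f. arm F (Tar X' f))
       (\<lambda>A. Tob X (obm F A)) (\<lambda>f. Tar X (arm F f)) (lax F) \<and>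
     (\<forall>A\<in>Ob X'.
       tp X (obm F A) \<cdot>\<^bsub>X\<^esub> lax F A = arm F (tp X' A) \<and>
       lax F A \<cdot>\<^bsub>X\<^esub> arm F (tz X' A) = tz X (obm F A) \<and>
       lax F A \<cdot>\<^bsub>X\<^esub> arm F (ts X' A) =
         ts X (obm F A) \<cdot>\<^bsub>X\<^esub>
           pair X (obm F A) (lax F A \<cdot>\<^bsub>X\<^esub> arm F (pr1 X' A)) (lax F A \<cdot>\<^bsub>X\<^esub> arm F (pr2 X' A)) \<and>
       tl X (obm F A) \<cdot>\<^bsub>X\<^esub> lax F A =
         Tar X (lax F A) \<cdot>\<^bsub>X\<^esub> lax F (Tob X' A) \<cdot>\<^bsub>X\<^esub> arm F (tl X' A) \<and>
       tc X (obm F A) \<cdot>\<^bsub>X\<^esub> Tar X (lax F A) \<cdot>\<^bsub>X\<^esub> lax F (Tob X' A) =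
         Tar X (lax F A) \<cdot>\<^bsub>X\<^esub> lax F (Tob X' A) \<cdot>\<^bsub>X\<^esub> arm F (tc X' A))"

definition is_strict ::
  "('x, 'y) tang \<Rightarrow> ('o, 'a) tang \<Rightarrow> ('x, 'y, 'o, 'a) mor \<Rightarrow> bool" where
  "is_strict X' X F \<longleftrightarrow>
     (\<forall>A\<in>Ob X'. obm F (Tob X' A) = Tob X (obm F A) \<and> lax F A = Idn X (Tob X (obm F A))) \<and>
     (\<forall>f\<in>Ar X'. arm F (Tar X' f) = Tar X (arm F f))"

definition strict_mor ::
  "('x, 'y) tang \<Rightarrow> ('o, 'a) tang \<Rightarrow> ('x \<Rightarrow> 'o) \<Rightarrow> ('y \<Rightarrow> 'a) \<Rightarrow> ('x, 'y, 'o, 'a) mor" where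
  "strict_mor X' X Fo Fa =
     \<lparr>obm = restrict Fo (Ob X'), arm = restrict Fa (Ar X'),
      lax = (\<lambda>A\<in>Ob X'. Idn X (Tob X (Fo A)))\<rparr>"

definition id_mor :: "('o, 'a) tang \<Rightarrow> ('o, 'a, 'o, 'a) mor" where
  "id_mor X = strict_mor X X (\<lambda>A. A) (\<lambda>f. f)"

definition comp_mor ::
  "('x, 'y) tang \<Rightarrow> ('p, 'b) tang \<Rightarrow> ('o, 'a, 'p, 'b) mor \<Rightarrow> ('x, 'y, 'o, 'a) mor \<Rightarrow>
   ('x, 'y, 'p, 'b) mor" where
  "comp_mor X' Y G F =
     \<lparr>obm = (\<lambda>A\<in>Ob X'. obm G (obm F A)), arm = (\<lambda>f\<in>Ar X'. arm G (arm F f)),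
      lax = (\<lambda>A\<in>Ob X'. lax G (obm F A) \<cdot>\<^bsub>Y\<^esub> arm G (lax F A))\<rparr>"

definition tangent_iso ::
  "('x, 'y) tang \<Rightarrow> ('o, 'a) tang \<Rightarrow> ('x, 'y, 'o, 'a) mor \<Rightarrow> bool" where
  "tangent_iso X' X F \<longleftrightarrow>
     tangent_category X' \<and> tangent_category X \<and> tangent_morphism X' X F \<and>
     (\<exists>G. tangent_morphism X X' G \<and>
        comp_mor X' X' G F = id_mor X' \<and> comp_mor X X F G = id_mor X)"


section \<open>The tangent category of tangent morphisms\<close>

text \<open>An arrow carrying its source and target. Arrows of hom categories and of categories of
  structured objects have this form, since their underlying data alone does not
  determine domain and codomain.\<close>

datatype ('s, 'b) marr = MArr (src: 's) (body: 'b) (tgt: 's)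

definition tangent_nat ::
  "('x, 'y) tang \<Rightarrow> ('o, 'a) tang \<Rightarrow> ('x, 'y, 'o, 'a) mor \<Rightarrow> ('x, 'y, 'o, 'a) mor \<Rightarrow>
   ('x \<Rightarrow> 'a) \<Rightarrow> bool" where
  "tangent_nat X' X F G \<phi> \<longleftrightarrow>
     \<phi> \<in> extensional (Ob X') \<and>
     is_natural X' X (obm F) (arm F) (obm G) (arm G) \<phi> \<and>
     (\<forall>A\<in>Ob X'. Tar X (\<phi> A) \<cdot>\<^bsub>X\<^esub> lax F A = lax G A \<cdot>\<^bsub>X\<^esub> \<phi> (Tob X' A))"

definition Tbar ::
  "('x, 'y) tang \<Rightarrow> ('o, 'a) tang \<Rightarrow> ('x, 'y, 'o, 'a) mor \<Rightarrow> ('x, 'y, 'o, 'a) mor" where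
  "Tbar X' X F =
     \<lparr>obm = (\<lambda>A\<in>Ob X'. Tob X (obm F A)), arm = (\<lambda>f\<in>Ar X'. Tar X (arm F f)),
      lax = (\<lambda>A\<in>Ob X'. tc X (obm F A) \<cdot>\<^bsub>X\<^esub> Tar X (lax F A))\<rparr>"

text \<open>The pullback \<open>T\<^sub>2\<close> of the hom category is computed pointwise: its distributive law
  \<open>T\<^sub>2 F T' A \<rightarrow> T T\<^sub>2 F A\<close> is the one for which both projections to \<open>Tbar\<close> are tangent
  natural transformations.\<close>

definition T2bar ::
  "('x, 'y) tang \<Rightarrow> ('o, 'a) tang \<Rightarrow> ('x, 'y, 'o, 'a) mor \<Rightarrow> ('x, 'y, 'o, 'a) mor" where
  "T2bar X' X F =
     \<lparr>obm = (\<lambda>A\<in>Ob X'. T2 X (obm F A)), arm = (\<lambda>f\<in>Ar X'. T2ar X (arm F f)),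
      lax = (\<lambda>A\<in>Ob X'. tpair X (obm F A)
        (tc X (obm F A) \<cdot>\<^bsub>X\<^esub> Tar X (lax F A) \<cdot>\<^bsub>X\<^esub> pr1 X (obm F (Tob X' A)))
        (tc X (obm F A) \<cdot>\<^bsub>X\<^esub> Tar X (lax F A) \<cdot>\<^bsub>X\<^esub> pr2 X (obm F (Tob X' A))))\<rparr>"

definition HOM ::
  "('x, 'y) tang \<Rightarrow> ('o, 'a) tang \<Rightarrow>
   (('x, 'y, 'o, 'a) mor, (('x, 'y, 'o, 'a) mor, 'x \<Rightarrow> 'a) marr) tang" where
  "HOM X' X =
     \<lparr>Ob = {F. tangent_morphism X' X F},
      Ar = {MArr F \<phi> G | F \<phi> G.
        tangent_morphism X' X F \<and> tangent_morphism X' X G \<and> tangent_nat X' X F G \<phi>},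
      Dom = src, Cod = tgt,
      Idn = (\<lambda>F. MArr F (\<lambda>A\<in>Ob X'. Idn X (obm F A)) F),
      Cmp = (\<lambda>\<psi> \<phi>. MArr (src \<phi>) (\<lambda>A\<in>Ob X'. body \<psi> A \<cdot>\<^bsub>X\<^esub> body \<phi> A) (tgt \<psi>)),
      Tob = Tbar X' X,
      Tar = (\<lambda>\<phi>. MArr (Tbar X' X (src \<phi>)) (\<lambda>A\<in>Ob X'. Tar X (body \<phi> A)) (Tbar X' X (tgt \<phi>))),
      T2 = T2bar X' X,
      pr1 = (\<lambda>F. MArr (T2bar X' X F) (\<lambda>A\<in>Ob X'. pr1 X (obm F A)) (Tbar X' X F)),
      pr2 = (\<lambda>F. MArr (T2bar X' X F) (\<lambda>A\<in>Ob X'. pr2 X (obm F A)) (Tbar X' X F)),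
      tp = (\<lambda>F. MArr (Tbar X' X F) (\<lambda>A\<in>Ob X'. tp X (obm F A)) F),
      tz = (\<lambda>F. MArr F (\<lambda>A\<in>Ob X'. tz X (obm F A)) (Tbar X' X F)),
      ts = (\<lambda>F. MArr (T2bar X' X F) (\<lambda>A\<in>Ob X'. ts X (obm F A)) (Tbar X' X F)),
      tl = (\<lambda>F. MArr (Tbar X' X F) (\<lambda>A\<in>Ob X'. tl X (obm F A)) (Tbar X' X (Tbar X' X F))),
      tc = (\<lambda>F. MArr (Tbar X' X (Tbar X' X F)) (\<lambda>A\<in>Ob X'. tc X (obm F A))
             (Tbar X' X (Tbar X' X F))),
      tn = (\<lambda>F. MArr (Tbar X' X F) (\<lambda>A\<in>Ob X'. tn X (obm F A)) (Tbar X' X F))\<rparr>"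

text \<open>Whiskering an arrow \<open>\<phi>\<close> of \<open>HOM X' V\<close> with \<open>U : V \<rightarrow> X\<close>, and an arrow \<open>w\<close> of
  \<open>HOM V X\<close> with \<open>H : X' \<rightarrow> V\<close>.\<close>

definition whisker_left ::
  "('x, 'y) tang \<Rightarrow> ('o, 'a) tang \<Rightarrow> ('vo, 'va, 'o, 'a) mor \<Rightarrow>
   (('x, 'y, 'vo, 'va) mor, 'x \<Rightarrow> 'va) marr \<Rightarrow> (('x, 'y, 'o, 'a) mor, 'x \<Rightarrow> 'a) marr" where
  "whisker_left X' X U \<phi> =
     MArr (comp_mor X' X U (src \<phi>)) (\<lambda>A\<in>Ob X'. arm U (body \<phi> A)) (comp_mor X' X U (tgt \<phi>))"

definition whisker_right ::
  "('x, 'y) tang \<Rightarrow> ('o, 'a) tang \<Rightarrow> (('vo, 'va, 'o, 'a) mor, 'vo \<Rightarrow> 'a) marr \<Rightarrow>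
   ('x, 'y, 'vo, 'va) mor \<Rightarrow> (('x, 'y, 'o, 'a) mor, 'x \<Rightarrow> 'a) marr" where
  "whisker_right X' X w H =
     MArr (comp_mor X' X (src w) H) (\<lambda>A\<in>Ob X'. body w (obm H A)) (comp_mor X' X (tgt w) H)"


section \<open>Vector fields, vertical affine connections and torsion\<close>

definition vector_field :: "('o, 'a) tang \<Rightarrow> 'o \<Rightarrow> 'a \<Rightarrow> bool" where
  "vector_field X M v \<longleftrightarrow> v \<in> hom X M (Tob X M) \<and> tp X M \<cdot>\<^bsub>X\<^esub> v = Idn X M"

definition vertical_connection :: "('o, 'a) tang \<Rightarrow> 'o \<Rightarrow> 'a \<Rightarrow> bool" where
  "vertical_connection X M k \<longleftrightarrow>
     k \<in> hom X (Tob X (Tob X M)) (Tob X M) \<and>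
     k \<cdot>\<^bsub>X\<^esub> tl X M = Idn X (Tob X M) \<and>
     tp X M \<cdot>\<^bsub>X\<^esub> k = tp X M \<cdot>\<^bsub>X\<^esub> tp X (Tob X M) \<and>
     Tar X k \<cdot>\<^bsub>X\<^esub> tl X (Tob X M) = tl X M \<cdot>\<^bsub>X\<^esub> k \<and>
     Tar X k \<cdot>\<^bsub>X\<^esub> tc X (Tob X M) \<cdot>\<^bsub>X\<^esub> Tar X (tl X M) = tl X M \<cdot>\<^bsub>X\<^esub> k"

definition fibre_diff :: "('o, 'a) tang \<Rightarrow> 'o \<Rightarrow> 'a \<Rightarrow> 'a \<Rightarrow> 'a" where
  "fibre_diff X M f g = ts X M \<cdot>\<^bsub>X\<^esub> pair X M f (tn X M \<cdot>\<^bsub>X\<^esub> g)"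

definition torsion :: "('o, 'a) tang \<Rightarrow> 'o \<Rightarrow> 'a \<Rightarrow> 'a" where
  "torsion X M k = fibre_diff X M (k \<cdot>\<^bsub>X\<^esub> tc X M) k"

definition torsion_tensor :: "('o, 'a) tang \<Rightarrow> 'o \<Rightarrow> 'a \<Rightarrow> 'a \<Rightarrow> 'a \<Rightarrow> 'a" where
  "torsion_tensor X M k u v = torsion X M k \<cdot>\<^bsub>X\<^esub> Tar X u \<cdot>\<^bsub>X\<^esub> v"

text \<open>Tangent categories of objects with extra structure, where all structure arrows are those of
  \<open>X\<close>: \<open>S\<close> is the set of structured objects, \<open>u\<close> the underlying object, \<open>R a f b\<close> says that
  \<open>f\<close> is compatible with the structures, and \<open>t\<close>, \<open>t2\<close> are the effects of \<open>T\<close>, \<open>T\<^sub>2\<close>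
  on structured objects.\<close>

definition structured ::
  "('o, 'a) tang \<Rightarrow> 's set \<Rightarrow> ('s \<Rightarrow> 'o) \<Rightarrow> ('s \<Rightarrow> 'a \<Rightarrow> 's \<Rightarrow> bool) \<Rightarrow> ('s \<Rightarrow> 's) \<Rightarrow> ('s \<Rightarrow> 's) \<Rightarrow>
   ('s, ('s, 'a) marr) tang" where
  "structured X S u R t t2 =
     \<lparr>Ob = S,
      Ar = {MArr a f b | a f b. a \<in> S \<and> b \<in> S \<and> f \<in> hom X (u a) (u b) \<and> R a f b},
      Dom = src, Cod = tgt,
      Idn = (\<lambda>a. MArr a (Idn X (u a)) a),
      Cmp = (\<lambda>g f. MArr (src f) (body g \<cdot>\<^bsub>X\<^esub> body f) (tgt g)),
      Tob = t,
      Tar = (\<lambda>f. MArr (t (src f)) (Tar X (body f)) (t (tgt f))),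
      T2 = t2,
      pr1 = (\<lambda>a. MArr (t2 a) (pr1 X (u a)) (t a)),
      pr2 = (\<lambda>a. MArr (t2 a) (pr2 X (u a)) (t a)),
      tp = (\<lambda>a. MArr (t a) (tp X (u a)) a),
      tz = (\<lambda>a. MArr a (tz X (u a)) (t a)),
      ts = (\<lambda>a. MArr (t2 a) (ts X (u a)) (t a)),
      tl = (\<lambda>a. MArr (t a) (tl X (u a)) (t (t a))),
      tc = (\<lambda>a. MArr (t (t a)) (tc X (u a)) (t (t a))),
      tn = (\<lambda>a. MArr (t a) (tn X (u a)) (t a))\<rparr>"

definition T_field :: "('o, 'a) tang \<Rightarrow> 'o \<Rightarrow> 'a \<Rightarrow> 'a" where
  "T_field X M v = tc X M \<cdot>\<^bsub>X\<^esub> Tar X v"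

definition T2_field :: "('o, 'a) tang \<Rightarrow> 'o \<Rightarrow> 'a \<Rightarrow> 'a" where
  "T2_field X M v = tpair X M (T_field X M v \<cdot>\<^bsub>X\<^esub> pr1 X M) (T_field X M v \<cdot>\<^bsub>X\<^esub> pr2 X M)"

definition T_conn :: "('o, 'a) tang \<Rightarrow> 'o \<Rightarrow> 'a \<Rightarrow> 'a" where
  "T_conn X M k = tc X M \<cdot>\<^bsub>X\<^esub> Tar X k \<cdot>\<^bsub>X\<^esub> tc X (Tob X M) \<cdot>\<^bsub>X\<^esub> Tar X (tc X M)"

definition T2_conn :: "('o, 'a) tang \<Rightarrow> 'o \<Rightarrow> 'a \<Rightarrow> 'a" where
  "T2_conn X M k = tpair X M (T_conn X M k \<cdot>\<^bsub>X\<^esub> Tar X (Tar X (pr1 X M)))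
                             (T_conn X M k \<cdot>\<^bsub>X\<^esub> Tar X (Tar X (pr2 X M)))"

definition field_morphism :: "('o, 'a) tang \<Rightarrow> 'a \<Rightarrow> 'a \<Rightarrow> 'a \<Rightarrow> bool" where
  "field_morphism X v f v' \<longleftrightarrow> v' \<cdot>\<^bsub>X\<^esub> f = Tar X f \<cdot>\<^bsub>X\<^esub> v"

definition conn_morphism :: "('o, 'a) tang \<Rightarrow> 'a \<Rightarrow> 'a \<Rightarrow> 'a \<Rightarrow> bool" where
  "conn_morphism X k f k' \<longleftrightarrow> k' \<cdot>\<^bsub>X\<^esub> Tar X (Tar X f) = Tar X f \<cdot>\<^bsub>X\<^esub> k"

definition VF :: "('o, 'a) tang \<Rightarrow> ('o \<times> 'a, ('o \<times> 'a, 'a) marr) tang" where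
  "VF X = structured X {(M, v). M \<in> Ob X \<and> vector_field X M v} fst
     (\<lambda>(M, v) f (M', v'). field_morphism X v f v')
     (\<lambda>(M, v). (Tob X M, T_field X M v))
     (\<lambda>(M, v). (T2 X M, T2_field X M v))"

definition VAC :: "('o, 'a) tang \<Rightarrow> ('o \<times> 'a, ('o \<times> 'a, 'a) marr) tang" where
  "VAC X = structured X {(M, k). M \<in> Ob X \<and> vertical_connection X M k} fst
     (\<lambda>(M, k) f (M', k'). conn_morphism X k f k')
     (\<lambda>(M, k). (Tob X M, T_conn X M k))
     (\<lambda>(M, k). (T2 X M, T2_conn X M k))"

definition VF2_VAC ::
  "('o, 'a) tang \<Rightarrow> ('o \<times> 'a \<times> 'a \<times> 'a, ('o \<times> 'a \<times> 'a \<times> 'a, 'a) marr) tang" where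
  "VF2_VAC X = structured X
     {(M, k, u, v). M \<in> Ob X \<and> vertical_connection X M k \<and>
        vector_field X M u \<and> vector_field X M v} fst
     (\<lambda>(M, k, u, v) f (M', k', u', v').
        conn_morphism X k f k' \<and> field_morphism X u f u' \<and> field_morphism X v f v')
     (\<lambda>(M, k, u, v). (Tob X M, T_conn X M k, T_field X M u, T_field X M v))
     (\<lambda>(M, k, u, v). (T2 X M, T2_conn X M k, T2_field X M u, T2_field X M v))"


section \<open>Universal constructions\<close>

text \<open>The morphism \<open>H \<mapsto> (U H, w\<^sub>H)\<close> from \<open>HOM X' V\<close> to \<open>E\<close>, for an arrow \<open>w\<close> of \<open>HOM V X\<close>; here
  \<open>E\<close> is \<open>VF (HOM X' X)\<close> or \<open>VAC (HOM X' X)\<close>. Its distributive law is that of \<open>U\<close>, whiskered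
  with \<open>H\<close>; it is the identity when \<open>U\<close> is strict.\<close>

definition induced where
  "induced X' X V E U w =
     (let \<Gamma> = (\<lambda>H. (comp_mor X' X U H, whisker_right X' X w H)) in
      \<lparr>obm = (\<lambda>H\<in>Ob (HOM X' V). \<Gamma> H),
       arm = (\<lambda>\<phi>\<in>Ar (HOM X' V). MArr (\<Gamma> (src \<phi>)) (whisker_left X' X U \<phi>) (\<Gamma> (tgt \<phi>))),
       lax = (\<lambda>H\<in>Ob (HOM X' V).
         MArr (\<Gamma> (Tob (HOM X' V) H))
           (MArr (comp_mor X' X U (Tob (HOM X' V) H)) (\<lambda>A\<in>Ob X'. lax U (obm H A))
             (Tob (HOM X' X) (comp_mor X' X U H)))
           (Tob E (\<Gamma> H)))\<rparr>)"

text \<open>In the following definitions the test categories \<open>X'\<close> range over all tangent categories on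
  the types \<open>'x\<close>, \<open>'y\<close>. As HOL cannot quantify over types inside a definition, these types are
  a parameter, and "for every tangent category" means that the type argument is left
  arbitrary. The universal data are parameters and not existentially bound, so
  that they cannot depend on the types \<open>'x\<close>, \<open>'y\<close>.\<close>

definition constructs_VF ::
  "('x, 'y) tang itself \<Rightarrow> ('o, 'a) tang \<Rightarrow> ('vo, 'va) tang \<Rightarrow> ('vo, 'va, 'o, 'a) mor \<Rightarrow>
   (('vo, 'va, 'o, 'a) mor, 'vo \<Rightarrow> 'a) marr \<Rightarrow> bool" where
  "constructs_VF _ X V U v \<longleftrightarrow>
     tangent_category V \<and> tangent_morphism V X U \<and> is_strict V X U \<and>
     vector_field (HOM V X) U v \<and>
     (\<forall>X' :: ('x, 'y) tang. tangent_category X' \<longrightarrow>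
        tangent_iso (HOM X' V) (VF (HOM X' X)) (induced X' X V (VF (HOM X' X)) U v))"

definition constructs_VAC ::
  "('x, 'y) tang itself \<Rightarrow> ('o, 'a) tang \<Rightarrow> ('ko, 'ka) tang \<Rightarrow> ('ko, 'ka, 'o, 'a) mor \<Rightarrow>
   (('ko, 'ka, 'o, 'a) mor, 'ko \<Rightarrow> 'a) marr \<Rightarrow> bool" where
  "constructs_VAC _ X K U k \<longleftrightarrow>
     tangent_category K \<and> tangent_morphism K X U \<and>
     vertical_connection (HOM K X) U k \<and>
     (\<forall>X' :: ('x, 'y) tang. tangent_category X' \<longrightarrow>
        tangent_iso (HOM X' K) (VAC (HOM X' X)) (induced X' X K (VAC (HOM X' X)) U k))"

text \<open>Threefold 2-pullback in the 2-category of tangent categories, tangent morphisms and tangent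
  natural transformations, in the strict sense: composition with the projections is an
  isomorphism from the category \<open>HOM X' P\<close> onto the pullback of the hom categories, that is, a
  bijection on tangent morphisms and on tangent natural transformations.\<close>

definition is_2_pullback3 ::
  "('x, 'y) tang itself \<Rightarrow> ('o, 'a) tang \<Rightarrow>
   ('o1, 'a1) tang \<Rightarrow> ('o1, 'a1, 'o, 'a) mor \<Rightarrow>
   ('o2, 'a2) tang \<Rightarrow> ('o2, 'a2, 'o, 'a) mor \<Rightarrow>
   ('o3, 'a3) tang \<Rightarrow> ('o3, 'a3, 'o, 'a) mor \<Rightarrow>
   ('po, 'pa) tang \<Rightarrow> ('po, 'pa, 'o1, 'a1) mor \<Rightarrow> ('po, 'pa, 'o2, 'a2) mor \<Rightarrow>
   ('po, 'pa, 'o3, 'a3) mor \<Rightarrow> bool" where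
  "is_2_pullback3 _ X Y1 U1 Y2 U2 Y3 U3 P \<pi>1 \<pi>2 \<pi>3 \<longleftrightarrow>
     tangent_category P \<and>
     tangent_morphism P Y1 \<pi>1 \<and> tangent_morphism P Y2 \<pi>2 \<and> tangent_morphism P Y3 \<pi>3 \<and>
     comp_mor P X U1 \<pi>1 = comp_mor P X U2 \<pi>2 \<and> comp_mor P X U2 \<pi>2 = comp_mor P X U3 \<pi>3 \<and>
     (\<forall>X' :: ('x, 'y) tang. tangent_category X' \<longrightarrow>
       (\<forall>H1 H2 H3.
          tangent_morphism X' Y1 H1 \<longrightarrow> tangent_morphism X' Y2 H2 \<longrightarrow> tangent_morphism X' Y3 H3 \<longrightarrow>
          comp_mor X' X U1 H1 = comp_mor X' X U2 H2 \<longrightarrow>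
          comp_mor X' X U2 H2 = comp_mor X' X U3 H3 \<longrightarrow>
          (\<exists>!H. tangent_morphism X' P H \<and>
             comp_mor X' Y1 \<pi>1 H = H1 \<and> comp_mor X' Y2 \<pi>2 H = H2 \<and> comp_mor X' Y3 \<pi>3 H = H3)) \<and>
       (\<forall>H G \<phi>1 \<phi>2 \<phi>3.
          tangent_morphism X' P H \<longrightarrow> tangent_morphism X' P G \<longrightarrow>
          \<phi>1 \<in> hom (HOM X' Y1) (comp_mor X' Y1 \<pi>1 H) (comp_mor X' Y1 \<pi>1 G) \<longrightarrow>
          \<phi>2 \<in> hom (HOM X' Y2) (comp_mor X' Y2 \<pi>2 H) (comp_mor X' Y2 \<pi>2 G) \<longrightarrow>
          \<phi>3 \<in> hom (HOM X' Y3) (comp_mor X' Y3 \<pi>3 H) (comp_mor X' Y3 \<pi>3 G) \<longrightarrow>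
          whisker_left X' X U1 \<phi>1 = whisker_left X' X U2 \<phi>2 \<longrightarrow>
          whisker_left X' X U2 \<phi>2 = whisker_left X' X U3 \<phi>3 \<longrightarrow>
          (\<exists>!\<phi>. \<phi> \<in> hom (HOM X' P) H G \<and>
             whisker_left X' Y1 \<pi>1 \<phi> = \<phi>1 \<and> whisker_left X' Y2 \<pi>2 \<phi> = \<phi>2 \<and>
             whisker_left X' Y3 \<pi>3 \<phi> = \<phi>3)))"

definition constructs_torsion_tensor where
  "constructs_torsion_tensor (t :: ('x, 'y) tang itself) X V U v K U' k P \<pi>1 \<pi>2 \<pi>3 \<longleftrightarrow>
     constructs_VF t X V U v \<and> constructs_VAC t X K U' k \<and>
     is_2_pullback3 t X V U V U K U' P \<pi>1 \<pi>2 \<pi>3"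

text \<open>The object over which the three pulled back structures live is \<open>comp_mor P X U \<pi>1\<close>.\<close>

definition universal_torsion where
  "universal_torsion X U v k P \<pi>1 \<pi>2 \<pi>3 =
     torsion_tensor (HOM P X) (comp_mor P X U \<pi>1) (whisker_right P X k \<pi>3)
       (whisker_right P X v \<pi>1) (whisker_right P X v \<pi>2)"

definition is_torsion_operator where
  "is_torsion_operator X V U v k P \<pi>1 \<pi>2 \<pi>3 W \<longleftrightarrow>
     tangent_morphism P V W \<and>
     obm (induced P X V (VF (HOM P X)) U v) W =
       (comp_mor P X U \<pi>1, universal_torsion X U v k P \<pi>1 \<pi>2 \<pi>3)"

definition torsion_operator where
  "torsion_operator X V U v k P \<pi>1 \<pi>2 \<pi>3 =
     (THE W. is_torsion_operator X V U v k P \<pi>1 \<pi>2 \<pi>3 W)"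


section \<open>The concrete data\<close>

definition VF_forget :: "('o, 'a) tang \<Rightarrow> ('o \<times> 'a, ('o \<times> 'a, 'a) marr, 'o, 'a) mor" where
  "VF_forget X = strict_mor (VF X) X fst body"

definition VF_univ ::
  "('o, 'a) tang \<Rightarrow>
   (('o \<times> 'a, ('o \<times> 'a, 'a) marr, 'o, 'a) mor, 'o \<times> 'a \<Rightarrow> 'a) marr" where
  "VF_univ X =
     MArr (VF_forget X) (\<lambda>a\<in>Ob (VF X). snd a) (Tob (HOM (VF X) X) (VF_forget X))"

definition VAC_forget :: "('o, 'a) tang \<Rightarrow> ('o \<times> 'a, ('o \<times> 'a, 'a) marr, 'o, 'a) mor" where
  "VAC_forget X = strict_mor (VAC X) X fst body"

definition VAC_univ ::
  "('o, 'a) tang \<Rightarrow>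
   (('o \<times> 'a, ('o \<times> 'a, 'a) marr, 'o, 'a) mor, 'o \<times> 'a \<Rightarrow> 'a) marr" where
  "VAC_univ X =
     MArr (Tob (HOM (VAC X) X) (Tob (HOM (VAC X) X) (VAC_forget X))) (\<lambda>a\<in>Ob (VAC X). snd a)
       (Tob (HOM (VAC X) X) (VAC_forget X))"

definition project ::
  "('s, ('s, 'a) marr) tang \<Rightarrow> ('r, ('r, 'a) marr) tang \<Rightarrow> ('s \<Rightarrow> 'r) \<Rightarrow>
   ('s, ('s, 'a) marr, 'r, ('r, 'a) marr) mor" where
  "project P Y g = strict_mor P Y g (\<lambda>f. MArr (g (src f)) (body f) (g (tgt f)))"

definition proj_u where
  "proj_u X = project (VF2_VAC X) (VF X) (\<lambda>(M, k, u, v). (M, u))"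

definition proj_v where
  "proj_v X = project (VF2_VAC X) (VF X) (\<lambda>(M, k, u, v). (M, v))"

definition proj_k where
  "proj_k X = project (VF2_VAC X) (VAC X) (\<lambda>(M, k, u, v). (M, k))"

end

theory Submission
  imports Defs
begin

text \<open>
  The proof rests on one observation about where tangent structures come from. Let \<open>C\<close> be a category
  with tangent data and let \<open>E\<^sub>i : C \<rightarrow> X\<close> be functors to a tangent category that are jointly faithful
  and preserve these data strictly. Every equational axiom holds in \<open>C\<close> because it holds after
  each \<open>E\<^sub>i\<close>. The axioms about pullbacks hold as soon as the pullbacks of \<open>p\<close> can be lifted to \<open>C\<close>
  and arrows into limit objects can be lifted along their projections
  (\<open>evaluations.tangent_category\<close>). An arrow of \<open>C\<close> will be an arrow of \<open>X\<close>, or a family of them,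
  that is compatible with some extra structure on its ends, and for arrows with codomain \<open>P\<close>
  compatibility is an equation between arrows into \<open>P\<close> or \<open>T P\<close>. It can therefore be tested on
  projections out of \<open>P\<close> that are jointly monic also after applying \<open>T\<close>. For the pullbacks of \<open>p\<close>
  this holds because \<open>T\<close> preserves them. For the square of the vertical lift it holds because the
  flip identifies the image of this square under \<open>T\<close> with the same square one level up
  (\<open>lift_T_monic\<close>).

  This applies to the category of tangent morphisms \<open>X' \<rightarrow> X\<close>, evaluated at the objects of \<open>X'\<close>, and
  to the categories of vector fields, of vertical connections and of triples of both, each with
  its forgetful functor. In the latter cases the extra structure consists of arrows \<open>x : J M \<rightarrow> T M\<close>
  with \<open>J\<close> the identity or \<open>T\<^sup>2\<close>. Since \<open>J\<close> is a tangent morphism, with law \<open>\<sigma> : J T \<rightarrow> T J\<close>, the tangent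
  functor \<open>x \<mapsto> c \<cdot> T x \<cdot> \<sigma>\<close> makes all structure arrows of \<open>X\<close> compatible
  (\<open>Str_structures\<close>).

  The universal properties now amount to reading one set of equations in two ways. A tangent
  morphism \<open>H\<close> from \<open>X'\<close> to \<open>VF X\<close> is a tangent morphism \<open>(F, \<alpha>)\<close> to \<open>X\<close> together with vector fields
  \<open>v\<^sub>A\<close> on the objects \<open>F A\<close> such that all \<open>F f\<close> and all \<open>\<alpha>\<^sub>A\<close> are morphisms of vector fields. The first
  condition says that \<open>v\<close> is natural. The second one says, as \<open>c \<cdot> c = id\<close>, that it is a tangent
  natural transformation \<open>F \<rightarrow> T F\<close>. So \<open>H\<close> is the same as a vector field on \<open>F\<close> in the category of
  tangent morphisms. The same applies to connections and to arrows, so the comparison functor is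
  strict and bijective, hence an isomorphism (\<open>comparison_iso\<close>). A triple of structures over the
  same \<open>F\<close> is in the same way a tangent morphism to \<open>VF2_VAC X\<close>, which is the 2-pullback.

  Finally, \<open>k \<cdot> c\<close> and \<open>k\<close> lie over the same arrow, so the torsion tensor of a connection and two
  vector fields is a vector field in every tangent category with negatives. The category of
  tangent morphisms inherits negatives pointwise, because inverses are unique and hence compatible
  with the flip. The torsion tensor of the universal structures is therefore a vector field there
  and corresponds to a unique tangent morphism \<open>W\<close>; evaluating it at \<open>(M, k, u, v)\<close> gives the
  torsion tensor of \<open>k\<close>, \<open>u\<close> and \<open>v\<close>.
\<close>

section \<open>Typed rewriting in categories and tangent categories\<close>

text \<open>An infix whose category is implicit, since the proofs consist largely of long composites in
  one fixed category.\<close>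

abbreviation cmp_index :: "('o, 'a, 'z) cat_scheme \<Rightarrow> 'a \<Rightarrow> 'a \<Rightarrow> 'a" (infixr "\<bullet>\<index>" 75) where
  "g \<bullet>\<^bsub>C\<^esub> f \<equiv> Cmp C g f"

locale category =
  fixes C :: "('o, 'a) tang" (structure)
  assumes category: "is_category C"
begin

text \<open>Arrows are typed by their domain and codomain rather than by membership in hom sets. The
  simplifier can then discharge the typing conditions of the rewrite rules by computing domains
  and codomains of composites.\<close>

lemma dom_ob [simp]: "f \<in> Ar C \<Longrightarrow> Dom C f \<in> Ob C"
  and cod_ob [simp]: "f \<in> Ar C \<Longrightarrow> Cod C f \<in> Ob C"
  and idn_ar [simp]: "A \<in> Ob C \<Longrightarrow> Idn C A \<in> Ar C"
  and idn_dom [simp]: "A \<in> Ob C \<Longrightarrow> Dom C (Idn C A) = A"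
  and idn_cod [simp]: "A \<in> Ob C \<Longrightarrow> Cod C (Idn C A) = A"
  and cmp_ar [simp]: "\<lbrakk>f \<in> Ar C; g \<in> Ar C; Cod C f = Dom C g\<rbrakk> \<Longrightarrow> g \<bullet> f \<in> Ar C"
  and cmp_dom [simp]: "\<lbrakk>f \<in> Ar C; g \<in> Ar C; Cod C f = Dom C g\<rbrakk> \<Longrightarrow> Dom C (g \<bullet> f) = Dom C f"
  and cmp_cod [simp]: "\<lbrakk>f \<in> Ar C; g \<in> Ar C; Cod C f = Dom C g\<rbrakk> \<Longrightarrow> Cod C (g \<bullet> f) = Cod C g"
  and assoc [simp]: "\<lbrakk>f \<in> Ar C; g \<in> Ar C; h \<in> Ar C; Cod C f = Dom C g; Cod C g = Dom C h\<rbrakk> \<Longrightarrow>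
    (h \<bullet> g) \<bullet> f = h \<bullet> (g \<bullet> f)"
  and idn_right [simp]: "\<lbrakk>f \<in> Ar C; Dom C f = A\<rbrakk> \<Longrightarrow> f \<bullet> Idn C A = f"
  and idn_left [simp]: "\<lbrakk>f \<in> Ar C; Cod C f = A\<rbrakk> \<Longrightarrow> Idn C A \<bullet> f = f"
  using category by (auto simp: is_category_def hom_def)

text \<open>Composites are normalised by nesting them to the right; this turns an equation between
  two composites into the rewrite rule that applies it in front of a further arrow.\<close>

lemma extend:
  assumes "a \<bullet> b = c" "a \<in> Ar C" "b \<in> Ar C" "Cod C b = Dom C a" "x \<in> Ar C" "Cod C x = Dom C b"
  shows "a \<bullet> (b \<bullet> x) = c \<bullet> x"
  using assms assoc[of x b a] by simp

end

text \<open>Two levels are needed because equations of two kinds are tested on such families: equations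
  between arrows into \<open>P\<close>, such as naturality, and compatibility with a structure or a
  distributive law, which is an equation between arrows into \<open>T P\<close>.\<close>

definition jointly_monic :: "('o, 'a) tang \<Rightarrow> 'o \<Rightarrow> 'a set \<Rightarrow> bool" where
  "jointly_monic X P L \<longleftrightarrow> (\<forall>a\<in>Ar X. \<forall>b\<in>Ar X. Dom X a = Dom X b \<longrightarrow> Cod X a = P \<longrightarrow> Cod X b = P \<longrightarrow>
     (\<forall>l\<in>L. l \<cdot>\<^bsub>X\<^esub> a = l \<cdot>\<^bsub>X\<^esub> b) \<longrightarrow> a = b)"

definition T_monic :: "('o, 'a) tang \<Rightarrow> 'o \<Rightarrow> 'a set \<Rightarrow> bool" where
  "T_monic X P L \<longleftrightarrow> jointly_monic X P L \<and> jointly_monic X (Tob X P) (Tar X ` L)"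

lemma jointly_monicD:
  assumes "jointly_monic X P L" "a \<in> Ar X" "b \<in> Ar X" "Dom X a = Dom X b" "Cod X a = P" "Cod X b = P"
    "\<And>l. l \<in> L \<Longrightarrow> l \<cdot>\<^bsub>X\<^esub> a = l \<cdot>\<^bsub>X\<^esub> b"
  shows "a = b"
  using assms unfolding jointly_monic_def by blast

lemma T_monicD0:
  assumes "T_monic X P L" "a \<in> Ar X" "b \<in> Ar X" "Dom X a = Dom X b" "Cod X a = P" "Cod X b = P"
    "\<And>l. l \<in> L \<Longrightarrow> l \<cdot>\<^bsub>X\<^esub> a = l \<cdot>\<^bsub>X\<^esub> b"
  shows "a = b"
  using assms unfolding T_monic_def by (blast intro: jointly_monicD)

lemma T_monicD1:
  assumes "T_monic X P L" "a \<in> Ar X" "b \<in> Ar X" "Dom X a = Dom X b"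
    "Cod X a = Tob X P" "Cod X b = Tob X P"
    "\<And>l. l \<in> L \<Longrightarrow> Tar X l \<cdot>\<^bsub>X\<^esub> a = Tar X l \<cdot>\<^bsub>X\<^esub> b"
  shows "a = b"
  using assms unfolding T_monic_def by (auto intro: jointly_monicD[of X "Tob X P" "Tar X ` L"])

lemma pullback_jointly_monic:
  fixes X :: "('o, 'a) tang" (structure)
  assumes "is_pullback X f g P a b" "is_category X"
  shows "jointly_monic X P {a, b}"
  unfolding jointly_monic_def
proof (intro ballI impI)
  fix x y assume *: "x \<in> Ar X" "y \<in> Ar X" "Dom X x = Dom X y" "Cod X x = P" "Cod X y = P"
    "\<forall>l\<in>{a, b}. l \<bullet> x = l \<bullet> y"
  interpret category X by unfold_locales (rule assms)
  have t: "f \<in> Ar X" "g \<in> Ar X" "a \<in> Ar X" "Dom X a = P" "Cod X a = Dom X f"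
    "b \<in> Ar X" "Dom X b = P" "Cod X b = Dom X g" "f \<bullet> a = g \<bullet> b" "Cod X f = Cod X g"
    using assms by (auto simp: is_pullback_def hom_def)
  have "f \<bullet> (a \<bullet> x) = g \<bullet> (b \<bullet> x)"
    using t * extend[of f a "g \<bullet> b" x] by simp
  then have "\<exists>!h. h \<in> hom X (Dom X x) P \<and> a \<bullet> h = a \<bullet> x \<and> b \<bullet> h = b \<bullet> x"
    using assms(1) t * by (auto simp: is_pullback_def hom_def)
  then show "x = y" using * by (auto simp: hom_def)
qed

lemma pullback_lift:
  fixes X :: "('o, 'a) tang" (structure)
  assumes "is_pullback X f g P a b" "is_category X"
    "x \<in> Ar X" "y \<in> Ar X" "Dom X x = Dom X y" "Cod X x = Dom X f" "Cod X y = Dom X g"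
    "f \<bullet> x = g \<bullet> y"
  shows "\<exists>h\<in>hom X (Dom X x) P. a \<bullet> h = x \<and> b \<bullet> h = y"
proof -
  interpret category X by unfold_locales (rule assms)
  have "\<exists>!h. h \<in> hom X (Dom X x) P \<and> a \<bullet> h = x \<and> b \<bullet> h = y"
    using assms unfolding is_pullback_def
    by (elim conjE) (drule bspec[of _ _ "Dom X x"], simp, drule bspec[of _ _ x], simp add: hom_def,
      drule bspec[of _ _ y], simp_all add: hom_def)
  then show ?thesis by auto
qed

lemma fold_pullback_jointly_monic:
  fixes X :: "('o, 'a) tang" (structure)
  assumes "is_fold_pullback X n e P q \<pi>" "is_category X"
  shows "jointly_monic X P (insert q (\<pi> ` {..<n}))"
  unfolding jointly_monic_def
proof (intro ballI impI)
  fix x y assume *: "x \<in> Ar X" "y \<in> Ar X" "Dom X x = Dom X y" "Cod X x = P" "Cod X y = P"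
    "\<forall>l\<in>insert q (\<pi> ` {..<n}). l \<bullet> x = l \<bullet> y"
  interpret category X by unfold_locales (rule assms)
  have t: "e \<in> Ar X" "q \<in> Ar X" "Dom X q = P" "Cod X q = Cod X e"
    "\<And>i. i < n \<Longrightarrow> \<pi> i \<in> Ar X" "\<And>i. i < n \<Longrightarrow> Dom X (\<pi> i) = P" "\<And>i. i < n \<Longrightarrow> Cod X (\<pi> i) = Dom X e"
    "\<And>i. i < n \<Longrightarrow> e \<bullet> \<pi> i = q"
    using assms by (auto simp: is_fold_pullback_def hom_def)
  have "\<And>i. i < n \<Longrightarrow> e \<bullet> (\<pi> i \<bullet> x) = q \<bullet> x"
    using t(1-8) *(1,4) by (subst assoc[symmetric]) simp_all
  then have "\<exists>!h. h \<in> hom X (Dom X x) P \<and> q \<bullet> h = q \<bullet> x \<and> (\<forall>i<n. \<pi> i \<bullet> h = \<pi> i \<bullet> x)"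
    using assms(1) t * unfolding is_fold_pullback_def
    by (elim conjE) (drule bspec[of _ _ "Dom X x"], simp, drule bspec[of _ _ "q \<bullet> x"],
      simp add: hom_def, drule spec[of _ "\<lambda>i. \<pi> i \<bullet> x"], simp add: hom_def)
  then show "x = y" using * by (auto simp: hom_def)
qed

lemma fold_pullback_lift:
  fixes X :: "('o, 'a) tang" (structure)
  assumes "is_fold_pullback X n e P q \<pi>" "is_category X" "r \<in> Ar X" "Cod X r = Cod X e"
    "\<And>i. i < n \<Longrightarrow> g i \<in> Ar X" "\<And>i. i < n \<Longrightarrow> Dom X (g i) = Dom X r"
    "\<And>i. i < n \<Longrightarrow> Cod X (g i) = Dom X e" "\<And>i. i < n \<Longrightarrow> e \<bullet> g i = r"
  shows "\<exists>h\<in>hom X (Dom X r) P. q \<bullet> h = r \<and> (\<forall>i<n. \<pi> i \<bullet> h = g i)"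
proof -
  interpret category X by unfold_locales (rule assms)
  have "\<exists>!h. h \<in> hom X (Dom X r) P \<and> q \<bullet> h = r \<and> (\<forall>i<n. \<pi> i \<bullet> h = g i)"
    using assms unfolding is_fold_pullback_def
    by (elim conjE) (drule bspec[of _ _ "Dom X r"], simp, drule bspec[of _ _ "r"],
      simp add: hom_def, drule spec[of _ g], simp add: hom_def)
  then show ?thesis by auto
qed

locale tangent =
  fixes X :: "('o, 'a) tang" (structure)
  assumes tangent: "tangent_category X"

sublocale tangent \<subseteq> category X
  by unfold_locales (use tangent in \<open>simp add: tangent_category_def\<close>)

context tangent
begin

lemmas axioms_conj = tangent[unfolded tangent_category_def]

lemma T_functor: "is_functor X X (Tob X) (Tar X)"
  using axioms_conj by (elim conjE)

lemma tob_ob [simp]: "A \<in> Ob X \<Longrightarrow> Tob X A \<in> Ob X"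
  and tar_idn [simp]: "A \<in> Ob X \<Longrightarrow> Tar X (Idn X A) = Idn X (Tob X A)"
  and tar_ar [simp]: "f \<in> Ar X \<Longrightarrow> Tar X f \<in> Ar X"
  and tar_dom [simp]: "f \<in> Ar X \<Longrightarrow> Dom X (Tar X f) = Tob X (Dom X f)"
  and tar_cod [simp]: "f \<in> Ar X \<Longrightarrow> Cod X (Tar X f) = Tob X (Cod X f)"
  and tar_cmp [simp]: "\<lbrakk>f \<in> Ar X; g \<in> Ar X; Cod X f = Dom X g\<rbrakk> \<Longrightarrow>
    Tar X (g \<bullet> f) = Tar X g \<bullet> Tar X f"
  using T_functor by (auto simp: is_functor_def hom_def)

lemma T2_pullback: "A \<in> Ob X \<Longrightarrow> is_pullback X (tp X A) (tp X A) (T2 X A) (pr1 X A) (pr2 X A)"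
  using axioms_conj[THEN conjunct2, THEN conjunct2, THEN conjunct2, THEN conjunct1] by blast

lemma fold_pullback_exists: "A \<in> Ob X \<Longrightarrow> \<exists>P q \<pi>. is_fold_pullback X n (tp X A) P q \<pi>"
  using axioms_conj by (elim conjE) blast

lemma fold_pullback_preserved:
  "A \<in> Ob X \<Longrightarrow> is_fold_pullback X n (tp X A) P q \<pi> \<Longrightarrow>
        is_fold_pullback X n ((Tar X ^^ m) (tp X A)) ((Tob X ^^ m) P) ((Tar X ^^ m) q)
          (\<lambda>i. (Tar X ^^ m) (\<pi> i))"
  using axioms_conj by (elim conjE) blast

lemma tp_ar [simp]: "A \<in> Ob X \<Longrightarrow> tp X A \<in> Ar X"
  and tp_dom [simp]: "A \<in> Ob X \<Longrightarrow> Dom X (tp X A) = Tob X A"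
  and tp_cod [simp]: "A \<in> Ob X \<Longrightarrow> Cod X (tp X A) = A"
  and tp_nat: "\<lbrakk>f \<in> Ar X; Cod X f = B\<rbrakk> \<Longrightarrow> tp X B \<bullet> Tar X f = f \<bullet> tp X (Dom X f)"
  using axioms_conj by (auto simp: is_natural_def hom_def)

lemma tz_ar [simp]: "A \<in> Ob X \<Longrightarrow> tz X A \<in> Ar X"
  and tz_dom [simp]: "A \<in> Ob X \<Longrightarrow> Dom X (tz X A) = A"
  and tz_cod [simp]: "A \<in> Ob X \<Longrightarrow> Cod X (tz X A) = Tob X A"
  and tz_nat: "\<lbrakk>f \<in> Ar X; Cod X f = B\<rbrakk> \<Longrightarrow> tz X B \<bullet> f = Tar X f \<bullet> tz X (Dom X f)"
  using axioms_conj by (auto simp: is_natural_def hom_def)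

lemma tl_ar [simp]: "A \<in> Ob X \<Longrightarrow> tl X A \<in> Ar X"
  and tl_dom [simp]: "A \<in> Ob X \<Longrightarrow> Dom X (tl X A) = Tob X A"
  and tl_cod [simp]: "A \<in> Ob X \<Longrightarrow> Cod X (tl X A) = Tob X (Tob X A)"
  and tl_nat: "\<lbrakk>f \<in> Ar X; Cod X f = B\<rbrakk> \<Longrightarrow>
     tl X B \<bullet> Tar X f = Tar X (Tar X f) \<bullet> tl X (Dom X f)"
  using axioms_conj by (auto simp: is_natural_def hom_def)

lemma tc_ar [simp]: "A \<in> Ob X \<Longrightarrow> tc X A \<in> Ar X"
  and tc_dom [simp]: "A \<in> Ob X \<Longrightarrow> Dom X (tc X A) = Tob X (Tob X A)"
  and tc_cod [simp]: "A \<in> Ob X \<Longrightarrow> Cod X (tc X A) = Tob X (Tob X A)"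
  and tc_nat: "\<lbrakk>f \<in> Ar X; Cod X f = B\<rbrakk> \<Longrightarrow>
     tc X B \<bullet> Tar X (Tar X f) = Tar X (Tar X f) \<bullet> tc X (Dom X f)"
  using axioms_conj by (auto simp: is_natural_def hom_def)

lemma ts_natural: "is_natural X X (T2 X) (T2ar X) (Tob X) (Tar X) (ts X)"
  using axioms_conj by (elim conjE)

lemma ts_ar [simp]: "A \<in> Ob X \<Longrightarrow> ts X A \<in> Ar X"
  and ts_dom [simp]: "A \<in> Ob X \<Longrightarrow> Dom X (ts X A) = T2 X A"
  and ts_cod [simp]: "A \<in> Ob X \<Longrightarrow> Cod X (ts X A) = Tob X A"
  using ts_natural by (auto simp: is_natural_def hom_def)

lemma pr1_ar [simp]: "A \<in> Ob X \<Longrightarrow> pr1 X A \<in> Ar X"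
  and pr1_dom [simp]: "A \<in> Ob X \<Longrightarrow> Dom X (pr1 X A) = T2 X A"
  and pr1_cod [simp]: "A \<in> Ob X \<Longrightarrow> Cod X (pr1 X A) = Tob X A"
  and pr2_ar [simp]: "A \<in> Ob X \<Longrightarrow> pr2 X A \<in> Ar X"
  and pr2_dom [simp]: "A \<in> Ob X \<Longrightarrow> Dom X (pr2 X A) = T2 X A"
  and pr2_cod [simp]: "A \<in> Ob X \<Longrightarrow> Cod X (pr2 X A) = Tob X A"
  and p_pr2 [simp]: "A \<in> Ob X \<Longrightarrow> tp X A \<bullet> pr2 X A = tp X A \<bullet> pr1 X A"
  using T2_pullback[of A] by (simp_all add: is_pullback_def hom_def)

lemma T2_ob [simp]: "A \<in> Ob X \<Longrightarrow> T2 X A \<in> Ob X"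
  using dom_ob[of "pr1 X A"] by simp

lemmas per_object = axioms_conj[THEN conjunct2, THEN conjunct2, THEN conjunct2, THEN conjunct2,
  THEN conjunct2, THEN conjunct2, THEN conjunct2, THEN conjunct2, THEN conjunct2, THEN conjunct2, THEN bspec]

lemma p_z: "A \<in> Ob X \<Longrightarrow> tp X A \<bullet> tz X A = Idn X A"
  and p_s: "A \<in> Ob X \<Longrightarrow> tp X A \<bullet> ts X A = tp X A \<bullet> pr1 X A"
  and s_assoc: "A \<in> Ob X \<Longrightarrow> (\<forall>P q \<pi>. is_fold_pullback X 3 (tp X A) P q \<pi> \<longrightarrow>
          ts X A \<bullet> pair X A (ts X A \<bullet> pair X A (\<pi> 0) (\<pi> 1)) (\<pi> 2) =
          ts X A \<bullet> pair X A (\<pi> 0) (ts X A \<bullet> pair X A (\<pi> 1) (\<pi> 2)))"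
  and s_unit: "A \<in> Ob X \<Longrightarrow> ts X A \<bullet> pair X A (tz X A \<bullet> tp X A) (Idn X (Tob X A)) = Idn X (Tob X A)"
  and s_comm: "A \<in> Ob X \<Longrightarrow> ts X A \<bullet> pair X A (pr2 X A) (pr1 X A) = ts X A"
  and Tp_l: "A \<in> Ob X \<Longrightarrow> Tar X (tp X A) \<bullet> tl X A = tz X A \<bullet> tp X A"
  and l_z: "A \<in> Ob X \<Longrightarrow> tl X A \<bullet> tz X A = Tar X (tz X A) \<bullet> tz X A"
  and l_s: "A \<in> Ob X \<Longrightarrow> tl X A \<bullet> ts X A =
         Tar X (ts X A) \<bullet> tpair X A (tl X A \<bullet> pr1 X A) (tl X A \<bullet> pr2 X A)"
  and p_c: "A \<in> Ob X \<Longrightarrow> tp X (Tob X A) \<bullet> tc X A = Tar X (tp X A)"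
  and c_Tz: "A \<in> Ob X \<Longrightarrow> tc X A \<bullet> Tar X (tz X A) = tz X (Tob X A)"
  and c_Ts: "A \<in> Ob X \<Longrightarrow> tc X A \<bullet> Tar X (ts X A) =
         ts X (Tob X A) \<bullet>
           pair X (Tob X A) (tc X A \<bullet> Tar X (pr1 X A)) (tc X A \<bullet> Tar X (pr2 X A))"
  and Tl_l: "A \<in> Ob X \<Longrightarrow> Tar X (tl X A) \<bullet> tl X A = tl X (Tob X A) \<bullet> tl X A"
  and c_l: "A \<in> Ob X \<Longrightarrow> tc X A \<bullet> tl X A = tl X A"
  and c_Tc_l: "A \<in> Ob X \<Longrightarrow>
     tc X (Tob X A) \<bullet> Tar X (tc X A) \<bullet> tl X (Tob X A) = Tar X (tl X A) \<bullet> tc X A"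
  and c_c: "A \<in> Ob X \<Longrightarrow> tc X A \<bullet> tc X A = Idn X (Tob X (Tob X A))"
  and braid: "A \<in> Ob X \<Longrightarrow> Tar X (tc X A) \<bullet> tc X (Tob X A) \<bullet> Tar X (tc X A) =
         tc X (Tob X A) \<bullet> Tar X (tc X A) \<bullet> tc X (Tob X A)"
  and lift_pullback: "A \<in> Ob X \<Longrightarrow> is_pullback X (Tar X (tp X A)) (tz X A) (T2 X A)
         (Tar X (ts X A) \<bullet> tpair X A (tz X (Tob X A) \<bullet> pr1 X A) (tl X A \<bullet> pr2 X A))
         (tp X A \<bullet> pr1 X A)"
  by (drule per_object, (elim conjE), assumption)+

text \<open>\<open>T\<^sub>2 A\<close> with its two projections is a two-fold pullback in the indexed sense, so that it is
  covered by the axiom on preservation.\<close>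

lemma T2_fold:
  assumes "A \<in> Ob X"
  shows "is_fold_pullback X 2 (tp X A) (T2 X A) (tp X A \<bullet> pr1 X A) (\<lambda>i. if i = 0 then pr1 X A else pr2 X A)"
  unfolding is_fold_pullback_def
proof (intro conjI ballI allI impI)
  fix Q r and g :: "nat \<Rightarrow> 'a"
  assume Q: "Q \<in> Ob X" and r: "r \<in> hom X Q (Cod X (tp X A))"
    and g: "\<forall>i<2. g i \<in> hom X Q (Dom X (tp X A)) \<and> tp X A \<bullet> g i = r"
  have g0: "g 0 \<in> hom X Q (Dom X (tp X A))" "tp X A \<bullet> g 0 = r"
   and g1: "g 1 \<in> hom X Q (Dom X (tp X A))" "tp X A \<bullet> g 1 = r" using g by simp_all
  have "\<exists>!h. h \<in> hom X Q (T2 X A) \<and> pr1 X A \<bullet> h = g 0 \<and> pr2 X A \<bullet> h = g 1"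
    using T2_pullback[OF assms] g0 g1 Q unfolding is_pullback_def
    by (elim conjE) (drule bspec[of _ _ Q], assumption, drule bspec[of _ _ "g 0"], assumption,
      drule bspec[of _ _ "g 1"], assumption, simp)
  moreover have "(h \<in> hom X Q (T2 X A) \<and> (tp X A \<bullet> pr1 X A) \<bullet> h = r \<and>
      (\<forall>i<2. (if i = 0 then pr1 X A else pr2 X A) \<bullet> h = g i)) \<longleftrightarrow>
    (h \<in> hom X Q (T2 X A) \<and> pr1 X A \<bullet> h = g 0 \<and> pr2 X A \<bullet> h = g 1)" for h
    using g0 assms by (auto simp: hom_def less_2_cases_iff)
  ultimately show "\<exists>!h. h \<in> hom X Q (T2 X A) \<and> (tp X A \<bullet> pr1 X A) \<bullet> h = r \<and>
      (\<forall>i<2. (if i = 0 then pr1 X A else pr2 X A) \<bullet> h = g i)" by simp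
qed (use assms in \<open>auto simp: hom_def\<close>)

text \<open>Preservation by all powers of \<open>T\<close> makes the projections jointly monic on every level, so
  that equations between arrows into \<open>T\<^sup>m P\<close> can be checked on them.\<close>

lemma fold_monic:
  assumes "A \<in> Ob X" "is_fold_pullback X n (tp X A) P q \<pi>"
  shows "jointly_monic X ((Tob X ^^ m) P) ((Tar X ^^ m) ` insert q (\<pi> ` {..<n}))"
  using fold_pullback_jointly_monic[OF fold_pullback_preserved[OF assms, of m] category]
  by (simp add: image_image)

lemma fold_T_monic:
  assumes "A \<in> Ob X" "is_fold_pullback X n (tp X A) P q \<pi>"
  shows "T_monic X ((Tob X ^^ m) P) ((Tar X ^^ m) ` insert q (\<pi> ` {..<n}))"
  using fold_monic[OF assms, of m] fold_monic[OF assms, of "Suc m"] unfolding T_monic_def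
  by (simp add: image_image)

lemma T2_monic: "A \<in> Ob X \<Longrightarrow> jointly_monic X (T2 X A) {pr1 X A, pr2 X A}"
  using pullback_jointly_monic[OF T2_pullback category] .

lemma T2_ext:
  assumes "A \<in> Ob X" "a \<in> Ar X" "b \<in> Ar X" "Dom X a = Dom X b" "Cod X a = T2 X A" "Cod X b = T2 X A"
    "pr1 X A \<bullet> a = pr1 X A \<bullet> b" "pr2 X A \<bullet> a = pr2 X A \<bullet> b"
  shows "a = b"
  by (rule jointly_monicD[OF T2_monic[of A]]) (use assms in auto)

lemma Tn_T2_ext:
  assumes A: "A \<in> Ob X" and ab: "a \<in> Ar X" "b \<in> Ar X" "Dom X a = Dom X b"
    "Cod X a = (Tob X ^^ m) (T2 X A)" "Cod X b = (Tob X ^^ m) (T2 X A)"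
    and 1: "(Tar X ^^ m) (pr1 X A) \<bullet> a = (Tar X ^^ m) (pr1 X A) \<bullet> b"
    and 2: "(Tar X ^^ m) (pr2 X A) \<bullet> a = (Tar X ^^ m) (pr2 X A) \<bullet> b"
  shows "a = b"
proof (rule jointly_monicD[OF fold_monic[OF A T2_fold[OF A], of m] ab])
  have iter: "(Tar X ^^ m) f \<in> Ar X \<and> Dom X ((Tar X ^^ m) f) = (Tob X ^^ m) (Dom X f) \<and>
     Cod X ((Tar X ^^ m) f) = (Tob X ^^ m) (Cod X f)" if "f \<in> Ar X" for f
    using that by (induction m) auto
  have iter2: "(Tar X ^^ m) (g \<bullet> f) = (Tar X ^^ m) g \<bullet> (Tar X ^^ m) f"
    if "f \<in> Ar X" "g \<in> Ar X" "Cod X f = Dom X g" for f g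
  proof (induction m)
    case (Suc m)
    have "(Tar X ^^ m) h \<in> Ar X \<and> Dom X ((Tar X ^^ m) h) = (Tob X ^^ m) (Dom X h) \<and>
     Cod X ((Tar X ^^ m) h) = (Tob X ^^ m) (Cod X h)" if "h \<in> Ar X" for h
      using that by (induction m) auto
    with Suc that show ?case by simp
  qed simp
  fix l assume "l \<in> (Tar X ^^ m) ` insert (tp X A \<bullet> pr1 X A) ((\<lambda>i. if i =
    0 then pr1 X A else pr2 X A) ` {..<2})"
  then consider "l = (Tar X ^^ m) (pr1 X A)" | "l = (Tar X ^^ m) (pr2 X A)" |
     "l = (Tar X ^^ m) (tp X A) \<bullet> (Tar X ^^ m) (pr1 X A)"
    using A iter2[of "pr1 X A" "tp X A"] by (auto split: if_splits)
  then show "l \<bullet> a = l \<bullet> b"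
    by cases (use 1 2 A ab iter[of "pr1 X A"] iter[of "tp X A"] in auto)
qed

lemma T2_T_monic: "A \<in> Ob X \<Longrightarrow> T_monic X (T2 X A) {pr1 X A, pr2 X A}"
  and TT2_T_monic: "A \<in> Ob X \<Longrightarrow> T_monic X (Tob X (T2 X A)) {Tar X (pr1 X A), Tar X (pr2 X A)}"
  unfolding T_monic_def jointly_monic_def using Tn_T2_ext[of A _ _ 0] Tn_T2_ext[of A _ _ 1]
    Tn_T2_ext[of A _ _ 2]
  by (auto simp: numeral_2_eq_2)

lemma
  assumes "A \<in> Ob X" "f \<in> Ar X" "g \<in> Ar X" "Dom X f = Dom X g" "Cod X f = Tob X A" "Cod X g = Tob X A"
    "tp X A \<bullet> f = tp X A \<bullet> g"
  shows pair_ar [simp]: "pair X A f g \<in> Ar X"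
    and pair_dom [simp]: "Dom X (pair X A f g) = Dom X f"
    and pair_cod [simp]: "Cod X (pair X A f g) = T2 X A"
    and pr1_pair [simp]: "pr1 X A \<bullet> pair X A f g = f"
    and pr2_pair [simp]: "pr2 X A \<bullet> pair X A f g = g"
proof -
  have "pair X A f g \<in> hom X (Dom X f) (T2 X A) \<and> pr1 X A \<bullet> pair X A f g = f \<and> pr2 X A \<bullet> pair X A f g = g"
    unfolding pair_def
    by (rule theI', insert T2_pullback[of A, unfolded is_pullback_def] assms) (simp add: hom_def)
  then show "pair X A f g \<in> Ar X" "Dom X (pair X A f g) = Dom X f" "Cod X (pair X A f g) = T2 X A"
    "pr1 X A \<bullet> pair X A f g = f" "pr2 X A \<bullet> pair X A f g = g"
    by (simp_all add: hom_def)
qed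

lemma
  assumes A: "A \<in> Ob X" and f: "f \<in> Ar X" "g \<in> Ar X" "Dom X f = Dom X g"
    "Cod X f = Tob X (Tob X A)" "Cod X g = Tob X (Tob X A)"
    "Tar X (tp X A) \<bullet> f = Tar X (tp X A) \<bullet> g"
  shows tpair_ar [simp]: "tpair X A f g \<in> Ar X"
    and tpair_dom [simp]: "Dom X (tpair X A f g) = Dom X f"
    and tpair_cod [simp]: "Cod X (tpair X A f g) = Tob X (T2 X A)"
    and Tpr1_tpair [simp]: "Tar X (pr1 X A) \<bullet> tpair X A f g = f"
    and Tpr2_tpair [simp]: "Tar X (pr2 X A) \<bullet> tpair X A f g = g"
proof -
  have "tpair X A f g \<in> hom X (Dom X f) (Tob X (T2 X A)) \<and>
      Tar X (pr1 X A) \<bullet> tpair X A f g = f \<and> Tar X (pr2 X A) \<bullet> tpair X A f g = g"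
    unfolding tpair_def
  proof (rule theI', rule ex_ex1I)
    have "\<exists>h\<in>hom X (Dom X (Tar X (tp X A) \<bullet> f)) (Tob X (T2 X A)).
        (Tar X (tp X A) \<bullet> Tar X (pr1 X A)) \<bullet> h = Tar X (tp X A) \<bullet> f \<and>
        (\<forall>i<2::nat. Tar X (if i = 0 then pr1 X A else pr2 X A) \<bullet> h = (if i = 0 then f else g))"
      using fold_pullback_lift[OF fold_pullback_preserved[OF A T2_fold[OF A], of 1] category,
        of "Tar X (tp X A) \<bullet> f" "\<lambda>i. if i = 0 then f else g"] A f by simp
    then show "\<exists>h. h \<in> hom X (Dom X f) (Tob X (T2 X A)) \<and>
        Tar X (pr1 X A) \<bullet> h = f \<and> Tar X (pr2 X A) \<bullet> h = g"
      using A f by (auto simp: less_2_cases_iff)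
  qed (use Tn_T2_ext[OF A, of _ _ 1] A f in \<open>auto simp: hom_def\<close>)
  then show "tpair X A f g \<in> Ar X" "Dom X (tpair X A f g) = Dom X f" "Cod X (tpair X A f g) = Tob X (T2 X A)"
    "Tar X (pr1 X A) \<bullet> tpair X A f g = f" "Tar X (pr2 X A) \<bullet> tpair X A f g = g"
    by (simp_all add: hom_def)
qed

end


section \<open>Fibrewise addition and the vertical lift\<close>

context tangent
begin

lemma c_c_extend [simp]: "\<lbrakk>A \<in> Ob X; x \<in> Ar X; Cod X x = Tob X (Tob X A)\<rbrakk> \<Longrightarrow> tc X A \<bullet> (tc X A \<bullet> x) = x"
  using extend[OF c_c[of A], of x] by simp

text \<open>The flip is an involution, so \<open>p\<close> and \<open>T p\<close> are interchanged in either direction.\<close>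

lemma Tp_c: "A \<in> Ob X \<Longrightarrow> Tar X (tp X A) \<bullet> tc X A = tp X (Tob X A)"
  using extend[OF p_c[of A], of "tc X A"] by (simp add: c_c)

lemma c_z: "A \<in> Ob X \<Longrightarrow> tc X A \<bullet> tz X (Tob X A) = Tar X (tz X A)"
  using c_c_extend[of A "Tar X (tz X A)"] by (simp add: c_Tz)

text \<open>The coherence between flip and lift, solved for each of its factors.\<close>

lemma Tc_c_Tl:
  assumes "A \<in> Ob X"
  shows "Tar X (tc X A) \<bullet> tc X (Tob X A) \<bullet> Tar X (tl X A) = tl X (Tob X A) \<bullet> tc X A"
proof -
  have 1: "Tar X (tl X A) = tc X (Tob X A) \<bullet> Tar X (tc X A) \<bullet> tl X (Tob X A) \<bullet> tc X A"
    using c_Tc_l[OF assms, THEN arg_cong[where f = "\<lambda>f. f \<bullet> tc X A"]] assms by (simp add: c_c)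
  have 2: "Tar X (tc X A) \<bullet> (Tar X (tc X A) \<bullet> x) = x"
    if "x \<in> Ar X" "Cod X x = Tob X (Tob X (Tob X A))" for x
    using assms that by (simp flip: assoc add: c_c flip: tar_cmp)
  show ?thesis
    unfolding 1 using assms by (simp add: 2)
qed

lemma c_T_Tc_Tl:
  assumes "A \<in> Ob X"
  shows "tc X (Tob X A) \<bullet> Tar X (tl X A) = Tar X (tc X A) \<bullet> tl X (Tob X A) \<bullet> tc X A"
proof -
  have "tc X (Tob X A) \<bullet> (tc X (Tob X A) \<bullet> Tar X (tc X A) \<bullet> tl X (Tob X A)) \<bullet> tc X A
      = tc X (Tob X A) \<bullet> (Tar X (tl X A) \<bullet> tc X A) \<bullet> tc X A"
    by (simp only: c_Tc_l[OF assms])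
  then show ?thesis using assms by (simp add: c_c)
qed

lemma pair_cmp:
  assumes "A \<in> Ob X" "f \<in> Ar X" "g \<in> Ar X" "Dom X f = Dom X g" "Cod X f = Tob X A" "Cod X g = Tob X A"
    "tp X A \<bullet> f = tp X A \<bullet> g" "h \<in> Ar X" "Cod X h = Dom X f"
  shows "pair X A f g \<bullet> h = pair X A (f \<bullet> h) (g \<bullet> h)"
proof -
  have *: "tp X A \<bullet> (f \<bullet> h) = tp X A \<bullet> (g \<bullet> h)"
    using assms by (simp flip: assoc)
  show ?thesis
    by (rule T2_ext[of A]) (use assms * in \<open>simp_all add: pr1_pair[THEN extend] pr2_pair[THEN extend]\<close>)
qed

lemma tpair_cmp:
  assumes "A \<in> Ob X" "f \<in> Ar X" "g \<in> Ar X" "Dom X f = Dom X g"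
    "Cod X f = Tob X (Tob X A)" "Cod X g = Tob X (Tob X A)"
    "Tar X (tp X A) \<bullet> f = Tar X (tp X A) \<bullet> g" "h \<in> Ar X" "Cod X h = Dom X f"
  shows "tpair X A f g \<bullet> h = tpair X A (f \<bullet> h) (g \<bullet> h)"
proof -
  have *: "Tar X (tp X A) \<bullet> (f \<bullet> h) = Tar X (tp X A) \<bullet> (g \<bullet> h)"
    using assms by (simp flip: assoc)
  show ?thesis
    by (rule Tn_T2_ext[where m = 1 and A = A])
      (use assms * in \<open>simp_all add: Tpr1_tpair[THEN extend] Tpr2_tpair[THEN extend]\<close>)
qed

lemma pair_prs: "A \<in> Ob X \<Longrightarrow> pair X A (pr1 X A) (pr2 X A) = Idn X (T2 X A)"
  by (rule T2_ext[of A]) simp_all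

lemma T2ar_fibre:
  assumes "f \<in> Ar X"
  shows "tp X (Cod X f) \<bullet> (Tar X f \<bullet> pr1 X (Dom X f)) = tp X (Cod X f) \<bullet> (Tar X f \<bullet> pr2 X (Dom X f))"
  using assms by (simp add: tp_nat[THEN extend])

lemma T2ar_ar [simp]: "f \<in> Ar X \<Longrightarrow> T2ar X f \<in> Ar X"
  and T2ar_dom [simp]: "f \<in> Ar X \<Longrightarrow> Dom X (T2ar X f) = T2 X (Dom X f)"
  and T2ar_cod [simp]: "f \<in> Ar X \<Longrightarrow> Cod X (T2ar X f) = T2 X (Cod X f)"
  and pr1_T2ar: "\<lbrakk>f \<in> Ar X; Cod X f = B\<rbrakk> \<Longrightarrow> pr1 X B \<bullet> T2ar X f = Tar X f \<bullet> pr1 X (Dom X f)"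
  and pr2_T2ar: "\<lbrakk>f \<in> Ar X; Cod X f = B\<rbrakk> \<Longrightarrow> pr2 X B \<bullet> T2ar X f = Tar X f \<bullet> pr2 X (Dom X f)"
  and s_nat: "\<lbrakk>f \<in> Ar X; Cod X f = B\<rbrakk> \<Longrightarrow> ts X B \<bullet> T2ar X f = Tar X f \<bullet> ts X (Dom X f)"
  using T2ar_fibre[of f] ts_natural by (auto simp: T2ar_def is_natural_def)

lemma fibre_T:
  assumes "f \<in> Ar X" "Dom X f = A" "Cod X f = B" "a \<in> Ar X" "b \<in> Ar X" "Dom X a = Dom X b"
    "Cod X a = Tob X A" "Cod X b = Tob X A" "tp X A \<bullet> a = tp X A \<bullet> b"
  shows "tp X B \<bullet> (Tar X f \<bullet> a) = tp X B \<bullet> (Tar X f \<bullet> b)"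
  using assms by (auto simp: tp_nat[THEN extend])

lemma add_nat:
  assumes "f \<in> Ar X" "Dom X f = A" "Cod X f = B" "a \<in> Ar X" "b \<in> Ar X" "Dom X a = Dom X b"
    "Cod X a = Tob X A" "Cod X b = Tob X A" "tp X A \<bullet> a = tp X A \<bullet> b"
  shows "Tar X f \<bullet> (ts X A \<bullet> pair X A a b) = ts X B \<bullet> pair X B (Tar X f \<bullet> a) (Tar X f \<bullet> b)"
proof -
  have A: "A \<in> Ob X" and B: "B \<in> Ob X" using assms(1-3) by auto
  have "T2ar X f \<bullet> pair X A a b = pair X B (Tar X f \<bullet> a) (Tar X f \<bullet> b)"
    by (rule T2_ext[of B]) (use fibre_T[OF assms] assms A B in
        \<open>simp_all add: pr1_T2ar[THEN extend] pr2_T2ar[THEN extend]\<close>)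
  then show ?thesis
    using assms A B s_nat[OF assms(1,3), THEN extend, of "pair X A a b"] by simp
qed

lemma c_add:
  assumes "A \<in> Ob X" "h \<in> Ar X" "Cod X h = Tob X (T2 X A)"
  shows "tc X A \<bullet> (Tar X (ts X A) \<bullet> h) = ts X (Tob X A) \<bullet>
     pair X (Tob X A) (tc X A \<bullet> (Tar X (pr1 X A) \<bullet> h)) (tc X A \<bullet> (Tar X (pr2 X A) \<bullet> h))"
proof -
  have *: "tp X (Tob X A) \<bullet> (tc X A \<bullet> Tar X (pr1 X A)) = tp X (Tob X A) \<bullet> (tc X A \<bullet> Tar X (pr2 X A))"
    using assms by (simp add: p_c[THEN extend] flip: tar_cmp)
  show ?thesis
    using assms * c_Ts[of A, THEN extend, of h] by (simp add: pair_cmp)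
qed

text \<open>Preservation by \<open>T\<close> of the pullback that expresses universality of the lift is a consequence
  of the axioms: the flip, applied in each corner, identifies the image under \<open>T\<close> of the square
  at \<open>A\<close> with the square at \<open>T A\<close>. The next lemmas show this as far as is needed to see that the
  projections stay jointly monic under \<open>T\<close>.\<close>

abbreviation lift_map :: "'o \<Rightarrow> 'a" where
  "lift_map A \<equiv> Tar X (ts X A) \<bullet> tpair X A (tz X (Tob X A) \<bullet> pr1 X A) (tl X A \<bullet> pr2 X A)"

lemma lift_map_fibre:
  "A \<in> Ob X \<Longrightarrow> Tar X (tp X A) \<bullet> (tz X (Tob X A) \<bullet> pr1 X A) = Tar X (tp X A) \<bullet> (tl X A \<bullet> pr2 X A)"
  using extend[OF tz_nat[of "tp X A" A, symmetric], of "pr1 X A"] by (simp add: Tp_l[THEN extend])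

lemma lift_map_T:
  assumes A: "A \<in> Ob X"
  defines "\<phi> \<equiv> pair X (Tob X A) (tc X A \<bullet> Tar X (pr1 X A)) (tc X A \<bullet> Tar X (pr2 X A))"
  shows "lift_map (Tob X A) \<bullet> \<phi> = Tar X (tc X A) \<bullet> (tc X (Tob X A) \<bullet> Tar X (lift_map A))"
    and "\<phi> \<in> Ar X" "Dom X \<phi> = Tob X (T2 X A)" "Cod X \<phi> = T2 X (Tob X A)"
    and "pr1 X (Tob X A) \<bullet> \<phi> = tc X A \<bullet> Tar X (pr1 X A)"
    and "pr2 X (Tob X A) \<bullet> \<phi> = tc X A \<bullet> Tar X (pr2 X A)"
proof -
  have *: "tp X (Tob X A) \<bullet> (tc X A \<bullet> Tar X (pr1 X A)) = tp X (Tob X A) \<bullet> (tc X A \<bullet> Tar X (pr2 X A))"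
    using A by (simp add: p_c[THEN extend] flip: tar_cmp)
  show \<phi>: "\<phi> \<in> Ar X" "Dom X \<phi> = Tob X (T2 X A)" "Cod X \<phi> = T2 X (Tob X A)"
    "pr1 X (Tob X A) \<bullet> \<phi> = tc X A \<bullet> Tar X (pr1 X A)"
    "pr2 X (Tob X A) \<bullet> \<phi> = tc X A \<bullet> Tar X (pr2 X A)"
    unfolding \<phi>_def using A * by simp_all
  note f = lift_map_fibre[OF A] lift_map_fibre[OF tob_ob[OF A]]
  let ?t = "tpair X A (tz X (Tob X A) \<bullet> pr1 X A) (tl X A \<bullet> pr2 X A)"
  let ?t' = "tpair X (Tob X A) (tz X (Tob X (Tob X A)) \<bullet> pr1 X (Tob X A)) (tl X (Tob X A) \<bullet> pr2 X (Tob X A))"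
  have t: "?t \<in> Ar X" "Dom X ?t = T2 X A" "Cod X ?t = Tob X (T2 X A)"
     "Tar X (pr1 X A) \<bullet> ?t = tz X (Tob X A) \<bullet> pr1 X A"
     "Tar X (pr2 X A) \<bullet> ?t = tl X A \<bullet> pr2 X A"
    using A f by simp_all
  have t': "?t' \<in> Ar X" "Dom X ?t' = T2 X (Tob X A)" "Cod X ?t' = Tob X (T2 X (Tob X A))"
     "Tar X (pr1 X (Tob X A)) \<bullet> ?t' = tz X (Tob X (Tob X A)) \<bullet> pr1 X (Tob X A)"
     "Tar X (pr2 X (Tob X A)) \<bullet> ?t' = tl X (Tob X A) \<bullet> pr2 X (Tob X A)"
    using A f by simp_all
  have T1: "Tar X (pr1 X (Tob X A)) \<bullet> Tar X \<phi> = Tar X (tc X A) \<bullet> Tar X (Tar X (pr1 X A))"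
    and T2: "Tar X (pr2 X (Tob X A)) \<bullet> Tar X \<phi> = Tar X (tc X A) \<bullet> Tar X (Tar X (pr2 X A))"
    using \<phi> A by (simp_all flip: tar_cmp)
  have tt: "Tar X (Tar X (pr1 X A)) \<bullet> Tar X ?t = Tar X (tz X (Tob X A)) \<bullet> Tar X (pr1 X A)"
    "Tar X (Tar X (pr2 X A)) \<bullet> Tar X ?t = Tar X (tl X A) \<bullet> Tar X (pr2 X A)"
    using t A by (simp_all flip: tar_cmp)
  \<comment> \<open>both sides are determined by their images under the projections of \<open>T T\<^sub>2 (T A)\<close>\<close>
  have key: "?t' \<bullet> \<phi> = Tar X \<phi> \<bullet> (tc X (T2 X A) \<bullet> Tar X ?t)"
  proof (rule Tn_T2_ext[where m = 1 and A = "Tob X A"])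
    have "Tar X (pr1 X (Tob X A)) \<bullet> (Tar X \<phi> \<bullet> (tc X (T2 X A) \<bullet> Tar X ?t))
       = Tar X (tc X A) \<bullet> (Tar X (Tar X (pr1 X A)) \<bullet> (tc X (T2 X A) \<bullet> Tar X ?t))"
      using extend[OF T1, of "tc X (T2 X A) \<bullet> Tar X ?t"] A \<phi> t by simp
    also have "\<dots> = Tar X (tc X A) \<bullet> (tc X (Tob X A) \<bullet> (Tar X (Tar X (pr1 X A)) \<bullet> Tar X ?t))"
      using extend[OF tc_nat[of "pr1 X A" "Tob X A"], of "Tar X ?t"] A \<phi> t by simp
    also have "\<dots> = tz X (Tob X (Tob X A)) \<bullet> tc X A \<bullet> Tar X (pr1 X A)"
      using A by (simp add: tt c_Tz[THEN extend] tz_nat[of "tc X A" "Tob X (Tob X A)", THEN extend])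
    finally show "(Tar X ^^ 1) (pr1 X (Tob X A)) \<bullet> (?t' \<bullet> \<phi>) =
       (Tar X ^^ 1) (pr1 X (Tob X A)) \<bullet> (Tar X \<phi> \<bullet> (tc X (T2 X A) \<bullet> Tar X ?t))"
      using A t' \<phi> extend[OF t'(4), of \<phi>] by simp
    have "Tar X (pr2 X (Tob X A)) \<bullet> (Tar X \<phi> \<bullet> (tc X (T2 X A) \<bullet> Tar X ?t))
       = Tar X (tc X A) \<bullet> (Tar X (Tar X (pr2 X A)) \<bullet> (tc X (T2 X A) \<bullet> Tar X ?t))"
      using extend[OF T2, of "tc X (T2 X A) \<bullet> Tar X ?t"] A \<phi> t by simp
    also have "\<dots> = Tar X (tc X A) \<bullet> (tc X (Tob X A) \<bullet> (Tar X (Tar X (pr2 X A)) \<bullet> Tar X ?t))"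
      using extend[OF tc_nat[of "pr2 X A" "Tob X A"], of "Tar X ?t"] A \<phi> t by simp
    also have "\<dots> = (Tar X (tc X A) \<bullet> tc X (Tob X A) \<bullet> Tar X (tl X A)) \<bullet> Tar X (pr2 X A)"
      using A tt by simp
    also have "\<dots> = tl X (Tob X A) \<bullet> tc X A \<bullet> Tar X (pr2 X A)"
      using A by (subst Tc_c_Tl) simp_all
    finally show "(Tar X ^^ 1) (pr2 X (Tob X A)) \<bullet> (?t' \<bullet> \<phi>) =
       (Tar X ^^ 1) (pr2 X (Tob X A)) \<bullet> (Tar X \<phi> \<bullet> (tc X (T2 X A) \<bullet> Tar X ?t))"
      using A t' \<phi> extend[OF t'(5), of \<phi>] by simp
  qed (use A \<phi> t t' in simp_all)
  have s: "Tar X (tc X A) \<bullet> Tar X (Tar X (ts X A)) = Tar X (ts X (Tob X A)) \<bullet> Tar X \<phi>"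
    using arg_cong[OF c_Ts[OF A], of "Tar X"] \<phi> A by (simp add: \<phi>_def)
  have "lift_map (Tob X A) \<bullet> \<phi> = Tar X (ts X (Tob X A)) \<bullet> (Tar X \<phi> \<bullet> (tc X (T2 X A) \<bullet> Tar X ?t))"
    unfolding key[symmetric] using A t' \<phi> by simp
  also have "\<dots> = Tar X (tc X A) \<bullet> (Tar X (Tar X (ts X A)) \<bullet> (tc X (T2 X A) \<bullet> Tar X ?t))"
    using extend[OF s, of "tc X (T2 X A) \<bullet> Tar X ?t"] A t \<phi> by simp
  also have "\<dots> = Tar X (tc X A) \<bullet> (tc X (Tob X A) \<bullet> Tar X (lift_map A))"
    using extend[OF tc_nat[of "ts X A" "Tob X A"], of "Tar X ?t"] A t by simp
  finally show "lift_map (Tob X A) \<bullet> \<phi> = Tar X (tc X A) \<bullet> (tc X (Tob X A) \<bullet> Tar X (lift_map A))" .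
qed

lemma lift_map_typed:
  assumes "A \<in> Ob X"
  shows "lift_map A \<in> Ar X" "Dom X (lift_map A) = T2 X A" "Cod X (lift_map A) = Tob X (Tob X A)"
  using assms lift_map_fibre[OF assms] by simp_all

lemma lift_T_monic:
  assumes A: "A \<in> Ob X"
  shows "T_monic X (T2 X A) {lift_map A, tp X A \<bullet> pr1 X A}"
  unfolding T_monic_def
proof
  show "jointly_monic X (T2 X A) {lift_map A, tp X A \<bullet> pr1 X A}"
    by (rule pullback_jointly_monic[OF lift_pullback[OF A] category])
  let ?m = "lift_map A" and ?m' = "lift_map (Tob X A)"
  let ?\<phi> = "pair X (Tob X A) (tc X A \<bullet> Tar X (pr1 X A)) (tc X A \<bullet> Tar X (pr2 X A))"
  note m = lift_map_typed[OF A] and m' = lift_map_typed[OF tob_ob[OF A]]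
  note \<phi> = lift_map_T[OF A]
  have *: "jointly_monic X (T2 X (Tob X A)) {?m', tp X (Tob X A) \<bullet> pr1 X (Tob X A)}"
    using A by (intro pullback_jointly_monic[OF lift_pullback category]) simp
  show "jointly_monic X (Tob X (T2 X A)) (Tar X ` {?m, tp X A \<bullet> pr1 X A})"
    unfolding jointly_monic_def
  proof (intro ballI impI)
    fix a b assume ab: "a \<in> Ar X" "b \<in> Ar X" "Dom X a = Dom X b" "Cod X a = Tob X (T2 X A)" "Cod X b =
      Tob X (T2 X A)"
      and "\<forall>l\<in>Tar X ` {?m, tp X A \<bullet> pr1 X A}. l \<bullet> a = l \<bullet> b"
    then have 1: "Tar X ?m \<bullet> a = Tar X ?m \<bullet> b"
      and 2: "Tar X (tp X A \<bullet> pr1 X A) \<bullet> a = Tar X (tp X A \<bullet> pr1 X A) \<bullet> b" by auto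
    have e: "?m' \<bullet> (?\<phi> \<bullet> x) = Tar X (tc X A) \<bullet> (tc X (Tob X A) \<bullet> (Tar X ?m \<bullet> x))"
      "tp X (Tob X A) \<bullet> (pr1 X (Tob X A) \<bullet> (?\<phi> \<bullet> x)) = Tar X (tp X A \<bullet> pr1 X A) \<bullet> x"
      if x: "x \<in> Ar X" "Cod X x = Tob X (T2 X A)" for x
    proof -
      have "?m' \<bullet> (?\<phi> \<bullet> x) = (Tar X (tc X A) \<bullet> (tc X (Tob X A) \<bullet> Tar X ?m)) \<bullet> x"
        by (rule extend[OF \<phi>(1)]) (use \<phi>(2-) m' x in simp_all)
      also have "\<dots> = Tar X (tc X A) \<bullet> ((tc X (Tob X A) \<bullet> Tar X ?m) \<bullet> x)"
        by (rule assoc) (use A m x in \<open>simp_all del: tar_cmp\<close>)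
      also have "\<dots> = Tar X (tc X A) \<bullet> (tc X (Tob X A) \<bullet> (Tar X ?m \<bullet> x))"
        by (subst assoc) (use A m x in \<open>simp_all del: tar_cmp\<close>)
      finally show "?m' \<bullet> (?\<phi> \<bullet> x) = Tar X (tc X A) \<bullet> (tc X (Tob X A) \<bullet> (Tar X ?m \<bullet> x))" .
      show "tp X (Tob X A) \<bullet> (pr1 X (Tob X A) \<bullet> (?\<phi> \<bullet> x)) = Tar X (tp X A \<bullet> pr1 X A) \<bullet> x"
        using extend[OF \<phi>(5), of x] \<phi>(2-4) A x by (simp add: p_c[THEN extend])
    qed
    have "?\<phi> \<bullet> a = ?\<phi> \<bullet> b"
    proof (rule jointly_monicD[OF *])
      fix l assume "l \<in> {?m', tp X (Tob X A) \<bullet> pr1 X (Tob X A)}"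
      then consider "l = ?m'" | "l = tp X (Tob X A) \<bullet> pr1 X (Tob X A)" by auto
      then show "l \<bullet> (?\<phi> \<bullet> a) = l \<bullet> (?\<phi> \<bullet> b)"
      proof cases
        case 1
        then show ?thesis using e(1) ab \<open>Tar X ?m \<bullet> a = Tar X ?m \<bullet> b\<close> by metis
      next
        case 2
        show ?thesis unfolding 2 using e(2) ab \<open>Tar X (tp X A \<bullet> pr1 X A) \<bullet> a = _\<close> \<phi>(2-4) A by simp
      qed
    qed (use \<phi>(2-4) ab in simp_all)
    then have "pr1 X (Tob X A) \<bullet> ?\<phi> \<bullet> a = pr1 X (Tob X A) \<bullet> ?\<phi> \<bullet> b"
      "pr2 X (Tob X A) \<bullet> ?\<phi> \<bullet> a = pr2 X (Tob X A) \<bullet> ?\<phi> \<bullet> b" by simp_all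
    then have eq: "tc X A \<bullet> Tar X (pr1 X A) \<bullet> a = tc X A \<bullet> Tar X (pr1 X A) \<bullet> b"
      "tc X A \<bullet> Tar X (pr2 X A) \<bullet> a = tc X A \<bullet> Tar X (pr2 X A) \<bullet> b"
      using extend[OF \<phi>(5), of a] extend[OF \<phi>(5), of b] extend[OF \<phi>(6), of a] extend[OF \<phi>(6), of b]
        A ab \<phi>(2-4) by simp_all
    show "a = b"
    proof (rule Tn_T2_ext[where m = 1 and A = A])
      show "(Tar X ^^ 1) (pr1 X A) \<bullet> a = (Tar X ^^ 1) (pr1 X A) \<bullet> b"
        using arg_cong[OF eq(1), of "\<lambda>f. tc X A \<bullet> f"] A ab by simp
      show "(Tar X ^^ 1) (pr2 X A) \<bullet> a = (Tar X ^^ 1) (pr2 X A) \<bullet> b"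
        using arg_cong[OF eq(2), of "\<lambda>f. tc X A \<bullet> f"] A ab by simp
    qed (use A ab in simp_all)
  qed
qed

text \<open>The axiom is the generic case, the projections of \<open>T\<^sub>3 A\<close>; any triple in a common fibre is
  induced from it.\<close>

lemma add_assoc:
  assumes A: "A \<in> Ob X" and Q: "Dom X f = Q" "Dom X g = Q" "Dom X h = Q"
    and f: "f \<in> Ar X" "g \<in> Ar X" "h \<in> Ar X"
    and c: "Cod X f = Tob X A" "Cod X g = Tob X A" "Cod X h = Tob X A"
    and p: "tp X A \<bullet> f = r" "tp X A \<bullet> g = r" "tp X A \<bullet> h = r"
  shows "ts X A \<bullet> pair X A (ts X A \<bullet> pair X A f g) h = ts X A \<bullet> pair X A f (ts X A \<bullet> pair X A g h)"
proof -
  obtain P q \<pi> where P: "is_fold_pullback X 3 (tp X A) P q \<pi>" using fold_pullback_exists[OF A] by blast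
  let ?k = "\<lambda>i::nat. if i = 0 then f else if i = 1 then g else h"
  have r: "r \<in> Ar X" "Dom X r = Q" "Cod X r = A" using p(1) A f c Q by auto
  have "\<exists>k\<in>hom X (Dom X r) P. q \<bullet> k = r \<and> (\<forall>i<3. \<pi> i \<bullet> k = ?k i)"
    by (rule fold_pullback_lift[OF P category]) (simp_all add: A r f c Q p)
  then obtain k where k: "k \<in> hom X Q P" "\<forall>i<3. \<pi> i \<bullet> k = ?k i" using r by auto
  have \<pi>: "\<And>i. i < 3 \<Longrightarrow> \<pi> i \<in> Ar X" "\<And>i. i < 3 \<Longrightarrow> Dom X (\<pi> i) = P" "\<And>i. i < 3 \<Longrightarrow> Cod X (\<pi> i) = Tob X A"
     "\<And>i. i < 3 \<Longrightarrow> tp X A \<bullet> \<pi> i = q" and k': "k \<in> Ar X" "Dom X k = Q" "Cod X k = P"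
    using P k(1) A by (auto simp: is_fold_pullback_def hom_def)
  have "\<pi> 0 \<bullet> k = f" "\<pi> 1 \<bullet> k = g" "\<pi> 2 \<bullet> k = h" using k(2) by simp_all
  then have \<pi>k: "\<pi> 0 \<bullet> k = f" "\<pi> (Suc 0) \<bullet> k = g" "\<pi> 2 \<bullet> k = h" by simp_all
  have "(ts X A \<bullet> pair X A (ts X A \<bullet> pair X A (\<pi> 0) (\<pi> 1)) (\<pi> 2)) \<bullet> k =
          (ts X A \<bullet> pair X A (\<pi> 0) (ts X A \<bullet> pair X A (\<pi> 1) (\<pi> 2))) \<bullet> k"
    using s_assoc[OF A] P by simp
  then show ?thesis using \<pi> k' A \<pi>k by (simp add: pair_cmp p_s[THEN extend])
qed

lemma s_add_unit:
  assumes A: "A \<in> Ob X" "f \<in> Ar X" "Cod X f = Tob X A"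
  shows "ts X A \<bullet> pair X A (tz X A \<bullet> tp X A \<bullet> f) f = f"
proof -
  have p: "tp X A \<bullet> (tz X A \<bullet> tp X A) = tp X A \<bullet> Idn X (Tob X A)"
    using A by (simp add: p_z[THEN extend])
  show ?thesis
    using arg_cong[OF s_unit[OF A(1)], of "\<lambda>g. g \<bullet> f"] p A by (simp add: pair_cmp)
qed

lemma s_add_comm:
  assumes A: "A \<in> Ob X" "f \<in> Ar X" "g \<in> Ar X" "Dom X f = Dom X g" "Cod X f = Tob X A" "Cod X g = Tob X A"
    "tp X A \<bullet> f = tp X A \<bullet> g"
  shows "ts X A \<bullet> pair X A f g = ts X A \<bullet> pair X A g f"
  using arg_cong[OF s_comm[OF A(1)], of "\<lambda>h. h \<bullet> pair X A g f"] A by (simp add: pair_cmp)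

end


section \<open>Tangent morphisms\<close>

locale lax_morphism = A: tangent X' + B: tangent X
  for X' :: "('x, 'y) tang" and X :: "('o, 'a) tang" (structure) +
  fixes F :: "('x, 'y, 'o, 'a) mor"
  assumes mor: "tangent_morphism X' X F"
begin

lemma obm_ob [simp]: "A \<in> Ob X' \<Longrightarrow> obm F A \<in> Ob X"
  and arm_idn [simp]: "A \<in> Ob X' \<Longrightarrow> arm F (Idn X' A) = Idn X (obm F A)"
  and arm_ar [simp]: "f \<in> Ar X' \<Longrightarrow> arm F f \<in> Ar X"
  and arm_dom [simp]: "f \<in> Ar X' \<Longrightarrow> Dom X (arm F f) = obm F (Dom X' f)"
  and arm_cod [simp]: "f \<in> Ar X' \<Longrightarrow> Cod X (arm F f) = obm F (Cod X' f)"
  and arm_cmp [simp]: "\<lbrakk>f \<in> Ar X'; g \<in> Ar X'; Cod X' f = Dom X' g\<rbrakk> \<Longrightarrow>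
    arm F (g \<cdot>\<^bsub>X'\<^esub> f) = arm F g \<bullet> arm F f"
  and lax_ar [simp]: "A \<in> Ob X' \<Longrightarrow> lax F A \<in> Ar X"
  and lax_dom [simp]: "A \<in> Ob X' \<Longrightarrow> Dom X (lax F A) = obm F (Tob X' A)"
  and lax_cod [simp]: "A \<in> Ob X' \<Longrightarrow> Cod X (lax F A) = Tob X (obm F A)"
  and lax_nat: "\<lbrakk>f \<in> Ar X'; Cod X' f = B\<rbrakk> \<Longrightarrow>
    lax F B \<bullet> arm F (Tar X' f) = Tar X (arm F f) \<bullet> lax F (Dom X' f)"
  and p_lax: "A \<in> Ob X' \<Longrightarrow> tp X (obm F A) \<bullet> lax F A = arm F (tp X' A)"
  and lax_z: "A \<in> Ob X' \<Longrightarrow> lax F A \<bullet> arm F (tz X' A) = tz X (obm F A)"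
  and lax_s: "A \<in> Ob X' \<Longrightarrow> lax F A \<bullet> arm F (ts X' A) =
         ts X (obm F A) \<bullet>
           pair X (obm F A) (lax F A \<bullet> arm F (pr1 X' A)) (lax F A \<bullet> arm F (pr2 X' A))"
  and l_lax: "A \<in> Ob X' \<Longrightarrow> tl X (obm F A) \<bullet> lax F A =
         Tar X (lax F A) \<bullet> lax F (Tob X' A) \<bullet> arm F (tl X' A)"
  and c_lax: "A \<in> Ob X' \<Longrightarrow> tc X (obm F A) \<bullet> Tar X (lax F A) \<bullet> lax F (Tob X' A) =
         Tar X (lax F A) \<bullet> lax F (Tob X' A) \<bullet> arm F (tc X' A)"
  and ext_obm: "obm F \<in> extensional (Ob X')"
  and ext_arm: "arm F \<in> extensional (Ar X')"
  and ext_lax: "lax F \<in> extensional (Ob X')"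
  using mor unfolding tangent_morphism_def is_functor_def is_natural_def hom_def by auto

lemma lax_fibre:
  assumes "A \<in> Ob X'" "f \<in> Ar X'" "g \<in> Ar X'" "Dom X' f = Dom X' g" "Cod X' f = Tob X' A" "Cod X' g = Tob X' A"
    "tp X' A \<cdot>\<^bsub>X'\<^esub> f = tp X' A \<cdot>\<^bsub>X'\<^esub> g"
  shows "tp X (obm F A) \<bullet> (lax F A \<bullet> arm F f) = tp X (obm F A) \<bullet> (lax F A \<bullet> arm F g)"
  using arg_cong[OF assms(7), of "arm F"] assms(1-6) by (simp add: p_lax[THEN B.extend])

lemma lax_fibre_prs: "A \<in> Ob X' \<Longrightarrow> tp X (obm F A) \<bullet> (lax F A \<bullet> arm F (pr1 X' A)) =
   tp X (obm F A) \<bullet> (lax F A \<bullet> arm F (pr2 X' A))"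
  by (rule lax_fibre) simp_all

lemma lax_add:
  assumes "A \<in> Ob X'" "f \<in> Ar X'" "g \<in> Ar X'" "Dom X' f = Dom X' g" "Cod X' f = Tob X' A" "Cod X' g = Tob X' A"
    "tp X' A \<cdot>\<^bsub>X'\<^esub> f = tp X' A \<cdot>\<^bsub>X'\<^esub> g"
  shows "lax F A \<bullet> (arm F (ts X' A) \<bullet> arm F (pair X' A f g)) =
    ts X (obm F A) \<bullet> pair X (obm F A) (lax F A \<bullet> arm F f) (lax F A \<bullet> arm F g)"
proof -
  have "arm F (pr1 X' A) \<bullet> arm F (pair X' A f g) = arm F f"
    "arm F (pr2 X' A) \<bullet> arm F (pair X' A f g) = arm F g"
    using assms by (simp_all flip: arm_cmp)
  then show ?thesis
    using B.extend[OF lax_s[of A], of "arm F (pair X' A f g)"] lax_fibre_prs[of A] assms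
    by (simp add: B.pair_cmp)
qed

end

lemma tangent_morphismI:
  fixes X' :: "('x, 'y) tang" and X :: "('o, 'a) tang" (structure)
  assumes "obm F \<in> extensional (Ob X')" "arm F \<in> extensional (Ar X')" "lax F \<in> extensional (Ob X')"
    and "\<And>A. A \<in> Ob X' \<Longrightarrow> obm F A \<in> Ob X"
    and "\<And>A. A \<in> Ob X' \<Longrightarrow> arm F (Idn X' A) = Idn X (obm F A)"
    and "\<And>f. f \<in> Ar X' \<Longrightarrow> arm F f \<in> Ar X"
    and "\<And>f. f \<in> Ar X' \<Longrightarrow> Dom X (arm F f) = obm F (Dom X' f)"
    and "\<And>f. f \<in> Ar X' \<Longrightarrow> Cod X (arm F f) = obm F (Cod X' f)"
    and "\<And>f g. \<lbrakk>f \<in> Ar X'; g \<in> Ar X'; Cod X' f = Dom X' g\<rbrakk> \<Longrightarrow>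
      arm F (g \<cdot>\<^bsub>X'\<^esub> f) = arm F g \<bullet> arm F f"
    and "\<And>A. A \<in> Ob X' \<Longrightarrow> lax F A \<in> Ar X"
    and "\<And>A. A \<in> Ob X' \<Longrightarrow> Dom X (lax F A) = obm F (Tob X' A)"
    and "\<And>A. A \<in> Ob X' \<Longrightarrow> Cod X (lax F A) = Tob X (obm F A)"
    and "\<And>f. f \<in> Ar X' \<Longrightarrow>
      lax F (Cod X' f) \<bullet> arm F (Tar X' f) = Tar X (arm F f) \<bullet> lax F (Dom X' f)"
    and "\<And>A. A \<in> Ob X' \<Longrightarrow> tp X (obm F A) \<bullet> lax F A = arm F (tp X' A)"
    and "\<And>A. A \<in> Ob X' \<Longrightarrow> lax F A \<bullet> arm F (tz X' A) = tz X (obm F A)"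
    and "\<And>A. A \<in> Ob X' \<Longrightarrow> lax F A \<bullet> arm F (ts X' A) =
         ts X (obm F A) \<bullet>
           pair X (obm F A) (lax F A \<bullet> arm F (pr1 X' A)) (lax F A \<bullet> arm F (pr2 X' A))"
    and "\<And>A. A \<in> Ob X' \<Longrightarrow> tl X (obm F A) \<bullet> lax F A =
         Tar X (lax F A) \<bullet> lax F (Tob X' A) \<bullet> arm F (tl X' A)"
    and "\<And>A. A \<in> Ob X' \<Longrightarrow> tc X (obm F A) \<bullet> Tar X (lax F A) \<bullet> lax F (Tob X' A) =
         Tar X (lax F A) \<bullet> lax F (Tob X' A) \<bullet> arm F (tc X' A)"
  shows "tangent_morphism X' X F"
  using assms unfolding tangent_morphism_def is_functor_def is_natural_def hom_def by simp

lemma lax_morphismI: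
  "tangent_category X' \<Longrightarrow> tangent_category X \<Longrightarrow> tangent_morphism X' X F \<Longrightarrow> lax_morphism X' X F"
  by unfold_locales

lemma id_mor_morphism:
  fixes X :: "('o, 'a) tang"
  assumes "tangent_category X"
  shows "tangent_morphism X X (id_mor X)"
proof -
  interpret tangent X by unfold_locales (rule assms)
  show ?thesis
    by (rule tangent_morphismI)
      (simp_all add: id_mor_def strict_mor_def pair_prs)
qed

lemma comp_mor_simps [simp]:
  "A \<in> Ob X' \<Longrightarrow> obm (comp_mor X' Y G F) A = obm G (obm F A)"
  "f \<in> Ar X' \<Longrightarrow> arm (comp_mor X' Y G F) f = arm G (arm F f)"
  "A \<in> Ob X' \<Longrightarrow> lax (comp_mor X' Y G F) A = lax G (obm F A) \<cdot>\<^bsub>Y\<^esub> arm G (lax F A)"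
  by (simp_all add: comp_mor_def)

lemma comp_mor_morphism:
  fixes X' :: "('x, 'y) tang" and X :: "('o, 'a) tang" (structure) and Y :: "('p, 'b) tang"
  assumes "tangent_category X'" "tangent_category X" "tangent_category Y"
    "tangent_morphism X' X F" "tangent_morphism X Y G"
  shows "tangent_morphism X' Y (comp_mor X' Y G F)"
proof -
  interpret F: lax_morphism X' X F by (rule lax_morphismI) fact+
  interpret G: lax_morphism X Y G by (rule lax_morphismI) fact+
  note [simp] = F.lax_fibre_prs G.lax_fibre_prs
  show ?thesis
  proof (rule tangent_morphismI)
    fix f assume f: "f \<in> Ar X'"
    have "arm G (lax F (Cod X' f)) \<cdot>\<^bsub>Y\<^esub> arm G (arm F (Tar X' f)) =
      arm G (Tar X (arm F f)) \<cdot>\<^bsub>Y\<^esub> arm G (lax F (Dom X' f))"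
      using arg_cong[OF F.lax_nat[OF f refl], of "arm G"] f by simp
    then show "lax (comp_mor X' Y G F) (Cod X' f) \<cdot>\<^bsub>Y\<^esub> arm (comp_mor X' Y G F) (Tar X' f) =
      Tar Y (arm (comp_mor X' Y G F) f) \<cdot>\<^bsub>Y\<^esub> lax (comp_mor X' Y G F) (Dom X' f)"
      using f by (simp add: G.lax_nat[THEN G.B.extend])
  next
    fix A assume A: "A \<in> Ob X'"
    show "tp Y (obm (comp_mor X' Y G F) A) \<cdot>\<^bsub>Y\<^esub> lax (comp_mor X' Y G F) A = arm (comp_mor X' Y G F) (tp X' A)"
      using A arg_cong[OF F.p_lax[OF A], of "arm G"] by (simp add: G.p_lax[THEN G.B.extend])
    show "lax (comp_mor X' Y G F) A \<cdot>\<^bsub>Y\<^esub> arm (comp_mor X' Y G F) (tz X' A) = tz Y (obm (comp_mor X' Y G F) A)"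
      using A arg_cong[OF F.lax_z[OF A], of "arm G"] by (simp add: G.lax_z)
    show "lax (comp_mor X' Y G F) A \<cdot>\<^bsub>Y\<^esub> arm (comp_mor X' Y G F) (ts X' A) =
         ts Y (obm (comp_mor X' Y G F) A) \<cdot>\<^bsub>Y\<^esub>
           pair Y (obm (comp_mor X' Y G F) A) (lax (comp_mor X' Y G F) A \<cdot>\<^bsub>Y\<^esub> arm (comp_mor X' Y G F) (pr1
             X' A))
             (lax (comp_mor X' Y G F) A \<cdot>\<^bsub>Y\<^esub> arm (comp_mor X' Y G F) (pr2 X' A))"
      using A arg_cong[OF F.lax_s[OF A], of "arm G"]
        G.lax_add[of "obm F A" "lax F A \<bullet> arm F (pr1 X' A)" "lax F A \<bullet> arm F (pr2 X' A)"] by simp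
    have "tl Y (obm G (obm F A)) \<cdot>\<^bsub>Y\<^esub> (lax G (obm F A) \<cdot>\<^bsub>Y\<^esub> arm G (lax F A)) =
      Tar Y (lax G (obm F A)) \<cdot>\<^bsub>Y\<^esub> lax G (Tob X (obm F A)) \<cdot>\<^bsub>Y\<^esub> arm G (tl X (obm F A) \<bullet> lax F A)"
      using A by (simp add: G.l_lax[THEN G.B.extend])
    also have "\<dots> = Tar Y (lax G (obm F A)) \<cdot>\<^bsub>Y\<^esub> Tar Y (arm G (lax F A)) \<cdot>\<^bsub>Y\<^esub> lax G (obm F (Tob X' A)) \<cdot>\<^bsub>Y\<^esub>
       arm G (lax F (Tob X' A)) \<cdot>\<^bsub>Y\<^esub> arm G (arm F (tl X' A))"
      unfolding F.l_lax[OF A] using A by (simp add: G.lax_nat[THEN G.B.extend])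
    finally show "tl Y (obm (comp_mor X' Y G F) A) \<cdot>\<^bsub>Y\<^esub> lax (comp_mor X' Y G F) A =
         Tar Y (lax (comp_mor X' Y G F) A) \<cdot>\<^bsub>Y\<^esub> lax (comp_mor X' Y G F) (Tob X' A) \<cdot>\<^bsub>Y\<^esub> arm (comp_mor X' Y
           G F) (tl X' A)"
      using A by simp
    have "tc Y (obm G (obm F A)) \<cdot>\<^bsub>Y\<^esub> Tar Y (lax G (obm F A)) \<cdot>\<^bsub>Y\<^esub> Tar Y (arm G (lax F A)) \<cdot>\<^bsub>Y\<^esub>
        lax G (obm F (Tob X' A)) \<cdot>\<^bsub>Y\<^esub> arm G (lax F (Tob X' A))
      = (tc Y (obm G (obm F A)) \<cdot>\<^bsub>Y\<^esub> Tar Y (lax G (obm F A)) \<cdot>\<^bsub>Y\<^esub> lax G (Tob X (obm F A))) \<cdot>\<^bsub>Y\<^esub>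
        arm G (Tar X (lax F A) \<bullet> lax F (Tob X' A))"
      using A by (simp add: G.lax_nat[THEN G.B.extend])
    also have "\<dots> = Tar Y (lax G (obm F A)) \<cdot>\<^bsub>Y\<^esub> lax G (Tob X (obm F A)) \<cdot>\<^bsub>Y\<^esub>
       arm G (tc X (obm F A) \<bullet> Tar X (lax F A) \<bullet> lax F (Tob X' A))"
      using A by (subst G.c_lax) simp_all
    also have "\<dots> = Tar Y (lax G (obm F A)) \<cdot>\<^bsub>Y\<^esub> Tar Y (arm G (lax F A)) \<cdot>\<^bsub>Y\<^esub> lax G (obm F (Tob X' A)) \<cdot>\<^bsub>Y\<^esub>
       arm G (lax F (Tob X' A)) \<cdot>\<^bsub>Y\<^esub> arm G (arm F (tc X' A))"
      unfolding F.c_lax[OF A] using A by (simp add: G.lax_nat[THEN G.B.extend])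
    finally show "tc Y (obm (comp_mor X' Y G F) A) \<cdot>\<^bsub>Y\<^esub> Tar Y (lax (comp_mor X' Y G F) A) \<cdot>\<^bsub>Y\<^esub> lax
      (comp_mor X' Y G F) (Tob X' A) =
         Tar Y (lax (comp_mor X' Y G F) A) \<cdot>\<^bsub>Y\<^esub> lax (comp_mor X' Y G F) (Tob X' A) \<cdot>\<^bsub>Y\<^esub> arm (comp_mor X' Y
           G F) (tc X' A)"
      using A by simp
  qed (simp_all add: comp_mor_def)
qed

lemma Tbar_simps [simp]:
  "A \<in> Ob X' \<Longrightarrow> obm (Tbar X' X F) A = Tob X (obm F A)"
  "f \<in> Ar X' \<Longrightarrow> arm (Tbar X' X F) f = Tar X (arm F f)"
  "A \<in> Ob X' \<Longrightarrow> lax (Tbar X' X F) A = tc X (obm F A) \<cdot>\<^bsub>X\<^esub> Tar X (lax F A)"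
  by (simp_all add: Tbar_def)

text \<open>Each axiom for \<open>c \<cdot> T \<alpha>\<close> is the image under \<open>T\<close> of the one for \<open>\<alpha>\<close>, moved past the flip: additivity
  uses that the flip is additive, the lift uses the coherence of flip and lift, and the flip itself
  the braid equation.\<close>

lemma Tbar_morphism:
  fixes X' :: "('x, 'y) tang" and X :: "('o, 'a) tang" (structure)
  assumes "tangent_category X'" "tangent_category X" "tangent_morphism X' X F"
  shows "tangent_morphism X' X (Tbar X' X F)"
proof -
  interpret lax_morphism X' X F by (rule lax_morphismI) fact+
  note [simp] = lax_fibre_prs
  show ?thesis
  proof (rule tangent_morphismI)
    fix f assume f: "f \<in> Ar X'"
    have "Tar X (lax F (Cod X' f)) \<bullet> Tar X (arm F (Tar X' f)) =
      Tar X (Tar X (arm F f)) \<bullet> Tar X (lax F (Dom X' f))"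
      using arg_cong[OF lax_nat[OF f refl], of "Tar X"] f by simp
    then show "lax (Tbar X' X F) (Cod X' f) \<bullet> arm (Tbar X' X F) (Tar X' f) =
      Tar X (arm (Tbar X' X F) f) \<bullet> lax (Tbar X' X F) (Dom X' f)"
      using f by (simp add: B.tc_nat[THEN B.extend])
  next
    fix A assume A: "A \<in> Ob X'"
    show "tp X (obm (Tbar X' X F) A) \<bullet> lax (Tbar X' X F) A = arm (Tbar X' X F) (tp X' A)"
      using A arg_cong[OF p_lax[OF A], of "Tar X"] by (simp add: B.p_c[THEN B.extend])
    show "lax (Tbar X' X F) A \<bullet> arm (Tbar X' X F) (tz X' A) = tz X (obm (Tbar X' X F) A)"
      using A arg_cong[OF lax_z[OF A], of "Tar X"] by (simp add: B.c_Tz)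
    let ?a = "lax F A \<bullet> arm F (pr1 X' A)" and ?b = "lax F A \<bullet> arm F (pr2 X' A)"
    have "Tar X (lax F A) \<bullet> Tar X (arm F (ts X' A)) = Tar X (ts X (obm F A)) \<bullet> Tar X (pair X (obm F A) ?a ?b)"
      using arg_cong[OF lax_s[OF A], of "Tar X"] A by simp
    moreover have "Tar X (pr1 X (obm F A)) \<bullet> Tar X (pair X (obm F A) ?a ?b) = Tar X ?a"
      "Tar X (pr2 X (obm F A)) \<bullet> Tar X (pair X (obm F A) ?a ?b) = Tar X ?b"
      using A by (simp_all flip: B.tar_cmp)
    ultimately show "lax (Tbar X' X F) A \<bullet> arm (Tbar X' X F) (ts X' A) =
         ts X (obm (Tbar X' X F) A) \<bullet>
           pair X (obm (Tbar X' X F) A) (lax (Tbar X' X F) A \<bullet> arm (Tbar X' X F) (pr1 X' A))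
             (lax (Tbar X' X F) A \<bullet> arm (Tbar X' X F) (pr2 X' A))"
      using A by (simp add: B.c_add)
    have "Tar X (tc X (obm F A)) \<bullet> Tar X (Tar X (lax F A)) \<bullet> tc X (obm F (Tob X' A)) \<bullet>
         Tar X (lax F (Tob X' A)) \<bullet> Tar X (arm F (tl X' A))
      = Tar X (tc X (obm F A)) \<bullet> tc X (Tob X (obm F A)) \<bullet>
          Tar X (Tar X (lax F A) \<bullet> lax F (Tob X' A) \<bullet> arm F (tl X' A))"
      using A by (simp add: B.tc_nat[THEN B.extend])
    also have "\<dots> = (Tar X (tc X (obm F A)) \<bullet> tc X (Tob X (obm F A)) \<bullet> Tar X (tl X (obm F A))) \<bullet> Tar X (lax F A)"
      unfolding l_lax[OF A, symmetric] using A by simp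
    also have "\<dots> = (tl X (Tob X (obm F A)) \<bullet> tc X (obm F A)) \<bullet> Tar X (lax F A)"
      using A by (subst B.Tc_c_Tl) simp_all
    finally show "tl X (obm (Tbar X' X F) A) \<bullet> lax (Tbar X' X F) A =
         Tar X (lax (Tbar X' X F) A) \<bullet> lax (Tbar X' X F) (Tob X' A) \<bullet> arm (Tbar X' X F) (tl X' A)"
      using A by simp
    have "tc X (Tob X (obm F A)) \<bullet> Tar X (tc X (obm F A)) \<bullet> Tar X (Tar X (lax F A)) \<bullet>
        tc X (obm F (Tob X' A)) \<bullet> Tar X (lax F (Tob X' A))
      = (tc X (Tob X (obm F A)) \<bullet> Tar X (tc X (obm F A)) \<bullet> tc X (Tob X (obm F A))) \<bullet>
        Tar X (Tar X (lax F A)) \<bullet> Tar X (lax F (Tob X' A))"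
      using A by (simp add: B.tc_nat[THEN B.extend])
    also have "\<dots> = Tar X (tc X (obm F A)) \<bullet> tc X (Tob X (obm F A)) \<bullet>
      Tar X (tc X (obm F A) \<bullet> Tar X (lax F A) \<bullet> lax F (Tob X' A))"
      using A by (subst B.braid[symmetric]) simp_all
    also have "\<dots> = Tar X (tc X (obm F A)) \<bullet> Tar X (Tar X (lax F A)) \<bullet>
        tc X (obm F (Tob X' A)) \<bullet> Tar X (lax F (Tob X' A)) \<bullet> Tar X (arm F (tc X' A))"
      unfolding c_lax[OF A] using A by (simp add: B.tc_nat[THEN B.extend])
    finally show "tc X (obm (Tbar X' X F) A) \<bullet> Tar X (lax (Tbar X' X F) A) \<bullet> lax (Tbar X' X F) (Tob X' A) =
         Tar X (lax (Tbar X' X F) A) \<bullet> lax (Tbar X' X F) (Tob X' A) \<bullet> arm (Tbar X' X F) (tc X' A)"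
      using A by simp
  qed (simp_all add: Tbar_def)
qed

text \<open>This is how pointwise limits of tangent morphisms are seen to be tangent morphisms. Every axiom
  is an equation between arrows into \<open>F A\<close>, \<open>T F A\<close> or \<open>T\<^sup>2 F A\<close>, and composing with the legs turns it
  into the same axiom for the morphisms \<open>B j\<close>; this is why joint monicity is required on three
  levels.\<close>

lemma morphism_by_monic_legs:
  fixes X' :: "('x, 'y) tang" and X :: "('o, 'a) tang" (structure)
  assumes X': "tangent_category X'" and X: "tangent_category X" and B: "\<And>j. j \<in> J \<Longrightarrow> tangent_morphism X' X (B j)"
    and ext: "obm F \<in> extensional (Ob X')" "arm F \<in> extensional (Ar X')" "lax F \<in> extensional (Ob X')"
    and ob: "\<And>A. A \<in> Ob X' \<Longrightarrow> obm F A \<in> Ob X"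
    and ar: "\<And>f. f \<in> Ar X' \<Longrightarrow> arm F f \<in> Ar X"
     "\<And>f. f \<in> Ar X' \<Longrightarrow> Dom X (arm F f) = obm F (Dom X' f)"
     "\<And>f. f \<in> Ar X' \<Longrightarrow> Cod X (arm F f) = obm F (Cod X' f)"
    and lax: "\<And>A. A \<in> Ob X' \<Longrightarrow> lax F A \<in> Ar X"
     "\<And>A. A \<in> Ob X' \<Longrightarrow> Dom X (lax F A) = obm F (Tob X' A)"
     "\<And>A. A \<in> Ob X' \<Longrightarrow> Cod X (lax F A) = Tob X (obm F A)"
    and leg: "\<And>j A. j \<in> J \<Longrightarrow> A \<in> Ob X' \<Longrightarrow> \<pi> j A \<in> Ar X"
      "\<And>j A. j \<in> J \<Longrightarrow> A \<in> Ob X' \<Longrightarrow> Dom X (\<pi> j A) = obm F A"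
      "\<And>j A. j \<in> J \<Longrightarrow> A \<in> Ob X' \<Longrightarrow> Cod X (\<pi> j A) = obm (B j) A"
    and leg_nat: "\<And>j f. j \<in> J \<Longrightarrow> f \<in> Ar X' \<Longrightarrow>
        \<pi> j (Cod X' f) \<bullet> arm F f = arm (B j) f \<bullet> \<pi> j (Dom X' f)"
    and leg_lax: "\<And>j A. j \<in> J \<Longrightarrow> A \<in> Ob X' \<Longrightarrow>
        Tar X (\<pi> j A) \<bullet> lax F A = lax (B j) A \<bullet> \<pi> j (Tob X' A)"
    and monic: "\<And>A. A \<in> Ob X' \<Longrightarrow> T_monic X (obm F A) ((\<lambda>j. \<pi> j A) ` J)"
      "\<And>A. A \<in> Ob X' \<Longrightarrow> T_monic X (Tob X (obm F A)) ((\<lambda>j. Tar X (\<pi> j A)) ` J)"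
  shows "tangent_morphism X' X F"
proof -
  interpret X': tangent X' by unfold_locales (rule X')
  interpret X: tangent X by unfold_locales (rule X)
  note [simp] = ob ar lax leg
  have ext0: "a = b" if "A \<in> Ob X'" "a \<in> Ar X" "b \<in> Ar X" "Dom X a = Dom X b" "Cod X a = obm F A"
    "Cod X b = obm F A"
    "\<And>j. j \<in> J \<Longrightarrow> \<pi> j A \<bullet> a = \<pi> j A \<bullet> b" for A a b
    by (rule T_monicD0[OF monic(1)]) (use that in auto)
  have ext1: "a = b" if "A \<in> Ob X'" "a \<in> Ar X" "b \<in> Ar X" "Dom X a = Dom X b"
    "Cod X a = Tob X (obm F A)" "Cod X b = Tob X (obm F A)"
    "\<And>j. j \<in> J \<Longrightarrow> Tar X (\<pi> j A) \<bullet> a = Tar X (\<pi> j A) \<bullet> b" for A a b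
    by (rule T_monicD1[OF monic(1)]) (use that in auto)
  have ext2: "a = b" if "A \<in> Ob X'" "a \<in> Ar X" "b \<in> Ar X" "Dom X a = Dom X b"
    "Cod X a = Tob X (Tob X (obm F A))" "Cod X b = Tob X (Tob X (obm F A))"
    "\<And>j. j \<in> J \<Longrightarrow> Tar X (Tar X (\<pi> j A)) \<bullet> a = Tar X (Tar X (\<pi> j A)) \<bullet> b" for A a b
    by (rule T_monicD1[OF monic(2)]) (use that in auto)
  have nat: "\<pi> j D \<bullet> arm F f = arm (B j) f \<bullet> \<pi> j (Dom X' f)" if "j \<in> J" "f \<in> Ar X'" "Cod X' f = D" for j f D
    using leg_nat that by blast
  have Tnat: "Tar X (\<pi> j D) \<bullet> Tar X (arm F f) = Tar X (arm (B j) f) \<bullet> Tar X (\<pi> j (Dom X' f))"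
    if "j \<in> J" "f \<in> Ar X'" "Cod X' f = D" for j f D
  proof -
    interpret lax_morphism X' X "B j" by (rule lax_morphismI) (use X' X B that in auto)
    show ?thesis using arg_cong[OF nat[OF that], of "Tar X"] that by auto
  qed
  have Tlax: "Tar X (Tar X (\<pi> j A)) \<bullet> Tar X (lax F A) = Tar X (lax (B j) A) \<bullet> Tar X (\<pi> j (Tob X' A))"
    if "j \<in> J" "A \<in> Ob X'" for j A
  proof -
    interpret lax_morphism X' X "B j" by (rule lax_morphismI) (use X' X B that in auto)
    show ?thesis using arg_cong[OF leg_lax[OF that], of "Tar X"] that by auto
  qed
  note ex = nat[THEN X.extend] Tnat[THEN X.extend] leg_lax[THEN X.extend] Tlax[THEN X.extend]
  have p_lax: "tp X (obm F A) \<bullet> lax F A = arm F (tp X' A)" if A: "A \<in> Ob X'" for A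
  proof (rule ext0[OF A])
    fix j assume j: "j \<in> J"
    interpret B: lax_morphism X' X "B j" by (rule lax_morphismI) (use X' X B j in auto)
    show "\<pi> j A \<bullet> (tp X (obm F A) \<bullet> lax F A) = \<pi> j A \<bullet> arm F (tp X' A)"
      using A j X.extend[OF X.tp_nat[of "\<pi> j A" "obm (B j) A", symmetric], of "lax F A"]
      by (simp add: nat leg_lax B.p_lax[THEN X.extend])
  qed (use A in simp_all)
  show ?thesis
  proof (rule tangent_morphismI)
    fix A assume A: "A \<in> Ob X'"
    show "arm F (Idn X' A) = Idn X (obm F A)"
    proof (rule ext0[OF A])
      fix j assume j: "j \<in> J"
      interpret B: lax_morphism X' X "B j" by (rule lax_morphismI) (use X' X B j in auto)
      show "\<pi> j A \<bullet> arm F (Idn X' A) = \<pi> j A \<bullet> Idn X (obm F A)"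
        using A j by (simp add: nat)
    qed (use A in simp_all)
    show "lax F A \<bullet> arm F (tz X' A) = tz X (obm F A)"
    proof (rule ext1[OF A])
      fix j assume j: "j \<in> J"
      interpret B: lax_morphism X' X "B j" by (rule lax_morphismI) (use X' X B j in auto)
      show "Tar X (\<pi> j A) \<bullet> (lax F A \<bullet> arm F (tz X' A)) = Tar X (\<pi> j A) \<bullet> tz X (obm F A)"
        using A j X.tz_nat[of "\<pi> j A" "obm (B j) A", symmetric] by (simp add: nat ex B.lax_z[THEN X.extend])
    qed (use A in simp_all)
    have lf: "tp X (obm F A) \<bullet> (lax F A \<bullet> arm F (pr1 X' A)) = tp X (obm F A) \<bullet> (lax F A \<bullet> arm F (pr2 X' A))"
    proof (rule ext0[OF A])
      fix j assume j: "j \<in> J"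
      interpret B: lax_morphism X' X "B j" by (rule lax_morphismI) (use X' X B j in auto)
      have *: "arm (B j) (tp X' A) \<bullet> arm (B j) (pr1 X' A) = arm (B j) (tp X' A) \<bullet> arm (B j) (pr2 X' A)"
        using A by (simp flip: B.arm_cmp)
      show "\<pi> j A \<bullet> (tp X (obm F A) \<bullet> (lax F A \<bullet> arm F (pr1 X' A))) =
        \<pi> j A \<bullet> (tp X (obm F A) \<bullet> (lax F A \<bullet> arm F (pr2 X' A)))"
        using A j X.extend[OF *] by (simp add: p_lax[THEN X.extend] nat ex)
    qed (use A in simp_all)
    show "lax F A \<bullet> arm F (ts X' A) =
         ts X (obm F A) \<bullet>
           pair X (obm F A) (lax F A \<bullet> arm F (pr1 X' A)) (lax F A \<bullet> arm F (pr2 X' A))"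
    proof (rule ext1[OF A])
      fix j assume j: "j \<in> J"
      interpret B: lax_morphism X' X "B j" by (rule lax_morphismI) (use X' X B j in auto)
      show "Tar X (\<pi> j A) \<bullet> (lax F A \<bullet> arm F (ts X' A)) = Tar X (\<pi> j A) \<bullet> (ts X (obm F A) \<bullet>
           pair X (obm F A) (lax F A \<bullet> arm F (pr1 X' A)) (lax F A \<bullet> arm F (pr2 X' A)))"
        using A j lf B.lax_fibre_prs[OF A]
        by (simp add: nat ex X.add_nat[where B = "obm (B j) A"] B.lax_s[THEN X.extend] X.pair_cmp)
    qed (use A lf in simp_all)
    show "tl X (obm F A) \<bullet> lax F A =
         Tar X (lax F A) \<bullet> lax F (Tob X' A) \<bullet> arm F (tl X' A)"
    proof (rule ext2[OF A])
      fix j assume j: "j \<in> J"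
      interpret B: lax_morphism X' X "B j" by (rule lax_morphismI) (use X' X B j in auto)
      show "Tar X (Tar X (\<pi> j A)) \<bullet> (tl X (obm F A) \<bullet> lax F A) =
        Tar X (Tar X (\<pi> j A)) \<bullet> (Tar X (lax F A) \<bullet> lax F (Tob X' A) \<bullet> arm F (tl X' A))"
        using A j X.extend[OF X.tl_nat[of "\<pi> j A" "obm (B j) A", symmetric], of "lax F A"]
        by (simp add: nat ex leg_lax B.l_lax[THEN X.extend])
    qed (use A in simp_all)
    show "tc X (obm F A) \<bullet> Tar X (lax F A) \<bullet> lax F (Tob X' A) =
         Tar X (lax F A) \<bullet> lax F (Tob X' A) \<bullet> arm F (tc X' A)"
    proof (rule ext2[OF A])
      fix j assume j: "j \<in> J"
      interpret B: lax_morphism X' X "B j" by (rule lax_morphismI) (use X' X B j in auto)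
      have "(tc X (obm (B j) A) \<bullet> Tar X (lax (B j) A) \<bullet> lax (B j) (Tob X' A)) \<bullet> \<pi> j (Tob X' (Tob X' A))
        = (Tar X (lax (B j) A) \<bullet> lax (B j) (Tob X' A) \<bullet> arm (B j) (tc X' A)) \<bullet> \<pi> j (Tob X' (Tob X' A))"
        using B.c_lax[OF A] by simp
      then show "Tar X (Tar X (\<pi> j A)) \<bullet> (tc X (obm F A) \<bullet> Tar X (lax F A) \<bullet> lax F (Tob X' A)) =
        Tar X (Tar X (\<pi> j A)) \<bullet> (Tar X (lax F A) \<bullet> lax F (Tob X' A) \<bullet> arm F (tc X' A))"
        using A j X.extend[OF X.tc_nat[of "\<pi> j A" "obm (B j) A", symmetric], of "Tar X (lax F A) \<bullet> lax F
          (Tob X' A)"]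
        by (simp add: nat ex leg_lax)
    qed (use A in simp_all)
  next
    fix f g assume f: "f \<in> Ar X'" "g \<in> Ar X'" "Cod X' f = Dom X' g"
    show "arm F (g \<cdot>\<^bsub>X'\<^esub> f) = arm F g \<bullet> arm F f"
    proof (rule ext0[of "Cod X' g"])
      fix j assume j: "j \<in> J"
      interpret B: lax_morphism X' X "B j" by (rule lax_morphismI) (use X' X B j in auto)
      show "\<pi> j (Cod X' g) \<bullet> arm F (g \<cdot>\<^bsub>X'\<^esub> f) = \<pi> j (Cod X' g) \<bullet> (arm F g \<bullet> arm F f)"
        using f j by (simp add: nat ex)
    qed (use f in simp_all)
  next
    fix f assume f: "f \<in> Ar X'"
    show "lax F (Cod X' f) \<bullet> arm F (Tar X' f) = Tar X (arm F f) \<bullet> lax F (Dom X' f)"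
    proof (rule ext1[of "Cod X' f"])
      fix j assume j: "j \<in> J"
      interpret B: lax_morphism X' X "B j" by (rule lax_morphismI) (use X' X B j in auto)
      show "Tar X (\<pi> j (Cod X' f)) \<bullet> (lax F (Cod X' f) \<bullet> arm F (Tar X' f)) =
         Tar X (\<pi> j (Cod X' f)) \<bullet> (Tar X (arm F f) \<bullet> lax F (Dom X' f))"
        using f j by (simp add: nat ex leg_lax B.lax_nat[THEN X.extend])
    qed (use f in simp_all)
  qed (use ext p_lax in simp_all)
qed


section \<open>Tangent structure detected by evaluations\<close>

lemma fold_pullback_iso:
  fixes X :: "('o, 'a) tang" (structure)
  assumes X: "is_category X" and P': "is_fold_pullback X n e P' q' \<pi>'"
    and k: "k \<in> Ar X" "Dom X k = P" "Cod X k = P'" and k': "k' \<in> Ar X" "Dom X k' = P'" "Cod X k' = P"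
    and kk': "k \<bullet> k' = Idn X P'" "k' \<bullet> k = Idn X P"
    and q: "q = q' \<bullet> k" and \<pi>: "\<And>j. j < n \<Longrightarrow> \<pi> j = \<pi>' j \<bullet> k"
  shows "is_fold_pullback X n e P q \<pi>"
proof -
  interpret category X by unfold_locales (rule X)
  have t: "e \<in> Ar X" "q' \<in> Ar X" "Dom X q' = P'" "Cod X q' = Cod X e"
    "\<And>i. i < n \<Longrightarrow> \<pi>' i \<in> Ar X" "\<And>i. i < n \<Longrightarrow> Dom X (\<pi>' i) = P'" "\<And>i. i < n \<Longrightarrow> Cod X (\<pi>' i) = Dom X e"
    "\<And>i. i < n \<Longrightarrow> e \<bullet> \<pi>' i = q'"
    using P' by (auto simp: is_fold_pullback_def hom_def)
  have P: "P \<in> Ob X" "P' \<in> Ob X" using k by auto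
  have ek: "e \<bullet> (\<pi>' j \<bullet> k) = q' \<bullet> k" if "j < n" for j
    using extend[OF t(8)[OF that], of k] t k that by simp
  show ?thesis
    unfolding is_fold_pullback_def
  proof (intro conjI ballI allI impI ex_ex1I)
    fix Q r g
    assume r: "r \<in> hom X Q (Cod X e)" and g: "\<forall>i<n. g i \<in> hom X Q (Dom X e) \<and> e \<bullet> g i = r"
    have "\<exists>h\<in>hom X (Dom X r) P'. q' \<bullet> h = r \<and> (\<forall>i<n. \<pi>' i \<bullet> h = g i)"
      by (rule fold_pullback_lift[OF P' X]) (use r g in \<open>auto simp: hom_def\<close>)
    then obtain h where h: "h \<in> Ar X" "Dom X h = Q" "Cod X h = P'" "q' \<bullet> h = r" "\<And>i. i < n \<Longrightarrow> \<pi>' i \<bullet> h = g i"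
      using r by (auto simp: hom_def)
    have kk: "k \<bullet> (k' \<bullet> h) = h" using extend[OF kk'(1), of h] h k k' P by simp
    show "\<exists>h. h \<in> hom X Q P \<and> q \<bullet> h = r \<and> (\<forall>i<n. \<pi> i \<bullet> h = g i)"
      using h k k' t kk by (intro exI[of _ "k' \<bullet> h"]) (simp add: hom_def q \<pi>)
    fix a b
    assume a: "a \<in> hom X Q P \<and> q \<bullet> a = r \<and> (\<forall>i<n. \<pi> i \<bullet> a = g i)"
      and b: "b \<in> hom X Q P \<and> q \<bullet> b = r \<and> (\<forall>i<n. \<pi> i \<bullet> b = g i)"
    have "k \<bullet> a = k \<bullet> b"
      by (rule jointly_monicD[OF fold_pullback_jointly_monic[OF P' X]])
        (use a b k t \<pi> in \<open>auto simp: hom_def q\<close>)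
    then have "k' \<bullet> (k \<bullet> a) = k' \<bullet> (k \<bullet> b)" by simp
    then show "a = b" using extend[OF kk'(2), of a] extend[OF kk'(2), of b] a b k k' P by (simp add: hom_def)
  qed (use t k q \<pi> ek in \<open>auto simp: hom_def\<close>)
qed

text \<open>The functors \<open>E\<^sub>i : C \<rightarrow> X\<close> are given by \<open>Eo i\<close> and \<open>Ea i\<close>. In the assumption \<open>lift\<close>, the arrows
  \<open>h i\<close> are candidates for the values of an arrow \<open>Q \<rightarrow> P\<close>, and they come from such an arrow if this
  is true after composition with a \<open>T\<close>-monic family of arrows \<open>L\<close> out of \<open>P\<close>. Categories of tangent morphisms
  (evaluated at the objects of the source) and of objects with structure (with their forgetful
  functor) are both of this form.\<close>

locale evaluations = X: tangent X + C: category C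
  for X :: "('o, 'a) tang" (structure) and C :: "('c, 'd) tang" +
  fixes I :: "'i set" and Eo :: "'i \<Rightarrow> 'c \<Rightarrow> 'o" and Ea :: "'i \<Rightarrow> 'd \<Rightarrow> 'a"
  assumes E_ob [simp]: "\<And>i A. i \<in> I \<Longrightarrow> A \<in> Ob C \<Longrightarrow> Eo i A \<in> Ob X"
    and E_ar [simp]: "\<And>i f. i \<in> I \<Longrightarrow> f \<in> Ar C \<Longrightarrow> Ea i f \<in> Ar X"
    and E_dom [simp]: "\<And>i f. i \<in> I \<Longrightarrow> f \<in> Ar C \<Longrightarrow> Dom X (Ea i f) = Eo i (Dom C f)"
    and E_cod [simp]: "\<And>i f. i \<in> I \<Longrightarrow> f \<in> Ar C \<Longrightarrow> Cod X (Ea i f) = Eo i (Cod C f)"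
    and E_idn [simp]: "\<And>i A. i \<in> I \<Longrightarrow> A \<in> Ob C \<Longrightarrow> Ea i (Idn C A) = Idn X (Eo i A)"
    and E_cmp [simp]: "\<And>i f g. i \<in> I \<Longrightarrow> f \<in> Ar C \<Longrightarrow> g \<in> Ar C \<Longrightarrow> Cod C f = Dom C g \<Longrightarrow>
      Ea i (g \<cdot>\<^bsub>C\<^esub> f) = Ea i g \<bullet> Ea i f"
    and faithful: "\<And>f g. f \<in> Ar C \<Longrightarrow> g \<in> Ar C \<Longrightarrow> Dom C f = Dom C g \<Longrightarrow> Cod C f = Cod C g \<Longrightarrow>
      (\<And>i. i \<in> I \<Longrightarrow> Ea i f = Ea i g) \<Longrightarrow> f = g"
    and C_tob_ob [simp]: "\<And>A. A \<in> Ob C \<Longrightarrow> Tob C A \<in> Ob C"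
    and C_tar_ar [simp]: "\<And>f. f \<in> Ar C \<Longrightarrow> Tar C f \<in> Ar C"
    and C_tar_dom [simp]: "\<And>f. f \<in> Ar C \<Longrightarrow> Dom C (Tar C f) = Tob C (Dom C f)"
    and C_tar_cod [simp]: "\<And>f. f \<in> Ar C \<Longrightarrow> Cod C (Tar C f) = Tob C (Cod C f)"
    and C_T2_ob [simp]: "\<And>A. A \<in> Ob C \<Longrightarrow> T2 C A \<in> Ob C"
    and C_pr1 [simp]: "\<And>A. A \<in> Ob C \<Longrightarrow> pr1 C A \<in> Ar C"
      "\<And>A. A \<in> Ob C \<Longrightarrow> Dom C (pr1 C A) = T2 C A" "\<And>A. A \<in> Ob C \<Longrightarrow> Cod C (pr1 C A) = Tob C A"
    and C_pr2 [simp]: "\<And>A. A \<in> Ob C \<Longrightarrow> pr2 C A \<in> Ar C"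
      "\<And>A. A \<in> Ob C \<Longrightarrow> Dom C (pr2 C A) = T2 C A" "\<And>A. A \<in> Ob C \<Longrightarrow> Cod C (pr2 C A) = Tob C A"
    and C_tp [simp]: "\<And>A. A \<in> Ob C \<Longrightarrow> tp C A \<in> Ar C"
      "\<And>A. A \<in> Ob C \<Longrightarrow> Dom C (tp C A) = Tob C A" "\<And>A. A \<in> Ob C \<Longrightarrow> Cod C (tp C A) = A"
    and C_tz [simp]: "\<And>A. A \<in> Ob C \<Longrightarrow> tz C A \<in> Ar C"
      "\<And>A. A \<in> Ob C \<Longrightarrow> Dom C (tz C A) = A" "\<And>A. A \<in> Ob C \<Longrightarrow> Cod C (tz C A) = Tob C A"
    and C_ts [simp]: "\<And>A. A \<in> Ob C \<Longrightarrow> ts C A \<in> Ar C"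
      "\<And>A. A \<in> Ob C \<Longrightarrow> Dom C (ts C A) = T2 C A" "\<And>A. A \<in> Ob C \<Longrightarrow> Cod C (ts C A) = Tob C A"
    and C_tl [simp]: "\<And>A. A \<in> Ob C \<Longrightarrow> tl C A \<in> Ar C"
      "\<And>A. A \<in> Ob C \<Longrightarrow> Dom C (tl C A) = Tob C A" "\<And>A. A \<in> Ob C \<Longrightarrow> Cod C (tl C A) = Tob C (Tob C A)"
    and C_tc [simp]: "\<And>A. A \<in> Ob C \<Longrightarrow> tc C A \<in> Ar C"
      "\<And>A. A \<in> Ob C \<Longrightarrow> Dom C (tc C A) = Tob C (Tob C A)" "\<And>A. A \<in> Ob C \<Longrightarrow> Cod C (tc C A) = Tob C (Tob C A)"
    and E_tob [simp]: "\<And>i A. i \<in> I \<Longrightarrow> A \<in> Ob C \<Longrightarrow> Eo i (Tob C A) = Tob X (Eo i A)"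
    and E_tar [simp]: "\<And>i f. i \<in> I \<Longrightarrow> f \<in> Ar C \<Longrightarrow> Ea i (Tar C f) = Tar X (Ea i f)"
    and E_T2 [simp]: "\<And>i A. i \<in> I \<Longrightarrow> A \<in> Ob C \<Longrightarrow> Eo i (T2 C A) = T2 X (Eo i A)"
    and E_pr1 [simp]: "\<And>i A. i \<in> I \<Longrightarrow> A \<in> Ob C \<Longrightarrow> Ea i (pr1 C A) = pr1 X (Eo i A)"
    and E_pr2 [simp]: "\<And>i A. i \<in> I \<Longrightarrow> A \<in> Ob C \<Longrightarrow> Ea i (pr2 C A) = pr2 X (Eo i A)"
    and E_tp [simp]: "\<And>i A. i \<in> I \<Longrightarrow> A \<in> Ob C \<Longrightarrow> Ea i (tp C A) = tp X (Eo i A)"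
    and E_tz [simp]: "\<And>i A. i \<in> I \<Longrightarrow> A \<in> Ob C \<Longrightarrow> Ea i (tz C A) = tz X (Eo i A)"
    and E_ts [simp]: "\<And>i A. i \<in> I \<Longrightarrow> A \<in> Ob C \<Longrightarrow> Ea i (ts C A) = ts X (Eo i A)"
    and E_tl [simp]: "\<And>i A. i \<in> I \<Longrightarrow> A \<in> Ob C \<Longrightarrow> Ea i (tl C A) = tl X (Eo i A)"
    and E_tc [simp]: "\<And>i A. i \<in> I \<Longrightarrow> A \<in> Ob C \<Longrightarrow> Ea i (tc C A) = tc X (Eo i A)"
    and lift: "\<And>Q P L h. \<lbrakk>Q \<in> Ob C; P \<in> Ob C; \<And>l. l \<in> L \<Longrightarrow> l \<in> Ar C; \<And>l. l \<in> L \<Longrightarrow> Dom C l = P;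
      \<And>i. i \<in> I \<Longrightarrow> T_monic X (Eo i P) (Ea i ` L);
      \<And>i. i \<in> I \<Longrightarrow> h i \<in> Ar X; \<And>i. i \<in> I \<Longrightarrow> Dom X (h i) = Eo i Q; \<And>i. i \<in> I \<Longrightarrow> Cod X (h i) = Eo i P;
      \<And>l. l \<in> L \<Longrightarrow> \<exists>g\<in>Ar C. Dom C g = Q \<and> Cod C g = Cod C l \<and> (\<forall>i\<in>I. Ea i g = Ea i l \<bullet> h i)\<rbrakk> \<Longrightarrow>
      \<exists>k\<in>Ar C. Dom C k = Q \<and> Cod C k = P \<and> (\<forall>i\<in>I. Ea i k = h i)"
    and fold: "\<And>A n. A \<in> Ob C \<Longrightarrow> \<exists>P q \<pi>. P \<in> Ob C \<and> q \<in> hom C P A \<and> (\<forall>j<n. \<pi> j \<in> hom C P (Tob C A)) \<and>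
      (\<forall>i\<in>I. is_fold_pullback X n (tp X (Eo i A)) (Eo i P) (Ea i q) (\<lambda>j. Ea i (\<pi> j)))"
begin

lemma E_eq:
  assumes "l \<cdot>\<^bsub>C\<^esub> a = f" "i \<in> I" "a \<in> Ar C" "l \<in> Ar C" "Cod C a = Dom C l"
  shows "Ea i l \<bullet> Ea i a = Ea i f"
  using assms by auto

text \<open>For limits with two projections, lifting and faithfulness combine to a universal property; it
  serves both for the pullback squares and for the induced arrows \<open>pair\<close> and \<open>tpair\<close>.\<close>

lemma lift_pair:
  assumes l: "l1 \<in> Ar C" "l2 \<in> Ar C" "Dom C l1 = P" "Dom C l2 = P"
    and f: "f \<in> Ar C" "g \<in> Ar C" "Dom C f = Q" "Dom C g = Q" "Cod C f = Cod C l1" "Cod C g = Cod C l2"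
    and T: "\<And>i. i \<in> I \<Longrightarrow> T_monic X (Eo i P) {Ea i l1, Ea i l2}"
    and h: "\<And>i. i \<in> I \<Longrightarrow> h i \<in> hom X (Eo i Q) (Eo i P)"
      "\<And>i. i \<in> I \<Longrightarrow> Ea i l1 \<bullet> h i = Ea i f" "\<And>i. i \<in> I \<Longrightarrow> Ea i l2 \<bullet> h i = Ea i g"
  shows "\<exists>k. k \<in> hom C Q P \<and> l1 \<cdot>\<^bsub>C\<^esub> k = f \<and> l2 \<cdot>\<^bsub>C\<^esub> k = g \<and> (\<forall>i\<in>I. Ea i k = h i) \<and>
    (\<forall>k'. k' \<in> hom C Q P \<and> l1 \<cdot>\<^bsub>C\<^esub> k' = f \<and> l2 \<cdot>\<^bsub>C\<^esub> k' = g \<longrightarrow> k' = k)"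
proof -
  have "\<exists>k\<in>Ar C. Dom C k = Q \<and> Cod C k = P \<and> (\<forall>i\<in>I. Ea i k = h i)"
  proof (rule lift[where L = "{l1, l2}"])
    show "\<exists>g\<in>Ar C. Dom C g = Q \<and> Cod C g = Cod C l \<and> (\<forall>i\<in>I. Ea i g = Ea i l \<bullet> h i)" if "l \<in> {l1, l2}" for l
      using that f l h by auto
  qed (use f l T h(1) in \<open>auto simp: hom_def\<close>)
  then obtain k where k: "k \<in> Ar C" "Dom C k = Q" "Cod C k = P" "\<And>i. i \<in> I \<Longrightarrow> Ea i k = h i" by auto
  show ?thesis
  proof (intro exI[of _ k] conjI allI impI ballI)
    show "k \<in> hom C Q P" "l1 \<cdot>\<^bsub>C\<^esub> k = f" "l2 \<cdot>\<^bsub>C\<^esub> k = g"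
      by (simp add: hom_def k) (rule faithful; use k l f h in simp)+
    fix k' assume "k' \<in> hom C Q P \<and> l1 \<cdot>\<^bsub>C\<^esub> k' = f \<and> l2 \<cdot>\<^bsub>C\<^esub> k' = g"
    then have k': "k' \<in> hom C Q P" "l1 \<cdot>\<^bsub>C\<^esub> k' = f" "l2 \<cdot>\<^bsub>C\<^esub> k' = g" by simp_all
    show "k' = k"
    proof (rule faithful)
      fix i assume i: "i \<in> I"
      have "Ea i l1 \<bullet> Ea i k' = Ea i f" "Ea i l2 \<bullet> Ea i k' = Ea i g"
        using E_eq[OF k'(2) i] E_eq[OF k'(3) i] k'(1) l by (simp_all add: hom_def)
      then show "Ea i k' = Ea i k"
        by - (rule T_monicD0[OF T[OF i]], use k(1-3) k(4)[OF i] k'(1) h[OF i] i in \<open>auto simp: hom_def\<close>)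
    qed (use k k' in \<open>simp_all add: hom_def\<close>)
  qed (rule k)
qed

lemma pullbackI:
  assumes f: "f \<in> Ar C" "g \<in> Ar C" "Cod C f = Cod C g" and a: "a \<in> Ar C" "Dom C a = P" "Cod C a = Dom C f"
    and b: "b \<in> Ar C" "Dom C b = P" "Cod C b = Dom C g"
    and E: "\<And>i. i \<in> I \<Longrightarrow> is_pullback X (Ea i f) (Ea i g) (Eo i P) (Ea i a) (Ea i b)"
    and T: "\<And>i. i \<in> I \<Longrightarrow> T_monic X (Eo i P) {Ea i a, Ea i b}"
  shows "is_pullback C f g P a b"
  unfolding is_pullback_def
proof (intro conjI ballI impI)
  show "f \<cdot>\<^bsub>C\<^esub> a = g \<cdot>\<^bsub>C\<^esub> b"
    by (rule faithful) (use f a b E in \<open>auto simp: is_pullback_def\<close>)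
  fix Q x y
  assume Q: "Q \<in> Ob C" and x: "x \<in> hom C Q (Dom C f)" and y: "y \<in> hom C Q (Dom C g)" and fx: "f \<cdot>\<^bsub>C\<^esub> x =
    g \<cdot>\<^bsub>C\<^esub> y"
  have x': "x \<in> Ar C" "Dom C x = Q" "Cod C x = Dom C f" and y': "y \<in> Ar C" "Dom C y = Q" "Cod C y = Dom C g"
    using x y by (auto simp: hom_def)
  have "\<exists>h\<in>hom X (Dom X (Ea i x)) (Eo i P). Ea i a \<bullet> h = Ea i x \<and> Ea i b \<bullet> h = Ea i y" if i: "i \<in> I" for i
  proof (rule pullback_lift[OF E[OF i] X.category])
    show "Ea i f \<bullet> Ea i x = Ea i g \<bullet> Ea i y"
      using arg_cong[OF fx, of "Ea i"] x' y' f i by simp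
  qed (use x' y' f i in simp_all)
  then obtain h where h: "\<And>i. i \<in> I \<Longrightarrow> h i \<in> hom X (Dom X (Ea i x)) (Eo i P)"
    "\<And>i. i \<in> I \<Longrightarrow> Ea i a \<bullet> h i = Ea i x" "\<And>i. i \<in> I \<Longrightarrow> Ea i b \<bullet> h i = Ea i y"
    by metis
  show "\<exists>!h. h \<in> hom C Q P \<and> a \<cdot>\<^bsub>C\<^esub> h = x \<and> b \<cdot>\<^bsub>C\<^esub> h = y"
  proof -
    have "\<exists>k. k \<in> hom C Q P \<and> a \<cdot>\<^bsub>C\<^esub> k = x \<and> b \<cdot>\<^bsub>C\<^esub> k = y \<and> (\<forall>i\<in>I. Ea i k = h i) \<and>
        (\<forall>k'. k' \<in> hom C Q P \<and> a \<cdot>\<^bsub>C\<^esub> k' = x \<and> b \<cdot>\<^bsub>C\<^esub> k' = y \<longrightarrow> k' = k)"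
      by (rule lift_pair) (use T h x' y' a b in \<open>simp_all add: hom_def\<close>)
    then show ?thesis by blast
  qed
qed (use f a b in \<open>auto simp: hom_def\<close>)

lemma fold_pullbackI:
  assumes e: "e \<in> Ar C" and q: "q \<in> Ar C" "Dom C q = P" "Cod C q = Cod C e"
    and \<pi>: "\<And>j. j < n \<Longrightarrow> \<pi> j \<in> Ar C" "\<And>j. j < n \<Longrightarrow> Dom C (\<pi> j) = P" "\<And>j. j < n \<Longrightarrow> Cod C (\<pi> j) = Dom C e"
    and E: "\<And>i. i \<in> I \<Longrightarrow> is_fold_pullback X n (Ea i e) (Eo i P) (Ea i q) (\<lambda>j. Ea i (\<pi> j))"
    and T: "\<And>i. i \<in> I \<Longrightarrow> T_monic X (Eo i P) (Ea i ` insert q (\<pi> ` {..<n}))"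
  shows "is_fold_pullback C n e P q \<pi>"
  unfolding is_fold_pullback_def
proof (intro conjI ballI impI allI ex_ex1I)
  show "e \<cdot>\<^bsub>C\<^esub> \<pi> j = q" if "j < n" for j
    by (rule faithful) (use e q \<pi> E that in \<open>auto simp: is_fold_pullback_def\<close>)
  fix Q r g
  assume Q: "Q \<in> Ob C" and r: "r \<in> hom C Q (Cod C e)" and g: "\<forall>i<n. g i \<in> hom C Q (Dom C e) \<and> e \<cdot>\<^bsub>C\<^esub> g i = r"
  have r': "r \<in> Ar C" "Dom C r = Q" "Cod C r = Cod C e"
    and g': "\<And>j. j < n \<Longrightarrow> g j \<in> Ar C" "\<And>j. j < n \<Longrightarrow> Dom C (g j) = Q" "\<And>j. j < n \<Longrightarrow> Cod C (g j) = Dom C e"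
      "\<And>j. j < n \<Longrightarrow> e \<cdot>\<^bsub>C\<^esub> g j = r"
    using r g by (auto simp: hom_def)
  have Eg: "Ea i e \<bullet> Ea i (g j) = Ea i r" if "i \<in> I" "j < n" for i j
    using arg_cong[OF g'(4)[OF that(2)], of "Ea i"] that g'(1-3) e by simp
  have "\<exists>h\<in>hom X (Dom X (Ea i r)) (Eo i P). Ea i q \<bullet> h = Ea i r \<and> (\<forall>j<n. Ea i (\<pi> j) \<bullet> h = Ea i (g j))"
    if i: "i \<in> I" for i
    by (rule fold_pullback_lift[OF E[OF i] X.category]) (use i r' g' e Eg in simp_all)
  then obtain h where h: "\<And>i. i \<in> I \<Longrightarrow> h i \<in> hom X (Dom X (Ea i r)) (Eo i P)"
    "\<And>i. i \<in> I \<Longrightarrow> Ea i q \<bullet> h i = Ea i r" "\<And>i j. i \<in> I \<Longrightarrow> j < n \<Longrightarrow> Ea i (\<pi> j) \<bullet> h i = Ea i (g j)"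
    by metis
  have "\<exists>k\<in>Ar C. Dom C k = Q \<and> Cod C k = P \<and> (\<forall>i\<in>I. Ea i k = h i)"
  proof (rule lift[where L = "insert q (\<pi> ` {..<n})"])
    show "\<exists>g\<in>Ar C. Dom C g = Q \<and> Cod C g = Cod C l \<and> (\<forall>i\<in>I. Ea i g = Ea i l \<bullet> h i)"
      if "l \<in> insert q (\<pi> ` {..<n})" for l
      using that r' q h(2)
    proof safe
      fix j assume "j < n"
      then show "\<exists>ga\<in>Ar C. Dom C ga = Dom C r \<and> Cod C ga = Cod C (\<pi> j) \<and> (\<forall>i\<in>I. Ea i ga = Ea i (\<pi> j) \<bullet> h i)"
        using r' g' \<pi> h(3) by (intro bexI[of _ "g j"]) auto
    qed auto
  qed (use Q q r' \<pi> T h(1) in \<open>auto simp: hom_def\<close>)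
  then obtain k where k: "k \<in> Ar C" "Dom C k = Q" "Cod C k = P" "\<And>i. i \<in> I \<Longrightarrow> Ea i k = h i" by auto
  have "q \<cdot>\<^bsub>C\<^esub> k = r"
    by (rule faithful; use k q r' h in simp)
  moreover have "\<pi> j \<cdot>\<^bsub>C\<^esub> k = g j" if "j < n" for j
    by (rule faithful; use k \<pi> g' h that in simp)
  ultimately show "\<exists>h. h \<in> hom C Q P \<and> q \<cdot>\<^bsub>C\<^esub> h = r \<and> (\<forall>i<n. \<pi> i \<cdot>\<^bsub>C\<^esub> h = g i)"
    using k by (auto simp: hom_def)
  fix c d
  assume c: "c \<in> hom C Q P \<and> q \<cdot>\<^bsub>C\<^esub> c = r \<and> (\<forall>i<n. \<pi> i \<cdot>\<^bsub>C\<^esub> c = g i)"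
    and d: "d \<in> hom C Q P \<and> q \<cdot>\<^bsub>C\<^esub> d = r \<and> (\<forall>i<n. \<pi> i \<cdot>\<^bsub>C\<^esub> d = g i)"
  show "c = d"
  proof (rule faithful)
    fix i assume i: "i \<in> I"
    have eq: "Ea i l \<bullet> Ea i c = Ea i l \<bullet> Ea i d" if "l \<in> Ar C" "Dom C l = P" "l \<cdot>\<^bsub>C\<^esub> c = l \<cdot>\<^bsub>C\<^esub> d" for l
      using arg_cong[OF that(3), of "Ea i"] that(1,2) c d i by (simp add: hom_def)
    show "Ea i c = Ea i d"
    proof (rule T_monicD0[OF T[OF i]])
      fix l assume "l \<in> Ea i ` insert q (\<pi> ` {..<n})"
      then obtain l' where l': "l = Ea i l'" "l' \<in> insert q (\<pi> ` {..<n})" by blast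
      have "l' \<in> Ar C" "Dom C l' = P" "l' \<cdot>\<^bsub>C\<^esub> c = l' \<cdot>\<^bsub>C\<^esub> d"
        using l'(2) q \<pi> c d by auto
      then show "l \<bullet> Ea i c = l \<bullet> Ea i d" unfolding l'(1) by (rule eq)
    qed (use c d i in \<open>simp_all add: hom_def\<close>)
  qed (use c d in \<open>auto simp: hom_def\<close>)
qed (use e q \<pi> in \<open>auto simp: hom_def\<close>)

lemma iterate_typed:
  "f \<in> Ar C \<Longrightarrow> (Tar C ^^ m) f \<in> Ar C \<and> Dom C ((Tar C ^^ m) f) = (Tob C ^^ m) (Dom C f) \<and>
     Cod C ((Tar C ^^ m) f) = (Tob C ^^ m) (Cod C f)"
  by (induction m) auto

lemma iterate_ob: "A \<in> Ob C \<Longrightarrow> (Tob C ^^ m) A \<in> Ob C"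
  by (induction m) auto

lemma E_iterate_ar: "i \<in> I \<Longrightarrow> f \<in> Ar C \<Longrightarrow> Ea i ((Tar C ^^ m) f) = (Tar X ^^ m) (Ea i f)"
  using iterate_typed by (induction m) auto

lemma E_iterate_ob: "i \<in> I \<Longrightarrow> A \<in> Ob C \<Longrightarrow> Eo i ((Tob C ^^ m) A) = (Tob X ^^ m) (Eo i A)"
  using iterate_ob by (induction m) auto

text \<open>Pullbacks in \<open>C\<close> whose images are pullbacks are preserved by \<open>T\<close> because their images are;
  uniqueness of pullbacks extends this to all pullbacks.\<close>

lemma fold_pullback_of_evaluations:
  assumes A: "A \<in> Ob C" and q: "q \<in> hom C P A" and \<pi>: "\<forall>j<n. \<pi> j \<in> hom C P (Tob C A)"
    and E: "\<And>i. i \<in> I \<Longrightarrow> is_fold_pullback X n (tp X (Eo i A)) (Eo i P) (Ea i q) (\<lambda>j. Ea i (\<pi> j))"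
  shows "is_fold_pullback C n ((Tar C ^^ m) (tp C A)) ((Tob C ^^ m) P) ((Tar C ^^ m) q) (\<lambda>j. (Tar C ^^ m)
    (\<pi> j))"
proof (rule fold_pullbackI)
  have q': "q \<in> Ar C" "Dom C q = P" "Cod C q = A"
    and \<pi>': "\<And>j. j < n \<Longrightarrow> \<pi> j \<in> Ar C" "\<And>j. j < n \<Longrightarrow> Dom C (\<pi> j) = P" "\<And>j. j < n \<Longrightarrow> Cod C (\<pi> j) = Tob C A"
    using q \<pi> by (auto simp: hom_def)
  then have P: "P \<in> Ob C" using C.dom_ob by blast
  show "(Tar C ^^ m) (tp C A) \<in> Ar C" "(Tar C ^^ m) q \<in> Ar C" "Dom C ((Tar C ^^ m) q) = (Tob C ^^ m) P"
    "Cod C ((Tar C ^^ m) q) = Cod C ((Tar C ^^ m) (tp C A))"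
    using iterate_typed[of q m] iterate_typed[of "tp C A" m] A q' by auto
  show "(Tar C ^^ m) (\<pi> j) \<in> Ar C" "Dom C ((Tar C ^^ m) (\<pi> j)) = (Tob C ^^ m) P"
    "Cod C ((Tar C ^^ m) (\<pi> j)) = Dom C ((Tar C ^^ m) (tp C A))" if "j < n" for j
    using iterate_typed[of "\<pi> j" m] iterate_typed[of "tp C A" m] A \<pi>' that by auto
  fix i assume i: "i \<in> I"
  have Em: "is_fold_pullback X n ((Tar X ^^ m) (tp X (Eo i A))) ((Tob X ^^ m) (Eo i P)) ((Tar X ^^ m) (Ea i q))
    (\<lambda>j. (Tar X ^^ m) (Ea i (\<pi> j)))"
    by (rule X.fold_pullback_preserved[OF _ E]) (use A i in auto)
  have *: "Ea i ((Tar C ^^ m) (tp C A)) = (Tar X ^^ m) (tp X (Eo i A))"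
    "Eo i ((Tob C ^^ m) P) = (Tob X ^^ m) (Eo i P)" "Ea i ((Tar C ^^ m) q) = (Tar X ^^ m) (Ea i q)"
    "\<And>j. j < n \<Longrightarrow> Ea i ((Tar C ^^ m) (\<pi> j)) = (Tar X ^^ m) (Ea i (\<pi> j))"
    using i A P q' \<pi>' by (simp_all add: E_iterate_ar E_iterate_ob)
  show "is_fold_pullback X n (Ea i ((Tar C ^^ m) (tp C A))) (Eo i ((Tob C ^^ m) P)) (Ea i ((Tar C ^^ m) q))
    (\<lambda>j. Ea i ((Tar C ^^ m) (\<pi> j)))"
    using Em * unfolding is_fold_pullback_def by (simp cong: conj_cong)
  have "Ea i ` insert ((Tar C ^^ m) q) ((\<lambda>j. (Tar C ^^ m) (\<pi> j)) ` {..<n}) =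
    (Tar X ^^ m) ` insert (Ea i q) ((\<lambda>j. Ea i (\<pi> j)) ` {..<n})"
    using * by (force simp: image_iff)
  then show "T_monic X (Eo i ((Tob C ^^ m) P)) (Ea i ` insert ((Tar C ^^ m) q) ((\<lambda>j. (Tar C ^^ m) (\<pi> j)) `
    {..<n}))"
    using X.fold_T_monic[OF _ E[OF i], of m] i A * by simp
qed

lemma fold_pullback_evaluates:
  assumes A: "A \<in> Ob C" and P: "is_fold_pullback C n (tp C A) P q \<pi>" and i: "i \<in> I"
  shows "is_fold_pullback X n (tp X (Eo i A)) (Eo i P) (Ea i q) (\<lambda>j. Ea i (\<pi> j))"
proof -
  obtain P' q' \<pi>' where P': "P' \<in> Ob C" "q' \<in> hom C P' A" "\<forall>j<n. \<pi>' j \<in> hom C P' (Tob C A)"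
      "\<forall>i\<in>I. is_fold_pullback X n (tp X (Eo i A)) (Eo i P') (Ea i q') (\<lambda>j. Ea i (\<pi>' j))"
    using fold[OF A, of n] by auto
  have F': "is_fold_pullback C n (tp C A) P' q' \<pi>'"
    using fold_pullback_of_evaluations[OF A P'(2,3), of 0] P'(4) by simp
  have t: "q \<in> Ar C" "Dom C q = P" "Cod C q = A"
    "\<And>j. j < n \<Longrightarrow> \<pi> j \<in> Ar C" "\<And>j. j < n \<Longrightarrow> Dom C (\<pi> j) = P" "\<And>j. j < n \<Longrightarrow> Cod C (\<pi> j) = Tob C A"
    "\<And>j. j < n \<Longrightarrow> tp C A \<cdot>\<^bsub>C\<^esub> \<pi> j = q"
    using P A by (auto simp: is_fold_pullback_def hom_def)
  have t': "q' \<in> Ar C" "Dom C q' = P'" "Cod C q' = A"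
    "\<And>j. j < n \<Longrightarrow> \<pi>' j \<in> Ar C" "\<And>j. j < n \<Longrightarrow> Dom C (\<pi>' j) = P'" "\<And>j. j < n \<Longrightarrow> Cod C (\<pi>' j) = Tob C A"
    "\<And>j. j < n \<Longrightarrow> tp C A \<cdot>\<^bsub>C\<^esub> \<pi>' j = q'"
    using F' A by (auto simp: is_fold_pullback_def hom_def)
  have "\<exists>k\<in>hom C (Dom C q) P'. q' \<cdot>\<^bsub>C\<^esub> k = q \<and> (\<forall>i<n. \<pi>' i \<cdot>\<^bsub>C\<^esub> k = \<pi> i)"
    by (rule fold_pullback_lift[OF F' C.category]) (use t A in simp_all)
  then obtain k where k: "k \<in> Ar C" "Dom C k = P" "Cod C k = P'" "q' \<cdot>\<^bsub>C\<^esub> k = q" "\<And>j. j < n \<Longrightarrow> \<pi>' j \<cdot>\<^bsub>C\<^esub> k = \<pi> j"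
    using t by (auto simp: hom_def)
  have "\<exists>k\<in>hom C (Dom C q') P. q \<cdot>\<^bsub>C\<^esub> k = q' \<and> (\<forall>i<n. \<pi> i \<cdot>\<^bsub>C\<^esub> k = \<pi>' i)"
    by (rule fold_pullback_lift[OF P C.category]) (use t' A in simp_all)
  then obtain k' where k': "k' \<in> Ar C" "Dom C k' = P'" "Cod C k' = P" "q \<cdot>\<^bsub>C\<^esub> k' = q'" "\<And>j. j < n \<Longrightarrow>
    \<pi> j \<cdot>\<^bsub>C\<^esub> k' = \<pi>' j"
    using t' by (auto simp: hom_def)
  have Ob: "P \<in> Ob C" "P' \<in> Ob C" using k by auto
  have e: "q' \<cdot>\<^bsub>C\<^esub> (k \<cdot>\<^bsub>C\<^esub> k') = q'" "\<And>j. j < n \<Longrightarrow> \<pi>' j \<cdot>\<^bsub>C\<^esub> (k \<cdot>\<^bsub>C\<^esub> k') = \<pi>' j"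
    "q \<cdot>\<^bsub>C\<^esub> (k' \<cdot>\<^bsub>C\<^esub> k) = q" "\<And>j. j < n \<Longrightarrow> \<pi> j \<cdot>\<^bsub>C\<^esub> (k' \<cdot>\<^bsub>C\<^esub> k) = \<pi> j"
    using k k' t t' C.extend[OF k(4), of k'] C.extend[OF k'(4), of k] C.extend[OF k(5), of _ k']
      C.extend[OF k'(5), of _ k] by simp_all
  have "k \<cdot>\<^bsub>C\<^esub> k' = Idn C P'"
    by (rule jointly_monicD[OF fold_pullback_jointly_monic[OF F' C.category]]) (use k(1-3) k'(1-3) e t' Ob
      in auto)
  moreover have "k' \<cdot>\<^bsub>C\<^esub> k = Idn C P"
    by (rule jointly_monicD[OF fold_pullback_jointly_monic[OF P C.category]]) (use k(1-3) k'(1-3) e t Ob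
      in auto)
  ultimately have "Ea i k \<bullet> Ea i k' = Idn X (Eo i P')" "Ea i k' \<bullet> Ea i k = Idn X (Eo i P)"
    using k k' i Ob by (metis E_cmp E_idn)+
  then show ?thesis
    by (intro fold_pullback_iso[OF X.category P'(4)[rule_format, OF i], of "Ea i k" _ "Ea i k'"])
      (use k k' t t' i in \<open>simp_all flip: E_cmp\<close>)
qed

lemma pair_typed:
  assumes A: "A \<in> Ob C" and f: "f \<in> Ar C" "g \<in> Ar C" "Dom C f = Dom C g" "Cod C f = Tob C A" "Cod C g = Tob C A"
    and fib: "tp C A \<cdot>\<^bsub>C\<^esub> f = tp C A \<cdot>\<^bsub>C\<^esub> g"
  shows "pair C A f g \<in> Ar C \<and> Dom C (pair C A f g) = Dom C f \<and> Cod C (pair C A f g) = T2 C A \<and>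
    (\<forall>i\<in>I. tp X (Eo i A) \<bullet> Ea i f = tp X (Eo i A) \<bullet> Ea i g \<and>
      Ea i (pair C A f g) = pair X (Eo i A) (Ea i f) (Ea i g))"
proof -
  have Ef: "tp X (Eo i A) \<bullet> Ea i f = tp X (Eo i A) \<bullet> Ea i g" if "i \<in> I" for i
    using arg_cong[OF fib, of "Ea i"] A f that by simp
  have "\<exists>k. k \<in> hom C (Dom C f) (T2 C A) \<and> pr1 C A \<cdot>\<^bsub>C\<^esub> k = f \<and> pr2 C A \<cdot>\<^bsub>C\<^esub> k = g \<and>
      (\<forall>i\<in>I. Ea i k = pair X (Eo i A) (Ea i f) (Ea i g)) \<and>
      (\<forall>k'. k' \<in> hom C (Dom C f) (T2 C A) \<and> pr1 C A \<cdot>\<^bsub>C\<^esub> k' = f \<and> pr2 C A \<cdot>\<^bsub>C\<^esub> k' = g \<longrightarrow> k' = k)"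
    by (rule lift_pair) (use A f Ef X.T2_T_monic in \<open>simp_all add: hom_def\<close>)
  then obtain k where k: "k \<in> hom C (Dom C f) (T2 C A)" "\<And>i. i \<in> I \<Longrightarrow> Ea i k = pair X (Eo i A) (Ea i f) (Ea i g)"
    and eq: "pr1 C A \<cdot>\<^bsub>C\<^esub> k = f" "pr2 C A \<cdot>\<^bsub>C\<^esub> k = g"
    and unique: "\<And>k'. k' \<in> hom C (Dom C f) (T2 C A) \<and> pr1 C A \<cdot>\<^bsub>C\<^esub> k' = f \<and> pr2 C A \<cdot>\<^bsub>C\<^esub> k' = g \<Longrightarrow> k' = k"
    by blast
  have "pair C A f g = k"
    unfolding pair_def by (rule the_equality) (use k(1) eq in blast, erule unique)
  then show ?thesis using k Ef by (auto simp: hom_def)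
qed

lemma tpair_typed:
  assumes A: "A \<in> Ob C" and f: "f \<in> Ar C" "g \<in> Ar C" "Dom C f = Dom C g"
     "Cod C f = Tob C (Tob C A)" "Cod C g = Tob C (Tob C A)"
    and fib: "Tar C (tp C A) \<cdot>\<^bsub>C\<^esub> f = Tar C (tp C A) \<cdot>\<^bsub>C\<^esub> g"
  shows "tpair C A f g \<in> Ar C \<and> Dom C (tpair C A f g) = Dom C f \<and> Cod C (tpair C A f g) = Tob C (T2 C A) \<and>
    (\<forall>i\<in>I. Tar X (tp X (Eo i A)) \<bullet> Ea i f = Tar X (tp X (Eo i A)) \<bullet> Ea i g \<and>
      Ea i (tpair C A f g) = tpair X (Eo i A) (Ea i f) (Ea i g))"
proof -
  have Ef: "Tar X (tp X (Eo i A)) \<bullet> Ea i f = Tar X (tp X (Eo i A)) \<bullet> Ea i g" if "i \<in> I" for i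
    using arg_cong[OF fib, of "Ea i"] A f that by simp
  have "\<exists>k. k \<in> hom C (Dom C f) (Tob C (T2 C A)) \<and> Tar C (pr1 C A) \<cdot>\<^bsub>C\<^esub> k = f \<and> Tar C (pr2 C A) \<cdot>\<^bsub>C\<^esub> k = g \<and>
      (\<forall>i\<in>I. Ea i k = tpair X (Eo i A) (Ea i f) (Ea i g)) \<and>
      (\<forall>k'. k' \<in> hom C (Dom C f) (Tob C (T2 C A)) \<and> Tar C (pr1 C A) \<cdot>\<^bsub>C\<^esub> k' = f \<and>
        Tar C (pr2 C A) \<cdot>\<^bsub>C\<^esub> k' = g \<longrightarrow> k' = k)"
    by (rule lift_pair) (use A f Ef X.TT2_T_monic in \<open>simp_all add: hom_def\<close>)
  then obtain k where k: "k \<in> hom C (Dom C f) (Tob C (T2 C A))" "\<And>i. i \<in> I \<Longrightarrow> Ea i k =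
    tpair X (Eo i A) (Ea i f) (Ea i g)"
    and eq: "Tar C (pr1 C A) \<cdot>\<^bsub>C\<^esub> k = f" "Tar C (pr2 C A) \<cdot>\<^bsub>C\<^esub> k = g"
    and unique: "\<And>k'. k' \<in> hom C (Dom C f) (Tob C (T2 C A)) \<and> Tar C (pr1 C A) \<cdot>\<^bsub>C\<^esub> k' = f \<and>
      Tar C (pr2 C A) \<cdot>\<^bsub>C\<^esub> k' = g \<Longrightarrow> k' = k"
    by blast
  have "tpair C A f g = k"
    unfolding tpair_def by (rule the_equality) (use k(1) eq in blast, erule unique)
  then show ?thesis using k Ef by (auto simp: hom_def)
qed

lemmas pair_rules = pair_typed[THEN conjunct1] pair_typed[THEN conjunct2, THEN conjunct1]
  pair_typed[THEN conjunct2, THEN conjunct2, THEN conjunct1]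
  pair_typed[THEN conjunct2, THEN conjunct2, THEN conjunct2, THEN bspec, THEN conjunct2]

lemmas tpair_rules = tpair_typed[THEN conjunct1] tpair_typed[THEN conjunct2, THEN conjunct1]
  tpair_typed[THEN conjunct2, THEN conjunct2, THEN conjunct1]
  tpair_typed[THEN conjunct2, THEN conjunct2, THEN conjunct2, THEN bspec, THEN conjunct2]

lemma C_p_pr2: "A \<in> Ob C \<Longrightarrow> tp C A \<cdot>\<^bsub>C\<^esub> pr2 C A = tp C A \<cdot>\<^bsub>C\<^esub> pr1 C A"
  by (rule faithful) simp_all

lemma C_tar_cmp: "\<lbrakk>f \<in> Ar C; g \<in> Ar C; Cod C f = Dom C g\<rbrakk> \<Longrightarrow> Tar C (g \<cdot>\<^bsub>C\<^esub> f) = Tar C g \<cdot>\<^bsub>C\<^esub> Tar C f"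
  by (rule faithful) simp_all

lemma T2ar_typed:
  assumes f: "f \<in> Ar C"
  shows "T2ar C f \<in> Ar C" "Dom C (T2ar C f) = T2 C (Dom C f)" "Cod C (T2ar C f) = T2 C (Cod C f)"
    "i \<in> I \<Longrightarrow> Ea i (T2ar C f) = T2ar X (Ea i f)"
proof -
  have *: "tp C (Cod C f) \<cdot>\<^bsub>C\<^esub> (Tar C f \<cdot>\<^bsub>C\<^esub> pr1 C (Dom C f)) =
    tp C (Cod C f) \<cdot>\<^bsub>C\<^esub> (Tar C f \<cdot>\<^bsub>C\<^esub> pr2 C (Dom C f))"
    by (rule faithful) (use f in \<open>simp_all add: X.tp_nat[THEN X.extend]\<close>)
  show "T2ar C f \<in> Ar C" "Dom C (T2ar C f) = T2 C (Dom C f)" "Cod C (T2ar C f) = T2 C (Cod C f)"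
    "i \<in> I \<Longrightarrow> Ea i (T2ar C f) = T2ar X (Ea i f)"
    unfolding T2ar_def using f * by (simp_all add: pair_rules)
qed

lemma naturals:
  "is_natural C C (Tob C) (Tar C) (\<lambda>A. A) (\<lambda>f. f) (tp C)"
  "is_natural C C (\<lambda>A. A) (\<lambda>f. f) (Tob C) (Tar C) (tz C)"
  "is_natural C C (T2 C) (T2ar C) (Tob C) (Tar C) (ts C)"
  "is_natural C C (Tob C) (Tar C) (\<lambda>A. Tob C (Tob C A)) (\<lambda>f. Tar C (Tar C f)) (tl C)"
  "is_natural C C (\<lambda>A. Tob C (Tob C A)) (\<lambda>f. Tar C (Tar C f))
       (\<lambda>A. Tob C (Tob C A)) (\<lambda>f. Tar C (Tar C f)) (tc C)"
  unfolding is_natural_def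
  by (intro conjI ballI; (simp add: hom_def; fail)?; rule faithful;
    simp add: X.tp_nat X.tz_nat X.s_nat X.tl_nat X.tc_nat T2ar_typed)+

lemma lift_map_typed:
  assumes A: "A \<in> Ob C"
  defines "m \<equiv> Tar C (ts C A) \<cdot>\<^bsub>C\<^esub> tpair C A (tz C (Tob C A) \<cdot>\<^bsub>C\<^esub> pr1 C A) (tl C A \<cdot>\<^bsub>C\<^esub> pr2 C A)"
  shows "m \<in> Ar C" "Dom C m = T2 C A" "Cod C m = Tob C (Tob C A)" "i \<in> I \<Longrightarrow> Ea i m = X.lift_map (Eo i A)"
proof -
  have *: "Tar C (tp C A) \<cdot>\<^bsub>C\<^esub> (tz C (Tob C A) \<cdot>\<^bsub>C\<^esub> pr1 C A) = Tar C (tp C A) \<cdot>\<^bsub>C\<^esub> (tl C A \<cdot>\<^bsub>C\<^esub> pr2 C A)"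
    by (rule faithful) (use A in \<open>simp_all add: X.lift_map_fibre\<close>)
  show "m \<in> Ar C" "Dom C m = T2 C A" "Cod C m = Tob C (Tob C A)" "i \<in> I \<Longrightarrow> Ea i m = X.lift_map (Eo i A)"
    unfolding m_def using A * by (simp_all add: tpair_rules)
qed

lemma lift_pullback:
  assumes A: "A \<in> Ob C"
  shows "is_pullback C (Tar C (tp C A)) (tz C A) (T2 C A)
         (Tar C (ts C A) \<cdot>\<^bsub>C\<^esub> tpair C A (tz C (Tob C A) \<cdot>\<^bsub>C\<^esub> pr1 C A) (tl C A \<cdot>\<^bsub>C\<^esub> pr2 C A))
         (tp C A \<cdot>\<^bsub>C\<^esub> pr1 C A)"
  by (rule pullbackI) (use A X.lift_pullback X.lift_T_monic in \<open>simp_all add: lift_map_typed\<close>)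

lemma T2_pullback: "A \<in> Ob C \<Longrightarrow> is_pullback C (tp C A) (tp C A) (T2 C A) (pr1 C A) (pr2 C A)"
  by (rule pullbackI) (simp_all add: X.T2_pullback X.T2_T_monic)

lemma s_assoc:
  assumes A: "A \<in> Ob C" and P: "is_fold_pullback C 3 (tp C A) P q \<pi>"
  shows "ts C A \<cdot>\<^bsub>C\<^esub> pair C A (ts C A \<cdot>\<^bsub>C\<^esub> pair C A (\<pi> 0) (\<pi> 1)) (\<pi> 2) =
          ts C A \<cdot>\<^bsub>C\<^esub> pair C A (\<pi> 0) (ts C A \<cdot>\<^bsub>C\<^esub> pair C A (\<pi> 1) (\<pi> 2))"
proof -
  have \<pi>: "\<pi> j \<in> Ar C" "Dom C (\<pi> j) = P" "Cod C (\<pi> j) = Tob C A" "tp C A \<cdot>\<^bsub>C\<^esub> \<pi> j = q" if "j < 3" for j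
    using P A that by (auto simp: is_fold_pullback_def hom_def)
  obtain f g h where fgh: "f = \<pi> 0" "g = \<pi> 1" "h = \<pi> 2" by blast
  have t: "f \<in> Ar C" "g \<in> Ar C" "h \<in> Ar C" "Dom C f = P" "Dom C g = P" "Dom C h = P"
    "Cod C f = Tob C A" "Cod C g = Tob C A" "Cod C h = Tob C A"
    "tp C A \<cdot>\<^bsub>C\<^esub> f = q" "tp C A \<cdot>\<^bsub>C\<^esub> g = q" "tp C A \<cdot>\<^bsub>C\<^esub> h = q"
    unfolding fgh by (rule \<pi>; simp)+
  have E: "tp X (Eo i A) \<bullet> Ea i f = Ea i q" "tp X (Eo i A) \<bullet> Ea i g = Ea i q" "tp X (Eo i A) \<bullet> Ea i h = Ea i q"
    if "i \<in> I" for i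
    using t(10-12)[THEN arg_cong[where f = "Ea i"]] t(1-9) A that by simp_all
  have p_s: "tp C A \<cdot>\<^bsub>C\<^esub> (ts C A \<cdot>\<^bsub>C\<^esub> x) = tp C A \<cdot>\<^bsub>C\<^esub> (pr1 C A \<cdot>\<^bsub>C\<^esub> x)" if "x \<in> Ar C" "Cod C x = T2 C A" for x
    by (rule faithful) (use A that in \<open>simp_all add: X.p_s[THEN X.extend]\<close>)
  have pp: "pr1 C A \<cdot>\<^bsub>C\<^esub> pair C A f g = f" "pr1 C A \<cdot>\<^bsub>C\<^esub> pair C A g h = g"
    by (rule faithful; use A t E in \<open>simp add: pair_rules\<close>)+
  have q: "q \<in> Ar C" using t(10) t A by auto
  show ?thesis
    unfolding fgh[symmetric]
  proof (rule faithful)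
    fix i assume i: "i \<in> I"
    show "Ea i (ts C A \<cdot>\<^bsub>C\<^esub> pair C A (ts C A \<cdot>\<^bsub>C\<^esub> pair C A f g) h) =
      Ea i (ts C A \<cdot>\<^bsub>C\<^esub> pair C A f (ts C A \<cdot>\<^bsub>C\<^esub> pair C A g h))"
      using A i t p_s pp q
        X.add_assoc[of "Eo i A" "Ea i f" "Eo i P" "Ea i g" "Ea i h" "Ea i q"] E[OF i] by (simp add: pair_rules)
  qed (use A t p_s pp in \<open>simp_all add: pair_rules\<close>)
qed

text \<open>The equations hold because they hold after every evaluation. For this the induced arrows
  occurring in them must be known to exist in \<open>C\<close> and to evaluate to the induced arrows of \<open>X\<close>.\<close>

theorem tangent_category: "tangent_category C"
proof -
  have TT: "is_functor C C (Tob C) (Tar C)"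
    unfolding is_functor_def by (auto simp: hom_def C_tar_cmp intro: faithful)
  have ex: "\<forall>A\<in>Ob C. \<forall>n. \<exists>P q \<pi>. is_fold_pullback C n (tp C A) P q \<pi>"
  proof (intro ballI allI)
    fix A n assume A: "A \<in> Ob C"
    obtain P q \<pi> where P: "q \<in> hom C P A" "\<forall>j<n. \<pi> j \<in> hom C P (Tob C A)"
      "\<forall>i\<in>I. is_fold_pullback X n (tp X (Eo i A)) (Eo i P) (Ea i q) (\<lambda>j. Ea i (\<pi> j))"
      using fold[OF A, of n] by auto
    show "\<exists>P q \<pi>. is_fold_pullback C n (tp C A) P q \<pi>"
      using fold_pullback_of_evaluations[OF A P(1,2), of 0] P(3) by auto
  qed
  have pres: "\<forall>A\<in>Ob C. \<forall>n m P q \<pi>. is_fold_pullback C n (tp C A) P q \<pi> \<longrightarrow>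
        is_fold_pullback C n ((Tar C ^^ m) (tp C A)) ((Tob C ^^ m) P) ((Tar C ^^ m) q)
          (\<lambda>i. (Tar C ^^ m) (\<pi> i))"
  proof (intro ballI allI impI)
    fix A n m P q \<pi> assume A: "A \<in> Ob C" and P: "is_fold_pullback C n (tp C A) P q \<pi>"
    then have "q \<in> hom C P A" "\<forall>j<n. \<pi> j \<in> hom C P (Tob C A)" by (simp_all add: is_fold_pullback_def)
    then show "is_fold_pullback C n ((Tar C ^^ m) (tp C A)) ((Tob C ^^ m) P) ((Tar C ^^ m) q)
          (\<lambda>i. (Tar C ^^ m) (\<pi> i))"
      by (rule fold_pullback_of_evaluations[OF A _ _ fold_pullback_evaluates[OF A P]])
  qed
  show ?thesis
    unfolding tangent_category_def
  proof (intro conjI, goal_cases)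
    case 11
    show ?case
    proof (intro ballI, intro conjI)
      fix A assume A: "A \<in> Ob C"
      have u: "tp C A \<cdot>\<^bsub>C\<^esub> (tz C A \<cdot>\<^bsub>C\<^esub> tp C A) = tp C A \<cdot>\<^bsub>C\<^esub> Idn C (Tob C A)"
        by (rule faithful) (use A in \<open>simp_all add: X.p_z[THEN X.extend]\<close>)
      show "ts C A \<cdot>\<^bsub>C\<^esub> pair C A (tz C A \<cdot>\<^bsub>C\<^esub> tp C A) (Idn C (Tob C A)) = Idn C (Tob C A)"
        by (rule faithful) (use A u X.s_unit in \<open>simp_all add: pair_rules\<close>)
      show "ts C A \<cdot>\<^bsub>C\<^esub> pair C A (pr2 C A) (pr1 C A) = ts C A"
        by (rule faithful) (use A in \<open>simp_all add: pair_rules C_p_pr2 X.s_comm\<close>)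
      have "Tar C (tp C A) \<cdot>\<^bsub>C\<^esub> (tl C A \<cdot>\<^bsub>C\<^esub> pr1 C A) = Tar C (tp C A) \<cdot>\<^bsub>C\<^esub> (tl C A \<cdot>\<^bsub>C\<^esub> pr2 C A)"
        by (rule faithful) (use A in \<open>simp_all add: X.Tp_l[THEN X.extend]\<close>)
      then show "tl C A \<cdot>\<^bsub>C\<^esub> ts C A = Tar C (ts C A) \<cdot>\<^bsub>C\<^esub> tpair C A (tl C A \<cdot>\<^bsub>C\<^esub> pr1 C A) (tl C A \<cdot>\<^bsub>C\<^esub> pr2 C A)"
        by - (rule faithful, use A in \<open>simp_all add: tpair_rules X.l_s\<close>)
      have "tp C (Tob C A) \<cdot>\<^bsub>C\<^esub> (tc C A \<cdot>\<^bsub>C\<^esub> Tar C (pr1 C A)) =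
        tp C (Tob C A) \<cdot>\<^bsub>C\<^esub> (tc C A \<cdot>\<^bsub>C\<^esub> Tar C (pr2 C A))"
        by (rule faithful) (use A in \<open>simp_all add: X.p_c[THEN X.extend] flip: X.tar_cmp\<close>)
      then show "tc C A \<cdot>\<^bsub>C\<^esub> Tar C (ts C A) =
         ts C (Tob C A) \<cdot>\<^bsub>C\<^esub>
           pair C (Tob C A) (tc C A \<cdot>\<^bsub>C\<^esub> Tar C (pr1 C A)) (tc C A \<cdot>\<^bsub>C\<^esub> Tar C (pr2 C A))"
        by - (rule faithful, use A in \<open>simp_all add: pair_rules X.c_Ts\<close>)
    qed (blast intro: s_assoc lift_pullback |
        rule faithful; simp add: X.p_z X.p_s X.Tp_l X.l_z X.p_c X.c_Tz X.Tl_l X.c_l X.c_Tc_l X.c_c X.braid)+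
  qed (use C.category TT ex pres naturals T2_pullback in auto)
qed

end

sublocale evaluations \<subseteq> T: tangent C
  by unfold_locales (rule tangent_category)


section \<open>The tangent category of tangent morphisms\<close>

context tangent
begin

text \<open>Additivity of the flip, read from \<open>p T\<close> to \<open>T p\<close>.\<close>

lemma c_s:
  assumes "A \<in> Ob X" "a \<in> Ar X" "b \<in> Ar X" "Dom X a = Dom X b" "Cod X a = Tob X (Tob X A)" "Cod X b =
    Tob X (Tob X A)"
    "tp X (Tob X A) \<bullet> a = tp X (Tob X A) \<bullet> b"
  shows "tc X A \<bullet> (ts X (Tob X A) \<bullet> pair X (Tob X A) a b) =
    Tar X (ts X A) \<bullet> tpair X A (tc X A \<bullet> a) (tc X A \<bullet> b)"
    and "Tar X (tp X A) \<bullet> (tc X A \<bullet> a) = Tar X (tp X A) \<bullet> (tc X A \<bullet> b)"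
proof -
  show *: "Tar X (tp X A) \<bullet> (tc X A \<bullet> a) = Tar X (tp X A) \<bullet> (tc X A \<bullet> b)"
    using assms by (simp add: Tp_c[THEN extend])
  have "tc X A \<bullet> (Tar X (ts X A) \<bullet> tpair X A (tc X A \<bullet> a) (tc X A \<bullet> b)) = ts X (Tob X A) \<bullet> pair X (Tob X A) a b"
    using assms * by (subst c_add) simp_all
  from arg_cong[OF this, of "\<lambda>f. tc X A \<bullet> f"]
  show "tc X A \<bullet> (ts X (Tob X A) \<bullet> pair X (Tob X A) a b) =
    Tar X (ts X A) \<bullet> tpair X A (tc X A \<bullet> a) (tc X A \<bullet> b)"
    using assms * by simp
qed

end

lemma tangent_nat_iff:
  fixes X' :: "('x, 'y) tang" and X :: "('o, 'a) tang" (structure)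
  shows "tangent_nat X' X F G \<phi> \<longleftrightarrow> \<phi> \<in> extensional (Ob X') \<and>
    (\<forall>A\<in>Ob X'. \<phi> A \<in> Ar X \<and> Dom X (\<phi> A) = obm F A \<and> Cod X (\<phi> A) = obm G A) \<and>
    (\<forall>f\<in>Ar X'. arm G f \<bullet> \<phi> (Dom X' f) = \<phi> (Cod X' f) \<bullet> arm F f) \<and>
    (\<forall>A\<in>Ob X'. Tar X (\<phi> A) \<bullet> lax F A = lax G A \<bullet> \<phi> (Tob X' A))"
  by (auto simp: tangent_nat_def is_natural_def hom_def)

lemma tangent_natD:
  fixes X' :: "('x, 'y) tang" and X :: "('o, 'a) tang" (structure)
  assumes "tangent_nat X' X F G \<phi>"
  shows "A \<in> Ob X' \<Longrightarrow> \<phi> A \<in> Ar X" "A \<in> Ob X' \<Longrightarrow> Dom X (\<phi> A) = obm F A" "A \<in> Ob X' \<Longrightarrow> Cod X (\<phi> A) = obm G A"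
    "f \<in> Ar X' \<Longrightarrow> Dom X' f = D \<Longrightarrow> arm G f \<bullet> \<phi> D = \<phi> (Cod X' f) \<bullet> arm F f"
    "A \<in> Ob X' \<Longrightarrow> Tar X (\<phi> A) \<bullet> lax F A = lax G A \<bullet> \<phi> (Tob X' A)"
    "\<phi> \<in> extensional (Ob X')"
  using assms by (auto simp: tangent_nat_iff)

lemma HOM_simps:
  "Ob (HOM X' X) = {F. tangent_morphism X' X F}"
  "Dom (HOM X' X) = src" "Cod (HOM X' X) = tgt"
  "Idn (HOM X' X) = (\<lambda>F. MArr F (\<lambda>A\<in>Ob X'. Idn X (obm F A)) F)"
  "Cmp (HOM X' X) = (\<lambda>\<psi> \<phi>. MArr (src \<phi>) (\<lambda>A\<in>Ob X'. body \<psi> A \<cdot>\<^bsub>X\<^esub> body \<phi> A) (tgt \<psi>))"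
  "Tob (HOM X' X) = Tbar X' X"
  "Tar (HOM X' X) = (\<lambda>\<phi>. MArr (Tbar X' X (src \<phi>)) (\<lambda>A\<in>Ob X'. Tar X (body \<phi> A)) (Tbar X' X (tgt \<phi>)))"
  "T2 (HOM X' X) = T2bar X' X"
  "pr1 (HOM X' X) = (\<lambda>F. MArr (T2bar X' X F) (\<lambda>A\<in>Ob X'. pr1 X (obm F A)) (Tbar X' X F))"
  "pr2 (HOM X' X) = (\<lambda>F. MArr (T2bar X' X F) (\<lambda>A\<in>Ob X'. pr2 X (obm F A)) (Tbar X' X F))"
  "tp (HOM X' X) = (\<lambda>F. MArr (Tbar X' X F) (\<lambda>A\<in>Ob X'. tp X (obm F A)) F)"
  "tz (HOM X' X) = (\<lambda>F. MArr F (\<lambda>A\<in>Ob X'. tz X (obm F A)) (Tbar X' X F))"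
  "ts (HOM X' X) = (\<lambda>F. MArr (T2bar X' X F) (\<lambda>A\<in>Ob X'. ts X (obm F A)) (Tbar X' X F))"
  "tl (HOM X' X) = (\<lambda>F. MArr (Tbar X' X F) (\<lambda>A\<in>Ob X'. tl X (obm F A)) (Tbar X' X (Tbar X' X F)))"
  "tc (HOM X' X) = (\<lambda>F. MArr (Tbar X' X (Tbar X' X F)) (\<lambda>A\<in>Ob X'. tc X (obm F A))
             (Tbar X' X (Tbar X' X F)))"
  "tn (HOM X' X) = (\<lambda>F. MArr (Tbar X' X F) (\<lambda>A\<in>Ob X'. tn X (obm F A)) (Tbar X' X F))"
  by (simp_all add: HOM_def)

lemma HOM_Ar: "\<phi> \<in> Ar (HOM X' X) \<longleftrightarrow>
   tangent_morphism X' X (src \<phi>) \<and> tangent_morphism X' X (tgt \<phi>) \<and> tangent_nat X' X (src \<phi>) (tgt \<phi>) (body \<phi>)"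
  by (cases \<phi>) (auto simp: HOM_def)

lemma HOM_body:
  assumes "\<phi> \<in> Ar (HOM X' X)" "A \<in> Ob X'"
  shows "body \<phi> A \<in> Ar X" "Dom X (body \<phi> A) = obm (src \<phi>) A" "Cod X (body \<phi> A) = obm (tgt \<phi>) A"
  using assms by (auto simp: HOM_Ar tangent_nat_iff)

lemma T2bar_simps [simp]:
  "A \<in> Ob X' \<Longrightarrow> obm (T2bar X' X F) A = T2 X (obm F A)"
  "f \<in> Ar X' \<Longrightarrow> arm (T2bar X' X F) f = T2ar X (arm F f)"
  "A \<in> Ob X' \<Longrightarrow> lax (T2bar X' X F) A = tpair X (obm F A)
        (tc X (obm F A) \<cdot>\<^bsub>X\<^esub> Tar X (lax F A) \<cdot>\<^bsub>X\<^esub> pr1 X (obm F (Tob X' A)))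
        (tc X (obm F A) \<cdot>\<^bsub>X\<^esub> Tar X (lax F A) \<cdot>\<^bsub>X\<^esub> pr2 X (obm F (Tob X' A)))"
  by (simp_all add: T2bar_def)

context lax_morphism
begin

text \<open>These equations provide the induced arrow that is the distributive law of \<open>T\<^sub>2 F\<close>.\<close>

lemma T2_lax:
  assumes A: "A \<in> Ob X'"
  shows "tp X (Tob X (obm F A)) \<bullet> (Tar X (lax F A) \<bullet> pr1 X (obm F (Tob X' A))) =
     tp X (Tob X (obm F A)) \<bullet> (Tar X (lax F A) \<bullet> pr2 X (obm F (Tob X' A)))"
   "Tar X (tp X (obm F A)) \<bullet> (tc X (obm F A) \<bullet> Tar X (lax F A) \<bullet> pr1 X (obm F (Tob X' A))) =
    Tar X (tp X (obm F A)) \<bullet> (tc X (obm F A) \<bullet> Tar X (lax F A) \<bullet> pr2 X (obm F (Tob X' A)))"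
proof -
  show *: "tp X (Tob X (obm F A)) \<bullet> (Tar X (lax F A) \<bullet> pr1 X (obm F (Tob X' A))) =
     tp X (Tob X (obm F A)) \<bullet> (Tar X (lax F A) \<bullet> pr2 X (obm F (Tob X' A)))"
    using A by (simp add: B.tp_nat[THEN B.extend])
  show "Tar X (tp X (obm F A)) \<bullet> (tc X (obm F A) \<bullet> Tar X (lax F A) \<bullet> pr1 X (obm F (Tob X' A))) =
    Tar X (tp X (obm F A)) \<bullet> (tc X (obm F A) \<bullet> Tar X (lax F A) \<bullet> pr2 X (obm F (Tob X' A)))"
    by (rule B.c_s(2)) (use A * in simp_all)
qed

lemma T2bar_morphism: "tangent_morphism X' X (T2bar X' X F)"
proof (rule morphism_by_monic_legs[where J = "UNIV :: bool set" and B = "\<lambda>_. Tbar X' X F" and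
    \<pi> = "\<lambda>j A. if j then pr1 X (obm F A) else pr2 X (obm F A)"])
  show "T_monic X (obm (T2bar X' X F) A) (range (\<lambda>j. if j then pr1 X (obm F A) else pr2 X (obm F A)))"
    "T_monic X (Tob X (obm (T2bar X' X F) A)) (range (\<lambda>j. Tar X (if j then pr1 X (obm F A) else pr2 X (obm
      F A))))"
    if A: "A \<in> Ob X'" for A
    using B.T2_T_monic[of "obm F A"] B.TT2_T_monic[of "obm F A"] A by (simp_all add: UNIV_bool insert_commute)
qed (use A.tangent B.tangent Tbar_morphism[OF A.tangent B.tangent mor] T2_lax in
   \<open>simp_all add: B.pr1_T2ar B.pr2_T2ar\<close>, simp_all add: T2bar_def)

text \<open>For each object choose the \<open>n\<close>-fold pullback of the projection; the induced arrows turn these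
  choices into a tangent morphism.\<close>

lemma fold_pullback_morphism:
  "\<exists>P q \<pi>. P \<in> Ob (HOM X' X) \<and> q \<in> hom (HOM X' X) P F \<and> (\<forall>j<n. \<pi> j \<in> hom (HOM X' X) P (Tbar X' X F)) \<and>
      (\<forall>A\<in>Ob X'. is_fold_pullback X n (tp X (obm F A)) (obm P A) (body q A) (\<lambda>j. body (\<pi> j) A))"
proof -
  have "\<forall>A\<in>Ob X'. \<exists>P q \<pi>. is_fold_pullback X n (tp X (obm F A)) P q \<pi>"
    using B.fold_pullback_exists by simp
  then obtain P q \<pi> where P: "\<And>A. A \<in> Ob X' \<Longrightarrow> is_fold_pullback X n (tp X (obm F A)) (P A) (q A) (\<pi> A)"
    by metis
  have t [simp]: "q A \<in> Ar X" "Dom X (q A) = P A" "Cod X (q A) = obm F A"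
    "\<And>j. j < n \<Longrightarrow> \<pi> A j \<in> Ar X" "\<And>j. j < n \<Longrightarrow> Dom X (\<pi> A j) = P A"
    "\<And>j. j < n \<Longrightarrow> Cod X (\<pi> A j) = Tob X (obm F A)"
    and p\<pi>: "\<And>j. j < n \<Longrightarrow> tp X (obm F A) \<bullet> \<pi> A j = q A" if "A \<in> Ob X'" for A
    using P[OF that] that by (auto simp: is_fold_pullback_def hom_def)
  have "\<exists>h\<in>hom X (Dom X (arm F f \<bullet> q (Dom X' f))) (P (Cod X' f)).
      q (Cod X' f) \<bullet> h = arm F f \<bullet> q (Dom X' f) \<and>
      (\<forall>j<n. \<pi> (Cod X' f) j \<bullet> h = Tar X (arm F f) \<bullet> \<pi> (Dom X' f) j)" if "f \<in> Ar X'" for f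
    by (rule fold_pullback_lift[OF P B.category]) (use that p\<pi> in \<open>simp_all add: B.tp_nat[THEN B.extend]\<close>)
  then obtain a where "\<And>f. f \<in> Ar X' \<Longrightarrow> a f \<in> hom X (Dom X (arm F f \<bullet> q (Dom X' f))) (P (Cod X' f)) \<and>
      q (Cod X' f) \<bullet> a f = arm F f \<bullet> q (Dom X' f) \<and>
      (\<forall>j<n. \<pi> (Cod X' f) j \<bullet> a f = Tar X (arm F f) \<bullet> \<pi> (Dom X' f) j)" by metis
  then have a: "\<And>f. f \<in> Ar X' \<Longrightarrow> a f \<in> Ar X" "\<And>f. f \<in> Ar X' \<Longrightarrow> Dom X (a f) = P (Dom X' f)"
      "\<And>f. f \<in> Ar X' \<Longrightarrow> Cod X (a f) = P (Cod X' f)"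
      "\<And>f. f \<in> Ar X' \<Longrightarrow> q (Cod X' f) \<bullet> a f = arm F f \<bullet> q (Dom X' f)"
      "\<And>f j. f \<in> Ar X' \<Longrightarrow> j < n \<Longrightarrow> \<pi> (Cod X' f) j \<bullet> a f = Tar X (arm F f) \<bullet> \<pi> (Dom X' f) j"
    by (simp_all add: hom_def)
  have TP: "is_fold_pullback X n (Tar X (tp X (obm F A))) (Tob X (P A)) (Tar X (q A)) (\<lambda>j. Tar X (\<pi> A j))"
    if "A \<in> Ob X'" for A
    using B.fold_pullback_preserved[OF _ P[OF that], of 1] that by simp
  have "\<exists>h\<in>hom X (Dom X (lax F A \<bullet> q (Tob X' A))) (Tob X (P A)).
      Tar X (q A) \<bullet> h = lax F A \<bullet> q (Tob X' A) \<and>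
      (\<forall>j<n. Tar X (\<pi> A j) \<bullet> h = tc X (obm F A) \<bullet> Tar X (lax F A) \<bullet> \<pi> (Tob X' A) j)" if "A \<in> Ob X'" for A
    by (rule fold_pullback_lift[OF TP B.category])
      (use that p\<pi> in \<open>simp_all add: B.tp_nat[THEN B.extend] B.Tp_c[THEN B.extend]\<close>)
  then obtain m where "\<And>A. A \<in> Ob X' \<Longrightarrow> m A \<in> hom X (Dom X (lax F A \<bullet> q (Tob X' A))) (Tob X (P A)) \<and>
      Tar X (q A) \<bullet> m A = lax F A \<bullet> q (Tob X' A) \<and>
      (\<forall>j<n. Tar X (\<pi> A j) \<bullet> m A = tc X (obm F A) \<bullet> Tar X (lax F A) \<bullet> \<pi> (Tob X' A) j)" by metis
  then have m: "\<And>A. A \<in> Ob X' \<Longrightarrow> m A \<in> Ar X" "\<And>A. A \<in> Ob X' \<Longrightarrow> Dom X (m A) = P (Tob X' A)"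
      "\<And>A. A \<in> Ob X' \<Longrightarrow> Cod X (m A) = Tob X (P A)"
      "\<And>A. A \<in> Ob X' \<Longrightarrow> Tar X (q A) \<bullet> m A = lax F A \<bullet> q (Tob X' A)"
      "\<And>A j. A \<in> Ob X' \<Longrightarrow> j < n \<Longrightarrow> Tar X (\<pi> A j) \<bullet> m A = tc X (obm F A) \<bullet> Tar X (lax F A) \<bullet> \<pi> (Tob X' A) j"
    by (simp_all add: hom_def)
  define PP where "PP = \<lparr>obm = restrict P (Ob X'), arm = restrict a (Ar X'), lax = restrict m (Ob X')\<rparr>"
  have P_ob: "P A \<in> Ob X" if "A \<in> Ob X'" for A using t(1,2)[OF that] B.dom_ob by metis
  \<comment> \<open>index \<open>n\<close> stands for the leg to the base, which the case \<open>n = 0\<close> needs\<close>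
  have PP: "tangent_morphism X' X PP"
  proof (rule morphism_by_monic_legs[where J = "{..n}" and B = "\<lambda>j. if j = n then F else Tbar X' X F" and
      \<pi> = "\<lambda>j A. if j = n then q A else \<pi> A j"])
    fix A assume A: "A \<in> Ob X'"
    have "(\<lambda>j. if j = n then q A else \<pi> A j) ` {..n} = insert (q A) (\<pi> A ` {..<n})"
      by (auto simp: image_iff Bex_def)
    moreover have "(\<lambda>j. Tar X (if j = n then q A else \<pi> A j)) ` {..n} =
        Tar X ` (\<lambda>j. if j = n then q A else \<pi> A j) ` {..n}"
      by (simp only: image_image)
    ultimately show "T_monic X (obm PP A) ((\<lambda>j. if j = n then q A else \<pi> A j) ` {..n})"
      "T_monic X (Tob X (obm PP A)) ((\<lambda>j. Tar X (if j = n then q A else \<pi> A j)) ` {..n})"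
      using B.fold_T_monic[OF _ P[OF A], of 0] B.fold_T_monic[OF _ P[OF A], of 1] A by (simp_all add: PP_def)
  qed (use A.tangent B.tangent mor Tbar_morphism[OF A.tangent B.tangent mor] in
      \<open>simp_all add: PP_def P_ob a m\<close>)
  have q: "MArr PP (restrict q (Ob X')) F \<in> hom (HOM X' X) PP F"
    using PP mor by (simp add: hom_def HOM_simps HOM_Ar tangent_nat_iff) (simp add: PP_def a m)
  have \<pi>: "MArr PP (\<lambda>A\<in>Ob X'. \<pi> A j) (Tbar X' X F) \<in> hom (HOM X' X) PP (Tbar X' X F)" if "j < n" for j
    using PP Tbar_morphism[OF A.tangent B.tangent mor] that
    by (simp add: hom_def HOM_simps HOM_Ar tangent_nat_iff) (simp add: PP_def a m)
  show ?thesis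
    by (rule exI[of _ PP], rule exI[of _ "MArr PP (restrict q (Ob X')) F"],
        rule exI[of _ "\<lambda>j. MArr PP (\<lambda>A\<in>Ob X'. \<pi> A j) (Tbar X' X F)"])
      (use PP q \<pi> P in \<open>simp add: HOM_simps PP_def cong: conj_cong\<close>)
qed

text \<open>Compatibility with the law \<open>c \<cdot> T \<alpha>\<close> of \<open>T F\<close> reduces in each case to the axiom that relates the
  structure arrow in question to the flip.\<close>

lemma structure_nats:
  "tangent_nat X' X F F (\<lambda>A\<in>Ob X'. Idn X (obm F A))"
  "tangent_nat X' X (T2bar X' X F) (Tbar X' X F) (\<lambda>A\<in>Ob X'. pr1 X (obm F A))"
  "tangent_nat X' X (T2bar X' X F) (Tbar X' X F) (\<lambda>A\<in>Ob X'. pr2 X (obm F A))"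
  "tangent_nat X' X (Tbar X' X F) F (\<lambda>A\<in>Ob X'. tp X (obm F A))"
  "tangent_nat X' X F (Tbar X' X F) (\<lambda>A\<in>Ob X'. tz X (obm F A))"
  "tangent_nat X' X (T2bar X' X F) (Tbar X' X F) (\<lambda>A\<in>Ob X'. ts X (obm F A))"
  "tangent_nat X' X (Tbar X' X F) (Tbar X' X (Tbar X' X F)) (\<lambda>A\<in>Ob X'. tl X (obm F A))"
  "tangent_nat X' X (Tbar X' X (Tbar X' X F)) (Tbar X' X (Tbar X' X F)) (\<lambda>A\<in>Ob X'. tc X (obm F A))"
proof -
  have s: "tc X (obm F A) \<bullet> (Tar X (lax F A) \<bullet> ts X (obm F (Tob X' A))) = Tar X (ts X (obm F A)) \<bullet>
     tpair X (obm F A)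
        (tc X (obm F A) \<bullet> Tar X (lax F A) \<bullet> pr1 X (obm F (Tob X' A)))
        (tc X (obm F A) \<bullet> Tar X (lax F A) \<bullet> pr2 X (obm F (Tob X' A)))" if A: "A \<in> Ob X'" for A
    using B.add_nat[of "lax F A" _ "Tob X (obm F A)" "pr1 X (obm F (Tob X' A))"
      "pr2 X (obm F (Tob X' A))"] A T2_lax(1)[OF A]
    by (simp add: B.pair_prs B.c_s(1))
  have l: "tc X (Tob X (obm F A)) \<bullet> Tar X (tc X (obm F A)) \<bullet> Tar X (Tar X (lax F A)) \<bullet> tl X (obm F (Tob X' A))
    = Tar X (tl X (obm F A)) \<bullet> tc X (obm F A) \<bullet> Tar X (lax F A)" if A: "A \<in> Ob X'" for A
    using B.tl_nat[of "lax F A" "Tob X (obm F A)", symmetric]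
      B.extend[OF B.c_Tc_l[of "obm F A"], of "Tar X (lax F A)"] A by simp
  have c: "tc X (Tob X (obm F A)) \<bullet> Tar X (tc X (obm F A)) \<bullet> Tar X (Tar X (lax F A)) \<bullet> tc X (obm F (Tob X' A))
    = Tar X (tc X (obm F A)) \<bullet> tc X (Tob X (obm F A)) \<bullet> Tar X (tc X (obm F A)) \<bullet> Tar X (Tar X (lax F A))"
      if A: "A \<in> Ob X'" for A
    using B.tc_nat[of "lax F A" "Tob X (obm F A)", symmetric]
      B.extend[OF B.braid[of "obm F A"], of "Tar X (Tar X (lax F A))"] A by simp
  have z: "tc X (obm F A) \<bullet> Tar X (lax F A) \<bullet> tz X (obm F (Tob X' A)) = Tar X (tz X (obm F A)) \<bullet> lax F A"
    if A: "A \<in> Ob X'" for A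
    using B.tz_nat[of "lax F A" "Tob X (obm F A)", symmetric] A by (simp add: B.c_z[THEN B.extend])
  show "tangent_nat X' X F F (\<lambda>A\<in>Ob X'. Idn X (obm F A))"
    "tangent_nat X' X (T2bar X' X F) (Tbar X' X F) (\<lambda>A\<in>Ob X'. pr1 X (obm F A))"
    "tangent_nat X' X (T2bar X' X F) (Tbar X' X F) (\<lambda>A\<in>Ob X'. pr2 X (obm F A))"
    "tangent_nat X' X (Tbar X' X F) F (\<lambda>A\<in>Ob X'. tp X (obm F A))"
    "tangent_nat X' X F (Tbar X' X F) (\<lambda>A\<in>Ob X'. tz X (obm F A))"
    by (simp_all add: tangent_nat_iff T2_lax B.pr1_T2ar B.pr2_T2ar B.tp_nat B.tz_nat B.Tp_c[THEN B.extend] z)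
  show "tangent_nat X' X (T2bar X' X F) (Tbar X' X F) (\<lambda>A\<in>Ob X'. ts X (obm F A))"
    by (simp add: tangent_nat_iff s B.s_nat)
  show "tangent_nat X' X (Tbar X' X F) (Tbar X' X (Tbar X' X F)) (\<lambda>A\<in>Ob X'. tl X (obm F A))"
    by (simp add: tangent_nat_iff l B.tl_nat)
  show "tangent_nat X' X (Tbar X' X (Tbar X' X F)) (Tbar X' X (Tbar X' X F)) (\<lambda>A\<in>Ob X'. tc X (obm F A))"
    by (simp add: tangent_nat_iff c B.tc_nat)
qed

end

lemma tangent_nat_comp:
  fixes X' :: "('x, 'y) tang" and X :: "('o, 'a) tang" (structure)
  assumes "tangent_category X'" "tangent_category X"
    and F: "tangent_morphism X' X F" and G: "tangent_morphism X' X G" and H: "tangent_morphism X' X H"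
    and \<phi>: "tangent_nat X' X F G \<phi>" and \<psi>: "tangent_nat X' X G H \<psi>"
  shows "tangent_nat X' X F H (\<lambda>A\<in>Ob X'. \<psi> A \<bullet> \<phi> A)"
proof -
  interpret F: lax_morphism X' X F by (rule lax_morphismI) fact+
  interpret G: lax_morphism X' X G by (rule lax_morphismI) fact+
  interpret H: lax_morphism X' X H by (rule lax_morphismI) fact+
  note [simp] = tangent_natD(1-3)[OF \<phi>] tangent_natD(1-3)[OF \<psi>]
  show ?thesis
    by (simp add: tangent_nat_iff tangent_natD(4,5)[OF \<phi>] tangent_natD(4,5)[OF \<psi>]
       tangent_natD(4,5)[OF \<phi>, THEN F.B.extend] tangent_natD(4,5)[OF \<psi>, THEN F.B.extend])
qed

lemma tangent_nat_Tar:
  fixes X' :: "('x, 'y) tang" and X :: "('o, 'a) tang" (structure)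
  assumes "tangent_category X'" "tangent_category X"
    and F: "tangent_morphism X' X F" and G: "tangent_morphism X' X G"
    and \<phi>: "tangent_nat X' X F G \<phi>"
  shows "tangent_nat X' X (Tbar X' X F) (Tbar X' X G) (\<lambda>A\<in>Ob X'. Tar X (\<phi> A))"
proof -
  interpret F: lax_morphism X' X F by (rule lax_morphismI) fact+
  interpret G: lax_morphism X' X G by (rule lax_morphismI) fact+
  note [simp] = tangent_natD(1-3)[OF \<phi>]
  have "Tar X (arm G f) \<bullet> Tar X (\<phi> (Dom X' f)) = Tar X (\<phi> (Cod X' f)) \<bullet> Tar X (arm F f)" if "f \<in> Ar X'" for f
    using arg_cong[OF tangent_natD(4)[OF \<phi> that refl], of "Tar X"] that by simp
  moreover have "Tar X (Tar X (\<phi> A)) \<bullet> Tar X (lax F A) = Tar X (lax G A) \<bullet> Tar X (\<phi> (Tob X' A))"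
    if "A \<in> Ob X'" for A
    using arg_cong[OF tangent_natD(5)[OF \<phi> that], of "Tar X"] that by simp
  moreover have "Tar X (Tar X (\<phi> A)) \<bullet> tc X (obm F A) \<bullet> Tar X (lax F A) =
      tc X (obm G A) \<bullet> Tar X (Tar X (\<phi> A)) \<bullet> Tar X (lax F A)" if "A \<in> Ob X'" for A
    using that F.B.extend[OF F.B.tc_nat[of "\<phi> A" "obm G A"], of "Tar X (lax F A)"] by simp
  ultimately show ?thesis
    by (simp add: tangent_nat_iff)
qed

text \<open>The point is the lifting of a family \<open>h\<close>. Naturality of \<open>h\<close> is an equation between arrows into
  \<open>P A\<close>, and compatibility with the distributive laws one between arrows into \<open>T P A\<close>; both hold after
  composition with the legs, where \<open>h\<close> becomes a tangent natural transformation.\<close>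

lemma HOM_evaluations:
  fixes X' :: "('x, 'y) tang" and X :: "('o, 'a) tang" (structure)
  assumes X': "tangent_category X'" and X: "tangent_category X"
  shows "evaluations X (HOM X' X) (Ob X') (\<lambda>A F. obm F A) (\<lambda>A \<phi>. body \<phi> A)"
proof -
  interpret X': tangent X' by unfold_locales (rule X')
  interpret X: tangent X by unfold_locales (rule X)
  let ?H = "HOM X' X"
  have lm: "lax_morphism X' X F" if "tangent_morphism X' X F" for F
    by (rule lax_morphismI[OF X' X that])
  note nats = lax_morphism.structure_nats[OF lm]
  note mors = Tbar_morphism[OF X' X] lax_morphism.T2bar_morphism[OF lm]
  have ext: "\<phi> = \<psi>" if "\<phi> \<in> Ar ?H" "\<psi> \<in> Ar ?H" "src \<phi> = src \<psi>" "tgt \<phi> = tgt \<psi>"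
    "\<And>A. A \<in> Ob X' \<Longrightarrow> body \<phi> A = body \<psi> A" for \<phi> \<psi>
  proof (rule marr.expand, intro conjI)
    show "body \<phi> = body \<psi>"
      by (rule extensionalityI[of _ "Ob X'"]) (use that in \<open>auto simp: HOM_Ar tangent_nat_iff\<close>)
  qed (use that in auto)
  have cmp: "\<psi> \<cdot>\<^bsub>?H\<^esub> \<phi> \<in> Ar ?H" if "\<phi> \<in> Ar ?H" "\<psi> \<in> Ar ?H" "tgt \<phi> = src \<psi>" for \<phi> \<psi>
    using that tangent_nat_comp[OF X' X, of "src \<phi>" "tgt \<phi>" "tgt \<psi>" "body \<phi>" "body \<psi>"]
    by (simp add: HOM_Ar) (simp add: HOM_simps)
  have cat: "is_category ?H"
    unfolding is_category_def hom_def
  proof (intro conjI ballI impI)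
    fix \<phi> assume \<phi>: "\<phi> \<in> Ar ?H"
    then show "Dom ?H \<phi> \<in> Ob ?H" "Cod ?H \<phi> \<in> Ob ?H" by (auto simp: HOM_simps HOM_Ar)
    have I: "Idn ?H F \<in> Ar ?H" if "tangent_morphism X' X F" for F
      using that nats by (simp add: HOM_simps HOM_Ar)
    have "\<phi> \<cdot>\<^bsub>?H\<^esub> Idn ?H (Dom ?H \<phi>) \<in> Ar ?H" "Idn ?H (Cod ?H \<phi>) \<cdot>\<^bsub>?H\<^esub> \<phi> \<in> Ar ?H"
      by (rule cmp; use \<phi> I in \<open>simp add: HOM_simps HOM_Ar\<close>)+
    then show "\<phi> \<cdot>\<^bsub>?H\<^esub> Idn ?H (Dom ?H \<phi>) = \<phi>" "Idn ?H (Cod ?H \<phi>) \<cdot>\<^bsub>?H\<^esub> \<phi> = \<phi>"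
      using \<phi> by (auto intro!: ext simp: HOM_simps) (auto simp: HOM_simps HOM_body)
  next
    fix \<phi> \<psi> \<chi> assume *: "\<phi> \<in> Ar ?H" "\<psi> \<in> Ar ?H" "\<chi> \<in> Ar ?H" "Cod ?H \<phi> = Dom ?H \<psi>" "Cod ?H \<psi> = Dom ?H \<chi>"
    show "\<chi> \<cdot>\<^bsub>?H\<^esub> (\<psi> \<cdot>\<^bsub>?H\<^esub> \<phi>) = (\<chi> \<cdot>\<^bsub>?H\<^esub> \<psi>) \<cdot>\<^bsub>?H\<^esub> \<phi>"
    proof (rule ext)
      show "\<chi> \<cdot>\<^bsub>?H\<^esub> (\<psi> \<cdot>\<^bsub>?H\<^esub> \<phi>) \<in> Ar ?H" "(\<chi> \<cdot>\<^bsub>?H\<^esub> \<psi>) \<cdot>\<^bsub>?H\<^esub> \<phi> \<in> Ar ?H"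
        by (intro cmp; use * in \<open>simp add: HOM_simps\<close>)+
    qed (use * in \<open>simp_all add: HOM_simps HOM_body\<close>)
  qed (use cmp nats in \<open>auto simp: HOM_simps HOM_Ar\<close>)
  show ?thesis
  proof (unfold_locales)
    show "is_category ?H" by (rule cat)
    show "\<phi> = \<psi>" if "\<phi> \<in> Ar ?H" "\<psi> \<in> Ar ?H" "Dom ?H \<phi> = Dom ?H \<psi>" "Cod ?H \<phi> = Cod ?H \<psi>"
      "\<And>A. A \<in> Ob X' \<Longrightarrow> body \<phi> A = body \<psi> A" for \<phi> \<psi>
      by (rule ext) (use that in \<open>simp_all add: HOM_simps\<close>)
    show "Tar ?H \<phi> \<in> Ar ?H" if "\<phi> \<in> Ar ?H" for \<phi>
      using that tangent_nat_Tar[OF X' X] mors by (simp add: HOM_Ar) (simp add: HOM_simps)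
    show "\<exists>P q \<pi>. P \<in> Ob ?H \<and> q \<in> hom ?H P F \<and> (\<forall>j<n. \<pi> j \<in> hom ?H P (Tob ?H F)) \<and>
      (\<forall>A\<in>Ob X'. is_fold_pullback X n (tp X (obm F A)) (obm P A) (body q A) (\<lambda>j. body (\<pi> j) A))"
      if "F \<in> Ob ?H" for F n
      using lax_morphism.fold_pullback_morphism[OF lm, of F n] that by (simp add: HOM_simps)
    fix Q P L and h :: "'x \<Rightarrow> 'a"
    assume Q: "Q \<in> Ob ?H" and P: "P \<in> Ob ?H" and L: "\<And>l. l \<in> L \<Longrightarrow> l \<in> Ar ?H" "\<And>l. l \<in> L \<Longrightarrow> Dom ?H l = P"
      and T: "\<And>A. A \<in> Ob X' \<Longrightarrow> T_monic X (obm P A) ((\<lambda>\<phi>. body \<phi> A) ` L)"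
      and h: "\<And>A. A \<in> Ob X' \<Longrightarrow> h A \<in> Ar X" "\<And>A. A \<in> Ob X' \<Longrightarrow> Dom X (h A) = obm Q A" "\<And>A. A \<in> Ob X' \<Longrightarrow>
        Cod X (h A) = obm P A"
      and g: "\<And>l. l \<in> L \<Longrightarrow> \<exists>g\<in>Ar ?H. Dom ?H g = Q \<and> Cod ?H g = Cod ?H l \<and> (\<forall>A\<in>Ob X'. body g A = body l A \<bullet> h A)"
    interpret Q: lax_morphism X' X Q by (rule lm) (use Q in \<open>simp add: HOM_simps\<close>)
    interpret P: lax_morphism X' X P by (rule lm) (use P in \<open>simp add: HOM_simps\<close>)
    note [simp] = h
    have "tangent_nat X' X Q P (restrict h (Ob X'))"
      unfolding tangent_nat_iff
    proof (intro conjI ballI)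
      fix f assume f: "f \<in> Ar X'"
      show "arm P f \<bullet> restrict h (Ob X') (Dom X' f) = restrict h (Ob X') (Cod X' f) \<bullet> arm Q f"
      proof (rule T_monicD0[OF T[of "Cod X' f"]])
        fix l' assume "l' \<in> (\<lambda>\<phi>. body \<phi> (Cod X' f)) ` L"
        then obtain l where l: "l \<in> L" "l' = body l (Cod X' f)" by blast
        obtain g where g: "g \<in> Ar ?H" "src g = Q" "tgt g = tgt l" "\<And>A. A \<in> Ob X' \<Longrightarrow> body g A = body l A \<bullet> h A"
          using g[OF l(1)] by (auto simp: HOM_simps)
        have gn: "tangent_nat X' X Q (tgt l) (body g)" and ln: "tangent_nat X' X P (tgt l) (body l)"
          and lt: "tangent_morphism X' X (tgt l)"
          using g L[OF l(1)] by (auto simp: HOM_Ar HOM_simps)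
        interpret B: lax_morphism X' X "tgt l" by (rule lm) fact
        have "arm (tgt l) f \<bullet> (body l (Dom X' f) \<bullet> h (Dom X' f)) = (body l (Cod X' f) \<bullet> h (Cod X' f)) \<bullet> arm Q f"
          using tangent_natD(4)[OF gn f refl] f by (simp add: g)
        then show "l' \<bullet> (arm P f \<bullet> restrict h (Ob X') (Dom X' f)) =
          l' \<bullet> (restrict h (Ob X') (Cod X' f) \<bullet> arm Q f)"
          using f tangent_natD(1-3)[OF ln] X.extend[OF tangent_natD(4)[OF ln f refl], of "h (Dom X' f)"]
            by (simp add: l(2))
      qed (use f in simp_all)
    next
      fix A assume A: "A \<in> Ob X'"
      show "Tar X (restrict h (Ob X') A) \<bullet> lax Q A = lax P A \<bullet> restrict h (Ob X') (Tob X' A)"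
      proof (rule T_monicD1[OF T[OF A]])
        fix l' assume "l' \<in> (\<lambda>\<phi>. body \<phi> A) ` L"
        then obtain l where l: "l \<in> L" "l' = body l A" by blast
        obtain g where g: "g \<in> Ar ?H" "src g = Q" "tgt g = tgt l" "\<And>A. A \<in> Ob X' \<Longrightarrow> body g A = body l A \<bullet> h A"
          using g[OF l(1)] by (auto simp: HOM_simps)
        have gn: "tangent_nat X' X Q (tgt l) (body g)" and ln: "tangent_nat X' X P (tgt l) (body l)"
          and lt: "tangent_morphism X' X (tgt l)"
          using g L[OF l(1)] by (auto simp: HOM_Ar HOM_simps)
        interpret B: lax_morphism X' X "tgt l" by (rule lm) fact
        have "Tar X (body l A \<bullet> h A) \<bullet> lax Q A = lax (tgt l) A \<bullet> (body l (Tob X' A) \<bullet> h (Tob X' A))"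
          using tangent_natD(5)[OF gn A] A by (simp add: g)
        then show "Tar X l' \<bullet> (Tar X (restrict h (Ob X') A) \<bullet> lax Q A) =
          Tar X l' \<bullet> (lax P A \<bullet> restrict h (Ob X') (Tob X' A))"
          using A tangent_natD(1-3)[OF ln] X.extend[OF tangent_natD(5)[OF ln A], of "h (Tob X' A)"]
            by (simp add: l(2))
      qed (use A in simp_all)
    qed simp_all
    then show "\<exists>k\<in>Ar ?H. Dom ?H k = Q \<and> Cod ?H k = P \<and> (\<forall>A\<in>Ob X'. body k A = h A)"
      using Q P by (intro bexI[of _ "MArr Q (restrict h (Ob X')) P"]) (simp_all add: HOM_simps HOM_Ar)
  qed (simp_all add: HOM_body, simp_all add: HOM_simps HOM_Ar lax_morphism.obm_ob[OF lm] nats mors)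
qed


section \<open>Objects with structure\<close>

text \<open>The conditions under which \<open>structured\<close> is a tangent category with a forgetful functor that
  is a single faithful evaluation. \<open>R_lift\<close> says that compatibility can be tested on \<open>T\<close>-monic
  families, and \<open>R_fold\<close> that the pullbacks of \<open>p\<close> carry structures.\<close>

locale structures = tangent X for X :: "('o, 'a) tang" (structure) +
  fixes S :: "'s set" and u :: "'s \<Rightarrow> 'o" and R :: "'s \<Rightarrow> 'a \<Rightarrow> 's \<Rightarrow> bool" and t t2 :: "'s \<Rightarrow> 's"
  assumes u_ob [simp]: "\<And>a. a \<in> S \<Longrightarrow> u a \<in> Ob X"
    and t_S [simp]: "\<And>a. a \<in> S \<Longrightarrow> t a \<in> S" and u_t [simp]: "\<And>a. a \<in> S \<Longrightarrow> u (t a) = Tob X (u a)"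
    and t2_S [simp]: "\<And>a. a \<in> S \<Longrightarrow> t2 a \<in> S" and u_t2 [simp]: "\<And>a. a \<in> S \<Longrightarrow> u (t2 a) = T2 X (u a)"
    and R_idn [simp]: "\<And>a. a \<in> S \<Longrightarrow> R a (Idn X (u a)) a"
    and R_cmp: "\<And>a b c f g. \<lbrakk>a \<in> S; b \<in> S; c \<in> S; f \<in> Ar X; g \<in> Ar X; Dom X f = u a; Cod X f = u b;
       Dom X g = u b; Cod X g = u c; R a f b; R b g c\<rbrakk> \<Longrightarrow> R a (g \<bullet> f) c"
    and R_T: "\<And>a b f. \<lbrakk>a \<in> S; b \<in> S; f \<in> Ar X; Dom X f = u a; Cod X f = u b; R a f b\<rbrakk> \<Longrightarrow> R (t a) (Tar X f) (t b)"
    and R_pr1 [simp]: "\<And>a. a \<in> S \<Longrightarrow> R (t2 a) (pr1 X (u a)) (t a)"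
    and R_pr2 [simp]: "\<And>a. a \<in> S \<Longrightarrow> R (t2 a) (pr2 X (u a)) (t a)"
    and R_tp [simp]: "\<And>a. a \<in> S \<Longrightarrow> R (t a) (tp X (u a)) a"
    and R_tz [simp]: "\<And>a. a \<in> S \<Longrightarrow> R a (tz X (u a)) (t a)"
    and R_ts [simp]: "\<And>a. a \<in> S \<Longrightarrow> R (t2 a) (ts X (u a)) (t a)"
    and R_tl [simp]: "\<And>a. a \<in> S \<Longrightarrow> R (t a) (tl X (u a)) (t (t a))"
    and R_tc [simp]: "\<And>a. a \<in> S \<Longrightarrow> R (t (t a)) (tc X (u a)) (t (t a))"
    and R_lift: "\<And>a b h L. \<lbrakk>a \<in> S; b \<in> S; h \<in> Ar X; Dom X h = u a; Cod X h = u b;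
      \<And>l c. (l, c) \<in> L \<Longrightarrow> c \<in> S \<and> l \<in> Ar X \<and> Dom X l = u b \<and> Cod X l = u c \<and> R b l c \<and> R a (l \<bullet> h) c;
      T_monic X (u b) (fst ` L)\<rbrakk> \<Longrightarrow> R a h b"
    and R_fold: "\<And>a n P q \<pi>. a \<in> S \<Longrightarrow> is_fold_pullback X n (tp X (u a)) P q \<pi> \<Longrightarrow>
      \<exists>b\<in>S. u b = P \<and> R b q a \<and> (\<forall>j<n. R b (\<pi> j) (t a))"

lemma structured_simps:
  "Ob (structured X S u R t t2) = S"
  "Dom (structured X S u R t t2) = src" "Cod (structured X S u R t t2) = tgt"
  "Idn (structured X S u R t t2) = (\<lambda>a. MArr a (Idn X (u a)) a)"
  "Cmp (structured X S u R t t2) = (\<lambda>g f. MArr (src f) (body g \<cdot>\<^bsub>X\<^esub> body f) (tgt g))"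
  "Tob (structured X S u R t t2) = t"
  "Tar (structured X S u R t t2) = (\<lambda>f. MArr (t (src f)) (Tar X (body f)) (t (tgt f)))"
  "T2 (structured X S u R t t2) = t2"
  "pr1 (structured X S u R t t2) = (\<lambda>a. MArr (t2 a) (pr1 X (u a)) (t a))"
  "pr2 (structured X S u R t t2) = (\<lambda>a. MArr (t2 a) (pr2 X (u a)) (t a))"
  "tp (structured X S u R t t2) = (\<lambda>a. MArr (t a) (tp X (u a)) a)"
  "tz (structured X S u R t t2) = (\<lambda>a. MArr a (tz X (u a)) (t a))"
  "ts (structured X S u R t t2) = (\<lambda>a. MArr (t2 a) (ts X (u a)) (t a))"
  "tl (structured X S u R t t2) = (\<lambda>a. MArr (t a) (tl X (u a)) (t (t a)))"
  "tc (structured X S u R t t2) = (\<lambda>a. MArr (t (t a)) (tc X (u a)) (t (t a)))"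
  by (simp_all add: structured_def)

lemma structured_Ar: "f \<in> Ar (structured X S u R t t2) \<longleftrightarrow> src f \<in> S \<and> tgt f \<in> S \<and>
  body f \<in> Ar X \<and> Dom X (body f) = u (src f) \<and> Cod X (body f) = u (tgt f) \<and> R (src f) (body f) (tgt f)"
  by (cases f) (auto simp: structured_def hom_def)

context structures
begin

abbreviation "C \<equiv> structured X S u R t t2"

lemma structured_evaluations: "evaluations X C {()} (\<lambda>_. u) (\<lambda>_. body)"
proof unfold_locales
  show "is_category C"
    unfolding is_category_def hom_def by (auto simp: structured_simps structured_Ar intro: R_cmp marr.expand)
  fix A n assume A: "A \<in> Ob C"
  obtain P q \<pi> where P: "is_fold_pullback X n (tp X (u A)) P q \<pi>"
    using fold_pullback_exists[of "u A" n] A by (auto simp: structured_simps)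
  obtain b where b: "b \<in> S" "u b = P" "R b q A" "\<And>j. j < n \<Longrightarrow> R b (\<pi> j) (t A)"
    using R_fold[OF _ P] A by (auto simp: structured_simps)
  have "q \<in> Ar X" "Dom X q = P" "Cod X q = u A"
    "\<And>j. j < n \<Longrightarrow> \<pi> j \<in> Ar X" "\<And>j. j < n \<Longrightarrow> Dom X (\<pi> j) = P" "\<And>j. j < n \<Longrightarrow> Cod X (\<pi> j) = Tob X (u A)"
    using P A by (auto simp: is_fold_pullback_def hom_def structured_simps)
  then show "\<exists>P q \<pi>. P \<in> Ob C \<and> q \<in> hom C P A \<and> (\<forall>j<n. \<pi> j \<in> hom C P (Tob C A)) \<and>
     (\<forall>i\<in>{()}. is_fold_pullback X n (tp X (u A)) (u P) (body q) (\<lambda>j. body (\<pi> j)))"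
    using A P b by (intro exI[of _ b] exI[of _ "MArr b q A"] exI[of _ "\<lambda>j. MArr b (\<pi> j) (t A)"])
      (auto simp: hom_def structured_simps structured_Ar)
next
  fix Q P L and h :: "unit \<Rightarrow> 'a"
  assume Q: "Q \<in> Ob C" and P: "P \<in> Ob C" and L: "\<And>l. l \<in> L \<Longrightarrow> l \<in> Ar C" "\<And>l. l \<in> L \<Longrightarrow> Dom C l = P"
    and T: "\<And>i. i \<in> {()} \<Longrightarrow> T_monic X (u P) (body ` L)"
    and h: "\<And>i. i \<in> {()} \<Longrightarrow> h i \<in> Ar X" "\<And>i. i \<in> {()} \<Longrightarrow> Dom X (h i) = u Q" "\<And>i. i \<in> {()} \<Longrightarrow> Cod X (h i) = u P"
    and g: "\<And>l. l \<in> L \<Longrightarrow> \<exists>g\<in>Ar C. Dom C g = Q \<and> Cod C g = Cod C l \<and> (\<forall>i\<in>{()}. body g = body l \<bullet> h i)"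
  have "R Q (h ()) P"
  proof (rule R_lift[where L = "(\<lambda>l. (body l, tgt l)) ` L"])
    show "T_monic X (u P) (fst ` (\<lambda>l. (body l, tgt l)) ` L)" using T by (simp add: image_image)
    fix l c assume "(l, c) \<in> (\<lambda>l. (body l, tgt l)) ` L"
    then obtain l' where l': "l' \<in> L" "l = body l'" "c = tgt l'" by auto
    then show "c \<in> S \<and> l \<in> Ar X \<and> Dom X l = u P \<and> Cod X l = u c \<and> R P l c \<and> R Q (l \<bullet> h ()) c"
      using L[OF l'(1)] g[OF l'(1)] by (auto simp: structured_simps structured_Ar)
  qed (use Q P h in \<open>simp_all add: structured_simps\<close>)
  then show "\<exists>k\<in>Ar C. Dom C k = Q \<and> Cod C k = P \<and> (\<forall>i\<in>{()}. body k = h i)"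
    using Q P h by (intro bexI[of _ "MArr Q (h ()) P"]) (simp_all add: structured_simps structured_Ar)
qed (auto simp: structured_simps structured_Ar R_T intro: marr.expand)

lemma structured_tangent_category: "tangent_category C"
  using evaluations.tangent_category[OF structured_evaluations] .

text \<open>Tangent morphisms and tangent natural transformations into objects with structure are the
  same as their underlying ones, together with structures on the values.\<close>

abbreviation "U \<equiv> strict_mor C X u body"

lemma U_simps [simp]: "a \<in> S \<Longrightarrow> obm U a = u a" "f \<in> Ar C \<Longrightarrow> arm U f = body f" "a \<in> S \<Longrightarrow> lax U a =
  Idn X (Tob X (u a))"
  by (simp_all add: strict_mor_def structured_simps)

lemma U_morphism: "tangent_morphism C X U"
proof (rule tangent_morphismI)
  fix f g assume "f \<in> Ar C" "g \<in> Ar C" "Cod C f = Dom C g"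
  moreover then have "g \<cdot>\<^bsub>C\<^esub> f \<in> Ar C" using R_cmp by (auto simp: structured_simps structured_Ar)
  ultimately show "arm U (g \<cdot>\<^bsub>C\<^esub> f) = arm U g \<bullet> arm U f" by (simp add: structured_simps)
qed (simp_all add: structured_simps structured_Ar pair_prs R_T, simp_all add: strict_mor_def structured_simps)

lemma U_strict: "is_strict C X U"
  by (simp add: is_strict_def structured_simps structured_Ar R_T)

lemma comp_U_simps [simp]:
  assumes "tangent_category X'" "tangent_morphism X' C H"
  shows "A \<in> Ob X' \<Longrightarrow> obm (comp_mor X' X U H) A = u (obm H A)"
    "f \<in> Ar X' \<Longrightarrow> arm (comp_mor X' X U H) f = body (arm H f)"
    "A \<in> Ob X' \<Longrightarrow> lax (comp_mor X' X U H) A = body (lax H A)"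
proof -
  interpret H: lax_morphism X' C H by (rule lax_morphismI[OF assms(1) structured_tangent_category assms(2)])
  show "A \<in> Ob X' \<Longrightarrow> obm (comp_mor X' X U H) A = u (obm H A)"
    "f \<in> Ar X' \<Longrightarrow> arm (comp_mor X' X U H) f = body (arm H f)"
    using H.obm_ob[of A] H.arm_ar[of f] by (simp_all add: structured_simps)
  show "lax (comp_mor X' X U H) A = body (lax H A)" if "A \<in> Ob X'"
    using H.obm_ob[OF that] H.lax_ar[OF that] H.lax_cod[OF that] that
    unfolding structured_simps structured_Ar by (simp add: structured_Ar)
qed

lemma morphism_into_structured:
  fixes X' :: "('x, 'y) tang"
  assumes X': "tangent_category X'" and F: "tangent_morphism X' X F"
    and ext: "obm H \<in> extensional (Ob X')" "arm H \<in> extensional (Ar X')" "lax H \<in> extensional (Ob X')"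
    and ob: "\<And>A. A \<in> Ob X' \<Longrightarrow> obm H A \<in> S \<and> u (obm H A) = obm F A"
    and ar: "\<And>f. f \<in> Ar X' \<Longrightarrow> arm H f = MArr (obm H (Dom X' f)) (arm F f) (obm H (Cod X' f))"
    and R_ar: "\<And>f. f \<in> Ar X' \<Longrightarrow> R (obm H (Dom X' f)) (arm F f) (obm H (Cod X' f))"
    and lax: "\<And>A. A \<in> Ob X' \<Longrightarrow> lax H A = MArr (obm H (Tob X' A)) (lax F A) (t (obm H A))"
    and R_lax: "\<And>A. A \<in> Ob X' \<Longrightarrow> R (obm H (Tob X' A)) (lax F A) (t (obm H A))"
  shows "tangent_morphism X' C H"
proof -
  interpret E: evaluations X C "{()}" "\<lambda>_. u" "\<lambda>_. body" by (rule structured_evaluations)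
  interpret F: lax_morphism X' X F by (rule lax_morphismI) (fact X' tangent F)+
  have [simp]: "obm H A \<in> Ob C" "u (obm H A) = obm F A" if "A \<in> Ob X'" for A
    using ob that by (simp_all add: structured_simps)
  have a [simp]: "arm H f \<in> Ar C" "Dom C (arm H f) = obm H (Dom X' f)" "Cod C (arm H f) = obm H (Cod X' f)"
     "body (arm H f) = arm F f" if "f \<in> Ar X'" for f
    using ob[of "Dom X' f"] ob[of "Cod X' f"] that by (simp_all add: ar R_ar structured_simps structured_Ar)
  have l [simp]: "lax H A \<in> Ar C" "Dom C (lax H A) = obm H (Tob X' A)" "Cod C (lax H A) = Tob C (obm H A)"
     "body (lax H A) = lax F A" if "A \<in> Ob X'" for A
    using ob[of A] ob[of "Tob X' A"] that by (simp_all add: lax R_lax structured_simps structured_Ar)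
  note faithful = E.faithful
  show ?thesis
  proof (rule tangent_morphismI)
    fix A assume A: "A \<in> Ob X'"
    have *: "tp C (obm H A) \<cdot>\<^bsub>C\<^esub> (lax H A \<cdot>\<^bsub>C\<^esub> arm H (pr1 X' A)) =
      tp C (obm H A) \<cdot>\<^bsub>C\<^esub> (lax H A \<cdot>\<^bsub>C\<^esub> arm H (pr2 X' A))"
      by (rule faithful) (use A F.lax_fibre_prs[OF A] in simp_all)
    show "lax H A \<cdot>\<^bsub>C\<^esub> arm H (ts X' A) =
         ts C (obm H A) \<cdot>\<^bsub>C\<^esub> pair C (obm H A) (lax H A \<cdot>\<^bsub>C\<^esub> arm H (pr1 X' A)) (lax H A \<cdot>\<^bsub>C\<^esub> arm H (pr2 X' A))"
      by (rule faithful) (use A * F.lax_s[OF A] in \<open>simp_all add: E.pair_rules\<close>)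
  next
    fix f assume "f \<in> Ar X'"
    then show "lax H (Cod X' f) \<cdot>\<^bsub>C\<^esub> arm H (Tar X' f) = Tar C (arm H f) \<cdot>\<^bsub>C\<^esub> lax H (Dom X' f)"
      by - (rule faithful, use F.lax_nat in simp_all)
  qed (use ext in simp_all, rule faithful, simp_all add: F.p_lax F.lax_z F.l_lax F.c_lax,
      (rule faithful, simp_all add: F.p_lax F.lax_z F.l_lax F.c_lax)+)
qed

lemma tangent_nat_structured:
  fixes X' :: "('x, 'y) tang"
  assumes X': "tangent_category X'" and H: "tangent_morphism X' C H" and G: "tangent_morphism X' C G"
  shows "tangent_nat X' C H G \<phi> \<longleftrightarrow> \<phi> \<in> extensional (Ob X') \<and>
    (\<forall>A\<in>Ob X'. \<phi> A = MArr (obm H A) (body (\<phi> A)) (obm G A) \<and> R (obm H A) (body (\<phi> A)) (obm G A)) \<and>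
    tangent_nat X' X (comp_mor X' X U H) (comp_mor X' X U G) (\<lambda>A\<in>Ob X'. body (\<phi> A))"
proof -
  interpret E: evaluations X C "{()}" "\<lambda>_. u" "\<lambda>_. body" by (rule structured_evaluations)
  interpret H: lax_morphism X' C H by (rule lax_morphismI[OF X' structured_tangent_category H])
  interpret G: lax_morphism X' C G by (rule lax_morphismI[OF X' structured_tangent_category G])
  have HS: "obm H A \<in> S" "obm G A \<in> S" if "A \<in> Ob X'" for A
    using H.obm_ob[OF that] G.obm_ob[OF that] by (simp_all add: structured_simps)
  have typed: "\<phi> A \<in> Ar C \<and> Dom C (\<phi> A) = obm H A \<and> Cod C (\<phi> A) = obm G A \<longleftrightarrow>
    \<phi> A = MArr (obm H A) (body (\<phi> A)) (obm G A) \<and> R (obm H A) (body (\<phi> A)) (obm G A) \<and>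
      body (\<phi> A) \<in> Ar X \<and> Dom X (body (\<phi> A)) = u (obm H A) \<and> Cod X (body (\<phi> A)) = u (obm G A)"
        if "A \<in> Ob X'" for A
    using HS[OF that] by (cases "\<phi> A") (auto simp: structured_simps structured_Ar)
  have nat: "arm G f \<cdot>\<^bsub>C\<^esub> \<phi> (Dom X' f) = \<phi> (Cod X' f) \<cdot>\<^bsub>C\<^esub> arm H f \<longleftrightarrow>
     body (arm G f) \<bullet> body (\<phi> (Dom X' f)) = body (\<phi> (Cod X' f)) \<bullet> body (arm H f)"
    if "f \<in> Ar X'" "\<And>A. A \<in> Ob X' \<Longrightarrow> \<phi> A \<in> Ar C \<and> Dom C (\<phi> A) = obm H A \<and> Cod C (\<phi> A) = obm G A" for f
    using that H.arm_dom[of f] G.arm_cod[of f] unfolding structured_simps by auto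
  have lax: "Tar C (\<phi> A) \<cdot>\<^bsub>C\<^esub> lax H A = lax G A \<cdot>\<^bsub>C\<^esub> \<phi> (Tob X' A) \<longleftrightarrow>
     Tar X (body (\<phi> A)) \<bullet> body (lax H A) = body (lax G A) \<bullet> body (\<phi> (Tob X' A))"
    if "A \<in> Ob X'" "\<And>A. A \<in> Ob X' \<Longrightarrow> \<phi> A \<in> Ar C \<and> Dom C (\<phi> A) = obm H A \<and> Cod C (\<phi> A) = obm G A" for A
    using that H.lax_dom[of A] G.lax_cod[of A] unfolding structured_simps by auto
  show ?thesis
    unfolding tangent_nat_iff using typed nat lax HS X' H G by (auto simp: comp_U_simps[OF X' H]
      comp_U_simps[OF X' G])
qed

end


section \<open>Vector fields and connections as structures\<close>

text \<open>A vector field is an arrow \<open>M \<rightarrow> T M\<close> and a vertical connection an arrow \<open>T\<^sup>2 M \<rightarrow> T M\<close>, both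
  subject to equations. To treat them alike, let \<open>J\<close> be the identity (for \<open>b = True\<close>) or \<open>T\<^sup>2\<close> (for
  \<open>b = False\<close>) and consider arrows \<open>x : J M \<rightarrow> T M\<close>. Apart from the equations, all that matters is
  that \<open>J\<close> is a tangent morphism; \<open>J_law\<close> is its distributive law \<open>J T M \<rightarrow> T J M\<close>. The functions \<open>J_ob\<close>
  and \<open>J_ar\<close> agree with \<open>J_mor\<close> on the carriers, but reduce to plain iterates of \<open>T\<close>.\<close>

definition J_ob :: "bool \<Rightarrow> ('o, 'a) tang \<Rightarrow> 'o \<Rightarrow> 'o" where
  "J_ob b X M = (if b then M else Tob X (Tob X M))"

definition J_ar :: "bool \<Rightarrow> ('o, 'a) tang \<Rightarrow> 'a \<Rightarrow> 'a" where
  "J_ar b X f = (if b then f else Tar X (Tar X f))"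

definition J_law :: "bool \<Rightarrow> ('o, 'a) tang \<Rightarrow> 'o \<Rightarrow> 'a" where
  "J_law b X M = (if b then Idn X (Tob X M) else tc X (Tob X M) \<cdot>\<^bsub>X\<^esub> Tar X (tc X M))"

definition J_mor :: "bool \<Rightarrow> ('o, 'a) tang \<Rightarrow> ('o, 'a, 'o, 'a) mor" where
  "J_mor b X = (if b then id_mor X else Tbar X X (Tbar X X (id_mor X)))"

definition is_str :: "bool \<Rightarrow> ('o, 'a) tang \<Rightarrow> 'o \<Rightarrow> 'a \<Rightarrow> bool" where
  "is_str b X M x = (if b then vector_field X M x else vertical_connection X M x)"

definition str_mor :: "bool \<Rightarrow> ('o, 'a) tang \<Rightarrow> 'a \<Rightarrow> 'a \<Rightarrow> 'a \<Rightarrow> bool" where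
  "str_mor b X x f x' \<longleftrightarrow> x' \<cdot>\<^bsub>X\<^esub> J_ar b X f = Tar X f \<cdot>\<^bsub>X\<^esub> x"

definition T_str :: "bool \<Rightarrow> ('o, 'a) tang \<Rightarrow> 'o \<Rightarrow> 'a \<Rightarrow> 'a" where
  "T_str b X M x = (if b then T_field X M x else T_conn X M x)"

definition T2_str :: "bool \<Rightarrow> ('o, 'a) tang \<Rightarrow> 'o \<Rightarrow> 'a \<Rightarrow> 'a" where
  "T2_str b X M x = tpair X M (T_str b X M x \<cdot>\<^bsub>X\<^esub> J_ar b X (pr1 X M)) (T_str b X M x \<cdot>\<^bsub>X\<^esub> J_ar b X (pr2 X M))"

abbreviation str_objects :: "bool \<Rightarrow> ('o, 'a) tang \<Rightarrow> ('o \<times> 'a) set" where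
  "str_objects b X \<equiv> {(M, x). M \<in> Ob X \<and> is_str b X M x}"

definition Str :: "bool \<Rightarrow> ('o, 'a) tang \<Rightarrow> ('o \<times> 'a, ('o \<times> 'a, 'a) marr) tang" where
  "Str b X = structured X (str_objects b X) fst
     (\<lambda>(M, x) f (M', x'). str_mor b X x f x')
     (\<lambda>(M, x). (Tob X M, T_str b X M x))
     (\<lambda>(M, x). (T2 X M, T2_str b X M x))"

lemma VF_eq_Str: "VF X = Str True X"
  by (simp add: VF_def Str_def is_str_def str_mor_def field_morphism_def J_ar_def T_str_def T2_str_def
    T2_field_def)

lemma VAC_eq_Str: "VAC X = Str False X"
  by (simp add: VAC_def Str_def is_str_def str_mor_def conn_morphism_def J_ar_def T_str_def T2_str_def
    T2_conn_def)

context tangent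
begin

lemma tar_eq: "\<lbrakk>a \<bullet> b = c; a \<in> Ar X; b \<in> Ar X; Cod X b = Dom X a\<rbrakk> \<Longrightarrow> Tar X a \<bullet> Tar X b = Tar X c"
  by auto

lemma J_ob_ob [simp]: "M \<in> Ob X \<Longrightarrow> J_ob b X M \<in> Ob X"
  and J_ar_ar [simp]: "f \<in> Ar X \<Longrightarrow> J_ar b X f \<in> Ar X"
  and J_ar_dom [simp]: "f \<in> Ar X \<Longrightarrow> Dom X (J_ar b X f) = J_ob b X (Dom X f)"
  and J_ar_cod [simp]: "f \<in> Ar X \<Longrightarrow> Cod X (J_ar b X f) = J_ob b X (Cod X f)"
  and J_ar_idn [simp]: "M \<in> Ob X \<Longrightarrow> J_ar b X (Idn X M) = Idn X (J_ob b X M)"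
  and J_ar_cmp [simp]: "\<lbrakk>f \<in> Ar X; g \<in> Ar X; Cod X f = Dom X g\<rbrakk> \<Longrightarrow> J_ar b X (g \<bullet> f) = J_ar b X g \<bullet> J_ar b X f"
  and J_law_ar [simp]: "M \<in> Ob X \<Longrightarrow> J_law b X M \<in> Ar X"
  and J_law_dom [simp]: "M \<in> Ob X \<Longrightarrow> Dom X (J_law b X M) = J_ob b X (Tob X M)"
  and J_law_cod [simp]: "M \<in> Ob X \<Longrightarrow> Cod X (J_law b X M) = Tob X (J_ob b X M)"
  by (simp_all add: J_ob_def J_ar_def J_law_def)

lemma J_ar_eq: "\<lbrakk>a \<bullet> b = c; a \<in> Ar X; b \<in> Ar X; Cod X b = Dom X a\<rbrakk> \<Longrightarrow> J_ar b' X a \<bullet> J_ar b' X b = J_ar b' X c"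
  by auto

lemma J_morphism: "tangent_morphism X X (J_mor b X)"
  by (simp add: J_mor_def id_mor_morphism Tbar_morphism tangent)

lemma J_simps:
  "M \<in> Ob X \<Longrightarrow> obm (J_mor b X) M = J_ob b X M"
  "f \<in> Ar X \<Longrightarrow> arm (J_mor b X) f = J_ar b X f"
  "M \<in> Ob X \<Longrightarrow> lax (J_mor b X) M = J_law b X M"
  by (simp_all add: J_mor_def id_mor_def strict_mor_def J_ob_def J_ar_def J_law_def)

end

sublocale tangent \<subseteq> J: lax_morphism X X "J_mor b X" for b
  by (rule lax_morphismI) (rule tangent tangent J_morphism)+

context tangent
begin

lemma J_law_nat: "\<lbrakk>f \<in> Ar X; Cod X f = B\<rbrakk> \<Longrightarrow> J_law b X B \<bullet> J_ar b X (Tar X f) =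
  Tar X (J_ar b X f) \<bullet> J_law b X (Dom X f)"
  using J.lax_nat[of f B b] by (auto simp: J_simps)

lemma p_J_law: "M \<in> Ob X \<Longrightarrow> tp X (J_ob b X M) \<bullet> J_law b X M = J_ar b X (tp X M)"
  using J.p_lax[of M b] by (simp add: J_simps)

lemma J_law_z: "M \<in> Ob X \<Longrightarrow> J_law b X M \<bullet> J_ar b X (tz X M) = tz X (J_ob b X M)"
  using J.lax_z[of M b] by (simp add: J_simps)

lemma J_law_s: "M \<in> Ob X \<Longrightarrow> J_law b X M \<bullet> J_ar b X (ts X M) =
    ts X (J_ob b X M) \<bullet> pair X (J_ob b X M) (J_law b X M \<bullet> J_ar b X (pr1 X M)) (J_law b X M \<bullet> J_ar b X
      (pr2 X M))"
  using J.lax_s[of M b] by (simp add: J_simps)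

lemma J_law_fibre: "M \<in> Ob X \<Longrightarrow> tp X (J_ob b X M) \<bullet> (J_law b X M \<bullet> J_ar b X (pr1 X M)) =
    tp X (J_ob b X M) \<bullet> (J_law b X M \<bullet> J_ar b X (pr2 X M))"
  using J.lax_fibre_prs[of M b] by (simp add: J_simps)

lemma l_J_law: "M \<in> Ob X \<Longrightarrow> Tar X (J_law b X M) \<bullet> J_law b X (Tob X M) \<bullet> J_ar b X (tl X M) =
  tl X (J_ob b X M) \<bullet> J_law b X M"
  using J.l_lax[of M b] by (simp add: J_simps)

lemma c_J_law: "M \<in> Ob X \<Longrightarrow> Tar X (J_law b X M) \<bullet> J_law b X (Tob X M) \<bullet> J_ar b X (tc X M) =
    tc X (J_ob b X M) \<bullet> Tar X (J_law b X M) \<bullet> J_law b X (Tob X M)"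
  using J.c_lax[of M b] by (simp add: J_simps)

lemma is_str_typed:
  assumes "is_str b X M x"
  shows "x \<in> Ar X" "Dom X x = J_ob b X M" "Cod X x = Tob X M"
  using assms by (auto simp: is_str_def J_ob_def vector_field_def vertical_connection_def hom_def split:
    if_splits)

text \<open>The uniform description of the tangent functor on structures. It is not taken as the definition,
  because for vector fields it carries an identity as last factor, which can be removed only from
  arrows.\<close>

lemma T_str_eq: "\<lbrakk>M \<in> Ob X; x \<in> Ar X; Dom X x = J_ob b X M; Cod X x = Tob X M\<rbrakk> \<Longrightarrow>
    T_str b X M x = tc X M \<bullet> Tar X x \<bullet> J_law b X M"
  by (simp add: T_str_def T_field_def T_conn_def J_law_def J_ob_def)

text \<open>The equations for vector fields and connections are natural, so they can be tested on a
  \<open>T\<close>-monic family of compatible arrows.\<close>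

lemma is_str_by_monic_legs:
  assumes P: "P \<in> Ob X" and y: "y \<in> Ar X" "Dom X y = J_ob b X P" "Cod X y = Tob X P"
    and L: "\<And>l N x. (l, N, x) \<in> L \<Longrightarrow> l \<in> Ar X \<and> Dom X l = P \<and> Cod X l = N \<and> is_str b X N x \<and> str_mor b X y l x"
    and T: "T_monic X P (fst ` L)" "T_monic X (Tob X P) (Tar X ` fst ` L)"
  shows "is_str b X P y"
proof -
  have ext0: "f = g" if "f \<in> Ar X" "g \<in> Ar X" "Dom X f = Dom X g" "Cod X f = P" "Cod X g = P"
    "\<And>l N x. (l, N, x) \<in> L \<Longrightarrow> l \<bullet> f = l \<bullet> g" for f g
    by (rule T_monicD0[OF T(1)]) (use that in auto)
  have ext1: "f = g" if "f \<in> Ar X" "g \<in> Ar X" "Dom X f = Dom X g" "Cod X f = Tob X P" "Cod X g = Tob X P"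
    "\<And>l N x. (l, N, x) \<in> L \<Longrightarrow> Tar X l \<bullet> f = Tar X l \<bullet> g" for f g
    by (rule T_monicD1[OF T(1)]) (use that in auto)
  have ext2: "f = g" if "f \<in> Ar X" "g \<in> Ar X" "Dom X f = Dom X g" "Cod X f = Tob X (Tob X P)" "Cod X g =
    Tob X (Tob X P)"
    "\<And>l N x. (l, N, x) \<in> L \<Longrightarrow> Tar X (Tar X l) \<bullet> f = Tar X (Tar X l) \<bullet> g" for f g
    by (rule T_monicD1[OF T(2)]) (use that in auto)
  have leg: "l \<in> Ar X" "Dom X l = P" "Cod X l = N" "N \<in> Ob X" "is_str b X N x" "x \<in> Ar X" "Dom X x =
    J_ob b X N" "Cod X x = Tob X N"
      "Tar X l \<bullet> y = x \<bullet> J_ar b X l"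
    if "(l, N, x) \<in> L" for l N x
    using L[OF that] is_str_typed[of b N x] cod_ob[of l] by (auto simp: str_mor_def)
  show ?thesis
  proof (cases b)
    case True
    have "tp X P \<bullet> y = Idn X P"
    proof (rule ext0)
      fix l N x assume "(l, N, x) \<in> L"
      note * = leg[OF this]
      have "l \<bullet> (tp X P \<bullet> y) = tp X N \<bullet> (Tar X l \<bullet> y)"
        using *(1-8) y P True extend[OF tp_nat[of l N], of y] by simp
      also have "\<dots> = l"
        using *(1-8) True extend[of "tp X N" x "Idn X N" l] by (simp add: *(9) J_ar_def J_ob_def
          vector_field_def is_str_def)
      finally show "l \<bullet> (tp X P \<bullet> y) = l \<bullet> Idn X P" using * P by simp
    qed (use P y True in \<open>simp_all add: J_ob_def\<close>)
    then show ?thesis using y True by (simp add: is_str_def vector_field_def hom_def J_ob_def)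
  next
    case False
    have y': "Dom X y = Tob X (Tob X P)" using y False by (simp add: J_ob_def)
    have leg': "Dom X x = Tob X (Tob X N)" "Tar X l \<bullet> y = x \<bullet> Tar X (Tar X l)"
       "Tar X (Tar X l) \<bullet> Tar X y = Tar X x \<bullet> Tar X (Tar X (Tar X l))"
       "x \<bullet> tl X N = Idn X (Tob X N)" "tp X N \<bullet> x = tp X N \<bullet> tp X (Tob X N)"
       "Tar X x \<bullet> tl X (Tob X N) = tl X N \<bullet> x"
       "Tar X x \<bullet> tc X (Tob X N) \<bullet> Tar X (tl X N) = tl X N \<bullet> x"
      if "(l, N, x) \<in> L" for l N x
    proof -
      show 1: "Dom X x = Tob X (Tob X N)" "Tar X l \<bullet> y = x \<bullet> Tar X (Tar X l)"
        using leg(7,9)[OF that] False by (simp_all add: J_ob_def J_ar_def)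
      show "Tar X (Tar X l) \<bullet> Tar X y = Tar X x \<bullet> Tar X (Tar X (Tar X l))"
        using tar_eq[OF 1(2)] 1(1) leg(1-4,6,8)[OF that] y y' by simp
      show "x \<bullet> tl X N = Idn X (Tob X N)" "tp X N \<bullet> x = tp X N \<bullet> tp X (Tob X N)"
       "Tar X x \<bullet> tl X (Tob X N) = tl X N \<bullet> x"
       "Tar X x \<bullet> tc X (Tob X N) \<bullet> Tar X (tl X N) = tl X N \<bullet> x"
        using leg(5)[OF that] False by (simp_all add: is_str_def vertical_connection_def)
    qed
    have "y \<bullet> tl X P = Idn X (Tob X P)"
    proof (rule ext1)
      fix l N x assume "(l, N, x) \<in> L"
      note * = leg(1-4,6,8)[OF this] leg'[OF this]
      show "Tar X l \<bullet> (y \<bullet> tl X P) = Tar X l \<bullet> Idn X (Tob X P)"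
        using * y y' P extend[OF *(8), of "tl X P"] tl_nat[of l N, symmetric]
          extend[OF *(10), of "Tar X l"] by simp
    qed (use P y y' in simp_all)
    moreover have "tp X P \<bullet> y = tp X P \<bullet> tp X (Tob X P)"
    proof (rule ext0)
      fix l N x assume "(l, N, x) \<in> L"
      note * = leg(1-4,6,8)[OF this] leg'[OF this]
      show "l \<bullet> (tp X P \<bullet> y) = l \<bullet> (tp X P \<bullet> tp X (Tob X P))"
        using * y y' P extend[OF tp_nat[of l N, symmetric], of y]
          extend[OF tp_nat[of l N, symmetric], of "tp X (Tob X P)"]
         extend[OF *(11), of "Tar X (Tar X l)"] tp_nat[of "Tar X l" "Tob X N"] by simp
    qed (use P y y' in simp_all)
    moreover have "Tar X y \<bullet> tl X (Tob X P) = tl X P \<bullet> y"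
    proof (rule ext2)
      fix l N x assume "(l, N, x) \<in> L"
      note * = leg(1-4,6,8)[OF this] leg'[OF this]
      have "Tar X (Tar X l) \<bullet> (Tar X y \<bullet> tl X (Tob X P)) = Tar X x \<bullet> Tar X (Tar X (Tar X l)) \<bullet> tl X (Tob X P)"
        using * y y' P extend[OF *(9), of "tl X (Tob X P)"] by simp
      also have "\<dots> = tl X N \<bullet> x \<bullet> Tar X (Tar X l)"
        using * y y' P tl_nat[of "Tar X l" "Tob X N", symmetric] extend[OF *(12), of "Tar X (Tar X l)"] by simp
      also have "\<dots> = Tar X (Tar X l) \<bullet> (tl X P \<bullet> y)"
        using * y y' P extend[OF tl_nat[of l N, symmetric], of y] by simp
      finally show "Tar X (Tar X l) \<bullet> (Tar X y \<bullet> tl X (Tob X P)) = Tar X (Tar X l) \<bullet> (tl X P \<bullet> y)" .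
    qed (use P y y' in simp_all)
    moreover have "Tar X y \<bullet> tc X (Tob X P) \<bullet> Tar X (tl X P) = tl X P \<bullet> y"
    proof (rule ext2)
      fix l N x assume "(l, N, x) \<in> L"
      note * = leg(1-4,6,8)[OF this] leg'[OF this]
      have Tl: "Tar X (Tar X (Tar X l)) \<bullet> Tar X (tl X P) = Tar X (tl X N) \<bullet> Tar X (Tar X l)"
        using arg_cong[OF tl_nat[of l N], of "Tar X"] * P by simp
      have "Tar X (Tar X l) \<bullet> (Tar X y \<bullet> tc X (Tob X P) \<bullet> Tar X (tl X P)) =
         Tar X x \<bullet> Tar X (Tar X (Tar X l)) \<bullet> tc X (Tob X P) \<bullet> Tar X (tl X P)"
        using * y y' P extend[OF *(9), of "tc X (Tob X P) \<bullet> Tar X (tl X P)"] by simp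
      also have "\<dots> = (Tar X x \<bullet> tc X (Tob X N) \<bullet> Tar X (tl X N)) \<bullet> Tar X (Tar X l)"
        using *(1-7) y y' P extend[OF tc_nat[of "Tar X l" "Tob X N", symmetric], of "Tar X (tl X P)"] Tl by simp
      also have "\<dots> = tl X N \<bullet> x \<bullet> Tar X (Tar X l)"
        unfolding *(13) using * P by simp
      also have "\<dots> = Tar X (Tar X l) \<bullet> (tl X P \<bullet> y)"
        using * y y' P extend[OF tl_nat[of l N, symmetric], of y] by simp
      finally show "Tar X (Tar X l) \<bullet> (Tar X y \<bullet> tc X (Tob X P) \<bullet> Tar X (tl X P)) =
        Tar X (Tar X l) \<bullet> (tl X P \<bullet> y)" .
    qed (use P y y' in simp_all)
    ultimately show ?thesis using y y' False by (simp add: is_str_def vertical_connection_def hom_def)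
  qed
qed

lemma is_str_T_field:
  assumes M: "M \<in> Ob X" and v: "vector_field X M v"
  shows "vector_field X (Tob X M) (T_field X M v)"
proof -
  have *: "v \<in> Ar X" "Dom X v = M" "Cod X v = Tob X M" "tp X M \<bullet> v = Idn X M"
    using v by (auto simp: vector_field_def hom_def)
  then show ?thesis
    using M tar_eq[OF *(4)] by (simp add: vector_field_def T_field_def hom_def p_c[THEN extend])
qed

text \<open>The new connection is \<open>T k\<close> between flips, so its equations are the images of those of \<open>k\<close> under
  \<open>T\<close>, transported along flips. The last two end in the same composite; the very last one needs the
  braid equation.\<close>

lemma is_str_T_conn:
  assumes M: "M \<in> Ob X" and k: "vertical_connection X M k"
  shows "vertical_connection X (Tob X M) (T_conn X M k)"
proof -
  have t: "k \<in> Ar X" "Dom X k = Tob X (Tob X M)" "Cod X k = Tob X M"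
    and k1: "k \<bullet> tl X M = Idn X (Tob X M)"
    and k2: "tp X M \<bullet> k = tp X M \<bullet> tp X (Tob X M)"
    and k3: "Tar X k \<bullet> tl X (Tob X M) = tl X M \<bullet> k"
    and k4: "Tar X k \<bullet> tc X (Tob X M) \<bullet> Tar X (tl X M) = tl X M \<bullet> k"
    using k by (auto simp: vertical_connection_def hom_def)
  note [simp] = M t
  have Tk1: "Tar X k \<bullet> Tar X (tl X M) = Idn X (Tob X (Tob X M))"
    using arg_cong[OF k1, of "Tar X"] by simp
  have Tk2: "Tar X (tp X M) \<bullet> Tar X k = Tar X (tp X M) \<bullet> Tar X (tp X (Tob X M))"
    using arg_cong[OF k2, of "Tar X"] by simp
  have Tk3: "Tar X (Tar X k) \<bullet> Tar X (tl X (Tob X M)) = Tar X (tl X M) \<bullet> Tar X k"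
    using arg_cong[OF k3, of "Tar X"] by simp
  have Tk4: "Tar X (Tar X k) \<bullet> Tar X (tc X (Tob X M)) \<bullet> Tar X (Tar X (tl X M)) = Tar X (tl X M) \<bullet> Tar X k"
    using arg_cong[OF k4, of "Tar X"] by simp
  let ?k = "T_conn X M k"
  have "?k \<bullet> tl X (Tob X M) = tc X M \<bullet> Tar X k \<bullet> (tc X (Tob X M) \<bullet> Tar X (tc X M) \<bullet> tl X (Tob X M))"
    by (simp add: T_conn_def)
  also have "\<dots> = Idn X (Tob X (Tob X M))"
    by (simp add: c_Tc_l extend[OF Tk1] c_c)
  finally have 1: "?k \<bullet> tl X (Tob X M) = Idn X (Tob X (Tob X M))" .
  have pp: "tp X M \<bullet> tp X (Tob X M) = tp X M \<bullet> Tar X (tp X M)"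
    using tp_nat[of "tp X M" M] by simp
  have "Tar X (tc X M) \<bullet> Tar X (tc X M) = Idn X (Tob X (Tob X (Tob X M)))"
    using arg_cong[OF c_c[of M], of "Tar X"] by simp
  note TcTc = extend[OF this]
  have Tpc: "Tar X (Tar X (tp X M)) \<bullet> Tar X (tc X M) = Tar X (tp X (Tob X M))"
    using arg_cong[OF Tp_c[of M], of "Tar X"] by simp
  have "tp X (Tob X M) \<bullet> ?k = Tar X (tp X M \<bullet> tp X (Tob X M)) \<bullet> tc X (Tob X M) \<bullet> Tar X (tc X M)"
    by (simp add: T_conn_def p_c[THEN extend] extend[OF Tk2])
  also have "\<dots> = Tar X (tp X M) \<bullet> (Tar X (Tar X (tp X M)) \<bullet> tc X (Tob X M)) \<bullet> Tar X (tc X M)"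
    unfolding pp by simp
  also have "\<dots> = tp X (Tob X M) \<bullet> Tar X (tp X (Tob X M))"
    using tc_nat[of "tp X M" M, symmetric] by (simp add: Tp_c[THEN extend] Tpc)
  also have "\<dots> = tp X (Tob X M) \<bullet> tp X (Tob X (Tob X M))"
    by (simp add: tp_nat)
  finally have 2: "tp X (Tob X M) \<bullet> ?k = tp X (Tob X M) \<bullet> tp X (Tob X (Tob X M))" .
  \<comment> \<open>the composite in which the last two equations end\<close>
  have fin: "Tar X (tc X M) \<bullet> tc X (Tob X M) \<bullet> Tar X (tl X M) \<bullet> Tar X k \<bullet> tc X (Tob X M) \<bullet> Tar X (tc X M)
    = tl X (Tob X M) \<bullet> ?k"
    using extend[OF Tc_c_Tl[of M], of "Tar X k \<bullet> tc X (Tob X M) \<bullet> Tar X (tc X M)"] by (simp add: T_conn_def)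
  have "Tar X ?k \<bullet> tl X (Tob X (Tob X M)) = Tar X (tc X M) \<bullet> Tar X (Tar X k) \<bullet> Tar X (tc X (Tob X M)) \<bullet>
      tl X (Tob X (Tob X M)) \<bullet> Tar X (tc X M)"
    using tl_nat[of "tc X M" "Tob X (Tob X M)"] by (simp add: T_conn_def)
  also have "\<dots> = Tar X (tc X M) \<bullet> Tar X (Tar X k) \<bullet>
     (tc X (Tob X (Tob X M)) \<bullet> Tar X (tl X (Tob X M)) \<bullet> tc X (Tob X M)) \<bullet> Tar X (tc X M)"
    by (simp add: c_T_Tc_Tl[THEN extend] c_c)
  also have "\<dots> = Tar X (tc X M) \<bullet> tc X (Tob X M) \<bullet> Tar X (tl X M) \<bullet> Tar X k \<bullet> tc X (Tob X M) \<bullet> Tar X (tc X M)"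
    using extend[OF tc_nat[of k "Tob X M", symmetric]] extend[OF Tk3] by simp
  finally have 3: "Tar X ?k \<bullet> tl X (Tob X (Tob X M)) = tl X (Tob X M) \<bullet> ?k"
    unfolding fin .
  have e: "Tar X (tc X M) \<bullet> tl X (Tob X M) = tc X (Tob X M) \<bullet> Tar X (tl X M) \<bullet> tc X M"
    by (simp add: c_T_Tc_Tl[THEN extend] c_c)
  have Te: "Tar X (Tar X (tc X M)) \<bullet> Tar X (tl X (Tob X M)) =
    Tar X (tc X (Tob X M)) \<bullet> Tar X (Tar X (tl X M)) \<bullet> Tar X (tc X M)"
    using arg_cong[OF e, of "Tar X"] by simp
  have "Tar X ?k \<bullet> tc X (Tob X (Tob X M)) \<bullet> Tar X (tl X (Tob X M)) =
     Tar X (tc X M) \<bullet> Tar X (Tar X k) \<bullet> Tar X (tc X (Tob X M)) \<bullet>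
       tc X (Tob X (Tob X M)) \<bullet> Tar X (Tar X (tc X M)) \<bullet> Tar X (tl X (Tob X M))"
    using extend[OF tc_nat[of "tc X M" "Tob X (Tob X M)", symmetric]] by (simp add: T_conn_def)
  also have "\<dots> = Tar X (tc X M) \<bullet> Tar X (Tar X k) \<bullet> (Tar X (tc X (Tob X M)) \<bullet>
       tc X (Tob X (Tob X M)) \<bullet> Tar X (tc X (Tob X M))) \<bullet> Tar X (Tar X (tl X M)) \<bullet> Tar X (tc X M)"
    unfolding Te by simp
  also have "\<dots> = Tar X (tc X M) \<bullet> (Tar X (Tar X k) \<bullet> tc X (Tob X (Tob X M))) \<bullet>
       Tar X (tc X (Tob X M)) \<bullet> (tc X (Tob X (Tob X M)) \<bullet> Tar X (Tar X (tl X M))) \<bullet> Tar X (tc X M)"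
    by (subst braid) simp_all
  also have "\<dots> = Tar X (tc X M) \<bullet> tc X (Tob X M) \<bullet>
       (Tar X (Tar X k) \<bullet> Tar X (tc X (Tob X M)) \<bullet> Tar X (Tar X (tl X M))) \<bullet> tc X (Tob X M) \<bullet> Tar X (tc X M)"
    using tc_nat[of k "Tob X M", symmetric] tc_nat[of "tl X M" "Tob X (Tob X M)"] by simp
  also have "\<dots> = Tar X (tc X M) \<bullet> tc X (Tob X M) \<bullet> Tar X (tl X M) \<bullet> Tar X k \<bullet> tc X (Tob X M) \<bullet> Tar X (tc X M)"
    unfolding Tk4 by simp
  finally have 4: "Tar X ?k \<bullet> tc X (Tob X (Tob X M)) \<bullet> Tar X (tl X (Tob X M)) = tl X (Tob X M) \<bullet> ?k"
    unfolding fin .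
  show ?thesis
    unfolding vertical_connection_def using 1 2 3 4 by (simp add: hom_def) (simp add: T_conn_def)
qed

lemma is_str_T: "\<lbrakk>M \<in> Ob X; is_str b X M x\<rbrakk> \<Longrightarrow> is_str b X (Tob X M) (T_str b X M x)"
  by (simp add: is_str_def T_str_def is_str_T_field is_str_T_conn)

lemma T_str_typed:
  assumes "M \<in> Ob X" "x \<in> Ar X" "Dom X x = J_ob b X M" "Cod X x = Tob X M"
  shows "T_str b X M x \<in> Ar X" "Dom X (T_str b X M x) = J_ob b X (Tob X M)" "Cod X (T_str b X M x) =
    Tob X (Tob X M)"
  using assms by (simp_all add: T_str_eq)

lemma str_mor_cmp:
  assumes "f \<in> Ar X" "g \<in> Ar X" "Cod X f = Dom X g"
    and "x \<in> Ar X" "Dom X x = J_ob b X (Dom X f)" "Cod X x = Tob X (Dom X f)"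
    and "y \<in> Ar X" "Dom X y = J_ob b X (Dom X g)" "Cod X y = Tob X (Dom X g)"
    and "z \<in> Ar X" "Dom X z = J_ob b X (Cod X g)" "Cod X z = Tob X (Cod X g)"
    and "str_mor b X x f y" "str_mor b X y g z"
  shows "str_mor b X x (g \<bullet> f) z"
  using assms extend[of z "J_ar b X g" "Tar X g \<bullet> y" "J_ar b X f"] by (simp add: str_mor_def)

text \<open>All structure arrows of \<open>X\<close> are compatible with the induced structures: each equation combines
  naturality of the structure arrow at \<open>x\<close>, the axiom for the flip, and the axiom for \<open>J\<close> as a tangent
  morphism.\<close>

context
  fixes M x b
  assumes M [simp]: "M \<in> Ob X" and x [simp]: "x \<in> Ar X" "Dom X x = J_ob b X M" "Cod X x = Tob X M"
begin

lemma str_mor_T: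
  assumes "f \<in> Ar X" "Cod X f = M" "Dom X f = N" "y \<in> Ar X" "Dom X y = J_ob b X N" "Cod X y = Tob X N"
    "str_mor b X y f x"
  shows "str_mor b X (T_str b X N y) (Tar X f) (T_str b X M x)"
proof -
  have N: "N \<in> Ob X" using assms(1,3) by auto
  have "Tar X x \<bullet> Tar X (J_ar b X f) = Tar X (Tar X f) \<bullet> Tar X y"
    using arg_cong[OF assms(7)[unfolded str_mor_def], of "Tar X"] assms by simp
  from extend[OF this, of "J_law b X N"] show ?thesis
    using assms N by (simp add: str_mor_def T_str_eq J_law_nat tc_nat[THEN extend])
qed

lemma str_mor_tp: "str_mor b X (T_str b X M x) (tp X M) x"
  by (simp add: str_mor_def T_str_eq Tp_c[THEN extend] tp_nat[THEN extend] p_J_law)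

lemma str_mor_tz: "str_mor b X x (tz X M) (T_str b X M x)"
  using tz_nat[of x, symmetric] by (simp add: str_mor_def T_str_eq J_law_z c_z[THEN extend])

lemma str_mor_tl: "str_mor b X (T_str b X M x) (tl X M) (T_str b X (Tob X M) (T_str b X M x))"
proof -
  have "tc X (Tob X M) \<bullet> Tar X (tc X M) \<bullet> Tar X (Tar X x) \<bullet> (Tar X (J_law b X M) \<bullet> J_law b X (Tob X M) \<bullet>
    J_ar b X (tl X M))
    = (tc X (Tob X M) \<bullet> Tar X (tc X M) \<bullet> tl X (Tob X M)) \<bullet> Tar X x \<bullet> J_law b X M"
    unfolding l_J_law[OF M] using extend[OF tl_nat[of x "Tob X M", symmetric], of "J_law b X M"] by simp
  also have "\<dots> = Tar X (tl X M) \<bullet> tc X M \<bullet> Tar X x \<bullet> J_law b X M"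
    by (simp only: c_Tc_l[OF M]) simp
  finally show ?thesis by (simp add: str_mor_def T_str_eq)
qed

lemma str_mor_tc: "str_mor b X (T_str b X (Tob X M) (T_str b X M x)) (tc X M) (T_str b X (Tob X M) (T_str
  b X M x))"
proof -
  have "tc X (Tob X M) \<bullet> Tar X (tc X M) \<bullet> Tar X (Tar X x) \<bullet> (Tar X (J_law b X M) \<bullet> J_law b X (Tob X M) \<bullet>
    J_ar b X (tc X M))
    = (tc X (Tob X M) \<bullet> Tar X (tc X M) \<bullet> tc X (Tob X M)) \<bullet> Tar X (Tar X x) \<bullet> Tar X (J_law b X M) \<bullet> J_law b
      X (Tob X M)"
    unfolding c_J_law[OF M] using extend[OF tc_nat[of x "Tob X M", symmetric], of "Tar X (J_law b X M) \<bullet>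
      J_law b X (Tob X M)"] by simp
  also have "\<dots> = Tar X (tc X M) \<bullet> tc X (Tob X M) \<bullet> Tar X (tc X M) \<bullet> Tar X (Tar X x) \<bullet> Tar X (J_law b X M)
    \<bullet> J_law b X (Tob X M)"
    by (simp only: braid[OF M, symmetric]) simp
  finally show ?thesis by (simp add: str_mor_def T_str_eq)
qed

lemma T2_str_fibre:
  "Tar X (tp X M) \<bullet> (T_str b X M x \<bullet> J_ar b X (pr1 X M)) = Tar X (tp X M) \<bullet> (T_str b X M x \<bullet> J_ar b X (pr2
    X M))"
proof -
  have 1: "Tar X (tp X M) \<bullet> T_str b X M x = x \<bullet> J_ar b X (tp X M)"
    using str_mor_tp by (simp add: str_mor_def)
  have 2: "J_ar b X (tp X M) \<bullet> J_ar b X (pr1 X M) = J_ar b X (tp X M) \<bullet> J_ar b X (pr2 X M)"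
    using J_ar_eq[OF p_pr2[OF M], of b] by simp
  show ?thesis using extend[OF 1] 2 by (simp add: T_str_typed)
qed

lemma T2_str_typed [simp]:
  "T2_str b X M x \<in> Ar X" "Dom X (T2_str b X M x) = J_ob b X (T2 X M)" "Cod X (T2_str b X M x) = Tob X (T2 X M)"
  and str_mor_pr1: "str_mor b X (T2_str b X M x) (pr1 X M) (T_str b X M x)"
  and str_mor_pr2: "str_mor b X (T2_str b X M x) (pr2 X M) (T_str b X M x)"
  using T2_str_fibre by (simp_all add: T2_str_def T_str_typed str_mor_def)

lemma str_mor_ts: "str_mor b X (T2_str b X M x) (ts X M) (T_str b X M x)"
proof -
  have f: "tp X (Tob X M) \<bullet> (Tar X x \<bullet> J_law b X M \<bullet> J_ar b X (pr1 X M)) =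
    tp X (Tob X M) \<bullet> (Tar X x \<bullet> J_law b X M \<bullet> J_ar b X (pr2 X M))"
    using J_law_fibre[OF M, of b] by (simp add: tp_nat[THEN extend])
  have "T_str b X M x \<bullet> J_ar b X (ts X M) = tc X M \<bullet> (ts X (Tob X M) \<bullet> pair X (Tob X M)
     (Tar X x \<bullet> J_law b X M \<bullet> J_ar b X (pr1 X M)) (Tar X x \<bullet> J_law b X M \<bullet> J_ar b X (pr2 X M)))"
    using J_law_fibre[OF M, of b] by (simp add: T_str_eq J_law_s add_nat[where B = "Tob X M"])
  then show ?thesis
    using f by (simp add: str_mor_def c_s(1) T2_str_def T_str_eq)
qed

text \<open>\<open>T P\<close> is the pullback of \<open>T p\<close>, and \<open>p\<close> is compatible with the structures. So the structures on \<open>M\<close> and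
  \<open>T M\<close> induce an arrow \<open>J P \<rightarrow> T P\<close> for which all projections are compatible.\<close>

lemma fold_str:
  assumes P: "is_fold_pullback X n (tp X M) P q \<pi>" and ok: "is_str b X M x"
  shows "\<exists>y. is_str b X P y \<and> str_mor b X y q x \<and> (\<forall>j<n. str_mor b X y (\<pi> j) (T_str b X M x))"
proof -
  have t: "q \<in> Ar X" "Dom X q = P" "Cod X q = M"
    "\<And>j. j < n \<Longrightarrow> \<pi> j \<in> Ar X" "\<And>j. j < n \<Longrightarrow> Dom X (\<pi> j) = P" "\<And>j. j < n \<Longrightarrow> Cod X (\<pi> j) = Tob X M"
    "\<And>j. j < n \<Longrightarrow> tp X M \<bullet> \<pi> j = q"
    using P by (auto simp: is_fold_pullback_def hom_def)
  have P_ob: "P \<in> Ob X" using t(1,2) by auto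
  have "is_fold_pullback X n (Tar X (tp X M)) (Tob X P) (Tar X q) (\<lambda>j. Tar X (\<pi> j))"
    using fold_pullback_preserved[OF M P, of 1] by simp
  then have "\<exists>y\<in>hom X (Dom X (x \<bullet> J_ar b X q)) (Tob X P). Tar X q \<bullet> y = x \<bullet> J_ar b X q \<and>
      (\<forall>j<n. Tar X (\<pi> j) \<bullet> y = T_str b X M x \<bullet> J_ar b X (\<pi> j))"
  proof (rule fold_pullback_lift[OF _ category])
    fix j assume j: "j < n"
    have 1: "Tar X (tp X M) \<bullet> T_str b X M x = x \<bullet> J_ar b X (tp X M)"
      using str_mor_tp by (simp add: str_mor_def)
    have 2: "J_ar b X (tp X M) \<bullet> J_ar b X (\<pi> j) = J_ar b X q"
      by (rule J_ar_eq[OF t(7)[OF j]]) (use t j in simp_all)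
    show "Tar X (tp X M) \<bullet> (T_str b X M x \<bullet> J_ar b X (\<pi> j)) = x \<bullet> J_ar b X q"
      using extend[OF 1] 2 t j by (simp add: T_str_typed)
  qed (use t in \<open>simp_all add: T_str_typed\<close>)
  then obtain y where y: "y \<in> Ar X" "Dom X y = J_ob b X P" "Cod X y = Tob X P"
     "str_mor b X y q x" "\<And>j. j < n \<Longrightarrow> str_mor b X y (\<pi> j) (T_str b X M x)"
    using t by (auto simp: hom_def str_mor_def)
  have "is_str b X P y"
  proof (rule is_str_by_monic_legs[OF P_ob y(1-3)])
    let ?L = "insert (q, M, x) ((\<lambda>j. (\<pi> j, Tob X M, T_str b X M x)) ` {..<n})"
    have eq: "fst ` ?L = insert q (\<pi> ` {..<n})" by force
    show "T_monic X P (fst ` ?L)" "T_monic X (Tob X P) (Tar X ` fst ` ?L)"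
      unfolding eq using fold_T_monic[OF M P, of 0] fold_T_monic[OF M P, of 1] by simp_all
    show "l \<in> Ar X \<and> Dom X l = P \<and> Cod X l = N \<and> is_str b X N z \<and> str_mor b X y l z"
      if "(l, N, z) \<in> ?L" for l N z
      using that t ok y(4,5) is_str_T[OF M ok] by auto
  qed
  then show ?thesis using y by auto
qed

lemma is_str_T2:
  assumes ok: "is_str b X M x"
  shows "is_str b X (T2 X M) (T2_str b X M x)"
proof (rule is_str_by_monic_legs)
  let ?L = "{(pr1 X M, Tob X M, T_str b X M x), (pr2 X M, Tob X M, T_str b X M x)}"
  show "T_monic X (T2 X M) (fst ` ?L)" "T_monic X (Tob X (T2 X M)) (Tar X ` fst ` ?L)"
    using T2_T_monic[OF M] TT2_T_monic[OF M] by simp_all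
qed (use is_str_T[OF M ok] str_mor_pr1 str_mor_pr2 in auto)

end

lemma str_mor_lift:
  assumes h: "h \<in> Ar X" "Dom X h = A" "Cod X h = B"
    and x: "x \<in> Ar X" "Dom X x = J_ob b X A" "Cod X x = Tob X A"
    and y: "y \<in> Ar X" "Dom X y = J_ob b X B" "Cod X y = Tob X B"
    and L: "\<And>l N z. (l, N, z) \<in> L \<Longrightarrow> l \<in> Ar X \<and> Dom X l = B \<and> Cod X l = N \<and> z \<in> Ar X \<and> Dom X z = J_ob b X N \<and>
       Cod X z = Tob X N \<and> str_mor b X y l z \<and> str_mor b X x (l \<bullet> h) z"
    and T: "T_monic X B (fst ` L)"
  shows "str_mor b X x h y"
  unfolding str_mor_def
proof (rule T_monicD1[OF T])
  fix l assume "l \<in> fst ` L"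
  then obtain N z where "(l, N, z) \<in> L" by auto
  from L[OF this] have *: "l \<in> Ar X" "Dom X l = B" "Cod X l = N" "z \<in> Ar X" "Dom X z = J_ob b X N"
    "Cod X z = Tob X N"
     "z \<bullet> J_ar b X l = Tar X l \<bullet> y" "z \<bullet> (J_ar b X l \<bullet> J_ar b X h) = Tar X l \<bullet> (Tar X h \<bullet> x)"
    using h x by (auto simp: str_mor_def)
  show "Tar X l \<bullet> (y \<bullet> J_ar b X h) = Tar X l \<bullet> (Tar X h \<bullet> x)"
    using extend[OF *(7), of "J_ar b X h"] * h x y by simp
qed (use h x y in auto)

lemma Str_structures: "structures X (str_objects b X) fst
     (\<lambda>(M, x) f (M', x'). str_mor b X x f x')
     (\<lambda>(M, x). (Tob X M, T_str b X M x))
     (\<lambda>(M, x). (T2 X M, T2_str b X M x))"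
proof unfold_locales
  let ?S = "str_objects b X" and ?R = "\<lambda>(M, x) f (M', x'). str_mor b X x f x'" and ?t =
    "\<lambda>(M, x). (Tob X M, T_str b X M x)"
  fix a c and h :: 'a
  assume a: "a \<in> ?S" and c: "c \<in> ?S" and h: "h \<in> Ar X" "Dom X h = fst a" "Cod X h = fst c"
  show "?R a (f \<bullet> h) d" if "d \<in> ?S" "f \<in> Ar X" "Dom X f = fst c" "Cod X f = fst d" "?R a h c" "?R c f d" for d f
    using that a c h str_mor_cmp[of h f "snd a" b "snd c" "snd d"] is_str_typed[of b]
      by (auto split: prod.splits)
  show "?R (?t a) (Tar X h) (?t c)" if "?R a h c"
    using that a c h str_mor_T[of "fst c" "snd c" b h "fst a" "snd a"] is_str_typed[of b]
      by (auto split: prod.splits)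
  fix L :: "('a \<times> 'o \<times> 'a) set"
  assume L: "\<And>l d. (l, d) \<in> L \<Longrightarrow> d \<in> ?S \<and> l \<in> Ar X \<and> Dom X l = fst c \<and> Cod X l = fst d \<and> ?R c l d \<and>
    ?R a (l \<bullet> h) d"
    and T: "T_monic X (fst c) (fst ` L)"
  have "str_mor b X (snd a) h (snd c)"
  proof (rule str_mor_lift[where L = L and A = "fst a" and B = "fst c"])
    fix l N z assume "(l, N, z) \<in> L"
    then show "l \<in> Ar X \<and> Dom X l = fst c \<and> Cod X l = N \<and> z \<in> Ar X \<and> Dom X z = J_ob b X N \<and>
       Cod X z = Tob X N \<and> str_mor b X (snd c) l z \<and> str_mor b X (snd a) (l \<bullet> h) z"
      using L[of l "(N, z)"] is_str_typed[of b N z] by (auto split: prod.splits)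
  qed (use a c h T is_str_typed[of b] in auto)
  then show "?R a h c" by (simp add: split_beta)
next
  let ?S = "str_objects b X" and ?R = "\<lambda>(M, x) f (M', x'). str_mor b X x f x'" and ?t =
    "\<lambda>(M, x). (Tob X M, T_str b X M x)"
  fix a n P q \<pi> assume "a \<in> ?S" and P: "is_fold_pullback X n (tp X (fst a)) P q \<pi>"
  then obtain M x where a: "a = (M, x)" "M \<in> Ob X" "is_str b X M x" by auto
  then obtain y where "is_str b X P y" "str_mor b X y q x" "\<forall>j<n. str_mor b X y (\<pi> j) (T_str b X M x)"
    using fold_str[of M x b n P q \<pi>] is_str_typed[OF a(3)] P by auto
  moreover have "P \<in> Ob X" using P dom_ob[of q] by (auto simp: is_fold_pullback_def hom_def)
  ultimately show "\<exists>c\<in>?S. fst c = P \<and> ?R c q a \<and> (\<forall>j<n. ?R c (\<pi> j) (?t a))"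
    using a by (intro bexI[of _ "(P, y)"]) auto
qed (auto simp: is_str_T is_str_T2 is_str_typed str_mor_T str_mor_pr1 str_mor_pr2 str_mor_tp str_mor_tz
  str_mor_ts
    str_mor_tl str_mor_tc, auto simp: str_mor_def is_str_typed)

end


section \<open>Structures in categories of tangent morphisms\<close>

context evaluations
begin

lemma E_eq_iff: "\<lbrakk>f \<in> Ar C; g \<in> Ar C; Dom C f = Dom C g; Cod C f = Cod C g\<rbrakk> \<Longrightarrow> f = g \<longleftrightarrow> (\<forall>i\<in>I. Ea i f = Ea i g)"
  using faithful by blast

lemma E_J_ob [simp]: "\<lbrakk>i \<in> I; M \<in> Ob C\<rbrakk> \<Longrightarrow> Eo i (J_ob b C M) = J_ob b X (Eo i M)"
  and E_J_ar [simp]: "\<lbrakk>i \<in> I; f \<in> Ar C\<rbrakk> \<Longrightarrow> Ea i (J_ar b C f) = J_ar b X (Ea i f)"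
  and E_J_law [simp]: "\<lbrakk>i \<in> I; M \<in> Ob C\<rbrakk> \<Longrightarrow> Ea i (J_law b C M) = J_law b X (Eo i M)"
  by (simp_all add: J_ob_def J_ar_def J_law_def)

lemma E_is_str:
  assumes M: "M \<in> Ob C" and x: "x \<in> Ar C" "Dom C x = J_ob b C M" "Cod C x = Tob C M"
  shows "is_str b C M x \<longleftrightarrow> (\<forall>i\<in>I. is_str b X (Eo i M) (Ea i x))"
proof (cases b)
  case True
  then have "is_str b C M x \<longleftrightarrow> tp C M \<cdot>\<^bsub>C\<^esub> x = Idn C M"
    using x by (simp add: is_str_def vector_field_def hom_def J_ob_def)
  also have "\<dots> \<longleftrightarrow> (\<forall>i\<in>I. tp X (Eo i M) \<bullet> Ea i x = Idn X (Eo i M))"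
    by (subst E_eq_iff) (use M x True in \<open>simp_all add: J_ob_def\<close>)
  finally show ?thesis
    using True M x by (simp add: is_str_def vector_field_def hom_def J_ob_def)
next
  case False
  have x': "Dom C x = Tob C (Tob C M)" using x False by (simp add: J_ob_def)
  have "is_str b C M x \<longleftrightarrow> x \<cdot>\<^bsub>C\<^esub> tl C M = Idn C (Tob C M) \<and>
     tp C M \<cdot>\<^bsub>C\<^esub> x = tp C M \<cdot>\<^bsub>C\<^esub> tp C (Tob C M) \<and>
     Tar C x \<cdot>\<^bsub>C\<^esub> tl C (Tob C M) = tl C M \<cdot>\<^bsub>C\<^esub> x \<and>
     Tar C x \<cdot>\<^bsub>C\<^esub> tc C (Tob C M) \<cdot>\<^bsub>C\<^esub> Tar C (tl C M) = tl C M \<cdot>\<^bsub>C\<^esub> x"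
    using x(1,3) x' False by (simp add: is_str_def vertical_connection_def hom_def)
  also have "\<dots> \<longleftrightarrow> (\<forall>i\<in>I. Ea i x \<bullet> tl X (Eo i M) = Idn X (Tob X (Eo i M)) \<and>
     tp X (Eo i M) \<bullet> Ea i x = tp X (Eo i M) \<bullet> tp X (Tob X (Eo i M)) \<and>
     Tar X (Ea i x) \<bullet> tl X (Tob X (Eo i M)) = tl X (Eo i M) \<bullet> Ea i x \<and>
     Tar X (Ea i x) \<bullet> tc X (Tob X (Eo i M)) \<bullet> Tar X (tl X (Eo i M)) = tl X (Eo i M) \<bullet> Ea i x)"
    using M x(1,3) x' by (simp add: E_eq_iff ball_conj_distrib)
  finally show ?thesis
    using False M x(1,3) x' by (simp add: is_str_def vertical_connection_def hom_def)
qed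

lemma E_str_mor:
  assumes "f \<in> Ar C" "x \<in> Ar C" "Dom C x = J_ob b C (Dom C f)" "Cod C x = Tob C (Dom C f)"
    "y \<in> Ar C" "Dom C y = J_ob b C (Cod C f)" "Cod C y = Tob C (Cod C f)"
  shows "str_mor b C x f y \<longleftrightarrow> (\<forall>i\<in>I. str_mor b X (Ea i x) (Ea i f) (Ea i y))"
  unfolding str_mor_def by (subst E_eq_iff) (use assms in simp_all)

lemma E_T_str:
  assumes "M \<in> Ob C" "x \<in> Ar C" "Dom C x = J_ob b C M" "Cod C x = Tob C M" "i \<in> I"
  shows "Ea i (T_str b C M x) = T_str b X (Eo i M) (Ea i x)"
  using assms by (simp add: X.T_str_eq T.T_str_eq)

end

lemma mor_eqI:
  assumes "obm F \<in> extensional S" "obm G \<in> extensional S" "arm F \<in> extensional S'" "arm G \<in> extensional S'"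
    "lax F \<in> extensional S" "lax G \<in> extensional S"
    "\<And>A. A \<in> S \<Longrightarrow> obm F A = obm G A" "\<And>f. f \<in> S' \<Longrightarrow> arm F f = arm G f" "\<And>A. A \<in> S \<Longrightarrow> lax F A = lax G A"
  shows "F = (G :: ('x, 'y, 'o, 'a) mor)"
proof (rule mor.equality)
  show "obm F = obm G" "lax F = lax G" by (rule extensionalityI[of _ S]; use assms in auto)+
  show "arm F = arm G" by (rule extensionalityI[of _ S']; use assms in auto)
qed simp

lemma comp_mor_extensional [simp]:
  "obm (comp_mor X' Y G F) \<in> extensional (Ob X')" "arm (comp_mor X' Y G F) \<in> extensional (Ar X')"
  "lax (comp_mor X' Y G F) \<in> extensional (Ob X')"
  by (simp_all add: comp_mor_def)

lemma Tbar_extensional [simp]: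
  "obm (Tbar X' Y F) \<in> extensional (Ob X')" "arm (Tbar X' Y F) \<in> extensional (Ar X')"
  "lax (Tbar X' Y F) \<in> extensional (Ob X')"
  by (simp_all add: Tbar_def)

text \<open>Here lies the reason for the universal property. Naturality of \<open>\<phi> : J F \<rightarrow> T F\<close> says that the
  arrows \<open>F f\<close> are compatible with the structures \<open>\<phi>\<^sub>A\<close>. Compatibility with the distributive laws
  becomes, after composition with the flip, compatibility of the arrows \<open>\<alpha>\<^sub>A : F T' A \<rightarrow> T F A\<close>. So \<open>\<phi>\<close> is
  exactly what lifts \<open>F\<close> to structured objects.\<close>

context lax_morphism
begin

lemma J_HOM:
  "A \<in> Ob X' \<Longrightarrow> obm (J_ob b (HOM X' X) F) A = J_ob b X (obm F A)"
  "f \<in> Ar X' \<Longrightarrow> arm (J_ob b (HOM X' X) F) f = J_ar b X (arm F f)"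
  "A \<in> Ob X' \<Longrightarrow> lax (J_ob b (HOM X' X) F) A = J_law b X (obm F A) \<bullet> J_ar b X (lax F A)"
  by (simp_all add: J_ob_def J_ar_def J_law_def HOM_simps)

lemma str_arrow_iff:
  "tangent_nat X' X (J_ob b (HOM X' X) F) (Tbar X' X F) \<phi> \<longleftrightarrow> \<phi> \<in> extensional (Ob X') \<and>
    (\<forall>A\<in>Ob X'. \<phi> A \<in> Ar X \<and> Dom X (\<phi> A) = J_ob b X (obm F A) \<and> Cod X (\<phi> A) = Tob X (obm F A)) \<and>
    (\<forall>f\<in>Ar X'. str_mor b X (\<phi> (Dom X' f)) (arm F f) (\<phi> (Cod X' f))) \<and>
    (\<forall>A\<in>Ob X'. str_mor b X (\<phi> (Tob X' A)) (lax F A) (T_str b X (obm F A) (\<phi> A)))"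
proof -
  have "Tar X (\<phi> A) \<bullet> (J_law b X (obm F A) \<bullet> J_ar b X (lax F A)) =
    tc X (obm F A) \<bullet> Tar X (lax F A) \<bullet> \<phi> (Tob X' A) \<longleftrightarrow>
     str_mor b X (\<phi> (Tob X' A)) (lax F A) (T_str b X (obm F A) (\<phi> A))" (is "?l = ?r \<longleftrightarrow> _")
    if A: "A \<in> Ob X'" and \<phi>: "\<And>A. A \<in> Ob X' \<Longrightarrow> \<phi> A \<in> Ar X \<and> Dom X (\<phi> A) = J_ob b X (obm F A) \<and>
      Cod X (\<phi> A) = Tob X (obm F A)" for A
  proof -
    note [simp] = A \<phi>[THEN conjunct1] \<phi>[THEN conjunct2, THEN conjunct1] \<phi>[THEN conjunct2, THEN conjunct2]
    have "?l = ?r \<longleftrightarrow> tc X (obm F A) \<bullet> ?l = tc X (obm F A) \<bullet> ?r"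
    proof
      assume "tc X (obm F A) \<bullet> ?l = tc X (obm F A) \<bullet> ?r"
      then have "tc X (obm F A) \<bullet> (tc X (obm F A) \<bullet> ?l) = tc X (obm F A) \<bullet> (tc X (obm F A) \<bullet> ?r)"
        by (simp only:)
      then show "?l = ?r" by simp
    qed simp
    also have "\<dots> \<longleftrightarrow> str_mor b X (\<phi> (Tob X' A)) (lax F A) (T_str b X (obm F A) (\<phi> A))"
      by (simp add: str_mor_def B.T_str_eq)
    finally show ?thesis .
  qed
  then show ?thesis
    unfolding tangent_nat_iff by (auto simp: J_HOM str_mor_def)
qed

end

lemma comp_Tbar:
  assumes "tangent_category X'" "tangent_category V" "tangent_category X"
    "tangent_morphism X' V H" "tangent_morphism V X U"
  shows "comp_mor X' X (Tbar V X U) H = Tbar X' X (comp_mor X' X U H)"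
proof -
  interpret H: lax_morphism X' V H by (rule lax_morphismI) fact+
  interpret U: lax_morphism V X U by (rule lax_morphismI) fact+
  show ?thesis by (rule mor_eqI[of _ "Ob X'" _ "Ar X'"]) simp_all
qed

section \<open>Strict isomorphisms\<close>

text \<open>The inverse of a bijective strict tangent morphism is again strict; that it preserves the
  addition follows because it reflects the pairing.\<close>

lemma tangent_isoI:
  fixes C :: "('x, 'y) tang" and D :: "('o, 'a) tang"
  assumes C: "tangent_category C" and D: "tangent_category D" and F: "tangent_morphism C D F"
    and strict: "is_strict C D F"
    and ob: "bij_betw (obm F) (Ob C) (Ob D)" and ar: "bij_betw (arm F) (Ar C) (Ar D)"
  shows "tangent_iso C D F"
proof -
  interpret F: lax_morphism C D F by (rule lax_morphismI) fact+
  define Go where "Go = inv_into (Ob C) (obm F)"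
  define Ga where "Ga = inv_into (Ar C) (arm F)"
  have Go [simp]: "\<And>A. A \<in> Ob C \<Longrightarrow> Go (obm F A) = A" "\<And>A. A \<in> Ob D \<Longrightarrow> obm F (Go A) = A" "\<And>A. A \<in> Ob D \<Longrightarrow>
    Go A \<in> Ob C"
    unfolding Go_def using ob bij_betw_inv_into_left[OF ob] bij_betw_inv_into_right[OF ob]
      bij_betw_inv_into[OF ob, THEN bij_betwE] by auto
  have Ga [simp]: "\<And>A. A \<in> Ar C \<Longrightarrow> Ga (arm F A) = A" "\<And>A. A \<in> Ar D \<Longrightarrow> arm F (Ga A) = A" "\<And>A. A \<in> Ar D \<Longrightarrow>
    Ga A \<in> Ar C"
    unfolding Ga_def using ar bij_betw_inv_into_left[OF ar] bij_betw_inv_into_right[OF ar]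
      bij_betw_inv_into[OF ar, THEN bij_betwE] by auto
  have inj: "f = g" if "f \<in> Ar C" "g \<in> Ar C" "arm F f = arm F g" for f g
    using that Ga(1) by metis
  have inj_ob: "A = B" if "A \<in> Ob C" "B \<in> Ob C" "obm F A = obm F B" for A B
    using that Go(1) by metis
  have st [simp]: "\<And>A. A \<in> Ob C \<Longrightarrow> obm F (Tob C A) = Tob D (obm F A)" "\<And>A. A \<in> Ob C \<Longrightarrow> lax F A =
    Idn D (Tob D (obm F A))"
    "\<And>f. f \<in> Ar C \<Longrightarrow> arm F (Tar C f) = Tar D (arm F f)"
    using strict by (auto simp: is_strict_def)
  have Gd [simp]: "Dom C (Ga f) = Go (Dom D f)" "Cod C (Ga f) = Go (Cod D f)" if "f \<in> Ar D" for f
    using that by (intro inj_ob; simp flip: F.arm_dom F.arm_cod)+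
  have GT [simp]: "Go (Tob D A) = Tob C (Go A)" if "A \<in> Ob D" for A
    using that by (intro inj_ob) simp_all
  have Fst [simp]: "arm F (tp C A) = tp D (obm F A)" "arm F (tz C A) = tz D (obm F A)" "arm F (tl C A) =
    tl D (obm F A)"
     "arm F (tc C A) = tc D (obm F A)" if "A \<in> Ob C" for A
    using F.p_lax[OF that] F.lax_z[OF that] F.l_lax[OF that] F.c_lax[OF that] that by simp_all
  have G: "tangent_morphism D C (strict_mor D C Go Ga)"
  proof (rule tangent_morphismI)
    fix A assume A: "A \<in> Ob D"
    have p: "tp C (Go A) \<cdot>\<^bsub>C\<^esub> Ga (pr1 D A) = tp C (Go A) \<cdot>\<^bsub>C\<^esub> Ga (pr2 D A)"
      by (rule inj) (use A in simp_all)
    have p': "tp D A \<cdot>\<^bsub>D\<^esub> arm F (pr1 C (Go A)) = tp D A \<cdot>\<^bsub>D\<^esub> arm F (pr2 C (Go A))"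
      using F.lax_fibre_prs[of "Go A"] A by simp
    have "arm F (pr1 C (Go A)) \<cdot>\<^bsub>D\<^esub> arm F (pair C (Go A) (Ga (pr1 D A)) (Ga (pr2 D A))) = pr1 D A"
       "arm F (pr2 C (Go A)) \<cdot>\<^bsub>D\<^esub> arm F (pair C (Go A) (Ga (pr1 D A)) (Ga (pr2 D A))) = pr2 D A"
      using A p by (simp_all flip: F.arm_cmp)
    then have "Ga (ts D A) = ts C (Go A) \<cdot>\<^bsub>C\<^esub> pair C (Go A) (Ga (pr1 D A)) (Ga (pr2 D A))"
      using F.lax_add[of "Go A" "Ga (pr1 D A)" "Ga (pr2 D A)"] A p p'
      by (intro inj) (simp_all add: F.B.pair_prs)
    then show "lax (strict_mor D C Go Ga) A \<cdot>\<^bsub>C\<^esub> arm (strict_mor D C Go Ga) (ts D A) =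
         ts C (obm (strict_mor D C Go Ga) A) \<cdot>\<^bsub>C\<^esub>
           pair C (obm (strict_mor D C Go Ga) A) (lax (strict_mor D C Go Ga) A \<cdot>\<^bsub>C\<^esub> arm (strict_mor D C Go
             Ga) (pr1 D A))
             (lax (strict_mor D C Go Ga) A \<cdot>\<^bsub>C\<^esub> arm (strict_mor D C Go Ga) (pr2 D A))"
      using A p by (simp add: strict_mor_def)
  qed (simp_all add: strict_mor_def, (rule inj; simp)+)
  have GI: "Ga (Idn D A) = Idn C (Go A)" if "A \<in> Ob D" for A
    by (rule inj) (use that in simp_all)
  have "comp_mor C C (strict_mor D C Go Ga) F = id_mor C" "comp_mor D D F (strict_mor D C Go Ga) = id_mor D"
    by (rule mor_eqI[of _ "Ob C" _ "Ar C"] mor_eqI[of _ "Ob D" _ "Ar D"];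
      simp add: id_mor_def strict_mor_def GI)+
  then show ?thesis unfolding tangent_iso_def using C D F G by blast
qed

section \<open>The universal property of structured objects\<close>

text \<open>The common form of the forgetful morphisms and universal structures for vector fields and
  connections.\<close>

definition forget :: "bool \<Rightarrow> ('o, 'a) tang \<Rightarrow> ('o \<times> 'a, ('o \<times> 'a, 'a) marr, 'o, 'a) mor" where
  "forget b X = strict_mor (Str b X) X fst body"

definition universal_str :: "bool \<Rightarrow> ('o, 'a) tang \<Rightarrow> (('o \<times> 'a, ('o \<times> 'a, 'a) marr, 'o, 'a) mor, 'o \<times> 'a \<Rightarrow>
  'a) marr" where
  "universal_str b X = MArr (J_ob b (HOM (Str b X) X) (forget b X)) (\<lambda>a\<in>Ob (Str b X). snd a) (Tob (HOM
    (Str b X) X) (forget b X))"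

lemma forget_eq: "VF_forget X = forget True X" "VAC_forget X = forget False X"
  by (simp_all add: VF_forget_def VAC_forget_def forget_def VF_eq_Str VAC_eq_Str)

lemma universal_str_eq: "VF_univ X = universal_str True X" "VAC_univ X = universal_str False X"
  by (simp_all add: VF_univ_def VAC_univ_def universal_str_def forget_eq VF_eq_Str VAC_eq_Str J_ob_def)

locale str_universal = X': tangent X' + X: tangent X for X' :: "('x, 'y) tang" and X :: "('o, 'a) tang"
  (structure) +
  fixes b :: bool
begin

sublocale S: structures X "str_objects b X" fst "\<lambda>(M, x) f (M', x'). str_mor b X x f x'"
    "\<lambda>(M, x). (Tob X M, T_str b X M x)" "\<lambda>(M, x). (T2 X M, T2_str b X M x)"
  rewrites "structured X (str_objects b X) fst (\<lambda>(M, x) f (M', x'). str_mor b X x f x')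
    (\<lambda>(M, x). (Tob X M, T_str b X M x)) (\<lambda>(M, x). (T2 X M, T2_str b X M x)) = Str b X"
  by (rule X.Str_structures) (simp add: Str_def)

text \<open>\<open>HX\<close> and \<open>HS\<close> are the categories of tangent morphisms from \<open>X'\<close> to \<open>X\<close> and to structured objects of
  \<open>X\<close>, and \<open>E\<close> consists of the structured objects of \<open>HX\<close>. The claim is that \<open>HS\<close> and \<open>E\<close> are
  isomorphic.\<close>

abbreviation "HX \<equiv> HOM X' X"
abbreviation "HS \<equiv> HOM X' (Str b X)"
abbreviation "E \<equiv> Str b HX"
abbreviation "U \<equiv> forget b X"

sublocale HX: evaluations X HX "Ob X'" "\<lambda>A F. obm F A" "\<lambda>A \<phi>. body \<phi> A"
  by (rule HOM_evaluations) (rule X'.tangent X.tangent)+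

sublocale SC: tangent "Str b X"
  by unfold_locales (rule S.structured_tangent_category)

sublocale HS: evaluations "Str b X" HS "Ob X'" "\<lambda>A F. obm F A" "\<lambda>A \<phi>. body \<phi> A"
  by (rule HOM_evaluations) (rule X'.tangent SC.tangent)+

sublocale ES: structures HX "str_objects b HX" fst "\<lambda>(M, x) f (M', x'). str_mor b HX x f x'"
    "\<lambda>(M, x). (Tob HX M, T_str b HX M x)" "\<lambda>(M, x). (T2 HX M, T2_str b HX M x)"
  rewrites "structured HX (str_objects b HX) fst (\<lambda>(M, x) f (M', x'). str_mor b HX x f x')
    (\<lambda>(M, x). (Tob HX M, T_str b HX M x)) (\<lambda>(M, x). (T2 HX M, T2_str b HX M x)) = E"
  by (rule HX.T.Str_structures) (simp add: Str_def)

sublocale E: evaluations HX E "{()}" "\<lambda>_. fst" "\<lambda>_. body"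
  by (rule ES.structured_evaluations)

lemma forget_morphism: "tangent_morphism (Str b X) X U"
  unfolding forget_def by (rule S.U_morphism)

lemma forget_strict: "is_strict (Str b X) X U"
  unfolding forget_def by (rule S.U_strict)

lemma Str_Ob: "Ob (Str b Y) = {(M, x). M \<in> Ob Y \<and> is_str b Y M x}"
  by (simp add: Str_def structured_simps)

lemma Str_Ar: "f \<in> Ar (Str b Y) \<longleftrightarrow> src f \<in> Ob (Str b Y) \<and> tgt f \<in> Ob (Str b Y) \<and> body f \<in> Ar Y \<and>
   Dom Y (body f) = fst (src f) \<and> Cod Y (body f) = fst (tgt f) \<and>
     str_mor b Y (snd (src f)) (body f) (snd (tgt f))"
  unfolding Str_def structured_simps structured_Ar by (auto simp: split_beta)

lemma Str_simps:
  "Dom (Str b Y) = src" "Cod (Str b Y) = tgt"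
  "Idn (Str b Y) = (\<lambda>a. MArr a (Idn Y (fst a)) a)"
  "Cmp (Str b Y) = (\<lambda>g f. MArr (src f) (body g \<cdot>\<^bsub>Y\<^esub> body f) (tgt g))"
  "Tob (Str b Y) = (\<lambda>(M, x). (Tob Y M, T_str b Y M x))"
  "Tar (Str b Y) f = MArr (Tob (Str b Y) (src f)) (Tar Y (body f)) (Tob (Str b Y) (tgt f))"
  by (simp_all add: Str_def structured_simps)

text \<open>The universal structure whiskered with \<open>H\<close>, in a form that shows its components.\<close>

definition lift_str :: "('x, 'y, 'o \<times> 'a, ('o \<times> 'a, 'a) marr) mor \<Rightarrow> (('x, 'y, 'o, 'a) mor, 'x \<Rightarrow> 'a) marr" where
  "lift_str H = MArr (J_ob b HX (comp_mor X' X U H)) (\<lambda>A\<in>Ob X'. snd (obm H A)) (Tbar X' X (comp_mor X' X U H))"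

lemma comp_forget:
  assumes "tangent_morphism X' (Str b X) H"
  shows "tangent_morphism X' X (comp_mor X' X U H)"
    "A \<in> Ob X' \<Longrightarrow> obm (comp_mor X' X U H) A = fst (obm H A)"
    "f \<in> Ar X' \<Longrightarrow> arm (comp_mor X' X U H) f = body (arm H f)"
    "A \<in> Ob X' \<Longrightarrow> lax (comp_mor X' X U H) A = body (lax H A)"
  using comp_mor_morphism[OF X'.tangent SC.tangent X.tangent assms forget_morphism]
     S.comp_U_simps[OF X'.tangent assms] unfolding forget_def by auto

lemma whisker_universal_str:
  assumes H: "tangent_morphism X' (Str b X) H"
  shows "whisker_right X' X (universal_str b X) H = lift_str H"
proof -
  interpret H: lax_morphism X' "Str b X" H by (rule lax_morphismI[OF X'.tangent SC.tangent H])
  note T = comp_Tbar[OF X'.tangent SC.tangent X.tangent H]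
  have "(\<lambda>A\<in>Ob X'. body (universal_str b X) (obm H A)) = (\<lambda>A\<in>Ob X'. snd (obm H A))"
    by (auto simp: universal_str_def restrict_def fun_eq_iff)
  moreover have "comp_mor X' X (J_ob b (HOM (Str b X) X) U) H = J_ob b HX (comp_mor X' X U H)"
    using T[OF forget_morphism] T[OF Tbar_morphism[OF SC.tangent X.tangent forget_morphism]]
    by (cases b) (simp_all add: J_ob_def HOM_simps)
  ultimately show ?thesis
    using T[OF forget_morphism] by (simp add: whisker_right_def lift_str_def universal_str_def HOM_simps)
qed

text \<open>The arrows \<open>H f\<close> and the laws of \<open>H\<close> are compatible with the structures of the objects \<open>H A\<close>. By
  \<open>str_arrow_iff\<close> this means that these structures form an arrow of \<open>HX\<close>. The next lemma reads the
  same equivalence backwards.\<close>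

lemma lift_str_object:
  assumes H: "tangent_morphism X' (Str b X) H"
  shows "(comp_mor X' X U H, lift_str H) \<in> Ob E"
proof -
  interpret H: lax_morphism X' "Str b X" H by (rule lax_morphismI[OF X'.tangent SC.tangent H])
  let ?F = "comp_mor X' X U H"
  note F = comp_forget[OF H]
  interpret F: lax_morphism X' X ?F by (rule lax_morphismI[OF X'.tangent X.tangent F(1)])
  have HA: "fst (obm H A) \<in> Ob X" "is_str b X (fst (obm H A)) (snd (obm H A))" if "A \<in> Ob X'" for A
    using H.obm_ob[OF that] by (auto simp: Str_Ob)
  have "tangent_nat X' X (J_ob b HX ?F) (Tbar X' X ?F) (\<lambda>A\<in>Ob X'. snd (obm H A))"
    unfolding F.str_arrow_iff
  proof (intro conjI ballI)
    fix f assume f: "f \<in> Ar X'"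
    show "str_mor b X ((\<lambda>A\<in>Ob X'. snd (obm H A)) (Dom X' f)) (arm ?F f) ((\<lambda>A\<in>Ob X'. snd (obm H A)) (Cod X' f))"
      using H.arm_ar[OF f] H.arm_dom[OF f] H.arm_cod[OF f] f unfolding Str_simps Str_Ar by (simp add: F
        del: comp_mor_simps)
  next
    fix A assume A: "A \<in> Ob X'"
    show "str_mor b X ((\<lambda>A\<in>Ob X'. snd (obm H A)) (Tob X' A)) (lax ?F A) (T_str b X (obm ?F A) ((\<lambda>A\<in>Ob X'.
      snd (obm H A)) A))"
      using H.lax_ar[OF A] H.lax_dom[OF A] H.lax_cod[OF A] A unfolding Str_simps Str_Ar by (simp add: F
        split_beta del: comp_mor_simps)
  qed (use HA X.is_str_typed[OF HA(2)] in \<open>auto simp: F simp del: comp_mor_simps\<close>)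
  then have ar: "lift_str H \<in> Ar HX"
    using F(1) HX.T.J_ob_ob[of ?F b] Tbar_morphism[OF X'.tangent X.tangent F(1)]
      by (simp add: lift_str_def HOM_Ar HOM_simps)
  have "is_str b HX ?F (lift_str H)"
    by (subst HX.E_is_str) (use F(1) ar in \<open>simp_all add: lift_str_def HOM_simps F HA del: comp_mor_simps\<close>)
  then show ?thesis using F(1) by (simp add: Str_Ob HOM_simps)
qed

lemma object_lift_str:
  assumes "(F, x) \<in> Ob E"
  shows "\<exists>H. tangent_morphism X' (Str b X) H \<and> comp_mor X' X U H = F \<and> lift_str H = x"
proof -
  have F: "tangent_morphism X' X F" and x: "is_str b HX F x" and F': "F \<in> Ob HX"
    using assms by (auto simp: Str_Ob HOM_simps)
  interpret F: lax_morphism X' X F by (rule lax_morphismI[OF X'.tangent X.tangent F])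
  note xt = HX.T.is_str_typed[OF x]
  have ok: "is_str b X (obm F A) (body x A)" if "A \<in> Ob X'" for A
    using HX.E_is_str[OF F' xt] x that by simp
  have x_eq: "src x = J_ob b HX F" "tgt x = Tbar X' X F" using xt by (simp_all add: HOM_simps)
  have nat: "tangent_nat X' X (J_ob b HX F) (Tbar X' X F) (body x)"
    using xt(1) x_eq by (simp add: HOM_Ar)
  note nat' = nat[unfolded F.str_arrow_iff]
  define Ho where "Ho A = (obm F A, body x A)" for A
  define H where "H = \<lparr>obm = restrict Ho (Ob X'), arm = (\<lambda>f\<in>Ar X'. MArr (Ho (Dom X' f)) (arm F f) (Ho (Cod
    X' f))),
    lax = (\<lambda>A\<in>Ob X'. MArr (Ho (Tob X' A)) (lax F A) (Tob (Str b X) (Ho A)))\<rparr>"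
  have H: "tangent_morphism X' (Str b X) H"
    by (rule S.morphism_into_structured[OF X'.tangent F])
      (use nat' ok in \<open>simp_all add: H_def Ho_def Str_simps\<close>)
  moreover have "comp_mor X' X U H = F"
    by (rule mor_eqI[of _ "Ob X'" _ "Ar X'"])
      (simp_all add: comp_forget[OF H] F.ext_obm F.ext_arm F.ext_lax del: comp_mor_simps, simp_all add:
        H_def Ho_def)
  moreover from this have "lift_str H = x"
    using x_eq nat' by (intro marr.expand) (auto simp: lift_str_def H_def Ho_def extensional_def fun_eq_iff)
  ultimately show ?thesis by blast
qed

lemma morphism_str_eqI:
  assumes H: "tangent_morphism X' (Str b X) H" and G: "tangent_morphism X' (Str b X) G"
    and eq: "comp_mor X' X U H = comp_mor X' X U G" "lift_str H = lift_str G"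
  shows "H = G"
proof -
  interpret H: lax_morphism X' "Str b X" H by (rule lax_morphismI[OF X'.tangent SC.tangent H])
  interpret G: lax_morphism X' "Str b X" G by (rule lax_morphismI[OF X'.tangent SC.tangent G])
  have o: "obm H A = obm G A" if "A \<in> Ob X'" for A
    using comp_forget(2)[OF H that] comp_forget(2)[OF G that] eq(1)
      fun_cong[OF arg_cong[OF eq(2), of body], of A] that by (simp add: prod_eq_iff lift_str_def del:
        comp_mor_simps)
  show ?thesis
  proof (rule mor_eqI[of _ "Ob X'" _ "Ar X'"])
    fix f assume f: "f \<in> Ar X'"
    show "arm H f = arm G f"
      using comp_forget(3)[OF H f] comp_forget(3)[OF G f] eq(1) o[of "Dom X' f"] o[of "Cod X' f"] f
        H.arm_dom[OF f] H.arm_cod[OF f] G.arm_dom[OF f] G.arm_cod[OF f]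
          by (intro marr.expand) (simp add: Str_simps del: comp_mor_simps)
  next
    fix A assume A: "A \<in> Ob X'"
    show "lax H A = lax G A"
      using comp_forget(4)[OF H A] comp_forget(4)[OF G A] eq(1) o[of A] o[of "Tob X' A"] A
        H.lax_dom[OF A] H.lax_cod[OF A] G.lax_dom[OF A] G.lax_cod[OF A]
          by (intro marr.expand) (simp add: Str_simps del: comp_mor_simps)
  qed (use o in \<open>simp_all add: H.ext_obm H.ext_arm H.ext_lax G.ext_obm G.ext_arm G.ext_lax\<close>)
qed

abbreviation "comparison \<equiv> induced X' X (Str b X) E U (universal_str b X)"
abbreviation "\<Gamma> H \<equiv> (comp_mor X' X U H, lift_str H)"

lemma comparison_simps:
  "tangent_morphism X' (Str b X) H \<Longrightarrow> obm comparison H = \<Gamma> H"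
  "\<phi> \<in> Ar HS \<Longrightarrow> arm comparison \<phi> = MArr (\<Gamma> (src \<phi>)) (whisker_left X' X U \<phi>) (\<Gamma> (tgt \<phi>))"
  by (auto simp: induced_def Let_def HOM_simps whisker_universal_str HOM_Ar)

lemma comparison_bij_ob: "bij_betw (obm comparison) (Ob HS) (Ob E)"
  unfolding bij_betw_def
proof
  show "inj_on (obm comparison) (Ob HS)"
    by (rule inj_onI) (auto simp: HOM_simps comparison_simps intro: morphism_str_eqI)
  show "obm comparison ` Ob HS = Ob E"
  proof
    show "obm comparison ` Ob HS \<subseteq> Ob E" by (auto simp: HOM_simps comparison_simps lift_str_object)
    show "Ob E \<subseteq> obm comparison ` Ob HS"
    proof
      fix e assume e: "e \<in> Ob E"
      obtain F x where [simp]: "e = (F, x)" by (cases e)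
      obtain H where "tangent_morphism X' (Str b X) H" "comp_mor X' X U H = F" "lift_str H = x"
        using object_lift_str[of F x] e by auto
      then show "e \<in> obm comparison ` Ob HS" by (intro image_eqI[of _ _ H]) (auto simp: comparison_simps
        HOM_simps)
    qed
  qed
qed

lemma whisker_left_body: "\<phi> \<in> Ar HS \<Longrightarrow> body (whisker_left X' X U \<phi>) = (\<lambda>A\<in>Ob X'. body (body \<phi> A))"
  using HOM_body[of \<phi> X' "Str b X"] by (auto simp: whisker_left_def forget_def strict_mor_def restrict_def
    fun_eq_iff)

lemma lift_str_typed:
  assumes H: "tangent_morphism X' (Str b X) H"
  shows "lift_str H \<in> Ar HX" "src (lift_str H) = J_ob b HX (comp_mor X' X U H)" "tgt (lift_str H) =
    Tbar X' X (comp_mor X' X U H)"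
  using lift_str_object[OF H] HX.T.is_str_typed[of b "comp_mor X' X U H" "lift_str H"]
    by (auto simp: Str_Ob HOM_simps)

text \<open>Compatibility with the structures is a pointwise condition on both sides.\<close>

lemma comparison_arrow_iff:
  assumes H: "tangent_morphism X' (Str b X) H" and G: "tangent_morphism X' (Str b X) G"
    and \<phi>: "\<phi> \<in> extensional (Ob X')" "\<And>A. A \<in> Ob X' \<Longrightarrow> \<phi> A = MArr (obm H A) (body (\<phi> A)) (obm G A)"
  shows "MArr H \<phi> G \<in> Ar HS \<longleftrightarrow>
    MArr (\<Gamma> H) (MArr (comp_mor X' X U H) (\<lambda>A\<in>Ob X'. body (\<phi> A)) (comp_mor X' X U G)) (\<Gamma> G) \<in> Ar E"
proof -
  let ?f = "MArr (comp_mor X' X U H) (\<lambda>A\<in>Ob X'. body (\<phi> A)) (comp_mor X' X U G)"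
  note UH = comp_forget[OF H] and UG = comp_forget[OF G]
  have 1: "MArr (\<Gamma> H) ?f (\<Gamma> G) \<in> Ar E \<longleftrightarrow> ?f \<in> Ar HX \<and> str_mor b HX (lift_str H) ?f (lift_str G)"
    using lift_str_object[OF H] lift_str_object[OF G] by (simp add: Str_Ar HOM_simps)
  have 2: "str_mor b HX (lift_str H) ?f (lift_str G) \<longleftrightarrow> (\<forall>A\<in>Ob X'. str_mor b X (snd (obm H A)) (body (\<phi> A))
    (snd (obm G A)))"
    if "?f \<in> Ar HX"
    by (subst HX.E_str_mor) (use that lift_str_typed[OF H] lift_str_typed[OF G]
      in \<open>simp_all add: HOM_simps\<close>, simp add: lift_str_def)
  have 3: "?f \<in> Ar HX \<longleftrightarrow> tangent_nat X' X (comp_mor X' X U H) (comp_mor X' X U G) (\<lambda>A\<in>Ob X'. body (\<phi> A))"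
    using UH UG by (simp add: HOM_Ar)
  have 4: "MArr H \<phi> G \<in> Ar HS \<longleftrightarrow> tangent_nat X' (Str b X) H G \<phi>"
    using H G by (simp add: HOM_Ar)
  show ?thesis
    using 1 2 3 4 S.tangent_nat_structured[OF X'.tangent H G, of \<phi>] \<phi> unfolding forget_def[symmetric]
      by (auto simp: split_beta)
qed

lemma HS_arrow:
  assumes "\<phi> \<in> Ar HS"
  shows "tangent_morphism X' (Str b X) (src \<phi>)" "tangent_morphism X' (Str b X) (tgt \<phi>)"
    "body \<phi> \<in> extensional (Ob X')" "A \<in> Ob X' \<Longrightarrow> body \<phi> A = MArr (obm (src \<phi>) A) (body (body \<phi> A)) (obm
      (tgt \<phi>) A)"
  using assms S.tangent_nat_structured[OF X'.tangent, of "src \<phi>" "tgt \<phi>" "body \<phi>"] by (auto simp: HOM_Ar)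

lemma arm_comparison_eq: "\<phi> \<in> Ar HS \<Longrightarrow> arm comparison \<phi> = MArr (\<Gamma> (src \<phi>))
   (MArr (comp_mor X' X U (src \<phi>)) (\<lambda>A\<in>Ob X'. body (body \<phi> A)) (comp_mor X' X U (tgt \<phi>))) (\<Gamma> (tgt \<phi>))"
  by (simp add: comparison_simps, intro marr.expand) (simp add: whisker_left_body, simp add: whisker_left_def)

lemma arm_comparison_ar:
  assumes \<phi>: "\<phi> \<in> Ar HS"
  shows "arm comparison \<phi> \<in> Ar E"
proof -
  have "MArr (src \<phi>) (body \<phi>) (tgt \<phi>) \<in> Ar HS" using \<phi> by simp
  then show ?thesis
    unfolding arm_comparison_eq[OF \<phi>]
    by (subst (asm) comparison_arrow_iff[OF HS_arrow(1,2,3)[OF \<phi>] HS_arrow(4)[OF \<phi>]])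
qed

lemma comparison_bij_ar: "bij_betw (arm comparison) (Ar HS) (Ar E)"
  unfolding bij_betw_def
proof
  show "inj_on (arm comparison) (Ar HS)"
  proof (rule inj_onI)
    fix \<phi> \<psi> assume *: "\<phi> \<in> Ar HS" "\<psi> \<in> Ar HS" "arm comparison \<phi> = arm comparison \<psi>"
    then have eq: "\<Gamma> (src \<phi>) = \<Gamma> (src \<psi>)" "\<Gamma> (tgt \<phi>) = \<Gamma> (tgt \<psi>)"
      "(\<lambda>A\<in>Ob X'. body (body \<phi> A)) = (\<lambda>A\<in>Ob X'. body (body \<psi> A))"
      by (auto simp: arm_comparison_eq)
    then have "src \<phi> = src \<psi>" "tgt \<phi> = tgt \<psi>"
      using morphism_str_eqI HS_arrow(1,2)[OF *(1)] HS_arrow(1,2)[OF *(2)] by auto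
    moreover from this have "body \<phi> A = body \<psi> A" if "A \<in> Ob X'" for A
      using fun_cong[OF eq(3), of A] HS_arrow(4)[OF *(1) that] HS_arrow(4)[OF *(2) that]
        that by (simp add: marr.expand)
    ultimately show "\<phi> = \<psi>"
      by - (rule HS.faithful[OF *(1,2)], simp_all add: HOM_simps)
  qed
  show "arm comparison ` Ar HS = Ar E"
  proof
    show "arm comparison ` Ar HS \<subseteq> Ar E" using arm_comparison_ar by auto
    show "Ar E \<subseteq> arm comparison ` Ar HS"
    proof
      fix f assume f: "f \<in> Ar E"
      have "(fst (src f), snd (src f)) \<in> Ob E" using f unfolding Str_Ar by simp
      from object_lift_str[OF this]
      obtain H where H: "tangent_morphism X' (Str b X) H" "src f = \<Gamma> H" by auto
      have "(fst (tgt f), snd (tgt f)) \<in> Ob E" using f unfolding Str_Ar by simp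
      from object_lift_str[OF this]
      obtain G where G: "tangent_morphism X' (Str b X) G" "tgt f = \<Gamma> G" by auto
      define \<phi> where "\<phi> = (\<lambda>A\<in>Ob X'. MArr (obm H A) (body (body f) A) (obm G A))"
      have "body f \<in> Ar HX" "Dom HX (body f) = fst (src f)" "Cod HX (body f) = fst (tgt f)"
        using f unfolding Str_Ar by blast+
      then have fb: "body f \<in> Ar HX" "src (body f) = comp_mor X' X U H" "tgt (body f) = comp_mor X' X U G"
        unfolding H(2) G(2) HOM_simps fst_conv .
      then have "body (body f) \<in> extensional (Ob X')" unfolding HOM_Ar tangent_nat_iff by blast
      then have b: "(\<lambda>A\<in>Ob X'. body (\<phi> A)) = body (body f)"
        by (auto simp: \<phi>_def fun_eq_iff extensional_def restrict_def)
      have bf: "MArr (comp_mor X' X U H) (\<lambda>A\<in>Ob X'. body (\<phi> A)) (comp_mor X' X U G) = body f"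
        unfolding b fb(2,3)[symmetric] marr.collapse ..
      have eq: "MArr (\<Gamma> H) (MArr (comp_mor X' X U H) (\<lambda>A\<in>Ob X'. body (\<phi> A)) (comp_mor X' X U G)) (\<Gamma> G) = f"
        unfolding bf unfolding H(2)[symmetric] G(2)[symmetric] marr.collapse ..
      have "MArr H \<phi> G \<in> Ar HS"
        by (subst comparison_arrow_iff[OF H(1) G(1)]) (simp_all add: eq f, simp_all add: \<phi>_def)
      then show "f \<in> arm comparison ` Ar HS"
        using eq by (intro image_eqI[of _ _ "MArr H \<phi> G"]) (simp_all add: arm_comparison_eq)
    qed
  qed
qed

text \<open>Both tangent functors are computed pointwise by the same formula.\<close>

lemma \<Gamma>_T:
  assumes H: "tangent_morphism X' (Str b X) H"
  shows "\<Gamma> (Tbar X' (Str b X) H) = Tob E (\<Gamma> H)"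
proof -
  interpret H: lax_morphism X' "Str b X" H by (rule lax_morphismI[OF X'.tangent SC.tangent H])
  note TH = Tbar_morphism[OF X'.tangent SC.tangent H]
  note UH = comp_forget[OF H] and UTH = comp_forget[OF TH]
  have "body (tc (Str b X) a) = tc X (fst a)" for a by (simp add: Str_def structured_simps)
  then have 1: "comp_mor X' X U (Tbar X' (Str b X) H) = Tbar X' X (comp_mor X' X U H)"
    by (intro mor_eqI[of _ "Ob X'" _ "Ar X'"]) (simp_all add: UTH UH del: comp_mor_simps, simp_all add:
      Str_simps split_beta)
  note t = lift_str_typed[OF H] and t' = lift_str_typed[OF TH] and T' =
    HX.T.T_str_typed[of "comp_mor X' X U H" "lift_str H" b]
  have "lift_str (Tbar X' (Str b X) H) = T_str b HX (comp_mor X' X U H) (lift_str H)"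
  proof (rule HX.faithful)
    fix A assume A: "A \<in> Ob X'"
    show "body (lift_str (Tbar X' (Str b X) H)) A = body (T_str b HX (comp_mor X' X U H) (lift_str H)) A"
      using A t UH(1) by (simp add: HX.E_T_str HOM_simps del: comp_mor_simps) (simp add: lift_str_def
        Str_simps UH split_beta del: comp_mor_simps)
  qed (use t t' T' UH 1 in \<open>simp_all add: HOM_simps\<close>)
  with 1 show ?thesis by (simp add: Str_simps HOM_simps)
qed

lemma comparison_strict: "is_strict HS E comparison"
  unfolding is_strict_def
proof (intro conjI ballI)
  fix H assume H: "H \<in> Ob HS"
  then have H': "tangent_morphism X' (Str b X) H" by (simp add: HOM_simps)
  interpret H: lax_morphism X' "Str b X" H by (rule lax_morphismI[OF X'.tangent SC.tangent H'])
  note TH = Tbar_morphism[OF X'.tangent SC.tangent H']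
  have 1: "comp_mor X' X U (Tbar X' (Str b X) H) = Tbar X' X (comp_mor X' X U H)"
    using \<Gamma>_T[OF H'] by (simp add: Str_simps HOM_simps)
  show "obm comparison (Tob HS H) = Tob E (obm comparison H)"
    using H' TH \<Gamma>_T[OF H'] by (simp add: comparison_simps HOM_simps)
  have "lax U a = Idn X (Tob X (fst a))" if "a \<in> Ob (Str b X)" for a
    using that by (simp add: forget_def strict_mor_def)
  then have "(\<lambda>A\<in>Ob X'. lax U (obm H A)) = (\<lambda>A\<in>Ob X'. Idn X (obm (Tbar X' X (comp_mor X' X U H)) A))"
    using H.obm_ob by (auto simp: comp_forget(2)[OF H'] fun_eq_iff restrict_def simp del: comp_mor_simps)
  then show "lax comparison H = Idn E (Tob E (obm comparison H))"
    using H H' TH \<Gamma>_T[OF H'] 1 whisker_universal_str[OF H'] whisker_universal_str[OF TH]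
    by (simp add: induced_def Let_def HOM_simps) (simp add: Str_simps HOM_simps)
next
  fix \<phi> assume \<phi>: "\<phi> \<in> Ar HS"
  have T\<phi>: "Tar HS \<phi> \<in> Ar HS" using \<phi> by (rule HS.C_tar_ar)
  have 1: "comp_mor X' X U (Tbar X' (Str b X) H) = Tbar X' X (comp_mor X' X U H)"
    if "tangent_morphism X' (Str b X) H" for H
    using \<Gamma>_T[OF that] by (simp add: Str_simps HOM_simps)
  show "arm comparison (Tar HS \<phi>) = Tar E (arm comparison \<phi>)"
    using HS_arrow(1,2)[OF \<phi>] \<Gamma>_T[OF HS_arrow(1)[OF \<phi>]] \<Gamma>_T[OF HS_arrow(2)[OF \<phi>]] 1[OF HS_arrow(1)[OF \<phi>]]
      1[OF HS_arrow(2)[OF \<phi>]]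
    unfolding arm_comparison_eq[OF T\<phi>] arm_comparison_eq[OF \<phi>]
    by (simp add: HOM_simps Str_simps(6)) (auto simp: Str_simps(6) fun_eq_iff HOM_body[OF \<phi>])
qed

lemma comparison_morphism: "tangent_morphism HS E comparison"
proof -
  have extensional: "obm comparison \<in> extensional (Ob HS)" "arm comparison \<in> extensional (Ar HS)"
    "lax comparison \<in> extensional (Ob HS)"
    by (simp_all add: induced_def Let_def)
  have lax: "lax comparison H = Idn E (Tob E (obm comparison H))" "obm comparison (Tob HS H) =
    Tob E (obm comparison H)" if "H \<in> Ob HS" for H
    using comparison_strict that by (auto simp: is_strict_def)
  have T: "arm comparison (Tar HS \<phi>) = Tar E (arm comparison \<phi>)" if "\<phi> \<in> Ar HS" for \<phi>
    using comparison_strict that by (auto simp: is_strict_def)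
  have ob [simp]: "obm comparison H \<in> Ob E" if "H \<in> Ob HS" for H
    using comparison_bij_ob that by (auto dest: bij_betwE)
  have ar [simp]: "arm comparison \<phi> \<in> Ar E" "Dom E (arm comparison \<phi>) = obm comparison (Dom HS \<phi>)"
    "Cod E (arm comparison \<phi>) = obm comparison (Cod HS \<phi>)" if "\<phi> \<in> Ar HS" for \<phi>
    using that arm_comparison_ar HS_arrow(1,2) by (simp_all add: comparison_simps Str_simps HOM_simps)
  have fst_ob: "fst (obm comparison H) = comp_mor X' X U H" if "H \<in> Ob HS" for H
    using that by (simp add: comparison_simps HOM_simps)
  have ev [simp]: "body (body (arm comparison \<phi>)) A = body (body \<phi> A)" if "\<phi> \<in> Ar HS" "A \<in> Ob X'" for \<phi> A
    using that by (simp add: arm_comparison_eq)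
  have evo [simp]: "obm (fst (obm comparison H)) A = fst (obm H A)" if "H \<in> Ob HS" "A \<in> Ob X'" for H A
    using that by (simp add: comparison_simps HOM_simps comp_forget del: comp_mor_simps)
  have fst_HA [simp]: "fst (obm H A) \<in> Ob X" if "H \<in> Ob HS" "A \<in> Ob X'" for H A
    using HS.E_ob[OF that(2,1)] by (auto simp: Str_Ob)
  have bodies: "body (tp (Str b X) a) = tp X (fst a)" "body (tz (Str b X) a) = tz X (fst a)"
    "body (ts (Str b X) a) = ts X (fst a)"
    "body (tl (Str b X) a) = tl X (fst a)" "body (tc (Str b X) a) = tc X (fst a)"
      "body (Idn (Str b X) a) = Idn X (fst a)"
    "body (pr1 (Str b X) a) = pr1 X (fst a)" "body (pr2 (Str b X) a) = pr2 X (fst a)" for a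
    by (simp_all add: Str_def structured_simps)
  have ext: "f = g" if "f \<in> Ar E" "g \<in> Ar E" "Dom E f = Dom E g" "Cod E f = Cod E g"
    "\<And>A. A \<in> Ob X' \<Longrightarrow> body (body f) A = body (body g) A" for f g
  proof (rule E.faithful[OF that(1-4)])
    have d: "Dom HX (body f) = Dom HX (body g)" "Cod HX (body f) = Cod HX (body g)" "body f \<in> Ar HX"
      "body g \<in> Ar HX"
      using E.E_dom[of "()" f] E.E_dom[of "()" g] E.E_cod[of "()" f] E.E_cod[of "()" g]
        that(1-4) E.E_ar[of "()"] by simp_all
    show "body f = body g"
      by (rule HX.faithful) (use d that(5) in simp_all)
  qed
  show ?thesis
  proof (rule tangent_morphismI)
    fix H assume H: "H \<in> Ob HS"
    have *: "tp E (obm comparison H) \<cdot>\<^bsub>E\<^esub> arm comparison (pr1 HS H) =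
      tp E (obm comparison H) \<cdot>\<^bsub>E\<^esub> arm comparison (pr2 HS H)"
      by (rule ext) (use H in \<open>simp_all add: lax bodies\<close>)
    have "arm comparison (ts HS H) = ts E (obm comparison H) \<cdot>\<^bsub>E\<^esub> pair E (obm comparison H) (arm
      comparison (pr1 HS H)) (arm comparison (pr2 HS H))"
    proof (rule ext)
      let ?p = "arm comparison (pr1 HS H)" and ?q = "arm comparison (pr2 HS H)" and ?K =
        "fst (obm comparison H)"
      have K: "?K \<in> Ob HX" using E.E_ob[of "()" "obm comparison H"] H by simp
      have p: "body ?p \<in> Ar HX" "Dom HX (body ?p) = fst (obm comparison (T2 HS H))" "Cod HX (body ?p) =
        Tob HX ?K"
        and q: "body ?q \<in> Ar HX" "Dom HX (body ?q) = fst (obm comparison (T2 HS H))" "Cod HX (body ?q) =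
          Tob HX ?K"
        using E.E_ar[of "()"] E.E_dom[of "()"] E.E_cod[of "()"] E.E_tob[of "()" "obm comparison H"]
          H by (simp_all add: lax)
      have fib: "tp HX ?K \<cdot>\<^bsub>HX\<^esub> body ?p = tp HX ?K \<cdot>\<^bsub>HX\<^esub> body ?q"
        using E.E_eq[OF *, of "()"] E.E_cmp[of "()" ?q "tp E (obm comparison H)"] E.E_tp[of "()"
          "obm comparison H"] H by (simp add: lax)
      have "body (pair E (obm comparison H) ?p ?q) = pair HX ?K (body ?p) (body ?q)"
        by (rule E.pair_rules(4)) (use H * in \<open>simp_all add: lax\<close>)
      moreover have "body (ts E (obm comparison H) \<cdot>\<^bsub>E\<^esub> pair E (obm comparison H) ?p ?q) =
        body (ts E (obm comparison H)) \<cdot>\<^bsub>HX\<^esub> body (pair E (obm comparison H) ?p ?q)"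
        by (rule E.E_cmp) (use H * in \<open>simp_all add: lax E.pair_rules(1-3)\<close>)
      moreover have "body (ts E (obm comparison H)) = ts HX ?K"
        using E.E_ts[of "()" "obm comparison H"] H by simp
      ultimately have b: "body (ts E (obm comparison H) \<cdot>\<^bsub>E\<^esub> pair E (obm comparison H) ?p ?q) =
        ts HX ?K \<cdot>\<^bsub>HX\<^esub> pair HX ?K (body ?p) (body ?q)"
        by simp
      fix A assume A: "A \<in> Ob X'"
      have "body (ts HX ?K \<cdot>\<^bsub>HX\<^esub> pair HX ?K (body ?p) (body ?q)) A =
        body (ts HX ?K) A \<bullet> body (pair HX ?K (body ?p) (body ?q)) A"
        by (rule HX.E_cmp) (use A K p q fib in \<open>simp_all add: HX.pair_rules(1-3)\<close>)
      also have "body (pair HX ?K (body ?p) (body ?q)) A = pair X (obm ?K A) (body (body ?p) A) (body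
        (body ?q) A)"
        by (rule HX.pair_rules(4)) (use A K p q fib in simp_all)
      finally show "body (body (arm comparison (ts HS H))) A =
        body (body (ts E (obm comparison H) \<cdot>\<^bsub>E\<^esub> pair E (obm comparison H) ?p ?q)) A"
        unfolding b using A H HX.E_ts[OF A K] by (simp add: bodies X.pair_prs)
    qed (use H * in \<open>simp_all add: lax E.pair_rules\<close>)
    then show "lax comparison H \<cdot>\<^bsub>E\<^esub> arm comparison (ts HS H) =
         ts E (obm comparison H) \<cdot>\<^bsub>E\<^esub>
           pair E (obm comparison H) (lax comparison H \<cdot>\<^bsub>E\<^esub> arm comparison (pr1 HS H)) (lax comparison H
             \<cdot>\<^bsub>E\<^esub> arm comparison (pr2 HS H))"
      using H * by (simp add: lax E.pair_rules)
  next
    fix f g assume "f \<in> Ar HS" "g \<in> Ar HS" "Cod HS f = Dom HS g"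
    then show "arm comparison (g \<cdot>\<^bsub>HS\<^esub> f) = arm comparison g \<cdot>\<^bsub>E\<^esub> arm comparison f"
      by - (rule ext, simp_all, simp add: Str_simps)
  qed (use extensional in \<open>simp_all add: lax T\<close>, (rule ext; simp add: lax bodies)+)
qed

theorem comparison_iso: "tangent_iso HS E comparison"
  by (rule tangent_isoI[OF HS.tangent_category E.tangent_category comparison_morphism comparison_strict
    comparison_bij_ob comparison_bij_ar])

end


section \<open>The pullback of structures\<close>

abbreviation tri_objects :: "('o, 'a) tang \<Rightarrow> ('o \<times> 'a \<times> 'a \<times> 'a) set" where
  "tri_objects X \<equiv> {(M, k, u, v). M \<in> Ob X \<and> is_str False X M k \<and> is_str True X M u \<and> is_str True X M v}"

abbreviation tri_mor :: "('o, 'a) tang \<Rightarrow> ('o \<times> 'a \<times> 'a \<times> 'a) \<Rightarrow> 'a \<Rightarrow> ('o \<times> 'a \<times> 'a \<times> 'a) \<Rightarrow> bool" where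
  "tri_mor X \<equiv> \<lambda>(M, k, u, v) f (M', k', u', v'). str_mor False X k f k' \<and> str_mor True X u f u' \<and>
    str_mor True X v f v'"

abbreviation tri_T :: "('o, 'a) tang \<Rightarrow> ('o \<times> 'a \<times> 'a \<times> 'a) \<Rightarrow> ('o \<times> 'a \<times> 'a \<times> 'a)" where
  "tri_T X \<equiv> \<lambda>(M, k, u, v). (Tob X M, T_str False X M k, T_str True X M u, T_str True X M v)"

abbreviation tri_T2 :: "('o, 'a) tang \<Rightarrow> ('o \<times> 'a \<times> 'a \<times> 'a) \<Rightarrow> ('o \<times> 'a \<times> 'a \<times> 'a)" where
  "tri_T2 X \<equiv> \<lambda>(M, k, u, v). (T2 X M, T2_str False X M k, T2_str True X M u, T2_str True X M v)"

lemma VF2_VAC_eq: "VF2_VAC X = structured X (tri_objects X) fst (tri_mor X) (tri_T X) (tri_T2 X)"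
  by (simp add: VF2_VAC_def is_str_def str_mor_def conn_morphism_def field_morphism_def J_ar_def T_str_def
    T2_str_def
    T2_field_def T2_conn_def)

text \<open>Each condition on triples is the conjunction of the conditions for the three components; only
  the testing families have to be restricted to one component.\<close>

lemma (in tangent) tri_structures: "structures X (tri_objects X) fst (tri_mor X) (tri_T X) (tri_T2 X)"
proof unfold_locales
  fix a c and h :: 'a
  assume a: "a \<in> tri_objects X" and c: "c \<in> tri_objects X" and h: "h \<in> Ar X" "Dom X h = fst a" "Cod X h = fst c"
  obtain A k u v where a': "a = (A, k, u, v)" by (cases a)
  obtain B k' u' v' where c': "c = (B, k', u', v')" by (cases c)
  have a'': "A \<in> Ob X" "is_str False X A k" "is_str True X A u" "is_str True X A v"
    and c'': "B \<in> Ob X" "is_str False X B k'" "is_str True X B u'" "is_str True X B v'"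
    using a c a' c' by auto
  note ta = is_str_typed[OF a''(2)] is_str_typed[OF a''(3)] is_str_typed[OF a''(4)]
  note tc = is_str_typed[OF c''(2)] is_str_typed[OF c''(3)] is_str_typed[OF c''(4)]
  show "tri_mor X a (f \<bullet> h) d"
    if "d \<in> tri_objects X" "f \<in> Ar X" "Dom X f = fst c" "Cod X f = fst d" "tri_mor X a h c"
      "tri_mor X c f d" for d f
  proof -
    obtain D k'' u'' v'' where d: "d = (D, k'', u'', v'')" by (cases d)
    then have d': "is_str False X D k''" "is_str True X D u''" "is_str True X D v''" using that by auto
    note td = is_str_typed[OF d'(1)] is_str_typed[OF d'(2)] is_str_typed[OF d'(3)]
    show ?thesis
      using that h a' c' d ta tc td str_mor_cmp[of h f k False k' k''] str_mor_cmp[of h f u True u' u'']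
        str_mor_cmp[of h f v True v' v'']
      by simp
  qed
  show "tri_mor X (tri_T X a) (Tar X h) (tri_T X c)" if "tri_mor X a h c"
    using that h a' c' ta tc c'' by (simp add: str_mor_T)
  fix L :: "('a \<times> 'o \<times> 'a \<times> 'a \<times> 'a) set"
  assume L: "\<And>l d. (l, d) \<in> L \<Longrightarrow> d \<in> tri_objects X \<and> l \<in> Ar X \<and> Dom X l = fst c \<and> Cod X l = fst d \<and>
      tri_mor X c l d \<and> tri_mor X a (l \<bullet> h) d"
    and T: "T_monic X (fst c) (fst ` L)"
  have lift: "str_mor b X x h y" if "is_str b X A x" "is_str b X B y"
    "\<And>l N k u v. (l, N, k, u, v) \<in> L \<Longrightarrow> is_str b X N (g (k, u, v)) \<and> str_mor b X y l (g (k, u, v)) \<and>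
      str_mor b X x (l \<bullet> h) (g (k, u, v))"
    for b x y and g :: "'a \<times> 'a \<times> 'a \<Rightarrow> 'a"
  proof (rule str_mor_lift[where L = "(\<lambda>(l, N, s). (l, N, g s)) ` L" and A = A and B = B])
    have "fst ` (\<lambda>(l, N, s). (l, N, g s)) ` L = fst ` L" by (force simp: image_image split_beta)
    then show "T_monic X B (fst ` (\<lambda>(l, N, s). (l, N, g s)) ` L)" using T c' by simp
    fix l N z assume "(l, N, z) \<in> (\<lambda>(l, N, s). (l, N, g s)) ` L"
    then obtain k u v where *: "(l, N, k, u, v) \<in> L" "z = g (k, u, v)" by auto
    show "l \<in> Ar X \<and> Dom X l = B \<and> Cod X l = N \<and> z \<in> Ar X \<and> Dom X z = J_ob b X N \<and>
       Cod X z = Tob X N \<and> str_mor b X y l z \<and> str_mor b X x (l \<bullet> h) z"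
      using that(3)[OF *(1)] L[OF *(1)] c' is_str_typed[of b N z] *(2) by auto
  qed (use h a' c' is_str_typed[OF that(1)] is_str_typed[OF that(2)] in simp_all)
  have "str_mor False X k h k'"
    by (rule lift[where g = fst]) (use L a' c' a'' c'' in auto)
  moreover have "str_mor True X u h u'"
    by (rule lift[where g = "\<lambda>s. fst (snd s)"]) (use L a' c' a'' c'' in auto)
  moreover have "str_mor True X v h v'"
    by (rule lift[where g = "\<lambda>s. snd (snd s)"]) (use L a' c' a'' c'' in auto)
  ultimately show "tri_mor X a h c" using a' c' by simp
next
  fix a n P q \<pi> assume a: "a \<in> tri_objects X" and P: "is_fold_pullback X n (tp X (fst a)) P q \<pi>"
  obtain M k u v where a': "a = (M, k, u, v)" by (cases a)
  then have s: "M \<in> Ob X" "is_str False X M k" "is_str True X M u" "is_str True X M v" using a by auto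
  note * = fold_str[OF s(1) is_str_typed[OF s(2)] _ s(2)] fold_str[OF s(1) is_str_typed[OF s(3)] _ s(3)]
    fold_str[OF s(1) is_str_typed[OF s(4)] _ s(4)]
  have P': "is_fold_pullback X n (tp X M) P q \<pi>" using P a' by simp
  have "P \<in> Ob X" using P dom_ob[of q] by (auto simp: is_fold_pullback_def hom_def)
  moreover obtain k' u' v' where
    "is_str False X P k'" "str_mor False X k' q k" "\<forall>j<n. str_mor False X k' (\<pi> j) (T_str False X M k)"
    "is_str True X P u'" "str_mor True X u' q u" "\<forall>j<n. str_mor True X u' (\<pi> j) (T_str True X M u)"
    "is_str True X P v'" "str_mor True X v' q v" "\<forall>j<n. str_mor True X v' (\<pi> j) (T_str True X M v)"
    using *(1)[OF P'] *(2)[OF P'] *(3)[OF P'] by blast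
  ultimately show "\<exists>c\<in>tri_objects X. fst c = P \<and> tri_mor X c q a \<and> (\<forall>j<n. tri_mor X c (\<pi> j) (tri_T X a))"
    unfolding a' by (intro bexI[of _ "(P, k', u', v')"]) auto
qed (auto simp: is_str_T is_str_T2 is_str_typed str_mor_pr1 str_mor_pr2 str_mor_tp str_mor_tz str_mor_ts
    str_mor_tl str_mor_tc, auto simp: str_mor_def is_str_typed)

lemma is_str_universal:
  fixes X' :: "('x, 'y) tang" and X :: "('o, 'a) tang"
  assumes "tangent_category X'" "tangent_category X"
  shows "str_universal X' X"
  by (unfold_locales; fact)

lemma Str_tangent_category:
  fixes X :: "('o, 'a) tang"
  assumes "tangent_category X"
  shows "tangent_category (Str b X)"
proof -
  interpret tangent X by unfold_locales fact
  show ?thesis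
    using structures.structured_tangent_category[OF Str_structures] by (simp add: Str_def)
qed

locale triples = X: tangent X for X :: "('o, 'a) tang" (structure)
begin

sublocale P: structures X "tri_objects X" fst "tri_mor X" "tri_T X" "tri_T2 X"
  rewrites "structured X (tri_objects X) fst (tri_mor X) (tri_T X) (tri_T2 X) = VF2_VAC X"
  by (rule X.tri_structures) (simp add: VF2_VAC_eq)

abbreviation "PU \<equiv> strict_mor (VF2_VAC X) X fst body"

sublocale PC: tangent "VF2_VAC X"
  by unfold_locales (rule P.structured_tangent_category)

lemma P_simps:
  "Ob (VF2_VAC X) = tri_objects X" "Dom (VF2_VAC X) = src" "Cod (VF2_VAC X) = tgt"
  "Tob (VF2_VAC X) = tri_T X"
  by (simp_all add: VF2_VAC_eq structured_simps)

text \<open>The three projections are treated alike: \<open>g\<close> selects a component of a triple and \<open>b\<close> is its kind.\<close>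

definition selector :: "bool \<Rightarrow> ('o \<times> 'a \<times> 'a \<times> 'a \<Rightarrow> 'o \<times> 'a) \<Rightarrow> bool" where
  "selector b g \<longleftrightarrow> (b, g) \<in> {(True, \<lambda>(M, k, u, v). (M, u)), (True, \<lambda>(M, k, u, v). (M, v)), (False, \<lambda>(M, k,
    u, v). (M, k))}"

definition proj :: "bool \<Rightarrow> ('o \<times> 'a \<times> 'a \<times> 'a \<Rightarrow> 'o \<times> 'a) \<Rightarrow> _" where
  "proj b g = project (VF2_VAC X) (Str b X) g"

lemma proj_eq: "proj_u X = proj True (\<lambda>(M, k, u, v). (M, u))" "proj_v X = proj True (\<lambda>(M, k, u, v). (M, v))"
    "proj_k X = proj False (\<lambda>(M, k, u, v). (M, k))"
  by (simp_all add: proj_u_def proj_v_def proj_k_def proj_def VF_eq_Str VAC_eq_Str)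

lemma sel: "selector True (\<lambda>(M, k, u, v). (M, u))" "selector True (\<lambda>(M, k, u, v). (M, v))"
  "selector False (\<lambda>(M, k, u, v). (M, k))"
  by (simp_all add: selector_def)

lemma selector_simps:
  assumes "selector b g"
  shows "s \<in> tri_objects X \<Longrightarrow> g s \<in> str_objects b X" "fst (g s) = fst s"
    "g (tri_T X s) = (Tob X (fst s), T_str b X (fst s) (snd (g s)))"
    "tri_mor X s f s' \<Longrightarrow> str_mor b X (snd (g s)) f (snd (g s'))"
  using assms by (auto simp: selector_def split: prod.splits)

lemma Str_Ob: "Ob (Str b X) = str_objects b X"
  by (simp add: Str_def structured_simps)

lemma proj_simps:
  "s \<in> tri_objects X \<Longrightarrow> obm (proj b g) s = g s"
  "f \<in> Ar (VF2_VAC X) \<Longrightarrow> arm (proj b g) f = MArr (g (src f)) (body f) (g (tgt f))"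
  "s \<in> tri_objects X \<Longrightarrow> lax (proj b g) s = Idn (Str b X) (Tob (Str b X) (g s))"
  by (simp_all add: proj_def project_def strict_mor_def P_simps)

lemma Idn_Str_T: "Idn (Str b X) (Tob (Str b X) a) = MArr (Tob (Str b X) a) (Idn X (Tob X (fst a))) (Tob
  (Str b X) a)"
  by (simp add: Str_def structured_simps split_beta)

lemma P_Ar: "f \<in> Ar (VF2_VAC X) \<longleftrightarrow> src f \<in> tri_objects X \<and> tgt f \<in> tri_objects X \<and>
  body f \<in> Ar X \<and> Dom X (body f) = fst (src f) \<and> Cod X (body f) = fst (tgt f) \<and>
    tri_mor X (src f) (body f) (tgt f)"
  unfolding VF2_VAC_eq structured_Ar by simp

lemma proj_morphism:
  assumes g: "selector b g"
  shows "tangent_morphism (VF2_VAC X) (Str b X) (proj b g)"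
proof -
  note S = selector_simps[OF g]
  note into = structures.morphism_into_structured[OF X.Str_structures PC.tangent P.U_morphism, of "proj b
    g" b, folded Str_def]
  have t: "Tob (Str b X) a = (Tob X (fst a), T_str b X (fst a) (snd a))" for a
    by (simp add: Str_def structured_simps split_beta)
  show ?thesis
  proof (rule into)
    fix s assume s: "s \<in> Ob (VF2_VAC X)"
    then have s': "s \<in> tri_objects X" and Ts: "tri_T X s \<in> tri_objects X"
      using P.t_S by (simp_all only: P_simps)
    have gs: "g s \<in> Ob (Str b X)" using S(1)[OF s'] by (simp add: Str_Ob)
    show "obm (proj b g) s \<in> str_objects b X \<and> fst (obm (proj b g) s) = obm PU s"
      using S(1)[OF s'] s' by (simp only: proj_simps S(2) P.U_simps)
    show "lax (proj b g) s = MArr (obm (proj b g) (Tob (VF2_VAC X) s)) (lax PU s) ((\<lambda>(M, x). (Tob X M,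
      T_str b X M x)) (obm (proj b g) s))"
      unfolding P_simps proj_simps(3)[OF s'] proj_simps(1)[OF s'] proj_simps(1)[OF Ts] P.U_simps(3)[OF s']
        S(3) Idn_Str_T
      unfolding t S(2)
      by (simp add: split_beta S(2))
    show "(\<lambda>(M, x) f (M', x'). str_mor b X x f x') (obm (proj b g) (Tob (VF2_VAC X) s)) (lax PU s) ((\<lambda>(M,
      x). (Tob X M, T_str b X M x)) (obm (proj b g) s))"
    proof -
      have "str_mor b X (snd (Tob (Str b X) (g s))) (Idn X (Tob X (fst s))) (snd (Tob (Str b X) (g s)))"
        using structures.R_idn[OF X.Str_structures structures.t_S[OF X.Str_structures], of "g s" b]
          S(1)[OF s'] S(2)
        by (simp only: t split_beta S(2) fst_conv)
      then show ?thesis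
        unfolding P_simps proj_simps(1)[OF s'] proj_simps(1)[OF Ts] P.U_simps(3)[OF s']
          S(3) t S(2) by (simp add: split_beta S(2))
    qed
  next
    fix f assume f: "f \<in> Ar (VF2_VAC X)"
    then have f': "src f \<in> tri_objects X" "tgt f \<in> tri_objects X" "tri_mor X (src f) (body f) (tgt f)"
      by (simp_all only: P_Ar)
    show "arm (proj b g) f = MArr (obm (proj b g) (Dom (VF2_VAC X) f)) (arm PU f) (obm (proj b g) (Cod
      (VF2_VAC X) f))"
      unfolding P_simps proj_simps(1)[OF f'(1)] proj_simps(1)[OF f'(2)] proj_simps(2)[OF f]
        P.U_simps(2)[OF f] ..
    show "(\<lambda>(M, x) f (M', x'). str_mor b X x f x') (obm (proj b g) (Dom (VF2_VAC X) f)) (arm PU f) (obm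
      (proj b g) (Cod (VF2_VAC X) f))"
      unfolding P_simps proj_simps(1)[OF f'(1)] proj_simps(1)[OF f'(2)] P.U_simps(2)[OF f]
      using S(4)[OF f'(3)] by (simp only: split_beta)
  qed (simp_all add: proj_def project_def strict_mor_def)
qed

lemma comp_forget_proj:
  assumes g: "selector b g"
  shows "comp_mor (VF2_VAC X) X (forget b X) (proj b g) = PU"
proof (rule mor_eqI[of _ "Ob (VF2_VAC X)" _ "Ar (VF2_VAC X)"])
  interpret \<pi>: lax_morphism "VF2_VAC X" "Str b X" "proj b g"
    by (rule lax_morphismI[OF PC.tangent Str_tangent_category[OF X.tangent] proj_morphism[OF g]])
  note cf = str_universal.comp_forget[OF is_str_universal[OF PC.tangent X.tangent] proj_morphism[OF g]]
  fix s assume s: "s \<in> Ob (VF2_VAC X)"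
  then have s': "s \<in> tri_objects X" by (simp only: P_simps)
  show "obm (comp_mor (VF2_VAC X) X (forget b X) (proj b g)) s = obm PU s"
    unfolding cf(2)[OF s] using s' selector_simps(2)[OF g] by (simp add: proj_simps)
  show "lax (comp_mor (VF2_VAC X) X (forget b X) (proj b g)) s = lax PU s"
    unfolding cf(4)[OF s] proj_simps(3)[OF s'] P.U_simps(3)[OF s'] Idn_Str_T marr.sel selector_simps(2)[OF g] ..
next
  fix f assume f: "f \<in> Ar (VF2_VAC X)"
  show "arm (comp_mor (VF2_VAC X) X (forget b X) (proj b g)) f = arm PU f"
    unfolding str_universal.comp_forget(3)[OF is_str_universal[OF PC.tangent X.tangent]
      proj_morphism[OF g] f] using f by (simp add: proj_simps)
qed (simp_all add: strict_mor_def)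

context
  fixes X' :: "('x, 'y) tang"
  assumes X': "tangent_category X'"
begin

lemma comp_proj:
  assumes g: "selector b g" and H: "tangent_morphism X' (VF2_VAC X) H"
  shows "A \<in> Ob X' \<Longrightarrow> obm H A \<in> tri_objects X"
    "A \<in> Ob X' \<Longrightarrow> obm (comp_mor X' (Str b X) (proj b g) H) A = g (obm H A)"
    "f \<in> Ar X' \<Longrightarrow> arm H f \<in> Ar (VF2_VAC X)"
    "f \<in> Ar X' \<Longrightarrow> src (arm H f) = obm H (Dom X' f)" "f \<in> Ar X' \<Longrightarrow> tgt (arm H f) = obm H (Cod X' f)"
    "f \<in> Ar X' \<Longrightarrow> body (arm (comp_mor X' (Str b X) (proj b g) H) f) = body (arm H f)"
    "A \<in> Ob X' \<Longrightarrow> lax H A \<in> Ar (VF2_VAC X)"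
    "A \<in> Ob X' \<Longrightarrow> src (lax H A) = obm H (Tob X' A)" "A \<in> Ob X' \<Longrightarrow> tgt (lax H A) = tri_T X (obm H A)"
    "A \<in> Ob X' \<Longrightarrow> body (lax (comp_mor X' (Str b X) (proj b g) H) A) = body (lax H A)"
proof -
  interpret H: lax_morphism X' "VF2_VAC X" H by (rule lax_morphismI[OF X' PC.tangent H])
  show ob: "obm H A \<in> tri_objects X" if "A \<in> Ob X'" for A using H.obm_ob[OF that] by (simp only: P_simps)
  show "A \<in> Ob X' \<Longrightarrow> obm (comp_mor X' (Str b X) (proj b g) H) A = g (obm H A)"
    using ob by (simp add: proj_simps)
  show "f \<in> Ar X' \<Longrightarrow> arm H f \<in> Ar (VF2_VAC X)" "A \<in> Ob X' \<Longrightarrow> lax H A \<in> Ar (VF2_VAC X)" by simp_all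
  show "f \<in> Ar X' \<Longrightarrow> src (arm H f) = obm H (Dom X' f)" "f \<in> Ar X' \<Longrightarrow> tgt (arm H f) = obm H (Cod X' f)"
    "A \<in> Ob X' \<Longrightarrow> src (lax H A) = obm H (Tob X' A)" "A \<in> Ob X' \<Longrightarrow> tgt (lax H A) = tri_T X (obm H A)"
    using H.arm_dom[of f] H.arm_cod[of f] H.lax_dom[of A] H.lax_cod[of A] unfolding P_simps by blast+
  show "f \<in> Ar X' \<Longrightarrow> body (arm (comp_mor X' (Str b X) (proj b g) H) f) = body (arm H f)"
    by (simp add: proj_simps)
  show "body (lax (comp_mor X' (Str b X) (proj b g) H) A) = body (lax H A)" if A: "A \<in> Ob X'"
  proof -
    have l: "body (lax H A) \<in> Ar X" "Cod X (body (lax H A)) = Tob X (fst (obm H A))"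
      using H.lax_ar[OF A] H.lax_cod[OF A] ob[OF A] unfolding P_Ar P_simps by auto
    have "body (lax (comp_mor X' (Str b X) (proj b g) H) A) =
      Idn X (Tob X (fst (g (obm H A)))) \<bullet> body (lax H A)"
      unfolding comp_mor_simps(3)[OF A] proj_simps(3)[OF ob[OF A]] proj_simps(2)[OF H.lax_ar[OF A]]
      by (simp add: Str_def structured_simps split_beta)
    then show ?thesis
      using l X.cod_ob[OF l(1)] unfolding selector_simps(2)[OF g] by simp
  qed
qed

lemma forget_comp_proj:
  assumes g: "selector b g" and H: "tangent_morphism X' (VF2_VAC X) H"
  shows "comp_mor X' X (forget b X) (comp_mor X' (Str b X) (proj b g) H) = comp_mor X' X PU H"
proof -
  interpret H: lax_morphism X' "VF2_VAC X" H by (rule lax_morphismI[OF X' PC.tangent H])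
  note m = comp_mor_morphism[OF X' PC.tangent Str_tangent_category[OF X.tangent] H proj_morphism[OF g]]
  note cf = str_universal.comp_forget[OF is_str_universal[OF X' X.tangent] m]
  note c = comp_proj[OF g H]
  show ?thesis
    by (rule mor_eqI[of _ "Ob X'" _ "Ar X'"])
      (simp_all add: cf c selector_simps(2)[OF g] P.comp_U_simps[OF X' H] del: comp_mor_simps)
qed

lemmas comp_proj_morphism = comp_mor_morphism[OF X' PC.tangent Str_tangent_category[OF X.tangent]
  _ proj_morphism]

abbreviation "\<pi>u H \<equiv> comp_mor X' (Str True X) (proj True (\<lambda>(M, k, u, v). (M, u))) H"
abbreviation "\<pi>v H \<equiv> comp_mor X' (Str True X) (proj True (\<lambda>(M, k, u, v). (M, v))) H"
abbreviation "\<pi>k H \<equiv> comp_mor X' (Str False X) (proj False (\<lambda>(M, k, u, v). (M, k))) H"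

text \<open>Three morphisms over the same underlying morphism \<open>F\<close> give triples of structures on the objects
  \<open>F A\<close>, and compatibility of the arrows \<open>F f\<close> and of the laws of \<open>F\<close> holds in each component. By
  \<open>morphism_into_structured\<close> the triples form a tangent morphism.\<close>

lemma pullback_morphism:
  assumes H1: "tangent_morphism X' (Str True X) H1" and H2: "tangent_morphism X' (Str True X) H2"
    and H3: "tangent_morphism X' (Str False X) H3"
    and eq: "comp_mor X' X (forget True X) H1 = comp_mor X' X (forget True X) H2"
      "comp_mor X' X (forget True X) H2 = comp_mor X' X (forget False X) H3"
  shows "\<exists>!H. tangent_morphism X' (VF2_VAC X) H \<and> \<pi>u H = H1 \<and> \<pi>v H = H2 \<and> \<pi>k H = H3"
proof (rule ex_ex1I)
  note su = is_str_universal[OF X' X.tangent]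
  note St = Str_tangent_category[OF X.tangent]
  interpret X': tangent X' by unfold_locales (rule X')
  interpret H1: lax_morphism X' "Str True X" H1 by (rule lax_morphismI[OF X' St H1])
  interpret H2: lax_morphism X' "Str True X" H2 by (rule lax_morphismI[OF X' St H2])
  interpret H3: lax_morphism X' "Str False X" H3 by (rule lax_morphismI[OF X' St H3])
  define F where "F = comp_mor X' X (forget True X) H1"
  note F1 = str_universal.comp_forget[OF su H1, folded F_def]
  note F2 = str_universal.comp_forget[OF su H2, folded eq(1), folded F_def]
  note F3 = str_universal.comp_forget[OF su H3, folded eq(2), folded eq(1), folded F_def]
  interpret F: lax_morphism X' X F by (rule lax_morphismI[OF X' X.tangent F1(1)])
  define Ho where "Ho A = (obm F A, snd (obm H3 A), snd (obm H1 A), snd (obm H2 A))" for A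
  define H where "H = \<lparr>obm = restrict Ho (Ob X'), arm = (\<lambda>f\<in>Ar X'. MArr (Ho (Dom X' f)) (arm F f) (Ho (Cod
    X' f))),
    lax = (\<lambda>A\<in>Ob X'. MArr (Ho (Tob X' A)) (lax F A) (tri_T X (Ho A)))\<rparr>"
  have s1: "is_str True X (obm F A) (snd (obm H1 A))" and s2: "is_str True X (obm F A) (snd (obm H2 A))"
    and s3: "is_str False X (obm F A) (snd (obm H3 A))" if "A \<in> Ob X'" for A
    using H1.obm_ob[OF that] H2.obm_ob[OF that] H3.obm_ob[OF that] F1(2)[OF that] F2(2)[OF that] F3(2)[OF that]
    unfolding Str_Ob by auto
  have a1: "str_mor True X (snd (obm H1 (Dom X' f))) (arm F f) (snd (obm H1 (Cod X' f)))"
    and a2: "str_mor True X (snd (obm H2 (Dom X' f))) (arm F f) (snd (obm H2 (Cod X' f)))"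
    and a3: "str_mor False X (snd (obm H3 (Dom X' f))) (arm F f) (snd (obm H3 (Cod X' f)))"
      if f: "f \<in> Ar X'" for f
    using H1.arm_ar[OF f] H1.arm_dom[OF f] H1.arm_cod[OF f] F1(3)[OF f] H2.arm_ar[OF f] H2.arm_dom[OF f]
      H2.arm_cod[OF f] F2(3)[OF f]
      H3.arm_ar[OF f] H3.arm_dom[OF f] H3.arm_cod[OF f] F3(3)[OF f]
    unfolding str_universal.Str_Ar[OF su] str_universal.Str_simps[OF su] by simp_all
  have l1: "str_mor True X (snd (obm H1 (Tob X' A))) (lax F A) (T_str True X (obm F A) (snd (obm H1 A)))"
    and l2: "str_mor True X (snd (obm H2 (Tob X' A))) (lax F A) (T_str True X (obm F A) (snd (obm H2 A)))"
    and l3: "str_mor False X (snd (obm H3 (Tob X' A))) (lax F A) (T_str False X (obm F A) (snd (obm H3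
      A)))" if f: "A \<in> Ob X'" for A
    using H1.lax_ar[OF f] H1.lax_dom[OF f] H1.lax_cod[OF f] F1(2,4)[OF f] H2.lax_ar[OF f] H2.lax_dom[OF f]
      H2.lax_cod[OF f] F2(2,4)[OF f]
      H3.lax_ar[OF f] H3.lax_dom[OF f] H3.lax_cod[OF f] F3(2,4)[OF f]
    unfolding str_universal.Str_Ar[OF su] str_universal.Str_simps[OF su] by (simp_all add: split_beta)
  have H: "tangent_morphism X' (VF2_VAC X) H"
    by (rule P.morphism_into_structured[OF X' F1(1)])
      (use s1 s2 s3 a1 a2 a3 l1 l2 l3 in \<open>simp_all add: H_def Ho_def\<close>)
  have U: "comp_mor X' X PU H = F"
    by (rule mor_eqI[of _ "Ob X'" _ "Ar X'"])
      (simp_all add: P.comp_U_simps[OF X' H] F.ext_obm F.ext_arm F.ext_lax del: comp_mor_simps, simp_all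
        add: H_def Ho_def)
  have HA: "obm H A = (obm F A, snd (obm H3 A), snd (obm H1 A), snd (obm H2 A))" if "A \<in> Ob X'" for A
    using that by (simp add: H_def Ho_def)
  have lift_eq: "str_universal.lift_str X' X b (comp_mor X' (Str b X) (proj b g) H) =
    str_universal.lift_str X' X b Hi"
    if "selector b g" "comp_mor X' X (forget b X) Hi = F" "\<And>A. A \<in> Ob X' \<Longrightarrow> snd (g (obm H A)) =
      snd (obm Hi A)" for b g Hi
    unfolding str_universal.lift_str_def[OF su] using forget_comp_proj[OF that(1) H]
      that(2,3) comp_proj(2)[OF that(1) H] U
    by (simp add: restrict_def fun_eq_iff del: comp_mor_simps)
  have "\<pi>u H = H1"
    by (rule str_universal.morphism_str_eqI[OF su comp_proj_morphism[OF H sel(1)] H1])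
      (use forget_comp_proj[OF sel(1) H] U F_def HA lift_eq[OF sel(1)] in simp_all)
  moreover have "\<pi>v H = H2"
    by (rule str_universal.morphism_str_eqI[OF su comp_proj_morphism[OF H sel(2)] H2])
      (use forget_comp_proj[OF sel(2) H] U F_def eq HA lift_eq[OF sel(2)] in simp_all)
  moreover have "\<pi>k H = H3"
    by (rule str_universal.morphism_str_eqI[OF su comp_proj_morphism[OF H sel(3)] H3])
      (use forget_comp_proj[OF sel(3) H] U F_def eq HA lift_eq[OF sel(3)] in simp_all)
  ultimately show "\<exists>H. tangent_morphism X' (VF2_VAC X) H \<and> \<pi>u H = H1 \<and> \<pi>v H = H2 \<and> \<pi>k H = H3"
    using H by blast
next
  interpret X': tangent X' by unfold_locales (rule X')
  fix H G
  assume H: "tangent_morphism X' (VF2_VAC X) H \<and> \<pi>u H = H1 \<and> \<pi>v H = H2 \<and> \<pi>k H = H3"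
    and G: "tangent_morphism X' (VF2_VAC X) G \<and> \<pi>u G = H1 \<and> \<pi>v G = H2 \<and> \<pi>k G = H3"
  interpret H: lax_morphism X' "VF2_VAC X" H by (rule lax_morphismI[OF X' PC.tangent H[THEN conjunct1]])
  interpret G: lax_morphism X' "VF2_VAC X" G by (rule lax_morphismI[OF X' PC.tangent G[THEN conjunct1]])
  have u: "\<pi>u H = \<pi>u G" and v: "\<pi>v H = \<pi>v G" and k: "\<pi>k H = \<pi>k G" using H G by simp_all
  have ob: "obm H A = obm G A" if A: "A \<in> Ob X'" for A
    using comp_proj(2)[OF sel(1) H[THEN conjunct1] A] comp_proj(2)[OF sel(2) H[THEN conjunct1] A]
      comp_proj(2)[OF sel(3) H[THEN conjunct1] A]
      comp_proj(2)[OF sel(1) G[THEN conjunct1] A] comp_proj(2)[OF sel(2) G[THEN conjunct1] A]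
        comp_proj(2)[OF sel(3) G[THEN conjunct1] A]
    unfolding u v k by (auto split: prod.splits)
  note cH = comp_proj[OF sel(1) H[THEN conjunct1]] and cG = comp_proj[OF sel(1) G[THEN conjunct1]]
  show "H = G"
  proof (rule mor_eqI[of _ "Ob X'" _ "Ar X'"])
    fix f assume f: "f \<in> Ar X'"
    show "arm H f = arm G f"
      using cH(4-6)[OF f] cG(4-6)[OF f] u ob f by (intro marr.expand) (simp del: comp_mor_simps)
  next
    fix A assume A: "A \<in> Ob X'"
    show "lax H A = lax G A"
      using cH(8-10)[OF A] cG(8-10)[OF A] u ob A by (intro marr.expand) (simp del: comp_mor_simps)
  qed (use ob in \<open>simp_all add: H.ext_obm H.ext_arm H.ext_lax G.ext_obm G.ext_arm G.ext_lax\<close>)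
qed

lemma pullback_nat:
  assumes H: "tangent_morphism X' (VF2_VAC X) H" and G: "tangent_morphism X' (VF2_VAC X) G"
    and \<phi>1: "\<phi>1 \<in> hom (HOM X' (Str True X)) (\<pi>u H) (\<pi>u G)" and \<phi>2: "\<phi>2 \<in> hom (HOM X' (Str True X)) (\<pi>v H)
      (\<pi>v G)"
    and \<phi>3: "\<phi>3 \<in> hom (HOM X' (Str False X)) (\<pi>k H) (\<pi>k G)"
    and eq: "whisker_left X' X (forget True X) \<phi>1 = whisker_left X' X (forget True X) \<phi>2"
      "whisker_left X' X (forget True X) \<phi>2 = whisker_left X' X (forget False X) \<phi>3"
  shows "\<exists>!\<phi>. \<phi> \<in> hom (HOM X' (VF2_VAC X)) H G \<and>
    whisker_left X' (Str True X) (proj True (\<lambda>(M, k, u, v). (M, u))) \<phi> = \<phi>1 \<and>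
    whisker_left X' (Str True X) (proj True (\<lambda>(M, k, u, v). (M, v))) \<phi> = \<phi>2 \<and>
    whisker_left X' (Str False X) (proj False (\<lambda>(M, k, u, v). (M, k))) \<phi> = \<phi>3"
proof -
  note su = is_str_universal[OF X' X.tangent]
  interpret X': tangent X' by unfold_locales (rule X')
  have hom: "\<phi> \<in> Ar (HOM X' C) \<and> src \<phi> = A \<and> tgt \<phi> = B" if "\<phi> \<in> hom (HOM X' C) A B"
    for \<phi> A B and C :: "('q, 'r) tang" using that by (simp add: hom_def HOM_simps)
  note \<phi>1 = hom[OF \<phi>1, THEN conjunct1] hom[OF \<phi>1, THEN conjunct2, THEN conjunct1]
    hom[OF \<phi>1, THEN conjunct2, THEN conjunct2]
  note \<phi>2 = hom[OF \<phi>2, THEN conjunct1] hom[OF \<phi>2, THEN conjunct2, THEN conjunct1]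
    hom[OF \<phi>2, THEN conjunct2, THEN conjunct2]
  note \<phi>3 = hom[OF \<phi>3, THEN conjunct1] hom[OF \<phi>3, THEN conjunct2, THEN conjunct1]
    hom[OF \<phi>3, THEN conjunct2, THEN conjunct2]
  have b12: "body (body \<phi>1 A) = body (body \<phi>2 A)" and b23: "body (body \<phi>2 A) = body (body \<phi>3 A)"
    if "A \<in> Ob X'" for A
    using fun_cong[OF arg_cong[OF eq(1), of body], of A] fun_cong[OF arg_cong[OF eq(2), of body], of A] that
    unfolding str_universal.whisker_left_body[OF su \<phi>1(1)] str_universal.whisker_left_body[OF su \<phi>2(1)]
      str_universal.whisker_left_body[OF su \<phi>3(1)]
    by simp_all
  let ?a = "\<lambda>A. body (body \<phi>1 A)"
  define \<phi> where "\<phi> = (\<lambda>A\<in>Ob X'. MArr (obm H A) (?a A) (obm G A))"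
  have val: "body \<phi>1 A = MArr ((\<lambda>(M, k, u, v). (M, u)) (obm H A)) (?a A) ((\<lambda>(M, k, u, v). (M, u)) (obm G A))"
    "body \<phi>2 A = MArr ((\<lambda>(M, k, u, v). (M, v)) (obm H A)) (?a A) ((\<lambda>(M, k, u, v). (M, v)) (obm G A))"
    "body \<phi>3 A = MArr ((\<lambda>(M, k, u, v). (M, k)) (obm H A)) (?a A) ((\<lambda>(M, k, u, v). (M, k)) (obm G A))"
      if A: "A \<in> Ob X'" for A
    using str_universal.HS_arrow(4)[OF su \<phi>1(1) A] str_universal.HS_arrow(4)[OF su \<phi>2(1) A]
      str_universal.HS_arrow(4)[OF su \<phi>3(1) A]
      b12[OF A] b23[OF A]
    unfolding \<phi>1(2,3) \<phi>2(2,3) \<phi>3(2,3) comp_proj(2)[OF sel(1) H A] comp_proj(2)[OF sel(2) H A]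
      comp_proj(2)[OF sel(3) H A]
      comp_proj(2)[OF sel(1) G A] comp_proj(2)[OF sel(2) G A] comp_proj(2)[OF sel(3) G A] by simp_all
  have mor: "tri_mor X (obm H A) (?a A) (obm G A)" if A: "A \<in> Ob X'" for A
  proof -
    have "body \<phi>1 A \<in> Ar (Str True X)" "body \<phi>2 A \<in> Ar (Str True X)" "body \<phi>3 A \<in> Ar (Str False X)"
      using HOM_body(1)[OF \<phi>1(1) A] HOM_body(1)[OF \<phi>2(1) A] HOM_body(1)[OF \<phi>3(1) A] by simp_all
    moreover note arg_cong[OF val(1)[OF A], of src] arg_cong[OF val(1)[OF A], of tgt]
      arg_cong[OF val(2)[OF A], of src]
      arg_cong[OF val(2)[OF A], of tgt] arg_cong[OF val(3)[OF A], of src] arg_cong[OF val(3)[OF A], of tgt]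
    ultimately show ?thesis
      using b12[OF A] b23[OF A] unfolding str_universal.Str_Ar[OF su] by (auto split: prod.splits)
  qed
  have "tangent_nat X' X (comp_mor X' X PU H) (comp_mor X' X PU G) (\<lambda>A\<in>Ob X'. ?a A)"
  proof -
    have "tangent_nat X' (Str True X) (\<pi>u H) (\<pi>u G) (body \<phi>1)" using \<phi>1 by (simp add: HOM_Ar)
    then show ?thesis
      using structures.tangent_nat_structured[OF X.Str_structures X', of True, folded Str_def, folded
        forget_def,
          OF comp_proj_morphism[OF H sel(1)] comp_proj_morphism[OF G sel(1)], of "body \<phi>1"]
      by (simp add: forget_comp_proj[OF sel(1) H] forget_comp_proj[OF sel(1) G])
  qed
  then have nat: "tangent_nat X' (VF2_VAC X) H G \<phi>"
    unfolding P.tangent_nat_structured[OF X' H G] using mor by (simp add: \<phi>_def cong: restrict_cong)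
  then have \<phi>_hom: "MArr H \<phi> G \<in> hom (HOM X' (VF2_VAC X)) H G" using H G by (simp add: hom_def HOM_simps HOM_Ar)
  have whisker: "whisker_left X' (Str b X) (proj b g) (MArr H \<phi> G) = \<psi>"
    if "\<psi> \<in> Ar (HOM X' (Str b X))" "src \<psi> = comp_mor X' (Str b X) (proj b g) H" "tgt \<psi> =
      comp_mor X' (Str b X) (proj b g) G"
      "\<And>A. A \<in> Ob X' \<Longrightarrow> body \<psi> A = MArr (g (obm H A)) (?a A) (g (obm G A))" for b g \<psi>
  proof (rule marr.expand, intro conjI)
    show "body (whisker_left X' (Str b X) (proj b g) (MArr H \<phi> G)) = body \<psi>"
    proof (rule extensionalityI[of _ "Ob X'"])
      fix A assume A: "A \<in> Ob X'"
      have "\<phi> A \<in> Ar (VF2_VAC X)" using tangent_natD(1)[OF nat A] .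
      then show "body (whisker_left X' (Str b X) (proj b g) (MArr H \<phi> G)) A = body \<psi> A"
        using A by (simp add: whisker_left_def proj_simps that(4)) (simp add: \<phi>_def)
    qed (use str_universal.HS_arrow(3)[OF su that(1)] in \<open>simp_all add: whisker_left_def\<close>)
  qed (use that in \<open>simp_all add: whisker_left_def\<close>)
  show ?thesis
  proof (rule ex1I[of _ "MArr H \<phi> G"], intro conjI)
    show "MArr H \<phi> G \<in> hom (HOM X' (VF2_VAC X)) H G" by (rule \<phi>_hom)
    show "whisker_left X' (Str True X) (proj True (\<lambda>(M, k, u, v). (M, u))) (MArr H \<phi> G) = \<phi>1"
      by (rule whisker[OF \<phi>1]) (rule val)
    show "whisker_left X' (Str True X) (proj True (\<lambda>(M, k, u, v). (M, v))) (MArr H \<phi> G) = \<phi>2"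
      by (rule whisker[OF \<phi>2]) (rule val)
    show "whisker_left X' (Str False X) (proj False (\<lambda>(M, k, u, v). (M, k))) (MArr H \<phi> G) = \<phi>3"
      by (rule whisker[OF \<phi>3]) (rule val)
  next
    fix \<psi> assume \<psi>: "\<psi> \<in> hom (HOM X' (VF2_VAC X)) H G \<and> whisker_left X' (Str True X) (proj True (\<lambda>(M, k,
      u, v). (M, u))) \<psi> = \<phi>1 \<and>
      whisker_left X' (Str True X) (proj True (\<lambda>(M, k, u, v). (M, v))) \<psi> = \<phi>2 \<and>
        whisker_left X' (Str False X) (proj False (\<lambda>(M, k, u, v). (M, k))) \<psi> = \<phi>3"
    then have \<psi>': "\<psi> \<in> Ar (HOM X' (VF2_VAC X))" "src \<psi> = H" "tgt \<psi> = G" using hom by blast+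
    then have n: "tangent_nat X' (VF2_VAC X) H G (body \<psi>)" by (simp add: HOM_Ar)
    show "\<psi> = MArr H \<phi> G"
    proof (rule marr.expand, intro conjI)
      show "body \<psi> = body (MArr H \<phi> G)"
      proof (rule extensionalityI[of _ "Ob X'"])
        fix A assume A: "A \<in> Ob X'"
        have eq: "body \<psi> A = MArr (obm H A) (body (body \<psi> A)) (obm G A)"
          using n[unfolded P.tangent_nat_structured[OF X' H G]] A by blast
        have "\<phi>1 = whisker_left X' (Str True X) (proj True (\<lambda>(M, k, u, v). (M, u))) \<psi>" using \<psi> by simp
        then have "body (body \<psi> A) = ?a A"
          using A tangent_natD(1)[OF n A] by (simp add: whisker_left_def proj_simps)
        then show "body \<psi> A = body (MArr H \<phi> G) A" using eq A by (simp add: \<phi>_def)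
      qed (use tangent_natD(6)[OF n] in \<open>simp_all add: \<phi>_def\<close>)
    qed (use \<psi>' in simp_all)
  qed
qed

end

end


section \<open>Negatives and torsion\<close>

locale tangent_with_negatives = tangent +
  assumes negatives: "has_negatives X"
begin

lemma tn_ar [simp]: "A \<in> Ob X \<Longrightarrow> tn X A \<in> Ar X"
  and tn_dom [simp]: "A \<in> Ob X \<Longrightarrow> Dom X (tn X A) = Tob X A"
  and tn_cod [simp]: "A \<in> Ob X \<Longrightarrow> Cod X (tn X A) = Tob X A"
  and tn_nat: "\<lbrakk>f \<in> Ar X; Cod X f = B\<rbrakk> \<Longrightarrow> tn X B \<bullet> Tar X f = Tar X f \<bullet> tn X (Dom X f)"
  and p_n: "A \<in> Ob X \<Longrightarrow> tp X A \<bullet> tn X A = tp X A"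
  and s_n: "A \<in> Ob X \<Longrightarrow> ts X A \<bullet> pair X A (tn X A) (Idn X (Tob X A)) = tz X A \<bullet> tp X A"
  using negatives by (auto simp: has_negatives_def is_natural_def hom_def)

text \<open>The usual proof that inverses in a monoid are unique, carried out in a fibre.\<close>

lemma negative_unique:
  assumes A: "A \<in> Ob X" and f: "f \<in> Ar X" "g \<in> Ar X" "Dom X f = Dom X g" "Cod X f = Tob X A" "Cod X g = Tob X A"
    and p: "tp X A \<bullet> f = tp X A \<bullet> g"
    and s: "ts X A \<bullet> pair X A f g = tz X A \<bullet> tp X A \<bullet> g"
  shows "f = tn X A \<bullet> g"
proof -
  let ?n = "tn X A \<bullet> g"
  have pn: "tp X A \<bullet> ?n = tp X A \<bullet> g" using A f by (simp add: p_n[THEN extend])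
  have z: "tp X A \<bullet> (tz X A \<bullet> tp X A \<bullet> g) = tp X A \<bullet> g" using A f by (simp add: p_z[THEN extend])
  have ng: "ts X A \<bullet> pair X A ?n g = tz X A \<bullet> tp X A \<bullet> g"
    using arg_cong[OF s_n[OF A], of "\<lambda>h. h \<bullet> g"] A f by (simp add: pair_cmp p_n)
  have gn: "ts X A \<bullet> pair X A g ?n = tz X A \<bullet> tp X A \<bullet> g"
    using s_add_comm[of A g ?n] ng A f pn by simp
  \<comment> \<open>\<open>f = f + 0 = f + (g - g) = (f + g) - g = - g\<close>\<close>
  have "f = ts X A \<bullet> pair X A f (tz X A \<bullet> tp X A \<bullet> g)"
    using s_add_unit[of A f] s_add_comm[of A f "tz X A \<bullet> tp X A \<bullet> g"] A f p z by simp
  also have "\<dots> = ts X A \<bullet> pair X A f (ts X A \<bullet> pair X A g ?n)"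
    by (simp only: gn)
  also have "\<dots> = ts X A \<bullet> pair X A (ts X A \<bullet> pair X A f g) ?n"
    by (rule add_assoc[symmetric, of A _ "Dom X g" _ _ "tp X A \<bullet> g"]) (use A f p pn in simp_all)
  also have "\<dots> = ?n"
    using s_add_unit[of A ?n] A f pn by (simp add: s)
  finally show ?thesis .
qed

text \<open>Since the flip is additive from \<open>T p\<close> to \<open>p T\<close>, it carries the inverses for one addition to
  those for the other.\<close>

lemma c_n:
  assumes A: "A \<in> Ob X"
  shows "Tar X (tn X A) \<bullet> tc X A = tc X A \<bullet> tn X (Tob X A)"
proof -
  let ?f = "tc X A \<bullet> Tar X (tn X A) \<bullet> tc X A" and ?I = "Idn X (Tob X (Tob X A))"
  let ?h = "pair X A (tn X A) (Idn X (Tob X A))"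
  have h: "?h \<in> Ar X" "Dom X ?h = Tob X A" "Cod X ?h = T2 X A" "pr1 X A \<bullet> ?h = tn X A" "pr2 X A \<bullet> ?h =
    Idn X (Tob X A)"
    using A p_n[OF A] by simp_all
  have pn: "Tar X (tp X A) \<bullet> Tar X (tn X A) = Tar X (tp X A)" using tar_eq[OF p_n[OF A]] A by simp
  have p: "tp X (Tob X A) \<bullet> ?f = tp X (Tob X A) \<bullet> ?I"
    using A by (simp add: p_c[THEN extend] extend[OF pn] Tp_c)
  have "tc X A \<bullet> (Tar X (ts X A) \<bullet> (Tar X ?h \<bullet> tc X A)) = ts X (Tob X A) \<bullet> pair X (Tob X A) ?f ?I"
    using A h extend[OF tar_eq[OF h(4)], of "tc X A"] extend[OF tar_eq[OF h(5)], of "tc X A"]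
      by (subst c_add) (simp_all add: c_c)
  moreover have "Tar X (ts X A) \<bullet> Tar X ?h = Tar X (tz X A) \<bullet> Tar X (tp X A)"
    using tar_eq[OF s_n[OF A]] A h by simp
  ultimately have "ts X (Tob X A) \<bullet> pair X (Tob X A) ?f ?I = tz X (Tob X A) \<bullet> tp X (Tob X A) \<bullet> ?I"
    using A h extend[of "Tar X (ts X A)" "Tar X ?h" "Tar X (tz X A) \<bullet> Tar X (tp X A)" "tc X A"]
    by (simp add: c_Tz[THEN extend] Tp_c)
  then have "?f = tn X (Tob X A) \<bullet> ?I"
    by (intro negative_unique) (use A p in simp_all)
  then have "tc X A \<bullet> ?f = tc X A \<bullet> tn X (Tob X A)" using A by simp
  then show ?thesis using A by simp
qed

text \<open>Both \<open>k c\<close> and \<open>k\<close> lie over \<open>p p\<^sub>T\<close>, so their difference exists and lies over it too.\<close>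

lemma torsion_typed:
  assumes M: "M \<in> Ob X" and k: "vertical_connection X M k"
  shows "torsion X M k \<in> Ar X" "Dom X (torsion X M k) = Tob X (Tob X M)" "Cod X (torsion X M k) = Tob X M"
    "tp X M \<bullet> torsion X M k = tp X M \<bullet> tp X (Tob X M)"
    "tp X M \<bullet> (k \<bullet> tc X M) = tp X M \<bullet> (tn X M \<bullet> k)"
proof -
  have t: "k \<in> Ar X" "Dom X k = Tob X (Tob X M)" "Cod X k = Tob X M"
    and pk: "tp X M \<bullet> k = tp X M \<bullet> tp X (Tob X M)"
    using k by (auto simp: vertical_connection_def hom_def)
  have pp: "tp X M \<bullet> Tar X (tp X M) = tp X M \<bullet> tp X (Tob X M)" using M by (simp add: tp_nat)
  have kc: "tp X M \<bullet> (k \<bullet> tc X M) = tp X M \<bullet> tp X (Tob X M)"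
    using M t extend[OF pk, of "tc X M"] by (simp add: p_c pp)
  then show f: "tp X M \<bullet> (k \<bullet> tc X M) = tp X M \<bullet> (tn X M \<bullet> k)"
    using M t pk by (simp add: p_n[THEN extend])
  show "torsion X M k \<in> Ar X" "Dom X (torsion X M k) = Tob X (Tob X M)" "Cod X (torsion X M k) = Tob X M"
    using M t f by (simp_all add: torsion_def fibre_diff_def)
  show "tp X M \<bullet> torsion X M k = tp X M \<bullet> tp X (Tob X M)"
    unfolding torsion_def fibre_diff_def using M t f kc by (simp add: p_s[THEN extend])
qed

lemma torsion_tensor_vector_field:
  assumes M: "M \<in> Ob X" and k: "vertical_connection X M k" and u: "vector_field X M u"
    and v: "vector_field X M v"
  shows "vector_field X M (torsion_tensor X M k u v)"
proof -
  have uv: "u \<in> Ar X" "Dom X u = M" "Cod X u = Tob X M" "tp X M \<bullet> u = Idn X M"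
    "v \<in> Ar X" "Dom X v = M" "Cod X v = Tob X M" "tp X M \<bullet> v = Idn X M"
    using u v by (auto simp: vector_field_def hom_def)
  note t = torsion_typed[OF M k]
  show ?thesis
    using M uv t extend[OF t(4), of "Tar X u \<bullet> v"] extend[OF uv(4)]
    by (simp add: vector_field_def torsion_tensor_def hom_def tp_nat[THEN extend])
qed

end

context evaluations
begin

context
  assumes X_neg: "has_negatives X"
    and C_tn: "\<And>A. A \<in> Ob C \<Longrightarrow> tn C A \<in> Ar C" "\<And>A. A \<in> Ob C \<Longrightarrow> Dom C (tn C A) = Tob C A"
      "\<And>A. A \<in> Ob C \<Longrightarrow> Cod C (tn C A) = Tob C A" "\<And>i A. i \<in> I \<Longrightarrow> A \<in> Ob C \<Longrightarrow> Ea i (tn C A) = tn X (Eo i A)"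
begin

lemma E_has_negatives: "has_negatives C"
proof -
  interpret N: tangent_with_negatives X by unfold_locales (rule X_neg)
  have p: "tp C A \<cdot>\<^bsub>C\<^esub> tn C A = tp C A" if "A \<in> Ob C" for A
    by (rule faithful) (use that in \<open>simp_all add: C_tn N.p_n\<close>)
  have s: "ts C A \<cdot>\<^bsub>C\<^esub> pair C A (tn C A) (Idn C (Tob C A)) = tz C A \<cdot>\<^bsub>C\<^esub> tp C A" if "A \<in> Ob C" for A
    by (rule faithful) (use that p in \<open>simp_all add: C_tn N.s_n pair_rules\<close>)
  have n: "Tar C f \<cdot>\<^bsub>C\<^esub> tn C (Dom C f) = tn C (Cod C f) \<cdot>\<^bsub>C\<^esub> Tar C f" if "f \<in> Ar C" for f
    by (rule faithful) (use that in \<open>simp_all add: C_tn N.tn_nat\<close>)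
  show ?thesis
    unfolding has_negatives_def is_natural_def using p s n by (simp add: hom_def C_tn)
qed

lemma E_torsion_tensor:
  assumes M: "M \<in> Ob C" and k: "vertical_connection C M k" and u: "vector_field C M u"
    and v: "vector_field C M v"
    and i: "i \<in> I"
  shows "Ea i (torsion_tensor C M k u v) = torsion_tensor X (Eo i M) (Ea i k) (Ea i u) (Ea i v)"
proof -
  interpret N: tangent_with_negatives C by unfold_locales (rule E_has_negatives)
  have t: "u \<in> Ar C" "Dom C u = M" "Cod C u = Tob C M" "v \<in> Ar C" "Dom C v = M" "Cod C v = Tob C M"
    "k \<in> Ar C" "Dom C k = Tob C (Tob C M)" "Cod C k = Tob C M"
    using u v k by (auto simp: vector_field_def vertical_connection_def hom_def)
  note tt = N.torsion_typed[OF M k]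
  have "Ea i (torsion C M k) = torsion X (Eo i M) (Ea i k)"
    using tt(5) t M i by (simp add: torsion_def fibre_diff_def pair_rules C_tn)
  then show ?thesis
    using tt t M i by (simp add: torsion_tensor_def)
qed

end

end

text \<open>The condition on distributive laws reduces to compatibility of negation with the flip.\<close>

lemma HOM_tn:
  fixes X' :: "('x, 'y) tang" and X :: "('o, 'a) tang" (structure)
  assumes X': "tangent_category X'" and X: "tangent_category X" "has_negatives X"
    and F: "tangent_morphism X' X F"
  shows "tn (HOM X' X) F \<in> Ar (HOM X' X)"
proof -
  interpret F: lax_morphism X' X F by (rule lax_morphismI[OF X' X(1) F])
  interpret N: tangent_with_negatives X by unfold_locales (rule X(2))
  have "tc X (obm F A) \<bullet> Tar X (lax F A) \<bullet> tn X (obm F (Tob X' A)) =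
     Tar X (tn X (obm F A)) \<bullet> tc X (obm F A) \<bullet> Tar X (lax F A)" if "A \<in> Ob X'" for A
    using that N.tn_nat[of "lax F A" "Tob X (obm F A)", symmetric]
      F.B.extend[OF N.c_n[of "obm F A"], of "Tar X (lax F A)"] by simp
  then show ?thesis
    using Tbar_morphism[OF X' X(1) F] by (simp add: HOM_Ar HOM_simps tangent_nat_iff N.tn_nat)
qed

section \<open>The construction of the torsion tensor\<close>

text \<open>The universal structure is the one that corresponds to the identity morphism.\<close>

lemma universal_str_is_str:
  fixes X :: "('o, 'a) tang"
  assumes X: "tangent_category X"
  shows "is_str b (HOM (Str b X) X) (forget b X) (universal_str b X)"
proof -
  note S = Str_tangent_category[OF X, of b]
  interpret S: tangent "Str b X" by unfold_locales (rule S)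
  interpret X: tangent X by unfold_locales (rule X)
  note su = is_str_universal[OF S X]
  note i = id_mor_morphism[OF S]
  interpret U: lax_morphism "Str b X" X "forget b X" by (rule lax_morphismI[OF S X
    str_universal.forget_morphism[OF su]])
  have "comp_mor (Str b X) X (forget b X) (id_mor (Str b X)) = forget b X"
    by (rule mor_eqI[of _ "Ob (Str b X)" _ "Ar (Str b X)"])
      (simp_all add: U.ext_obm U.ext_arm U.ext_lax, simp_all add: id_mor_def strict_mor_def)
  moreover from this have "str_universal.lift_str (Str b X) X b (id_mor (Str b X)) = universal_str b X"
    unfolding str_universal.lift_str_def[OF su] universal_str_def by (auto simp: HOM_simps id_mor_def
      strict_mor_def fun_eq_iff restrict_def)
  ultimately show ?thesis
    using str_universal.lift_str_object[OF su i] by (simp add: str_universal.Str_Ob[OF su])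
qed

lemma constructs_VF_Str:
  fixes X :: "('o, 'a) tang"
  assumes X: "tangent_category X"
  shows "constructs_VF TYPE(('x, 'y) tang) X (VF X) (VF_forget X) (VF_univ X)"
  unfolding constructs_VF_def VF_eq_Str forget_eq universal_str_eq
proof (intro conjI allI impI)
  note su = is_str_universal[OF _ X]
  show "tangent_category (Str True X)" by (rule Str_tangent_category[OF X])
  show "tangent_morphism (Str True X) X (forget True X)" "is_strict (Str True X) X (forget True X)"
    using str_universal.forget_morphism[OF su[OF X]] str_universal.forget_strict[OF su[OF X]] by blast+
  show "vector_field (HOM (Str True X) X) (forget True X) (universal_str True X)"
    using universal_str_is_str[OF X, of True] by (simp add: is_str_def)
  fix X' :: "('x, 'y) tang" assume X': "tangent_category X'"
  show "tangent_iso (HOM X' (Str True X)) (Str True (HOM X' X)) (induced X' X (Str True X) (Str True (HOM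
    X' X)) (forget True X) (universal_str True X))"
    by (rule str_universal.comparison_iso[OF su[OF X']])
qed

lemma constructs_VAC_Str:
  fixes X :: "('o, 'a) tang"
  assumes X: "tangent_category X"
  shows "constructs_VAC TYPE(('x, 'y) tang) X (VAC X) (VAC_forget X) (VAC_univ X)"
  unfolding constructs_VAC_def VAC_eq_Str forget_eq universal_str_eq
proof (intro conjI allI impI)
  note su = is_str_universal[OF _ X]
  show "tangent_category (Str False X)" by (rule Str_tangent_category[OF X])
  show "tangent_morphism (Str False X) X (forget False X)"
    using str_universal.forget_morphism[OF su[OF X]] by blast
  show "vertical_connection (HOM (Str False X) X) (forget False X) (universal_str False X)"
    using universal_str_is_str[OF X, of False] by (simp add: is_str_def)
  fix X' :: "('x, 'y) tang" assume X': "tangent_category X'"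
  show "tangent_iso (HOM X' (Str False X)) (Str False (HOM X' X)) (induced X' X (Str False X) (Str False
    (HOM X' X)) (forget False X) (universal_str False X))"
    by (rule str_universal.comparison_iso[OF su[OF X']])
qed

lemma VF2_VAC_2_pullback:
  fixes X :: "('o, 'a) tang"
  assumes X: "tangent_category X"
  shows "is_2_pullback3 TYPE(('x, 'y) tang) X (VF X) (VF_forget X) (VF X) (VF_forget X) (VAC X) (VAC_forget X)
    (VF2_VAC X) (proj_u X) (proj_v X) (proj_k X)"
proof -
  have tr: "triples X" by unfold_locales (rule X)
  interpret T: triples X by (rule tr)
  note sel = T.sel
  show ?thesis
    unfolding is_2_pullback3_def T.proj_eq VF_eq_Str VAC_eq_Str forget_eq
  proof (intro conjI allI impI)
    show "tangent_category (VF2_VAC X)" by (rule T.PC.tangent)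
    show "comp_mor (VF2_VAC X) X (forget True X) (T.proj True (\<lambda>(M, k, u, v). (M, u))) =
       comp_mor (VF2_VAC X) X (forget True X) (T.proj True (\<lambda>(M, k, u, v). (M, v)))"
      "comp_mor (VF2_VAC X) X (forget True X) (T.proj True (\<lambda>(M, k, u, v). (M, v))) =
       comp_mor (VF2_VAC X) X (forget False X) (T.proj False (\<lambda>(M, k, u, v). (M, k)))"
      by (simp_all only: T.comp_forget_proj[OF sel(1)] T.comp_forget_proj[OF sel(2)]
        T.comp_forget_proj[OF sel(3)])
  next
    fix X' :: "('x, 'y) tang" and H1 H2 H3
    assume "tangent_category X'" "tangent_morphism X' (Str True X) H1" "tangent_morphism X' (Str True X) H2"
      "tangent_morphism X' (Str False X) H3"
      "comp_mor X' X (forget True X) H1 = comp_mor X' X (forget True X) H2"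
      "comp_mor X' X (forget True X) H2 = comp_mor X' X (forget False X) H3"
    then show "\<exists>!H. tangent_morphism X' (VF2_VAC X) H \<and>
        comp_mor X' (Str True X) (T.proj True (\<lambda>(M, k, u, v). (M, u))) H = H1 \<and>
        comp_mor X' (Str True X) (T.proj True (\<lambda>(M, k, u, v). (M, v))) H = H2 \<and>
        comp_mor X' (Str False X) (T.proj False (\<lambda>(M, k, u, v). (M, k))) H = H3"
      by (rule T.pullback_morphism)
  next
    fix X' :: "('x, 'y) tang" and H G \<phi>1 \<phi>2 \<phi>3
    assume "tangent_category X'" "tangent_morphism X' (VF2_VAC X) H" "tangent_morphism X' (VF2_VAC X) G"
      "\<phi>1 \<in> hom (HOM X' (Str True X)) (comp_mor X' (Str True X) (T.proj True (\<lambda>(M, k, u, v). (M, u))) H)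
        (comp_mor X' (Str True X) (T.proj True (\<lambda>(M, k, u, v). (M, u))) G)"
      "\<phi>2 \<in> hom (HOM X' (Str True X)) (comp_mor X' (Str True X) (T.proj True (\<lambda>(M, k, u, v). (M, v))) H)
        (comp_mor X' (Str True X) (T.proj True (\<lambda>(M, k, u, v). (M, v))) G)"
      "\<phi>3 \<in> hom (HOM X' (Str False X)) (comp_mor X' (Str False X) (T.proj False (\<lambda>(M, k, u, v). (M, k)))
        H) (comp_mor X' (Str False X) (T.proj False (\<lambda>(M, k, u, v). (M, k))) G)"
      "whisker_left X' X (forget True X) \<phi>1 = whisker_left X' X (forget True X) \<phi>2"
      "whisker_left X' X (forget True X) \<phi>2 = whisker_left X' X (forget False X) \<phi>3"
    then show "\<exists>!\<phi>. \<phi> \<in> hom (HOM X' (VF2_VAC X)) H G \<and>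
      whisker_left X' (Str True X) (T.proj True (\<lambda>(M, k, u, v). (M, u))) \<phi> = \<phi>1 \<and>
      whisker_left X' (Str True X) (T.proj True (\<lambda>(M, k, u, v). (M, v))) \<phi> = \<phi>2 \<and>
      whisker_left X' (Str False X) (T.proj False (\<lambda>(M, k, u, v). (M, k))) \<phi> = \<phi>3"
      by (rule T.pullback_nat)
  qed (use T.proj_morphism sel in blast)+
qed

text \<open>The torsion tensor of the universal structures is formed in the category of tangent morphisms
  from \<open>VF2_VAC X\<close> to \<open>X\<close>. The universal property of \<open>VF X\<close> turns it into the operator, and since all
  operations are pointwise, its value at an object is the torsion tensor of the structures there.\<close>

theorem theorem5p50:
  fixes X :: "('o, 'a) tang"
  assumes "tangent_category X" and "has_negatives X"
  shows "constructs_torsion_tensor TYPE(('x, 'y) tang) X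
           (VF X) (VF_forget X) (VF_univ X) (VAC X) (VAC_forget X) (VAC_univ X)
           (VF2_VAC X) (proj_u X) (proj_v X) (proj_k X) \<and>
         (\<exists>!W. is_torsion_operator X (VF X) (VF_forget X) (VF_univ X) (VAC_univ X)
           (VF2_VAC X) (proj_u X) (proj_v X) (proj_k X) W) \<and>
         (let W = torsion_operator X (VF X) (VF_forget X) (VF_univ X) (VAC_univ X)
                    (VF2_VAC X) (proj_u X) (proj_v X) (proj_k X) in
            is_functor (VF2_VAC X) (VF X) (obm W) (arm W) \<and>
            (\<forall>M k u v. M \<in> Ob X \<and> vertical_connection X M k \<and>
                vector_field X M u \<and> vector_field X M v \<longrightarrow>
              vector_field X M (torsion_tensor X M k u v) \<and>
              obm W (M, k, u, v) = (M, torsion_tensor X M k u v)))"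
proof (intro conjI)
  note X = assms(1)
  interpret N: tangent_with_negatives X by unfold_locales (rule assms)+
  have tr: "triples X" by unfold_locales
  interpret T: triples X by (rule tr)
  show "constructs_torsion_tensor TYPE(('x, 'y) tang) X
           (VF X) (VF_forget X) (VF_univ X) (VAC X) (VAC_forget X) (VAC_univ X)
           (VF2_VAC X) (proj_u X) (proj_v X) (proj_k X)"
    unfolding constructs_torsion_tensor_def
    using constructs_VF_Str[OF X] constructs_VAC_Str[OF X] VF2_VAC_2_pullback[OF X] by blast
  let ?P = "VF2_VAC X" and ?H = "HOM (VF2_VAC X) X"
  note P = T.PC.tangent
  note su = is_str_universal[OF P X]
  note sel = T.sel
  let ?F = "comp_mor ?P X (VF_forget X) (proj_u X)"
  let ?u = "whisker_right ?P X (VF_univ X) (proj_u X)" and ?v = "whisker_right ?P X (VF_univ X) (proj_v X)"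
    and ?k = "whisker_right ?P X (VAC_univ X) (proj_k X)"
  have F: "?F = T.PU" unfolding T.proj_eq forget_eq by (rule T.comp_forget_proj[OF sel(1)])
  have lift: "T.PU \<in> Ob ?H" "is_str b ?H T.PU (whisker_right ?P X (universal_str b X) (T.proj b g))"
    if "T.selector b g" for b g
    using str_universal.lift_str_object[OF su T.proj_morphism[OF that]]
    unfolding str_universal.whisker_universal_str[OF su T.proj_morphism[OF that]]
      T.comp_forget_proj[OF that] str_universal.Str_Ob[OF su] by auto
  have F_ob: "?F \<in> Ob ?H" unfolding F using lift(1)[OF sel(1)] .
  have k: "vertical_connection ?H ?F ?k" and u: "vector_field ?H ?F ?u" and v: "vector_field ?H ?F ?v"
    using lift(2)[OF sel(3)] lift(2)[OF sel(1)] lift(2)[OF sel(2)]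
      unfolding F unfolding T.proj_eq universal_str_eq is_str_def by simp_all
  interpret H: evaluations X ?H "Ob ?P" "\<lambda>A F. obm F A" "\<lambda>A \<phi>. body \<phi> A"
    by (rule HOM_evaluations[OF P X])
  have H_tn: "tn ?H G \<in> Ar ?H" "Dom ?H (tn ?H G) = Tob ?H G" "Cod ?H (tn ?H G) = Tob ?H G"
     "s \<in> Ob ?P \<Longrightarrow> body (tn ?H G) s = tn X (obm G s)" if "G \<in> Ob ?H" for G s
    using HOM_tn[OF P X assms(2), of G] that by (simp_all add: HOM_simps)
  interpret HN: tangent_with_negatives ?H
    by unfold_locales (rule H.E_has_negatives[OF assms(2) H_tn])
  \<comment> \<open>the universal torsion tensor, an object of the category to which the operators correspond\<close>
  define \<tau> where "\<tau> = universal_torsion X (VF_forget X) (VF_univ X) (VAC_univ X) ?P (proj_u X) (proj_v X)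
    (proj_k X)"
  have \<tau>_eq: "\<tau> = torsion_tensor ?H ?F ?k ?u ?v" by (simp add: \<tau>_def universal_torsion_def)
  have "vector_field ?H ?F \<tau>" unfolding \<tau>_eq by (rule HN.torsion_tensor_vector_field[OF F_ob k u v])
  then have \<tau>: "(?F, \<tau>) \<in> Ob (Str True ?H)" using F_ob by (simp add: str_universal.Str_Ob[OF su] is_str_def)
  have op_iff: "is_torsion_operator X (VF X) (VF_forget X) (VF_univ X) (VAC_univ X) ?P (proj_u X) (proj_v
    X) (proj_k X) W \<longleftrightarrow>
     tangent_morphism ?P (Str True X) W \<and> comp_mor ?P X (forget True X) W = ?F \<and>
       str_universal.lift_str ?P X True W = \<tau>" for W
    unfolding is_torsion_operator_def \<tau>_def VF_eq_Str forget_eq universal_str_eq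
    using str_universal.comparison_simps(1)[OF su, of True W] by auto
  show unique: "\<exists>!W. is_torsion_operator X (VF X) (VF_forget X) (VF_univ X) (VAC_univ X) ?P (proj_u X)
    (proj_v X) (proj_k X) W"
  proof (rule ex_ex1I)
    show "\<exists>W. is_torsion_operator X (VF X) (VF_forget X) (VF_univ X) (VAC_univ X) ?P (proj_u X) (proj_v X)
      (proj_k X) W"
      unfolding op_iff by (rule str_universal.object_lift_str[OF su \<tau>])
    show "W = W'" if "is_torsion_operator X (VF X) (VF_forget X) (VF_univ X) (VAC_univ X) ?P (proj_u X)
      (proj_v X) (proj_k X) W"
      "is_torsion_operator X (VF X) (VF_forget X) (VF_univ X) (VAC_univ X) ?P (proj_u X) (proj_v X)
        (proj_k X) W'" for W W'
      using that unfolding op_iff by (intro str_universal.morphism_str_eqI[OF su]) auto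
  qed
  define W where "W = torsion_operator X (VF X) (VF_forget X) (VF_univ X) (VAC_univ X) ?P (proj_u X)
    (proj_v X) (proj_k X)"
  have "is_torsion_operator X (VF X) (VF_forget X) (VF_univ X) (VAC_univ X) ?P (proj_u X) (proj_v X)
    (proj_k X) W"
    unfolding W_def torsion_operator_def by (rule theI'[OF unique])
  then have W: "tangent_morphism ?P (Str True X) W" "comp_mor ?P X (forget True X) W = ?F"
    "str_universal.lift_str ?P X True W = \<tau>"
    unfolding op_iff by auto
  have "obm W (M, k, u, v) = (M, torsion_tensor X M k u v)"
    if s: "M \<in> Ob X" "vertical_connection X M k" "vector_field X M u" "vector_field X M v" for M k u v
  proof -
    let ?s = "(M, k, u, v)"
    have s': "?s \<in> tri_objects X" using s by (simp add: is_str_def)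
    then have sP: "?s \<in> Ob ?P" by (simp only: T.P_simps)
    have PU: "obm T.PU ?s = M" using T.P.U_simps(1)[OF s'] by simp
    have "fst (obm W ?s) = M"
      using str_universal.comp_forget(2)[OF su W(1) sP] unfolding W(2) F PU by simp
    moreover have "snd (obm W ?s) = body \<tau> ?s"
      using fun_cong[OF arg_cong[OF W(3), of body], of ?s] sP by (simp add: str_universal.lift_str_def[OF su])
    moreover have "body \<tau> ?s = torsion_tensor X (obm ?F ?s) (body ?k ?s) (body ?u ?s) (body ?v ?s)"
      unfolding \<tau>_eq by (rule H.E_torsion_tensor[OF assms(2) H_tn F_ob k u v sP])
    moreover have "body (whisker_right ?P X (universal_str b X) (T.proj b g)) ?s = snd (g ?s)"
      if "T.selector b g" for b g
      unfolding str_universal.whisker_universal_str[OF su T.proj_morphism[OF that]]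
        str_universal.lift_str_def[OF su]
      using sP T.proj_simps(1)[OF s', of b g] by simp
    then have "body ?k ?s = k" "body ?u ?s = u" "body ?v ?s = v"
      unfolding T.proj_eq universal_str_eq using sel by simp_all
    ultimately show ?thesis unfolding F PU by (simp add: prod_eq_iff)
  qed
  moreover have "is_functor ?P (VF X) (obm W) (arm W)"
    using W(1) unfolding tangent_morphism_def VF_eq_Str by blast
  ultimately show "let W = torsion_operator X (VF X) (VF_forget X) (VF_univ X) (VAC_univ X)
                    (VF2_VAC X) (proj_u X) (proj_v X) (proj_k X) in
            is_functor (VF2_VAC X) (VF X) (obm W) (arm W) \<and>
            (\<forall>M k u v. M \<in> Ob X \<and> vertical_connection X M k \<and>
                vector_field X M u \<and> vector_field X M v \<longrightarrow>
              vector_field X M (torsion_tensor X M k u v) \<and>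
              obm W (M, k, u, v) = (M, torsion_tensor X M k u v))"
    unfolding W_def[symmetric] Let_def using N.torsion_tensor_vector_field by blast
qed

end
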